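(* Let $p,q$ be positive integers, let $\gamma_1$ be a positive bridging arc or a peripheral arc in $\mathbb{U}$, and let $\gamma_2$ be a peripheral arc in $\mathbb{U}$. Suppose that $I^+(\gamma_2,\gamma_1)=1$ and that this positive intersection $M$ is admissible. Then there is a nonzero morphism $f_M:\phi(\pi(\gamma_1))\to\phi(\pi(\gamma_2))$ associated with the positive intersection $M$ of $\gamma_2$ and $\gamma_1$. Furthermore, $f_M$ can be uniquely decomposed, up to isomorphism, into an epimorphism followed by a monomorphism through $\phi(\pi(\gamma))$, $$\phi(\pi(\gamma_1))\twoheadrightarrow\phi(\pi(\gamma))\hookrightarrow\phi(\pi(\gamma_2)),$$ where $\gamma$ is the peripheral arc contained in $\gamma_2$ obtained by smoothing the crossing at $M$.
   Context: **Category.** $\Bbbk$ is an algebraically closed field. $\mathbb{L}=\mathbb{L}(p,q)$ is the abelian group generated by $\vec x_1,\vec x_2$ with relation $p\vec x_1=q\vec x_2=:\vec c$. $S=\Bbbk[x_1,x_2]$ is $\mathbb{L}$-graded by $\deg x_i=\vec x_i$. $\mathrm{coh}\text{-}\mathbb{X}(p,q)$ is the quotient of finitely generated $\mathbb{L}$-graded $S$-modules by finite-dimensional ones. $\mathcal{O}(\vec x)$ are the line bundles; the exceptional simple $S_{\infty,i}$, $i\in\mathbb{Z}/p$ (resp. $S_{0,i}$, $i\in\mathbb{Z}/q$) is the cokernel of $\mathcal{O}((i-1)\vec x_1)\xrightarrow{x_1}\mathcal{O}(i\vec x_1)$ (resp. $\mathcal{O}((i-1)\vec x_2)\xrightarrow{x_2}\mathcal{O}(i\vec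 x_2)$); $S_{\lambda,i}^{(j)}$ is the indecomposable (uniserial) finite-length sheaf of length $j$ with top $S_{\lambda,i}$. **Geometric model.** $\mathbb{U}=\{(x,y)\in\mathbb{R}^2:0\le y\le1\}$ with standard orientation, upper boundary $\partial$, lower boundary $\partial'$, marked points $x_\partial=(x,1)$, $x\in\frac1p\mathbb{Z}$, $x_{\partial'}=(x,0)$, $x\in\frac1q\mathbb{Z}$; $\pi:\mathbb{U}\to A_{p,q}$ is the quotient by $(x,y)\mapsto(x+1,y)$. Curves are up to homotopy fixing endpoints and in minimal position. $D^{i/p}_{j/q}$ is the oriented arc from $(j/q)_{\partial'}$ to $(i/p)_\partial$ (positive bridging arc); $D^{i/p,j/p}$ (resp. $D_{i/q,j/q}$), $j-i\ge2$, is the oriented arc from $(i/p)_\partial$ to $(j/p)_\partial$ (resp. $(i/q)_{\partial'}$ to $(j/q)_{\partial'}$) (peripheral arcs). $\phi(\pi(D^{i/p}_{j/q}))=\mathcal{O}(i\vec x_1-j\vec x_2)$, $\phi(\pi(D^{\frac{i-j-1}{p},\frac ip}))=S_{\infty,i}^{(j)}$, $\phi(\pi(D_{-\frac iq,\frac{j-i+1}{q}}))=S_{0,i}^{(j)}$. **Intersections.** A positive intersection of $\gamma,\gamma'$ is an interior crossing at which $\gamma'$ crosses $\gamma$ from the right side of $\gamma$ to its left side; $I^+(\gamma,\gamma')$ is the minimal number of these over homotopy. The positive intersection $M$ of $\gamma_2,\gamma_1$ is called admissible here if at $M$ the arc $\gamma_2$ follows $\gamma_1$ in the clockwise order and $(\gamma_1,\gamma_2)$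 is not one of the following excluded configurations: $\gamma_2=D_{a/q,b/q}$ and $\gamma_1$ starts at $((b-1)/q)_{\partial'}$; or $\gamma_2=D^{a/p,b/p}$ and $\gamma_1$ ends at $((a+1)/p)_\partial$ (i.e. there must be a marked point strictly between the starting point of $\gamma_1$ and the ending point of $\gamma_2$ on $\partial'$, resp. between the starting point of $\gamma_2$ and the ending point of $\gamma_1$ on $\partial$). The smoothed arc $\gamma$: if $\gamma_2$ has its endpoints on $\partial$, $\gamma$ goes from the starting point of $\gamma_2$ to the ending point of $\gamma_1$; if $\gamma_2$ has its endpoints on $\partial'$, $\gamma$ goes from the starting point of $\gamma_1$ to the ending point of $\gamma_2$. *)

theory Defs
  imports
    "HOL-Analysis.Analysis"
    "HOL-Computational_Algebra.Polynomial"
    "HOL-Algebra.Module"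
    "HOL-Algebra.Elementary_Groups"
begin

section \<open>Notions of an abelian category\<close>

record ('o, 'a) cat =
  Obj :: "'o set"
  Arr :: "'o \<Rightarrow> 'o \<Rightarrow> 'a set"
  Comp :: "'a \<Rightarrow> 'a \<Rightarrow> 'a"
  Ident :: "'o \<Rightarrow> 'a"

text \<open>\<open>Comp C g f\<close> is \<open>g\<close> after \<open>f\<close>.\<close>

definition is_monomorphism :: "('o, 'a) cat \<Rightarrow> 'o \<Rightarrow> 'o \<Rightarrow> 'a \<Rightarrow> bool" where
  "is_monomorphism C A B f \<longleftrightarrow> f \<in> Arr C A B \<and>
     (\<forall>X\<in>Obj C. \<forall>g\<in>Arr C X A. \<forall>h\<in>Arr C X A. Comp C f g = Comp C f h \<longrightarrow> g = h)"

definition is_epimorphism :: "('o, 'a) cat \<Rightarrow> 'o \<Rightarrow> 'o \<Rightarrow> 'a \<Rightarrow> bool" where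
  "is_epimorphism C A B f \<longleftrightarrow> f \<in> Arr C A B \<and>
     (\<forall>X\<in>Obj C. \<forall>g\<in>Arr C B X. \<forall>h\<in>Arr C B X. Comp C g f = Comp C h f \<longrightarrow> g = h)"

definition is_isomorphism :: "('o, 'a) cat \<Rightarrow> 'o \<Rightarrow> 'o \<Rightarrow> 'a \<Rightarrow> bool" where
  "is_isomorphism C A B f \<longleftrightarrow> f \<in> Arr C A B \<and>
     (\<exists>g\<in>Arr C B A. Comp C g f = Ident C A \<and> Comp C f g = Ident C B)"

definition zero_object :: "('o, 'a) cat \<Rightarrow> 'o \<Rightarrow> bool" where
  "zero_object C Z \<longleftrightarrow> Z \<in> Obj C \<and>
     (\<forall>X\<in>Obj C. (\<exists>!f. f \<in> Arr C X Z) \<and> (\<exists>!f. f \<in> Arr C Z X))"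

definition zero_arrow :: "('o, 'a) cat \<Rightarrow> 'o \<Rightarrow> 'o \<Rightarrow> 'a \<Rightarrow> bool" where
  "zero_arrow C A B f \<longleftrightarrow>
     (\<exists>Z. zero_object C Z \<and> (\<exists>u\<in>Arr C A Z. \<exists>v\<in>Arr C Z B. f = Comp C v u))"

definition is_cokernel :: "('o, 'a) cat \<Rightarrow> 'o \<Rightarrow> 'o \<Rightarrow> 'a \<Rightarrow> 'o \<Rightarrow> 'a \<Rightarrow> bool" where
  "is_cokernel C A B f T c \<longleftrightarrow>
     f \<in> Arr C A B \<and> T \<in> Obj C \<and> c \<in> Arr C B T \<and> zero_arrow C A T (Comp C c f) \<and>
     (\<forall>X\<in>Obj C. \<forall>x\<in>Arr C B X. zero_arrow C A X (Comp C x f) \<longrightarrow>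
        (\<exists>!u. u \<in> Arr C T X \<and> Comp C u c = x))"

definition simple_object :: "('o, 'a) cat \<Rightarrow> 'o \<Rightarrow> bool" where
  "simple_object C T \<longleftrightarrow> T \<in> Obj C \<and> \<not> zero_object C T \<and>
     (\<forall>K\<in>Obj C. \<forall>m. is_monomorphism C K T m \<longrightarrow> zero_object C K \<or> is_isomorphism C K T m)"

text \<open>Existence of a composition series with \<open>n\<close> simple factors.\<close>

primrec has_length :: "('o, 'a) cat \<Rightarrow> nat \<Rightarrow> 'o \<Rightarrow> bool" where
  "has_length C 0 E \<longleftrightarrow> zero_object C E"
| "has_length C (Suc n) E \<longleftrightarrow> E \<in> Obj C \<and>
     (\<exists>K\<in>Obj C. has_length C n K \<and>
        (\<exists>m T c. is_monomorphism C K E m \<and> is_cokernel C K E m T c \<and> simple_object C T))"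

text \<open>Direct sums in an additive category are the same as binary coproducts.\<close>

definition is_coproduct :: "('o, 'a) cat \<Rightarrow> 'o \<Rightarrow> 'o \<Rightarrow> 'o \<Rightarrow> 'a \<Rightarrow> 'a \<Rightarrow> bool" where
  "is_coproduct C A B E i j \<longleftrightarrow> i \<in> Arr C A E \<and> j \<in> Arr C B E \<and>
     (\<forall>X\<in>Obj C. \<forall>a\<in>Arr C A X. \<forall>b\<in>Arr C B X.
        \<exists>!u. u \<in> Arr C E X \<and> Comp C u i = a \<and> Comp C u j = b)"

definition indecomposable :: "('o, 'a) cat \<Rightarrow> 'o \<Rightarrow> bool" where
  "indecomposable C E \<longleftrightarrow> E \<in> Obj C \<and> \<not> zero_object C E \<and>
     (\<forall>A\<in>Obj C. \<forall>B\<in>Obj C. \<forall>i j. is_coproduct C A B E i j \<longrightarrow>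
        zero_object C A \<or> zero_object C B)"

definition factors_through :: "('o, 'a) cat \<Rightarrow> 'o \<Rightarrow> 'a \<Rightarrow> 'o \<Rightarrow> 'a \<Rightarrow> bool" where
  "factors_through C X x K m \<longleftrightarrow> (\<exists>u\<in>Arr C X K. x = Comp C m u)"

definition uniserial :: "('o, 'a) cat \<Rightarrow> 'o \<Rightarrow> bool" where
  "uniserial C E \<longleftrightarrow>
     (\<forall>K\<in>Obj C. \<forall>L\<in>Obj C. \<forall>k l. is_monomorphism C K E k \<and> is_monomorphism C L E l \<longrightarrow>
        factors_through C K k L l \<or> factors_through C L l K k)"

definition maximal_subobject :: "('o, 'a) cat \<Rightarrow> 'o \<Rightarrow> 'o \<Rightarrow> 'a \<Rightarrow> bool" where
  "maximal_subobject C E K m \<longleftrightarrow> K \<in> Obj C \<and> is_monomorphism C K E m \<and>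
     (\<exists>T c. is_cokernel C K E m T c \<and> simple_object C T)"

text \<open>The radical is the intersection of all maximal subobjects, the top the quotient by it.\<close>

definition is_radical :: "('o, 'a) cat \<Rightarrow> 'o \<Rightarrow> 'o \<Rightarrow> 'a \<Rightarrow> bool" where
  "is_radical C E R r \<longleftrightarrow> R \<in> Obj C \<and> is_monomorphism C R E r \<and>
     (\<forall>X\<in>Obj C. \<forall>x\<in>Arr C X E.
        factors_through C X x R r \<longleftrightarrow>
        (\<forall>K m. maximal_subobject C E K m \<longrightarrow> factors_through C X x K m))"

definition is_top :: "('o, 'a) cat \<Rightarrow> 'o \<Rightarrow> 'o \<Rightarrow> bool" where
  "is_top C E T \<longleftrightarrow> (\<exists>R r t. is_radical C E R r \<and> is_cokernel C R E r T t)"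

definition epi_mono_factorization ::
    "('o, 'a) cat \<Rightarrow> 'o \<Rightarrow> 'o \<Rightarrow> 'a \<Rightarrow> 'o \<Rightarrow> 'a \<Rightarrow> 'a \<Rightarrow> bool" where
  "epi_mono_factorization C A B f X e m \<longleftrightarrow>
     X \<in> Obj C \<and> is_epimorphism C A X e \<and> is_monomorphism C X B m \<and> f = Comp C m e"

section \<open>The grading group and graded modules\<close>

definition Z2 :: "(int \<times> int) monoid" where
  "Z2 = integer_group \<times>\<times> integer_group"

definition Lrel :: "nat \<Rightarrow> nat \<Rightarrow> (int \<times> int) set" where
  "Lrel p q = generate Z2 {(int p, - int q)}"

definition LL :: "nat \<Rightarrow> nat \<Rightarrow> (int \<times> int) set monoid" where
  "LL p q = Z2 Mod Lrel p q"

text \<open>\<open>Lvec p q a b\<close> is the element $a\vec x_1 + b\vec x_2$.\<close>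

definition Lvec :: "nat \<Rightarrow> nat \<Rightarrow> int \<Rightarrow> int \<Rightarrow> (int \<times> int) set" where
  "Lvec p q a b = Lrel p q #>\<^bsub>Z2\<^esub> (a, b)"

text \<open>$S = \Bbbk[x_1, x_2]$ is \<open>'k poly poly\<close> with $x_1$ the inner and $x_2$ the outer variable.\<close>

definition S_x1 :: "'k::alg_closed_field poly poly" where
  "S_x1 = [:[:0, 1:]:]"

definition S_x2 :: "'k::alg_closed_field poly poly" where
  "S_x2 = [:0, 1:]"

definition S_ring :: "'k::alg_closed_field poly poly ring" where
  "S_ring = \<lparr>carrier = UNIV, monoid.mult = (*), one = 1, zero = 0, add = (+)\<rparr>"

definition S_piece :: "nat \<Rightarrow> nat \<Rightarrow> (int \<times> int) set \<Rightarrow> 'k::alg_closed_field poly poly set" where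
  "S_piece p q d = {f. \<forall>a b. coeff (coeff f b) a \<noteq> 0 \<longrightarrow> Lvec p q (int a) (int b) = d}"

text \<open>The ring fields \<open>mult\<close> and \<open>one\<close> inherited from \<^typ>\<open>('a, 'b) module\<close> carry no meaning.\<close>

record ('s, 'm) graded_module = "('s, 'm) module" +
  piece :: "(int \<times> int) set \<Rightarrow> 'm set"

definition decomposition ::
    "nat \<Rightarrow> nat \<Rightarrow> ('s, 'm) graded_module \<Rightarrow> 'm \<Rightarrow> ((int \<times> int) set \<Rightarrow> 'm) \<Rightarrow> bool" where
  "decomposition p q M m c \<longleftrightarrow>
     c \<in> (\<Pi>\<^sub>E d\<in>carrier (LL p q). piece M d) \<and>
     finite {d \<in> carrier (LL p q). c d \<noteq> \<zero>\<^bsub>M\<^esub>} \<and>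
     m = finsum M c {d \<in> carrier (LL p q). c d \<noteq> \<zero>\<^bsub>M\<^esub>}"

definition component ::
    "nat \<Rightarrow> nat \<Rightarrow> ('s, 'm) graded_module \<Rightarrow> 'm \<Rightarrow> (int \<times> int) set \<Rightarrow> 'm" where
  "component p q M m = (THE c. decomposition p q M m c)"

definition L_graded_module ::
    "nat \<Rightarrow> nat \<Rightarrow> ('k::alg_closed_field poly poly, 'm) graded_module \<Rightarrow> bool" where
  "L_graded_module p q M \<longleftrightarrow> Module.module S_ring M \<and>
     (\<forall>d\<in>carrier (LL p q). subgroup (piece M d) (add_monoid M)) \<and>
     (\<forall>m\<in>carrier M. \<exists>!c. decomposition p q M m c) \<and>
     (\<forall>d\<in>carrier (LL p q). \<forall>e\<in>carrier (LL p q). \<forall>s\<in>S_piece p q e. \<forall>m\<in>piece M d.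
        s \<odot>\<^bsub>M\<^esub> m \<in> piece M (e \<otimes>\<^bsub>LL p q\<^esub> d))"

definition finitely_generated ::
    "('k::alg_closed_field poly poly, 'm) graded_module \<Rightarrow> bool" where
  "finitely_generated M \<longleftrightarrow>
     (\<exists>G. finite G \<and> G \<subseteq> carrier M \<and>
        (\<forall>N. submodule N S_ring M \<and> G \<subseteq> N \<longrightarrow> N = carrier M))"

definition graded_submodule ::
    "nat \<Rightarrow> nat \<Rightarrow> ('k::alg_closed_field poly poly, 'm) graded_module \<Rightarrow> 'm set \<Rightarrow> bool" where
  "graded_submodule p q M N \<longleftrightarrow> submodule N S_ring M \<and>
     (\<forall>n\<in>N. \<forall>d\<in>carrier (LL p q). component p q M n d \<in> N)"

text \<open>For submodules \<open>W \<subseteq> V\<close> of \<open>M\<close>: the \<open>\<Bbbk>\<close>-vector space \<open>V/W\<close> is finite-dimensional.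
  The scalar \<open>c\<close> of $\Bbbk$ is the constant polynomial \<open>[:[:c:]:]\<close>.\<close>

definition finite_dim_quotient ::
    "('k::alg_closed_field poly poly, 'm) graded_module \<Rightarrow> 'm set \<Rightarrow> 'm set \<Rightarrow> bool" where
  "finite_dim_quotient M V W \<longleftrightarrow>
     (\<exists>B. finite B \<and> B \<subseteq> V \<and>
        (\<forall>v\<in>V. \<exists>c. v \<ominus>\<^bsub>M\<^esub> finsum M (\<lambda>b. [:[:c b:]:] \<odot>\<^bsub>M\<^esub> b) B \<in> W))"

section \<open>The category of coherent sheaves\<close>

text \<open>Morphisms of the Serre quotient are, by definition, elements of the direct limit of the
  groups \<open>Hom(M', N/N')\<close> of degree-zero homomorphisms, where \<open>M'\<close> runs through the graded
  submodules of \<open>M\<close> and \<open>N'\<close> through those of \<open>N\<close> such that \<open>M/M'\<close> and \<open>N'\<close> are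
  finite-dimensional.  A homomorphism \<open>f : M' \<rightarrow> N/N'\<close> is stored as the set of pairs \<open>(m, n)\<close> with
  \<open>m \<in> M'\<close> and \<open>n \<in> f m\<close>.  It is a graded submodule of \<open>M \<oplus> N\<close> from which one recovers \<open>M'\<close> as
  its domain and \<open>N'\<close> as \<open>{n. (0, n) \<in> R}\<close>, and every graded submodule of \<open>M \<oplus> N\<close> for which this
  \<open>M/M'\<close> and \<open>N'\<close> are finite-dimensional arises in this way.\<close>

definition partial_hom ::
    "nat \<Rightarrow> nat \<Rightarrow> ('k::alg_closed_field poly poly, 'm) graded_module \<Rightarrow>
     ('k poly poly, 'm) graded_module \<Rightarrow> ('m \<times> 'm) set \<Rightarrow> bool" where
  "partial_hom p q M N R \<longleftrightarrow>
     R \<subseteq> carrier M \<times> carrier N \<and>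
     (\<zero>\<^bsub>M\<^esub>, \<zero>\<^bsub>N\<^esub>) \<in> R \<and>
     (\<forall>(m, n)\<in>R. \<forall>(m', n')\<in>R. (m \<oplus>\<^bsub>M\<^esub> m', n \<oplus>\<^bsub>N\<^esub> n') \<in> R) \<and>
     (\<forall>s. \<forall>(m, n)\<in>R. (s \<odot>\<^bsub>M\<^esub> m, s \<odot>\<^bsub>N\<^esub> n) \<in> R) \<and>
     (\<forall>(m, n)\<in>R. \<forall>d\<in>carrier (LL p q). (component p q M m d, component p q N n d) \<in> R) \<and>
     finite_dim_quotient M (carrier M) (Domain R) \<and>
     finite_dim_quotient N {n. (\<zero>\<^bsub>M\<^esub>, n) \<in> R} {\<zero>\<^bsub>N\<^esub>}"

text \<open>Equality in the direct limit: the two homomorphisms agree as maps \<open>M'' \<rightarrow> N/N''\<close>.  The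
  last line forces \<open>N''\<close> to contain both \<open>{n. (0, n) \<in> R}\<close> and \<open>{n. (0, n) \<in> R'}\<close>.\<close>

definition partial_hom_eq ::
    "nat \<Rightarrow> nat \<Rightarrow> ('k::alg_closed_field poly poly, 'm) graded_module \<Rightarrow>
     ('k poly poly, 'm) graded_module \<Rightarrow> ('m \<times> 'm) set \<Rightarrow> ('m \<times> 'm) set \<Rightarrow> bool" where
  "partial_hom_eq p q M N R R' \<longleftrightarrow>
     (\<exists>M'' N''. graded_submodule p q M M'' \<and> graded_submodule p q N N'' \<and>
        finite_dim_quotient M (carrier M) M'' \<and> finite_dim_quotient N N'' {\<zero>\<^bsub>N\<^esub>} \<and>
        M'' \<subseteq> Domain R \<inter> Domain R' \<and>
        (\<forall>m\<in>M''. \<forall>n n'. (m, n) \<in> R \<and> (m, n') \<in> R' \<longrightarrow> n \<ominus>\<^bsub>N\<^esub> n' \<in> N''))"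

definition quotient_class ::
    "nat \<Rightarrow> nat \<Rightarrow> ('k::alg_closed_field poly poly, 'm) graded_module \<Rightarrow>
     ('k poly poly, 'm) graded_module \<Rightarrow> ('m \<times> 'm) set \<Rightarrow> ('m \<times> 'm) set set" where
  "quotient_class p q M N R = {R'. partial_hom p q M N R' \<and> partial_hom_eq p q M N R R'}"

text \<open>An arrow consists of its domain, its codomain and an element of the direct limit.\<close>

type_synonym ('k, 'm) quotient_arrow =
  "('k poly poly, 'm) graded_module \<times> ('k poly poly, 'm) graded_module \<times> ('m \<times> 'm) set set"

definition quotient_comp ::
    "nat \<Rightarrow> nat \<Rightarrow> ('k::alg_closed_field, 'm) quotient_arrow \<Rightarrow>
     ('k, 'm) quotient_arrow \<Rightarrow> ('k, 'm) quotient_arrow" where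
  "quotient_comp p q = (\<lambda>(_, P, G) (M, _, F).
     (M, P, \<Union>R\<in>F. \<Union>T\<in>G. quotient_class p q M P (R O T)))"

text \<open>The image in the quotient category of a degree-zero homomorphism of graded modules.\<close>

definition quotient_arrow_of ::
    "nat \<Rightarrow> nat \<Rightarrow> ('k::alg_closed_field poly poly, 'm) graded_module \<Rightarrow>
     ('k poly poly, 'm) graded_module \<Rightarrow> ('m \<Rightarrow> 'm) \<Rightarrow> ('k, 'm) quotient_arrow" where
  "quotient_arrow_of p q M N f =
     (M, N, quotient_class p q M N ((\<lambda>m. (m, f m)) ` carrier M))"

text \<open>Carriers are subsets of $S$.  This loses nothing up to isomorphism: \<open>\<Bbbk>\<close> is infinite, so
  every finitely generated module over $S$ has at most as many elements as $S$.\<close>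

type_synonym 'k sheaf = "('k poly poly, 'k poly poly) graded_module"

type_synonym 'k sheaf_arrow = "('k, 'k poly poly) quotient_arrow"

definition coh :: "nat \<Rightarrow> nat \<Rightarrow> ('k::alg_closed_field sheaf, 'k sheaf_arrow) cat" where
  "coh p q =
     \<lparr>Obj = {M. L_graded_module p q M \<and> finitely_generated M},
      Arr = (\<lambda>M N. {(M, N, quotient_class p q M N R) | R. partial_hom p q M N R}),
      Comp = quotient_comp p q,
      Ident = (\<lambda>M. quotient_arrow_of p q M M (\<lambda>m. m))\<rparr>"

text \<open>\<open>line_bundle p q a b\<close> is $\mathcal O(a\vec x_1 + b\vec x_2)$, the class of the shifted module
  $S(\vec x)$ with $S(\vec x)_{\vec y} = S_{\vec x + \vec y}$.\<close>

definition line_bundle :: "nat \<Rightarrow> nat \<Rightarrow> int \<Rightarrow> int \<Rightarrow> 'k::alg_closed_field sheaf" where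
  "line_bundle p q a b =
     \<lparr>carrier = UNIV, monoid.mult = (*), one = 1, zero = 0, add = (+), smult = (*),
      piece = (\<lambda>d. S_piece p q (Lvec p q a b \<otimes>\<^bsub>LL p q\<^esub> d))\<rparr>"

text \<open>The exceptional simple sheaves $S_{\infty,i}$ and $S_{0,i}$, which depend up to isomorphism
  only on \<open>i\<close> modulo \<open>p\<close> and \<open>q\<close> respectively.\<close>

definition is_S_inf :: "nat \<Rightarrow> nat \<Rightarrow> int \<Rightarrow> 'k::alg_closed_field sheaf \<Rightarrow> bool" where
  "is_S_inf p q i T \<longleftrightarrow>
     (let A = line_bundle p q (i - 1) 0; B = line_bundle p q i 0
      in \<exists>c. is_cokernel (coh p q) A B (quotient_arrow_of p q A B (\<lambda>s. S_x1 * s)) T c)"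

definition is_S_zero :: "nat \<Rightarrow> nat \<Rightarrow> int \<Rightarrow> 'k::alg_closed_field sheaf \<Rightarrow> bool" where
  "is_S_zero p q i T \<longleftrightarrow>
     (let A = line_bundle p q 0 (i - 1); B = line_bundle p q 0 i
      in \<exists>c. is_cokernel (coh p q) A B (quotient_arrow_of p q A B (\<lambda>s. S_x2 * s)) T c)"

definition is_uniserial_with_top :: "('o, 'a) cat \<Rightarrow> 'o \<Rightarrow> nat \<Rightarrow> 'o \<Rightarrow> bool" where
  "is_uniserial_with_top C T j E \<longleftrightarrow>
     indecomposable C E \<and> uniserial C E \<and> has_length C j E \<and> is_top C E T"

text \<open>\<open>E\<close> is $S_{\infty,i}^{(j)}$, respectively $S_{0,i}^{(j)}$.\<close>

definition is_tube_inf :: "nat \<Rightarrow> nat \<Rightarrow> int \<Rightarrow> nat \<Rightarrow> 'k::alg_closed_field sheaf \<Rightarrow> bool" where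
  "is_tube_inf p q i j E \<longleftrightarrow>
     (\<exists>T. is_S_inf p q i T \<and> is_uniserial_with_top (coh p q) T j E)"

definition is_tube_zero :: "nat \<Rightarrow> nat \<Rightarrow> int \<Rightarrow> nat \<Rightarrow> 'k::alg_closed_field sheaf \<Rightarrow> bool" where
  "is_tube_zero p q i j E \<longleftrightarrow>
     (\<exists>T. is_S_zero p q i T \<and> is_uniserial_with_top (coh p q) T j E)"

section \<open>Arcs in the strip\<close>

definition strip :: "(real \<times> real) set" where
  "strip = {(x, y). 0 \<le> y \<and> y \<le> 1}"

text \<open>\<open>Upper i\<close> is $(i/p)_\partial$ and \<open>Lower j\<close> is $(j/q)_{\partial'}$.\<close>

datatype marked_point = Upper int | Lower int

primrec position :: "nat \<Rightarrow> nat \<Rightarrow> marked_point \<Rightarrow> real \<times> real" where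
  "position p q (Upper i) = (real_of_int i / real p, 1)"
| "position p q (Lower j) = (real_of_int j / real q, 0)"

text \<open>An arc, up to homotopy fixing endpoints, is given by its starting point and its ending
  point; its representatives are the regular \<open>C\<^sup>1\<close> curves below, which are all homotopic because
  \<open>strip\<close> is convex.\<close>

type_synonym arc = "marked_point \<times> marked_point"

definition arc_curves :: "nat \<Rightarrow> nat \<Rightarrow> arc \<Rightarrow> (real \<Rightarrow> real \<times> real) set" where
  "arc_curves p q \<gamma> = {g.
     g C1_differentiable_on {0..1} \<and> (\<forall>t\<in>{0..1}. vector_derivative g (at t) \<noteq> 0) \<and>
     g ` {0<..<1} \<subseteq> interior strip \<and>
     pathstart g = position p q (fst \<gamma>) \<and> pathfinish g = position p q (snd \<gamma>)}"

lemma convex_strip: "convex strip"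
proof -
  have "strip = UNIV \<times> {0..1}"
    by (auto simp: strip_def)
  moreover have "convex (UNIV \<times> {0..1} :: (real \<times> real) set)"
    by (intro convex_Times convex_UNIV convex_real_interval)
  ultimately show ?thesis
    by metis
qed

lemma arc_curves_homotopic:
  assumes "g \<in> arc_curves p q \<gamma>" "h \<in> arc_curves p q \<gamma>"
  shows "homotopic_paths strip g h"
proof -
  have P: "path k \<and> path_image k \<subseteq> strip" if k: "k \<in> arc_curves p q \<gamma>" for k
  proof
    show "path k"
      using k C1_differentiable_imp_continuous_on by (auto simp: arc_curves_def path_def)
    have "position p q z \<in> strip" for z
      by (cases z) (auto simp: strip_def)
    then have "k 0 \<in> strip" "k 1 \<in> strip"
      using k by (auto simp: arc_curves_def pathstart_def pathfinish_def)
    moreover have "k t \<in> strip" if "0 < t" "t < 1" for t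
      using k that interior_subset[of strip] by (force simp: arc_curves_def)
    ultimately have "k t \<in> strip" if "t \<in> {0..1}" for t
      using that by (cases "t = 0 \<or> t = 1") auto
    then show "path_image k \<subseteq> strip"
      by (auto simp: path_image_def)
  qed
  show ?thesis
    using assms P convex_imp_simply_connected[OF convex_strip]
    by (auto simp: simply_connected_eq_homotopic_paths arc_curves_def)
qed

definition bridging_arc :: "int \<Rightarrow> int \<Rightarrow> arc" where
  "bridging_arc i j = (Lower j, Upper i)"

definition upper_arc :: "int \<Rightarrow> int \<Rightarrow> arc" where
  "upper_arc i j = (Upper i, Upper j)"

definition lower_arc :: "int \<Rightarrow> int \<Rightarrow> arc" where
  "lower_arc i j = (Lower i, Lower j)"

definition positive_bridging :: "arc \<Rightarrow> bool" where
  "positive_bridging \<gamma> \<longleftrightarrow> (\<exists>i j. \<gamma> = bridging_arc i j)"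

definition peripheral :: "arc \<Rightarrow> bool" where
  "peripheral \<gamma> \<longleftrightarrow> (\<exists>i j. j - i \<ge> 2 \<and> (\<gamma> = upper_arc i j \<or> \<gamma> = lower_arc i j))"

text \<open>Crossings are recorded as pairs of parameters.  The sign of the determinant of the tangent
  vectors is positive when \<open>h\<close> passes from the right side of \<open>g\<close> to its left side.\<close>

definition det2 :: "real \<times> real \<Rightarrow> real \<times> real \<Rightarrow> real" where
  "det2 u v = fst u * snd v - snd u * fst v"

definition crossings :: "(real \<Rightarrow> real \<times> real) \<Rightarrow> (real \<Rightarrow> real \<times> real) \<Rightarrow> (real \<times> real) set" where
  "crossings g h = {(s, t). s \<in> {0<..<1} \<and> t \<in> {0<..<1} \<and> g s = h t}"

definition positive_crossings ::
    "(real \<Rightarrow> real \<times> real) \<Rightarrow> (real \<Rightarrow> real \<times> real) \<Rightarrow> (real \<times> real) set" where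
  "positive_crossings g h = {(s, t) \<in> crossings g h.
     det2 (vector_derivative g (at s)) (vector_derivative h (at t)) > 0}"

definition transversal :: "(real \<Rightarrow> real \<times> real) \<Rightarrow> (real \<Rightarrow> real \<times> real) \<Rightarrow> bool" where
  "transversal g h \<longleftrightarrow> finite (crossings g h) \<and>
     (\<forall>(s, t)\<in>crossings g h.
        det2 (vector_derivative g (at s)) (vector_derivative h (at t)) \<noteq> 0)"

definition I_plus :: "nat \<Rightarrow> nat \<Rightarrow> arc \<Rightarrow> arc \<Rightarrow> nat" where
  "I_plus p q \<gamma> \<gamma>' =
     (LEAST n. \<exists>g\<in>arc_curves p q \<gamma>. \<exists>h\<in>arc_curves p q \<gamma>'.
        transversal g h \<and> card (positive_crossings g h) = n)"

definition minimal_position ::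
    "nat \<Rightarrow> nat \<Rightarrow> arc \<Rightarrow> arc \<Rightarrow> (real \<Rightarrow> real \<times> real) \<Rightarrow> (real \<Rightarrow> real \<times> real) \<Rightarrow> bool" where
  "minimal_position p q \<gamma> \<gamma>' g h \<longleftrightarrow>
     g \<in> arc_curves p q \<gamma> \<and> h \<in> arc_curves p q \<gamma>' \<and> transversal g h \<and>
     (\<forall>g'\<in>arc_curves p q \<gamma>. \<forall>h'\<in>arc_curves p q \<gamma>'.
        transversal g' h' \<longrightarrow> card (crossings g h) \<le> card (crossings g' h'))"

text \<open>The direction of \<open>v\<close> is that of \<open>u\<close> turned clockwise by an angle \<open>\<theta>\<close> between 0 and \<open>\<pi>\<close>.\<close>

definition follows_clockwise :: "real \<times> real \<Rightarrow> real \<times> real \<Rightarrow> bool" where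
  "follows_clockwise u v \<longleftrightarrow>
     (\<exists>r>0. \<exists>\<theta>\<in>{0<..<pi}.
        v = r *\<^sub>R (cos \<theta> * fst u + sin \<theta> * snd u, cos \<theta> * snd u - sin \<theta> * fst u))"

text \<open>The crossing \<open>(s, t)\<close> is a positive intersection of \<open>\<gamma>\<^sub>2\<close> and \<open>\<gamma>\<^sub>1\<close>, represented by the
  curves \<open>g\<^sub>2\<close> (at parameter \<open>s\<close>) and \<open>g\<^sub>1\<close> (at parameter \<open>t\<close>).\<close>

definition admissible ::
    "arc \<Rightarrow> arc \<Rightarrow> (real \<Rightarrow> real \<times> real) \<Rightarrow> (real \<Rightarrow> real \<times> real) \<Rightarrow> real \<times> real \<Rightarrow> bool" where
  "admissible \<gamma>\<^sub>1 \<gamma>\<^sub>2 g\<^sub>1 g\<^sub>2 = (\<lambda>(s, t).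
     follows_clockwise (vector_derivative g\<^sub>1 (at t)) (vector_derivative g\<^sub>2 (at s)) \<and>
     \<not> (\<exists>a b. \<gamma>\<^sub>2 = lower_arc a b \<and> fst \<gamma>\<^sub>1 = Lower (b - 1)) \<and>
     \<not> (\<exists>a b. \<gamma>\<^sub>2 = upper_arc a b \<and> snd \<gamma>\<^sub>1 = Upper (a + 1)))"

definition smoothing :: "arc \<Rightarrow> arc \<Rightarrow> arc" where
  "smoothing \<gamma>\<^sub>1 \<gamma>\<^sub>2 =
     (if \<exists>a b. \<gamma>\<^sub>2 = upper_arc a b then (fst \<gamma>\<^sub>2, snd \<gamma>\<^sub>1) else (fst \<gamma>\<^sub>1, snd \<gamma>\<^sub>2))"

text \<open>Containment of peripheral arcs: the boundary segment cut off by \<open>\<gamma>\<close> lies in the one cut off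
  by \<open>\<gamma>'\<close>.\<close>

definition contained_in :: "arc \<Rightarrow> arc \<Rightarrow> bool" where
  "contained_in \<gamma> \<gamma>' \<longleftrightarrow>
     (\<exists>a b a' b'. a' \<le> a \<and> b \<le> b' \<and>
        (\<gamma> = upper_arc a b \<and> \<gamma>' = upper_arc a' b' \<or> \<gamma> = lower_arc a b \<and> \<gamma>' = lower_arc a' b'))"

text \<open>The image of an arc in the annulus is recorded as the set of its lifts, that is, its orbit
  under the translations by integers.\<close>

primrec translate_point :: "nat \<Rightarrow> nat \<Rightarrow> int \<Rightarrow> marked_point \<Rightarrow> marked_point" where
  "translate_point p q k (Upper i) = Upper (i + k * int p)"
| "translate_point p q k (Lower j) = Lower (j + k * int q)"

definition annulus_arc :: "nat \<Rightarrow> nat \<Rightarrow> arc \<Rightarrow> arc set" where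
  "annulus_arc p q \<gamma> = (\<lambda>k. map_prod (translate_point p q k) (translate_point p q k) \<gamma>) ` UNIV"

text \<open>The sheaf \<open>\<phi>(A)\<close> attached to an arc \<open>A\<close> of the annulus, which is determined up to
  isomorphism.\<close>

definition represents :: "nat \<Rightarrow> nat \<Rightarrow> arc set \<Rightarrow> 'k::alg_closed_field sheaf \<Rightarrow> bool" where
  "represents p q A E \<longleftrightarrow>
     (\<exists>i j. A = annulus_arc p q (bridging_arc i j) \<and> E = line_bundle p q i (- j)) \<or>
     (\<exists>i. \<exists>j\<ge>1. A = annulus_arc p q (upper_arc (i - int j - 1) i) \<and> is_tube_inf p q i j E) \<or>
     (\<exists>i. \<exists>j\<ge>1. A = annulus_arc p q (lower_arc (- i) (int j - i + 1)) \<and> is_tube_zero p q i j E)"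

definition phi :: "nat \<Rightarrow> nat \<Rightarrow> arc set \<Rightarrow> 'k::alg_closed_field sheaf" where
  "phi p q A = (SOME E. represents p q A E)"

end

theory Submission
  imports Defs
begin

text \<open>A submodule of a finitely generated graded module is finite-dimensional iff each of its elements
  is killed by a power of \<open>x\<^sub>1\<close> and by a power of \<open>x\<^sub>2\<close>.  Morphisms of coherent sheaves are therefore
  graded additive relations that are total and single-valued up to such torsion; they compose as
  relations, and isomorphisms are inverted by taking converses.

  In this calculus an object of an exceptional tube with top \<open>S\<^sub>i\<close> and length \<open>l\<close> is a quotient of a
  line bundle \<open>\<O>(i x + b y)\<close> by \<open>x\<^sup>l\<close>, where \<open>x\<close> is the variable vanishing at the point, \<open>y\<close> the
  other variable and \<open>b\<close> is arbitrary: a homogeneous ideal containing a power of \<open>x\<close> agrees up to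
  saturation with some \<open>(x\<^sup>a)\<close>.  Conversely, a uniserial object with this top is generated, up to
  torsion, by any homogeneous lift of a generator of the top.  The epimorphism of the theorem is
  induced by a common line bundle covering both sides, the monomorphism by multiplication with a power
  of \<open>x\<close>.

  On the geometric side, explicit curves show that \<open>I\<^sup>+ = 0\<close> unless the endpoints are positioned as
  required.\<close>

section \<open>Noetherian rings and modules over \<open>S\<close>\<close>

text \<open>The sheaves in the statement are chosen by \<open>SOME\<close>, so all that is known of
  them is a categorical description: indecomposable, uniserial, of a given length and top. The hard
  step is therefore recognition: every such object must be brought into the form of a line bundle
  modulo a power of one variable (\<open>uniserial_with_top_tube\<close>). The twist in the other
  variable is free because that variable acts invertibly, up to torsion, on whatever is killed by a
  power of the first. The freedom is needed: a bridging arc prescribes its line bundle completely,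
  and the presentations of the other two sheaves have to be moved to its twist.

  A peripheral arc from \<open>a\<close> to \<open>b\<close> has length \<open>b - a - 1\<close>.
  Admissibility thus says that the smoothed arc has positive length: in the excluded configurations
  it would join neighbouring marked points, and the composite would be zero.

  The Noetherian property enters because being killed elementwise by powers gives finite dimension
  only once finitely many generators share one exponent.\<close>

definition is_ideal :: "'a::comm_ring_1 set \<Rightarrow> bool" where
  "is_ideal I \<longleftrightarrow> 0 \<in> I \<and> (\<forall>a\<in>I. \<forall>b\<in>I. a + b \<in> I) \<and> (\<forall>r. \<forall>a\<in>I. r * a \<in> I)"

text \<open>Generation by \<open>G\<close> is expressed as: every ideal containing \<open>G\<close>
  contains \<open>I\<close>. This avoids finite linear combinations and lets ideals be compared
  through their generators alone.\<close>

definition noetherian :: "'a::comm_ring_1 itself \<Rightarrow> bool" where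
  "noetherian _ \<longleftrightarrow> (\<forall>I::'a set. is_ideal I \<longrightarrow>
     (\<exists>G. finite G \<and> G \<subseteq> I \<and> (\<forall>J. is_ideal J \<and> G \<subseteq> J \<longrightarrow> I \<subseteq> J)))"

lemma is_idealD:
  assumes "is_ideal I"
  shows "0 \<in> I" "a \<in> I \<Longrightarrow> b \<in> I \<Longrightarrow> a + b \<in> I" "a \<in> I \<Longrightarrow> r * a \<in> I"
    "a \<in> I \<Longrightarrow> b \<in> I \<Longrightarrow> a - b \<in> I"
proof -
  show *: "0 \<in> I" "a \<in> I \<Longrightarrow> b \<in> I \<Longrightarrow> a + b \<in> I" "a \<in> I \<Longrightarrow> r * a \<in> I" for a b r
    using assms by (auto simp: is_ideal_def)
  show "a \<in> I \<Longrightarrow> b \<in> I \<Longrightarrow> a - b \<in> I"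
    using *(2)[of a "- 1 * b"] *(3)[of b "- 1"] by simp
qed

lemma noetherian_field: "noetherian TYPE('k::field)"
  unfolding noetherian_def
proof (intro allI impI)
  fix I :: "'k set" assume I: "is_ideal I"
  show "\<exists>G. finite G \<and> G \<subseteq> I \<and> (\<forall>J. is_ideal J \<and> G \<subseteq> J \<longrightarrow> I \<subseteq> J)"
  proof (cases "I \<subseteq> {0}")
    case True
    then show ?thesis by (intro exI[of _ "{}"]) (auto simp: is_ideal_def)
  next
    case False
    then obtain a where a: "a \<in> I" "a \<noteq> 0" by auto
    have "x \<in> J" if "is_ideal J" "a \<in> J" for J x
      using is_idealD(3)[OF that, of "x / a"] a by simp
    then show ?thesis using a by (intro exI[of _ "{a}"]) auto
  qed
qed

text \<open>Hilbert's basis theorem. The ideals of leading coefficients in degree \<open>n\<close>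
  increase with \<open>n\<close>. Generators of their union all occur in some degree
  \<open>m\<close>, so lifts of generators for the degrees up to \<open>m\<close> generate the
  ideal.\<close>

lemma noetherian_poly:
  assumes N: "noetherian TYPE('a::comm_ring_1)"
  shows "noetherian TYPE('a poly)"
  unfolding noetherian_def
proof (intro allI impI)
  fix I :: "'a poly set" assume I: "is_ideal I"
  define L where "L K n = {coeff f n | f. f \<in> K \<and> (\<forall>i>n. coeff f i = 0)}"
    for K :: "'a poly set" and n
  have L_I: "coeff f n \<in> L K n" if "f \<in> K" "\<And>i. i > n \<Longrightarrow> coeff f i = 0" for f K n
    using that by (auto simp: L_def)
  have L_E: "\<exists>f\<in>K. coeff f n = c \<and> (\<forall>i>n. coeff f i = 0)" if "c \<in> L K n" for c K n
    using that by (auto simp: L_def)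
  have idL: "is_ideal (L K n)" if K: "is_ideal K" for K n
    unfolding is_ideal_def
  proof (intro conjI ballI allI)
    show "0 \<in> L K n" using L_I[of 0 K n] is_idealD(1)[OF K] by simp
    fix a assume "a \<in> L K n"
    then obtain f where f: "f \<in> K" "coeff f n = a" "\<forall>i>n. coeff f i = 0" using L_E by blast
    show "r * a \<in> L K n" for r
      using L_I[of "[:r:] * f" K n] is_idealD(3)[OF K f(1), of "[:r:]"] f by simp
    fix b assume "b \<in> L K n"
    then obtain g where g: "g \<in> K" "coeff g n = b" "\<forall>i>n. coeff g i = 0" using L_E by blast
    show "a + b \<in> L K n"
      using L_I[of "f + g" K n] is_idealD(2)[OF K f(1) g(1)] f g by simp
  qed
  have LSuc: "L K n \<subseteq> L K (Suc n)" if K: "is_ideal K" for K n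
  proof
    fix c assume "c \<in> L K n"
    then obtain f where f: "f \<in> K" "coeff f n = c" "\<forall>i>n. coeff f i = 0" using L_E by blast
    show "c \<in> L K (Suc n)"
      using L_I[of "[:0, 1:] * f" K "Suc n"] is_idealD(3)[OF K f(1), of "[:0, 1:]"] f
      by (auto simp: coeff_pCons split: nat.splits)
  qed
  have Lmono: "L K n \<subseteq> L K m" if "is_ideal K" "n \<le> m" for K n m
    using that(2) by (rule lift_Suc_mono_le[of "L K", OF LSuc[OF that(1)]])
  let ?U = "\<Union>n. L I n"
  have "is_ideal ?U"
    unfolding is_ideal_def
  proof (intro conjI ballI allI)
    show "0 \<in> ?U" using is_idealD(1)[OF idL[OF I]] by blast
    fix a assume "a \<in> ?U"
    then obtain n where n: "a \<in> L I n" by blast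
    then show "r * a \<in> ?U" for r using is_idealD(3)[OF idL[OF I]] by blast
    fix b assume "b \<in> ?U"
    then obtain m where m: "b \<in> L I m" by blast
    have "a \<in> L I (max n m)" "b \<in> L I (max n m)"
      using n m Lmono[OF I, of n "max n m"] Lmono[OF I, of m "max n m"] by auto
    then show "a + b \<in> ?U" using is_idealD(2)[OF idL[OF I]] by blast
  qed
  then obtain G where G: "finite G" "G \<subseteq> ?U" "\<And>J. is_ideal J \<Longrightarrow> G \<subseteq> J \<Longrightarrow> ?U \<subseteq> J"
    using N unfolding noetherian_def by meson
  from G(1,2) have "\<exists>n. G \<subseteq> L I n"
  proof (induction G rule: finite_induct)
    case (insert x F)
    then obtain n m where "F \<subseteq> L I n" "x \<in> L I m" by auto
    then show ?case
      using Lmono[OF I, of n "max n m"] Lmono[OF I, of m "max n m"]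
      by (intro exI[of _ "max n m"]) auto
  qed auto
  then obtain m where m: "G \<subseteq> L I m" by blast
  then have UL: "?U \<subseteq> L I m" using G(3)[OF idL[OF I]] by blast
  have "\<forall>n. \<exists>G. finite G \<and> G \<subseteq> L I n \<and> (\<forall>J. is_ideal J \<and> G \<subseteq> J \<longrightarrow> L I n \<subseteq> J)"
    using N idL[OF I] unfolding noetherian_def by blast
  then obtain Gn where Gn: "\<And>n. finite (Gn n)" "\<And>n. Gn n \<subseteq> L I n"
      "\<And>n J. is_ideal J \<Longrightarrow> Gn n \<subseteq> J \<Longrightarrow> L I n \<subseteq> J"
    by metis
  have "\<forall>n c. \<exists>f. c \<in> L I n \<longrightarrow> f \<in> I \<and> coeff f n = c \<and> (\<forall>i>n. coeff f i = 0)"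
    using L_E by blast
  then obtain F where F: "\<And>n c. c \<in> L I n \<Longrightarrow> F n c \<in> I \<and> coeff (F n c) n = c \<and> (\<forall>i>n. coeff (F n c) i = 0)"
    by metis
  let ?H = "\<Union>n\<le>m. F n ` Gn n"
  have "finite ?H" using Gn(1) by auto
  moreover have "?H \<subseteq> I" using F Gn(2) by blast
  moreover have "I \<subseteq> J" if J: "is_ideal J" and H: "?H \<subseteq> J" for J
  proof -
    \<comment> \<open>Leading coefficients are compared for \<open>I\<close> and
      \<open>I \<inter> J\<close> rather than \<open>J\<close>: the polynomial \<open>h\<close>
      subtracted below must lie in \<open>I\<close> for the induction on the degree to continue with
      \<open>f - h\<close>.\<close>
    have IJ: "is_ideal (I \<inter> J)" using I J by (auto simp: is_ideal_def)
    have sub: "L I n \<subseteq> L (I \<inter> J) n" if "n \<le> m" for n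
    proof (rule Gn(3)[OF idL[OF IJ]], rule subsetI)
      fix c assume c: "c \<in> Gn n"
      then have "F n c \<in> I \<inter> J" "c \<in> L I n" using F Gn(2) H that by blast+
      then show "c \<in> L (I \<inter> J) n" using F[of c n] L_I[of "F n c" "I \<inter> J" n] by auto
    qed
    have sub': "L I n \<subseteq> L (I \<inter> J) n" for n
    proof (cases "n \<le> m")
      case False
      have "L I n \<subseteq> L (I \<inter> J) m" using UL sub[of m] by blast
      then show ?thesis using Lmono[OF IJ, of m n] False by auto
    qed (rule sub)
    have "f \<in> J" if "f \<in> I" "\<forall>i\<ge>n. coeff f i = 0" for f n
      using that
    proof (induction n arbitrary: f)
      case 0
      then have "f = 0" by (auto intro: poly_eqI)
      then show ?case using is_idealD(1)[OF J] by simp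
    next
      case (Suc n)
      then have "coeff f n \<in> L I n" by (intro L_I) auto
      then obtain h where h: "h \<in> I \<inter> J" "coeff h n = coeff f n" "\<forall>i>n. coeff h i = 0"
        using sub'[of n] L_E by (metis subsetD)
      have "f - h \<in> J"
      proof (rule Suc.IH)
        show "f - h \<in> I" using is_idealD(4)[OF I Suc.prems(1)] h by blast
        show "\<forall>i\<ge>n. coeff (f - h) i = 0"
          using h Suc.prems(2) by (metis coeff_diff diff_self le_neq_implies_less Suc_le_eq)
      qed
      then show ?case using is_idealD(2)[OF J, of "f - h" h] h by simp
    qed
    note * = this
    show ?thesis
    proof
      fix f assume "f \<in> I"
      then show "f \<in> J" using *[of f "Suc (degree f)"] by (simp add: coeff_eq_0)
    qed
  qed
  ultimately show "\<exists>G. finite G \<and> G \<subseteq> I \<and> (\<forall>J. is_ideal J \<and> G \<subseteq> J \<longrightarrow> I \<subseteq> J)"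
    by (intro exI[of _ ?H] conjI allI impI) (assumption | elim conjE)+
qed

lemma noetherian_S: "noetherian TYPE('k::field poly poly)"
  by (intro noetherian_poly noetherian_field)

section \<open>Calculation in modules over \<open>S\<close>\<close>

abbreviation smod :: "('k::alg_closed_field poly poly, 'm, 'z) module_scheme \<Rightarrow> bool" where
  "smod M \<equiv> Module.module S_ring M"

lemma cring_S_ring: "cring (S_ring :: 'k::alg_closed_field poly poly ring)"
proof (rule cringI)
  show "abelian_group (S_ring :: 'k poly poly ring)"
  proof (rule abelian_groupI)
    fix x :: "'k poly poly"
    show "\<exists>y\<in>carrier S_ring. y \<oplus>\<^bsub>S_ring\<^esub> x = \<zero>\<^bsub>S_ring\<^esub>"
      by (rule bexI[of _ "- x"]) (auto simp: S_ring_def)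
  qed (auto simp: S_ring_def)
  show "comm_monoid (S_ring :: 'k poly poly ring)"
    by (rule comm_monoidI) (auto simp: S_ring_def)
qed (auto simp: S_ring_def algebra_simps)

lemma S_ring_simps [simp]:
  "carrier S_ring = UNIV" "a \<oplus>\<^bsub>S_ring\<^esub> b = a + b" "a \<otimes>\<^bsub>S_ring\<^esub> b = a * b"
  "\<zero>\<^bsub>S_ring\<^esub> = 0" "\<one>\<^bsub>S_ring\<^esub> = 1"
  by (auto simp: S_ring_def)

lemma S_ring_minus [simp]: "\<ominus>\<^bsub>S_ring\<^esub> (a::'k::alg_closed_field poly poly) = - a"
proof -
  interpret cring "S_ring :: 'k poly poly ring" by (rule cring_S_ring)
  have "a \<oplus>\<^bsub>S_ring\<^esub> (- a) = \<zero>\<^bsub>S_ring\<^esub>" by simp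
  then show ?thesis by (metis S_ring_simps(1) UNIV_I minus_equality add.m_comm)
qed

context
  fixes M :: "('k::alg_closed_field poly poly, 'm, 'z) module_scheme"
  assumes M: "smod M"
begin

interpretation module S_ring M by (rule M)

lemma smod_closed [simp]:
  "\<zero>\<^bsub>M\<^esub> \<in> carrier M"
  "a \<in> carrier M \<Longrightarrow> b \<in> carrier M \<Longrightarrow> a \<oplus>\<^bsub>M\<^esub> b \<in> carrier M"
  "a \<in> carrier M \<Longrightarrow> s \<odot>\<^bsub>M\<^esub> a \<in> carrier M"
  "a \<in> carrier M \<Longrightarrow> \<ominus>\<^bsub>M\<^esub> a \<in> carrier M"
  "a \<in> carrier M \<Longrightarrow> b \<in> carrier M \<Longrightarrow> a \<ominus>\<^bsub>M\<^esub> b \<in> carrier M"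
  using smult_closed[of s a] by auto

lemma smod_simps [simp]:
  "a \<in> carrier M \<Longrightarrow> 1 \<odot>\<^bsub>M\<^esub> a = a"
  "a \<in> carrier M \<Longrightarrow> 0 \<odot>\<^bsub>M\<^esub> a = \<zero>\<^bsub>M\<^esub>"
  "s \<odot>\<^bsub>M\<^esub> \<zero>\<^bsub>M\<^esub> = \<zero>\<^bsub>M\<^esub>"
  "a \<in> carrier M \<Longrightarrow> \<zero>\<^bsub>M\<^esub> \<oplus>\<^bsub>M\<^esub> a = a"
  "a \<in> carrier M \<Longrightarrow> a \<oplus>\<^bsub>M\<^esub> \<zero>\<^bsub>M\<^esub> = a"
  "a \<in> carrier M \<Longrightarrow> a \<ominus>\<^bsub>M\<^esub> \<zero>\<^bsub>M\<^esub> = a"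
  "a \<in> carrier M \<Longrightarrow> a \<ominus>\<^bsub>M\<^esub> a = \<zero>\<^bsub>M\<^esub>"
  using smult_one[of a] smult_l_null[of a] smult_r_null[of s]
  by (auto simp: a_minus_def M.r_neg)

lemma smod_uminus: "a \<in> carrier M \<Longrightarrow> \<ominus>\<^bsub>M\<^esub> a = (- 1) \<odot>\<^bsub>M\<^esub> a"
  using smult_l_minus[of 1 a] by simp

lemma smod_add_ac:
  "a \<in> carrier M \<Longrightarrow> b \<in> carrier M \<Longrightarrow> c \<in> carrier M \<Longrightarrow> (a \<oplus>\<^bsub>M\<^esub> b) \<oplus>\<^bsub>M\<^esub> c = a \<oplus>\<^bsub>M\<^esub> (b \<oplus>\<^bsub>M\<^esub> c)"
  "a \<in> carrier M \<Longrightarrow> b \<in> carrier M \<Longrightarrow> a \<oplus>\<^bsub>M\<^esub> b = b \<oplus>\<^bsub>M\<^esub> a"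
  "a \<in> carrier M \<Longrightarrow> b \<in> carrier M \<Longrightarrow> c \<in> carrier M \<Longrightarrow> a \<oplus>\<^bsub>M\<^esub> (b \<oplus>\<^bsub>M\<^esub> c) = b \<oplus>\<^bsub>M\<^esub> (a \<oplus>\<^bsub>M\<^esub> c)"
  by (auto simp: M.a_assoc M.a_comm M.a_lcomm)

text \<open>Differences are turned into sums with \<open>- 1\<close> as a scalar; identities are
  then normalised by \<open>smod_smult\<close> and \<open>smod_add_ac\<close> and closed by
  \<open>smod_cancel\<close>.\<close>

lemma smod_minus: "a \<in> carrier M \<Longrightarrow> b \<in> carrier M \<Longrightarrow> a \<ominus>\<^bsub>M\<^esub> b = a \<oplus>\<^bsub>M\<^esub> (- 1) \<odot>\<^bsub>M\<^esub> b"
  by (simp add: a_minus_def smod_uminus)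

lemma smod_smult:
  "a \<in> carrier M \<Longrightarrow> (s + t) \<odot>\<^bsub>M\<^esub> a = s \<odot>\<^bsub>M\<^esub> a \<oplus>\<^bsub>M\<^esub> t \<odot>\<^bsub>M\<^esub> a"
  "a \<in> carrier M \<Longrightarrow> b \<in> carrier M \<Longrightarrow> s \<odot>\<^bsub>M\<^esub> (a \<oplus>\<^bsub>M\<^esub> b) = s \<odot>\<^bsub>M\<^esub> a \<oplus>\<^bsub>M\<^esub> s \<odot>\<^bsub>M\<^esub> b"
  "a \<in> carrier M \<Longrightarrow> s \<odot>\<^bsub>M\<^esub> (t \<odot>\<^bsub>M\<^esub> a) = (s * t) \<odot>\<^bsub>M\<^esub> a"
  using smult_l_distr[of s t a] smult_r_distr[of s a b] smult_assoc1[of s t a] by auto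

lemma smod_smult_minus:
  "a \<in> carrier M \<Longrightarrow> b \<in> carrier M \<Longrightarrow> s \<odot>\<^bsub>M\<^esub> (a \<ominus>\<^bsub>M\<^esub> b) = s \<odot>\<^bsub>M\<^esub> a \<ominus>\<^bsub>M\<^esub> s \<odot>\<^bsub>M\<^esub> b"
  by (simp add: smod_minus smod_smult)

lemma smod_cancel:
  "a \<in> carrier M \<Longrightarrow> (- 1) \<odot>\<^bsub>M\<^esub> a \<oplus>\<^bsub>M\<^esub> a = \<zero>\<^bsub>M\<^esub>"
  "a \<in> carrier M \<Longrightarrow> a \<oplus>\<^bsub>M\<^esub> (- 1) \<odot>\<^bsub>M\<^esub> a = \<zero>\<^bsub>M\<^esub>"
  "a \<in> carrier M \<Longrightarrow> b \<in> carrier M \<Longrightarrow> a \<oplus>\<^bsub>M\<^esub> ((- 1) \<odot>\<^bsub>M\<^esub> a \<oplus>\<^bsub>M\<^esub> b) = b"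
  "a \<in> carrier M \<Longrightarrow> b \<in> carrier M \<Longrightarrow> (- 1) \<odot>\<^bsub>M\<^esub> a \<oplus>\<^bsub>M\<^esub> (a \<oplus>\<^bsub>M\<^esub> b) = b"
  using M.l_neg M.r_neg M.r_neg1 M.r_neg2 by (auto simp: smod_uminus)

lemma smod_submodule_iff:
  "submodule W S_ring M \<longleftrightarrow> W \<subseteq> carrier M \<and> \<zero>\<^bsub>M\<^esub> \<in> W \<and>
     (\<forall>a\<in>W. \<forall>b\<in>W. a \<oplus>\<^bsub>M\<^esub> b \<in> W) \<and> (\<forall>s. \<forall>a\<in>W. s \<odot>\<^bsub>M\<^esub> a \<in> W)" (is "_ \<longleftrightarrow> ?R")
proof
  assume *: "submodule W S_ring M"
  then have "subgroup W (add_monoid M)" by (simp add: submodule_def)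
  with * show ?R
    using submoduleE[OF *] subgroup.one_closed[of W "add_monoid M"] by auto
next
  assume *: ?R
  show "submodule W S_ring M"
  proof (rule submoduleI)
    show "\<ominus>\<^bsub>M\<^esub> a \<in> W" if "a \<in> W" for a
      using * that smod_uminus[of a] by (metis subsetD)
  qed (use * in auto)
qed

end

text \<open>With \<open>U\<close> spanned by the remaining generators, these are the coefficients at
  \<open>g\<close> of members of \<open>W\<close>. They take the place of the leading coefficients
  in Hilbert's theorem.\<close>

lemma is_ideal_transporter:
  assumes "smod M" "submodule U S_ring M" "submodule W S_ring M" "g \<in> carrier M"
  shows "is_ideal {s. \<exists>w\<in>U. s \<odot>\<^bsub>M\<^esub> g \<oplus>\<^bsub>M\<^esub> w \<in> W}"
  unfolding is_ideal_def
proof (intro conjI ballI allI CollectI)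
  note [simp] = assms(1,4)
  have U: "U \<subseteq> carrier M" "\<zero>\<^bsub>M\<^esub> \<in> U" "\<And>a b. a \<in> U \<Longrightarrow> b \<in> U \<Longrightarrow> a \<oplus>\<^bsub>M\<^esub> b \<in> U"
      "\<And>s a. a \<in> U \<Longrightarrow> s \<odot>\<^bsub>M\<^esub> a \<in> U"
    and W: "W \<subseteq> carrier M" "\<zero>\<^bsub>M\<^esub> \<in> W" "\<And>a b. a \<in> W \<Longrightarrow> b \<in> W \<Longrightarrow> a \<oplus>\<^bsub>M\<^esub> b \<in> W"
      "\<And>s a. a \<in> W \<Longrightarrow> s \<odot>\<^bsub>M\<^esub> a \<in> W"
    using assms by (auto simp: smod_submodule_iff)
  show "\<exists>w\<in>U. 0 \<odot>\<^bsub>M\<^esub> g \<oplus>\<^bsub>M\<^esub> w \<in> W"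
    using U W by (intro bexI[of _ "\<zero>\<^bsub>M\<^esub>"]) auto
  fix s assume "s \<in> {s. \<exists>w\<in>U. s \<odot>\<^bsub>M\<^esub> g \<oplus>\<^bsub>M\<^esub> w \<in> W}"
  then obtain u where u: "u \<in> U" "s \<odot>\<^bsub>M\<^esub> g \<oplus>\<^bsub>M\<^esub> u \<in> W" by blast
  then have u': "u \<in> carrier M" using U by blast
  show "\<exists>w\<in>U. (r * s) \<odot>\<^bsub>M\<^esub> g \<oplus>\<^bsub>M\<^esub> w \<in> W" for r
    using U(4)[OF u(1), of r] W(4)[OF u(2), of r] u'
    by (intro bexI[of _ "r \<odot>\<^bsub>M\<^esub> u"]) (auto simp: smod_smult)
  fix t assume "t \<in> {s. \<exists>w\<in>U. s \<odot>\<^bsub>M\<^esub> g \<oplus>\<^bsub>M\<^esub> w \<in> W}"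
  then obtain v where v: "v \<in> U" "t \<odot>\<^bsub>M\<^esub> g \<oplus>\<^bsub>M\<^esub> v \<in> W" by blast
  then have v': "v \<in> carrier M" using U by blast
  show "\<exists>w\<in>U. (s + t) \<odot>\<^bsub>M\<^esub> g \<oplus>\<^bsub>M\<^esub> w \<in> W"
    using U(3)[OF u(1) v(1)] W(3)[OF u(2) v(2)] u' v'
    by (intro bexI[of _ "u \<oplus>\<^bsub>M\<^esub> v"]) (auto simp: smod_smult smod_add_ac)
qed

text \<open>Induction on the number of generators of the ambient module. If \<open>U\<close> is
  spanned by all generators but \<open>g\<close>, then \<open>W\<close> is generated by generators
  of \<open>W \<inter> U\<close> together with lifts of generators of its ideal of coefficients at
  \<open>g\<close>.\<close>

lemma submodule_fg:
  fixes M :: "('k::alg_closed_field poly poly, 'm) graded_module"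
  assumes M: "smod M" and fg: "finitely_generated M" and W: "submodule W S_ring M"
  shows "\<exists>G. finite G \<and> G \<subseteq> W \<and> (\<forall>N. submodule N S_ring M \<and> G \<subseteq> N \<longrightarrow> W \<subseteq> N)"
proof -
  note [simp] = M
  define sp where "sp G = \<Inter>{N. submodule N S_ring M \<and> G \<subseteq> N}" for G
  have carr: "submodule (carrier M) S_ring M" by (auto simp: smod_submodule_iff)
  have sp_sub: "submodule (sp G) S_ring M" if "G \<subseteq> carrier M" for G
    using that carr unfolding smod_submodule_iff[OF M] sp_def by auto
  have sp_least: "sp G \<subseteq> N" if "submodule N S_ring M" "G \<subseteq> N" for G N
    using that by (auto simp: sp_def)
  have sp_incl: "G \<subseteq> sp G" for G by (auto simp: sp_def)
  \<comment> \<open>The induction concerns submodules of the span of \<open>G\<close> inside the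
    fixed \<open>M\<close>, so that no smaller ambient module has to be formed.\<close>
  have main: "\<exists>H. finite H \<and> H \<subseteq> W \<and> (\<forall>N. submodule N S_ring M \<and> H \<subseteq> N \<longrightarrow> W \<subseteq> N)"
    if "finite G" "G \<subseteq> carrier M" "submodule W S_ring M" "W \<subseteq> sp G" for G W
    using that
  proof (induction G arbitrary: W rule: finite_induct)
    case empty
    have "sp {} \<subseteq> {\<zero>\<^bsub>M\<^esub>}" by (rule sp_least) (auto simp: smod_submodule_iff)
    then show ?case using empty by (intro exI[of _ "{}"]) (auto simp: smod_submodule_iff)
  next
    case (insert g G)
    have g: "g \<in> carrier M" and G: "G \<subseteq> carrier M" using insert by auto
    note [simp] = g
    define U where "U = sp G"
    have Us: "submodule U S_ring M" using sp_sub[OF G] by (simp add: U_def)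
    have U: "U \<subseteq> carrier M" "\<zero>\<^bsub>M\<^esub> \<in> U" "\<And>a b. a \<in> U \<Longrightarrow> b \<in> U \<Longrightarrow> a \<oplus>\<^bsub>M\<^esub> b \<in> U"
        "\<And>s a. a \<in> U \<Longrightarrow> s \<odot>\<^bsub>M\<^esub> a \<in> U"
      using Us by (auto simp: smod_submodule_iff)
    have Wc: "W \<subseteq> carrier M" using insert.prems by (auto simp: smod_submodule_iff)
    let ?P = "{s \<odot>\<^bsub>M\<^esub> g \<oplus>\<^bsub>M\<^esub> w | s w. w \<in> U}"
    have "submodule ?P S_ring M"
      unfolding smod_submodule_iff[OF M]
    proof (intro conjI ballI allI)
      show "?P \<subseteq> carrier M" using U by auto
      have "\<zero>\<^bsub>M\<^esub> = 0 \<odot>\<^bsub>M\<^esub> g \<oplus>\<^bsub>M\<^esub> \<zero>\<^bsub>M\<^esub>" by simp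
      then show "\<zero>\<^bsub>M\<^esub> \<in> ?P" using U by blast
      fix a assume "a \<in> ?P"
      then obtain s u where a: "a = s \<odot>\<^bsub>M\<^esub> g \<oplus>\<^bsub>M\<^esub> u" "u \<in> U" by blast
      then have u': "u \<in> carrier M" using U by blast
      show "r \<odot>\<^bsub>M\<^esub> a \<in> ?P" for r
      proof -
        have "r \<odot>\<^bsub>M\<^esub> a = (r * s) \<odot>\<^bsub>M\<^esub> g \<oplus>\<^bsub>M\<^esub> r \<odot>\<^bsub>M\<^esub> u"
          using a u' by (simp add: smod_smult)
        then show ?thesis using U a by blast
      qed
      fix b assume "b \<in> ?P"
      then obtain t v where b: "b = t \<odot>\<^bsub>M\<^esub> g \<oplus>\<^bsub>M\<^esub> v" "v \<in> U" by blast
      then have v': "v \<in> carrier M" using U by blast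
      have "a \<oplus>\<^bsub>M\<^esub> b = (s + t) \<odot>\<^bsub>M\<^esub> g \<oplus>\<^bsub>M\<^esub> (u \<oplus>\<^bsub>M\<^esub> v)"
        using a b u' v' by (simp add: smod_smult smod_add_ac)
      then show "a \<oplus>\<^bsub>M\<^esub> b \<in> ?P" using U a b by blast
    qed
    moreover have "insert g G \<subseteq> ?P"
    proof -
      have "g = 1 \<odot>\<^bsub>M\<^esub> g \<oplus>\<^bsub>M\<^esub> \<zero>\<^bsub>M\<^esub>" by simp
      moreover have "w = 0 \<odot>\<^bsub>M\<^esub> g \<oplus>\<^bsub>M\<^esub> w" if "w \<in> G" for w using that G by auto
      moreover have "G \<subseteq> U" using sp_incl by (simp add: U_def)
      ultimately show ?thesis using U(2) by blast
    qed
    ultimately have WP: "W \<subseteq> ?P" using sp_least[of ?P "insert g G"] insert.prems by blast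
    let ?I = "\<lambda>W. {s. \<exists>w\<in>U. s \<odot>\<^bsub>M\<^esub> g \<oplus>\<^bsub>M\<^esub> w \<in> W}"
    have "is_ideal (?I W)" using is_ideal_transporter[OF M Us insert.prems(2) g] .
    then obtain GI where GI: "finite GI" "GI \<subseteq> ?I W" "\<And>J. is_ideal J \<Longrightarrow> GI \<subseteq> J \<Longrightarrow> ?I W \<subseteq> J"
      using noetherian_S[where 'k='k] unfolding noetherian_def by meson
    have "\<forall>s. \<exists>w. s \<in> GI \<longrightarrow> w \<in> U \<and> s \<odot>\<^bsub>M\<^esub> g \<oplus>\<^bsub>M\<^esub> w \<in> W" using GI(2) by blast
    then obtain w where w: "\<And>s. s \<in> GI \<Longrightarrow> w s \<in> U \<and> s \<odot>\<^bsub>M\<^esub> g \<oplus>\<^bsub>M\<^esub> w s \<in> W" by metis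
    have WU: "submodule (W \<inter> U) S_ring M" using insert.prems(2) Us by (auto simp: smod_submodule_iff)
    obtain G0 where G0: "finite G0" "G0 \<subseteq> W \<inter> U"
        "\<And>N. submodule N S_ring M \<Longrightarrow> G0 \<subseteq> N \<Longrightarrow> W \<inter> U \<subseteq> N"
    proof -
      have "W \<inter> U \<subseteq> sp G" by (simp add: U_def)
      from insert.IH[OF G WU this] that show thesis by meson
    qed
    let ?H = "(\<lambda>s. s \<odot>\<^bsub>M\<^esub> g \<oplus>\<^bsub>M\<^esub> w s) ` GI \<union> G0"
    have "W \<subseteq> N" if N: "submodule N S_ring M" and H: "?H \<subseteq> N" for N
    proof
      fix x assume x: "x \<in> W"
      have WN: "submodule (W \<inter> N) S_ring M" using insert.prems(2) N by (auto simp: smod_submodule_iff)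
      have "is_ideal (?I (W \<inter> N))" using is_ideal_transporter[OF M Us WN g] .
      moreover have "GI \<subseteq> ?I (W \<inter> N)" using w H by blast
      ultimately have IJ: "?I W \<subseteq> ?I (W \<inter> N)" by (rule GI(3))
      from x WP obtain s u where su: "x = s \<odot>\<^bsub>M\<^esub> g \<oplus>\<^bsub>M\<^esub> u" "u \<in> U" by blast
      then have "s \<in> ?I W" using x by blast
      \<comment> \<open>Both \<open>x\<close> and this element of \<open>W \<inter> N\<close> have
        coefficient \<open>s\<close> at \<open>g\<close>. Their difference therefore lies in
        \<open>W \<inter> U\<close>, which is generated by \<open>G0\<close>.\<close>
      then obtain v where v: "v \<in> U" "s \<odot>\<^bsub>M\<^esub> g \<oplus>\<^bsub>M\<^esub> v \<in> W \<inter> N" using IJ by blast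
      have uv: "u \<in> carrier M" "v \<in> carrier M" using U su v by auto
      let ?d = "u \<oplus>\<^bsub>M\<^esub> (- 1) \<odot>\<^bsub>M\<^esub> v"
      have "(s \<odot>\<^bsub>M\<^esub> g \<oplus>\<^bsub>M\<^esub> v) \<oplus>\<^bsub>M\<^esub> ?d = (s \<odot>\<^bsub>M\<^esub> g \<oplus>\<^bsub>M\<^esub> u) \<oplus>\<^bsub>M\<^esub> (v \<oplus>\<^bsub>M\<^esub> (- 1) \<odot>\<^bsub>M\<^esub> v)"
        using uv by (simp add: smod_add_ac)
      then have x_eq: "x = (s \<odot>\<^bsub>M\<^esub> g \<oplus>\<^bsub>M\<^esub> v) \<oplus>\<^bsub>M\<^esub> ?d"
        using uv su(1) by (simp add: smod_cancel)
      have d_eq: "?d = x \<oplus>\<^bsub>M\<^esub> (- 1) \<odot>\<^bsub>M\<^esub> (s \<odot>\<^bsub>M\<^esub> g \<oplus>\<^bsub>M\<^esub> v)"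
        using uv smod_cancel(3)[OF M, of "s \<odot>\<^bsub>M\<^esub> g" "u \<oplus>\<^bsub>M\<^esub> (- 1) \<odot>\<^bsub>M\<^esub> v"] unfolding su(1)
        by (simp add: smod_smult smod_add_ac)
      have "?d \<in> U" using U su v by blast
      moreover have "?d \<in> W" unfolding d_eq
        using x v insert.prems(2) unfolding smod_submodule_iff[OF M] by blast
      ultimately have "?d \<in> N" using G0(3)[OF N] H by blast
      then show "x \<in> N" using v N unfolding x_eq smod_submodule_iff[OF M] by blast
    qed
    moreover have "finite ?H" "?H \<subseteq> W" using GI(1) G0 w by auto
    ultimately show ?case
      by (intro exI[of _ ?H] conjI allI impI) (assumption | elim conjE)+
  qed
  obtain G where "finite G" "G \<subseteq> carrier M" "\<And>N. submodule N S_ring M \<Longrightarrow> G \<subseteq> N \<Longrightarrow> N = carrier M"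
    using fg unfolding finitely_generated_def by blast
  moreover from this have "sp G = carrier M" using sp_sub sp_incl by blast
  ultimately show ?thesis using main[of G W] W by (auto simp: smod_submodule_iff)
qed

section \<open>The grading group and saturation\<close>

lemma Z2_simps [simp]:
  "carrier Z2 = UNIV" "x \<otimes>\<^bsub>Z2\<^esub> y = (fst x + fst y, snd x + snd y)" "\<one>\<^bsub>Z2\<^esub> = (0, 0)"
  by (auto simp: Z2_def DirProd_def case_prod_unfold)

lemma group_Z2: "group Z2"
  by (simp add: Z2_def DirProd_group)

lemma Lrel_eq: "Lrel p q = {(k * int p, - k * int q) | k. True}"
proof -
  interpret group Z2 by (rule group_Z2)
  let ?H = "{(k * int p, - k * int q) | k. True}"
  have inv: "inv\<^bsub>Z2\<^esub> (a, b) = (- a, - b)" for a b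
    by (rule inv_equality) auto
  have "Lrel p q \<subseteq> ?H"
  proof
    fix x assume "x \<in> Lrel p q"
    then show "x \<in> ?H"
      unfolding Lrel_def
    proof (induction rule: generate.induct)
      case one
      show ?case by (auto intro: exI[of _ 0])
    next
      case (incl h)
      then show ?case by (auto intro: exI[of _ 1])
    next
      case (inv h)
      then show ?case using \<open>\<And>b a. inv\<^bsub>Z2\<^esub> (a, b) = (- a, - b)\<close> by (auto intro!: exI[of _ "-1"])
    next
      case (eng h1 h2)
      then obtain k l where "h1 = (k * int p, - k * int q)" "h2 = (l * int p, - l * int q)" by blast
      then show ?case by (auto intro!: exI[of _ "k + l"] simp: algebra_simps)
    qed
  qed
  moreover have nat: "(int n * int p, - int n * int q) \<in> Lrel p q" for n
  proof (induction n)
    case 0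
    then show ?case using generate.one[of Z2] by (simp add: Lrel_def)
  next
    case (Suc n)
    have "(int p, - int q) \<in> Lrel p q" by (simp add: Lrel_def generate.incl)
    from generate.eng[OF Suc[unfolded Lrel_def] this[unfolded Lrel_def]]
    show ?case by (simp add: Lrel_def algebra_simps)
  qed
  have "(k * int p, - k * int q) \<in> Lrel p q" for k
  proof (cases "k \<ge> 0")
    case True
    then show ?thesis using nat[of "nat k"] by simp
  next
    case False
    have "subgroup (Lrel p q) Z2" by (simp add: Lrel_def generate_is_subgroup)
    from subgroup.m_inv_closed[OF this nat[of "nat (- k)"]] False
    show ?thesis by (simp add: inv)
  qed
  ultimately show ?thesis by auto
qed

lemma Lvec_eq: "Lvec p q a b = {(a + k * int p, b - k * int q) | k. True}"
  by (auto simp: Lvec_def Lrel_eq r_coset_def algebra_simps)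

lemma Lvec_eq_iff:
  "Lvec p q a b = Lvec p q a' b' \<longleftrightarrow> (\<exists>k. a' = a + k * int p \<and> b' = b - k * int q)"
proof
  assume *: "Lvec p q a b = Lvec p q a' b'"
  have "(a', b') \<in> Lvec p q a' b'" by (auto simp: Lvec_eq intro: exI[of _ 0])
  then have "(a', b') \<in> Lvec p q a b" using * by simp
  then show "\<exists>k. a' = a + k * int p \<and> b' = b - k * int q" by (simp add: Lvec_eq)
next
  assume "\<exists>k. a' = a + k * int p \<and> b' = b - k * int q"
  then obtain k where k: "a' = a + k * int p" "b' = b - k * int q" by blast
  show "Lvec p q a b = Lvec p q a' b'"
  proof (rule Set.set_eqI, rule iffI)
    fix x assume "x \<in> Lvec p q a b"
    then obtain l where "x = (a + l * int p, b - l * int q)" by (auto simp: Lvec_eq)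
    then show "x \<in> Lvec p q a' b'"
      by (auto simp: Lvec_eq k algebra_simps intro!: exI[of _ "l - k"])
  next
    fix x assume "x \<in> Lvec p q a' b'"
    then obtain l where "x = (a' + l * int p, b' - l * int q)" by (auto simp: Lvec_eq)
    then show "x \<in> Lvec p q a b"
      by (auto simp: Lvec_eq k algebra_simps intro!: exI[of _ "l + k"])
  qed
qed

lemma carrier_LL: "carrier (LL p q) = {Lvec p q a b | a b. True}"
  by (auto simp: LL_def FactGroup_def RCOSETS_def Lvec_def)

lemma Lvec_in [simp]: "Lvec p q a b \<in> carrier (LL p q)"
  by (auto simp: carrier_LL)

lemma Lvec_mult [simp]: "Lvec p q a b \<otimes>\<^bsub>LL p q\<^esub> Lvec p q c d = Lvec p q (a + c) (b + d)"
proof -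
  have "Lvec p q a b <#>\<^bsub>Z2\<^esub> Lvec p q c d = Lvec p q (a + c) (b + d)"
  proof (rule Set.set_eqI, rule iffI)
    fix x assume "x \<in> Lvec p q a b <#>\<^bsub>Z2\<^esub> Lvec p q c d"
    then obtain k l where "x = (a + k * int p + (c + l * int p), b - k * int q + (d - l * int q))"
      by (auto simp: set_mult_def Lvec_eq)
    then show "x \<in> Lvec p q (a + c) (b + d)"
      by (auto simp: Lvec_eq algebra_simps intro!: exI[of _ "k + l"])
  next
    fix x assume "x \<in> Lvec p q (a + c) (b + d)"
    then obtain k where x: "x = (a + c + k * int p, b + d - k * int q)" by (auto simp: Lvec_eq)
    have "(a + k * int p, b - k * int q) \<in> Lvec p q a b" "(c, d) \<in> Lvec p q c d"
      by (auto simp: Lvec_eq intro: exI[of _ 0])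
    then show "x \<in> Lvec p q a b <#>\<^bsub>Z2\<^esub> Lvec p q c d"
      unfolding set_mult_def x by (force simp: algebra_simps)
  qed
  then show ?thesis by (simp add: LL_def FactGroup_def)
qed

lemma one_LL: "\<one>\<^bsub>LL p q\<^esub> = Lvec p q 0 0"
  by (auto simp: LL_def FactGroup_def Lvec_eq Lrel_eq)

lemma LL_E: assumes "d \<in> carrier (LL p q)" obtains a b where "d = Lvec p q a b"
  using assms by (auto simp: carrier_LL)

lemma comm_group_LL: "comm_group (LL p q)"
proof (rule comm_groupI)
  fix x assume "x \<in> carrier (LL p q)"
  then obtain a b where "x = Lvec p q a b" by (rule LL_E)
  then show "\<exists>y\<in>carrier (LL p q). y \<otimes>\<^bsub>LL p q\<^esub> x = \<one>\<^bsub>LL p q\<^esub>"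
    by (intro bexI[of _ "Lvec p q (- a) (- b)"]) (auto simp: one_LL)
qed (auto simp: one_LL algebra_simps elim!: LL_E)

lemma inv_Lvec [simp]: "inv\<^bsub>LL p q\<^esub> (Lvec p q a b) = Lvec p q (- a) (- b)"
proof -
  interpret comm_group "LL p q" by (rule comm_group_LL)
  show ?thesis by (rule inv_equality) (auto simp: one_LL)
qed

text \<open>The filter of high powers of the variables; \<open>\<forall>\<^sub>F s in irr. s \<odot>\<^bsub>M\<^esub> m \<in> W\<close> says that \<open>m\<close> lies in
  \<open>W\<close> up to torsion.\<close>

definition irr :: "'k::alg_closed_field poly poly filter" where
  "irr = sup (filtermap (\<lambda>k. S_x1 ^ k) sequentially) (filtermap (\<lambda>k. S_x2 ^ k) sequentially)"

lemma eventually_irr: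
  "eventually P irr \<longleftrightarrow> (\<exists>k0. \<forall>k\<ge>k0. P (S_x1 ^ k) \<and> P (S_x2 ^ k))"
proof -
  have "(\<exists>k0. \<forall>k\<ge>k0. P (S_x1 ^ k)) \<and> (\<exists>k0. \<forall>k\<ge>k0. P (S_x2 ^ k)) \<Longrightarrow>
    (\<exists>k0. \<forall>k\<ge>k0. P (S_x1 ^ k) \<and> P (S_x2 ^ k))"
    by (meson max.bounded_iff)
  then show ?thesis
    unfolding irr_def eventually_sup eventually_filtermap eventually_sequentially by blast
qed

lemma eventually_irr_ex:
  assumes "eventually P irr" obtains k where "P (S_x1 ^ k)" "P (S_x2 ^ k)"
  using assms by (auto simp: eventually_irr)

text \<open>For \<open>s\<close> a power of one variable, let \<open>t\<close> be a high power of
  the same variable: the products run through all high powers of it. This makes saturation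
  idempotent and lets relations be composed.\<close>

lemma eventually_irr_mult:
  assumes "\<forall>\<^sub>F s in irr. \<forall>\<^sub>F t in irr. P (t * s)"
  shows "eventually P irr"
proof -
  obtain i where "\<forall>\<^sub>F t in irr. P (t * S_x1 ^ i)" "\<forall>\<^sub>F t in irr. P (t * S_x2 ^ i)"
    using eventually_irr_ex[OF assms] by blast
  then have "\<forall>\<^sub>F t in irr. P (t * S_x1 ^ i) \<and> P (t * S_x2 ^ i)" by (rule eventually_conj)
  then obtain j where j: "\<And>k. k \<ge> j \<Longrightarrow> P (S_x1 ^ k * S_x1 ^ i)" "\<And>k. k \<ge> j \<Longrightarrow> P (S_x2 ^ k * S_x2 ^ i)"
    by (auto simp: eventually_irr)
  show ?thesis
    unfolding eventually_irr
  proof (intro exI[of _ "i + j"] allI impI)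
    fix k assume "k \<ge> i + j"
    then obtain m where "k = m + i" "m \<ge> j" by (metis add.commute le_Suc_ex le_add2 add.assoc)
    then show "P (S_x1 ^ k) \<and> P (S_x2 ^ k)" using j[of m] by (simp add: power_add)
  qed
qed

lemma smod_submoduleD:
  assumes "smod M" "submodule W S_ring M"
  shows "a \<in> W \<Longrightarrow> a \<in> carrier M" "\<zero>\<^bsub>M\<^esub> \<in> W" "a \<in> W \<Longrightarrow> b \<in> W \<Longrightarrow> a \<oplus>\<^bsub>M\<^esub> b \<in> W"
    "a \<in> W \<Longrightarrow> s \<odot>\<^bsub>M\<^esub> a \<in> W" "a \<in> W \<Longrightarrow> b \<in> W \<Longrightarrow> a \<ominus>\<^bsub>M\<^esub> b \<in> W"
proof -
  note [simp] = assms(1)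
  show "a \<in> W \<Longrightarrow> a \<in> carrier M" "\<zero>\<^bsub>M\<^esub> \<in> W" "a \<in> W \<Longrightarrow> b \<in> W \<Longrightarrow> a \<oplus>\<^bsub>M\<^esub> b \<in> W"
    "a \<in> W \<Longrightarrow> s \<odot>\<^bsub>M\<^esub> a \<in> W" for a b s
    using assms(2) by (auto simp: smod_submodule_iff)
  then show "a \<in> W \<Longrightarrow> b \<in> W \<Longrightarrow> a \<ominus>\<^bsub>M\<^esub> b \<in> W"
    by (simp add: smod_minus)
qed

text \<open>Saturation with respect to the irrelevant ideal, tested on the powers of the two
  variables. Submodules with the same saturation give the same subobject in the quotient
  category.\<close>

definition sat :: "('k::alg_closed_field poly poly, 'm, 'z) module_scheme \<Rightarrow> 'm set \<Rightarrow> 'm set" where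
  "sat M W = {m \<in> carrier M. \<forall>\<^sub>F s in irr. s \<odot>\<^bsub>M\<^esub> m \<in> W}"

abbreviation tors :: "('k::alg_closed_field poly poly, 'm, 'z) module_scheme \<Rightarrow> 'm set" where
  "tors M \<equiv> sat M {\<zero>\<^bsub>M\<^esub>}"

lemma zero_submodule: "smod M \<Longrightarrow> submodule {\<zero>\<^bsub>M\<^esub>} S_ring M"
  by (auto simp: smod_submodule_iff)

lemma carrier_submodule: "smod M \<Longrightarrow> submodule (carrier M) S_ring M"
  by (auto simp: smod_submodule_iff)

lemma sat_carrier: "m \<in> sat M W \<Longrightarrow> m \<in> carrier M"
  by (simp add: sat_def)

lemma satI:
  assumes "smod M" "submodule W S_ring M" "m \<in> carrier M"
    "S_x1 ^ i \<odot>\<^bsub>M\<^esub> m \<in> W" "S_x2 ^ j \<odot>\<^bsub>M\<^esub> m \<in> W"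
  shows "m \<in> sat M W"
proof -
  have "S_x1 ^ k \<odot>\<^bsub>M\<^esub> m \<in> W \<and> S_x2 ^ k \<odot>\<^bsub>M\<^esub> m \<in> W" if "k \<ge> i + j" for k
  proof -
    obtain a b where "k = a + i" "k = b + j" using \<open>k \<ge> i + j\<close>
      by (metis add_leD1 add_leD2 add.commute le_Suc_ex)
    then have "S_x1 ^ k \<odot>\<^bsub>M\<^esub> m = S_x1 ^ a \<odot>\<^bsub>M\<^esub> (S_x1 ^ i \<odot>\<^bsub>M\<^esub> m)"
      "S_x2 ^ k \<odot>\<^bsub>M\<^esub> m = S_x2 ^ b \<odot>\<^bsub>M\<^esub> (S_x2 ^ j \<odot>\<^bsub>M\<^esub> m)"
      using smod_smult(3)[OF assms(1,3)] by (simp_all add: power_add[symmetric])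
    then show ?thesis using smod_submoduleD(4)[OF assms(1,2)] assms(4,5) by simp
  qed
  then show ?thesis using assms(3) unfolding sat_def eventually_irr by blast
qed

lemma sat_mono: "W \<subseteq> W' \<Longrightarrow> sat M W \<subseteq> sat M W'"
  by (auto simp: sat_def elim: eventually_mono)

lemma sat_incl:
  assumes "smod M" "submodule W S_ring M" shows "W \<subseteq> sat M W"
  using smod_submoduleD[OF assms] by (auto simp: sat_def)

text \<open>The usual entry into the arguments below: before an element is placed in a saturation,
  it may be multiplied by high powers of the variables, for instance to bring it into the domain or
  the range of a relation.\<close>

lemma sat_eventually:
  assumes "smod M" "m \<in> carrier M" "\<forall>\<^sub>F s in irr. s \<odot>\<^bsub>M\<^esub> m \<in> sat M W"
  shows "m \<in> sat M W"
proof -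
  have "\<forall>\<^sub>F s in irr. \<forall>\<^sub>F t in irr. (t * s) \<odot>\<^bsub>M\<^esub> m \<in> W"
    using assms(3) by (rule eventually_mono) (use assms in \<open>simp add: sat_def smod_smult\<close>)
  then have "\<forall>\<^sub>F s in irr. s \<odot>\<^bsub>M\<^esub> m \<in> W" by (rule eventually_irr_mult)
  then show ?thesis using assms(2) by (simp add: sat_def)
qed

lemma sat_submodule:
  assumes "smod M" "submodule W S_ring M" shows "submodule (sat M W) S_ring M"
  unfolding smod_submodule_iff[OF assms(1)]
proof (intro conjI ballI allI)
  note [simp] = assms(1)
  note W = smod_submoduleD[OF assms]
  show "sat M W \<subseteq> carrier M" by (auto simp: sat_def)
  show "\<zero>\<^bsub>M\<^esub> \<in> sat M W" using W by (simp add: sat_def)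
  fix a assume a: "a \<in> sat M W"
  show "r \<odot>\<^bsub>M\<^esub> a \<in> sat M W" for r
  proof -
    have "\<forall>\<^sub>F s in irr. s \<odot>\<^bsub>M\<^esub> (r \<odot>\<^bsub>M\<^esub> a) \<in> W"
    proof (rule eventually_mono)
      show "\<forall>\<^sub>F s in irr. s \<odot>\<^bsub>M\<^esub> a \<in> W" using a by (simp add: sat_def)
      fix s assume "s \<odot>\<^bsub>M\<^esub> a \<in> W"
      then have "r \<odot>\<^bsub>M\<^esub> (s \<odot>\<^bsub>M\<^esub> a) \<in> W" using W by simp
      then show "s \<odot>\<^bsub>M\<^esub> (r \<odot>\<^bsub>M\<^esub> a) \<in> W"
        using sat_carrier[OF a] by (simp add: smod_smult mult.commute)
    qed
    then show ?thesis using sat_carrier[OF a] by (simp add: sat_def)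
  qed
  fix b assume b: "b \<in> sat M W"
  have "\<forall>\<^sub>F s in irr. s \<odot>\<^bsub>M\<^esub> a \<in> W \<and> s \<odot>\<^bsub>M\<^esub> b \<in> W"
    using a b by (auto simp: sat_def intro: eventually_conj)
  then have "\<forall>\<^sub>F s in irr. s \<odot>\<^bsub>M\<^esub> (a \<oplus>\<^bsub>M\<^esub> b) \<in> W"
    by (rule eventually_mono) (use W sat_carrier[OF a] sat_carrier[OF b] in \<open>simp add: smod_smult\<close>)
  then show "a \<oplus>\<^bsub>M\<^esub> b \<in> sat M W" using sat_carrier[OF a] sat_carrier[OF b] by (simp add: sat_def)
qed

lemma sat_sat:
  assumes "smod M" "submodule W S_ring M" shows "sat M (sat M W) = sat M W"
proof
  show "sat M (sat M W) \<subseteq> sat M W"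
    using sat_eventually[OF assms(1)] by (auto simp: sat_def[of M "sat M W"])
  show "sat M W \<subseteq> sat M (sat M W)" using sat_incl[OF assms(1) sat_submodule[OF assms]] .
qed

text \<open>Membership in the carrier is part of the congruence, so that chains of congruences need
  no side conditions.\<close>

definition cg :: "('k::alg_closed_field poly poly, 'm, 'z) module_scheme \<Rightarrow> 'm set \<Rightarrow> 'm \<Rightarrow> 'm \<Rightarrow> bool" where
  "cg M W a b \<longleftrightarrow> a \<in> carrier M \<and> b \<in> carrier M \<and> a \<ominus>\<^bsub>M\<^esub> b \<in> W"

context
  fixes M :: "('k::alg_closed_field poly poly, 'm, 'z) module_scheme" and W
  assumes M: "smod M" and W: "submodule W S_ring M"
begin

lemma cg_carrier: "cg M W a b \<Longrightarrow> a \<in> carrier M" "cg M W a b \<Longrightarrow> b \<in> carrier M"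
  by (auto simp: cg_def)

lemma cg_refl [simp]: "a \<in> carrier M \<Longrightarrow> cg M W a a"
  using M smod_submoduleD[OF M W] by (simp add: cg_def)

lemma cg_sym: assumes "cg M W a b" shows "cg M W b a"
proof -
  have "b \<ominus>\<^bsub>M\<^esub> a = (- 1) \<odot>\<^bsub>M\<^esub> (a \<ominus>\<^bsub>M\<^esub> b)"
    using assms M by (simp add: cg_def smod_minus smod_smult smod_add_ac)
  then show ?thesis using assms smod_submoduleD[OF M W] by (simp add: cg_def)
qed

lemma cg_trans [trans]: assumes "cg M W a b" "cg M W b c" shows "cg M W a c"
proof -
  have "a \<ominus>\<^bsub>M\<^esub> c = (a \<ominus>\<^bsub>M\<^esub> b) \<oplus>\<^bsub>M\<^esub> (b \<ominus>\<^bsub>M\<^esub> c)"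
    using assms M by (simp add: cg_def smod_minus smod_add_ac smod_cancel)
  then show ?thesis using assms smod_submoduleD[OF M W] by (simp add: cg_def)
qed

lemma cg_add: assumes "cg M W a b" "cg M W c d" shows "cg M W (a \<oplus>\<^bsub>M\<^esub> c) (b \<oplus>\<^bsub>M\<^esub> d)"
proof -
  have "(a \<oplus>\<^bsub>M\<^esub> c) \<ominus>\<^bsub>M\<^esub> (b \<oplus>\<^bsub>M\<^esub> d) = (a \<ominus>\<^bsub>M\<^esub> b) \<oplus>\<^bsub>M\<^esub> (c \<ominus>\<^bsub>M\<^esub> d)"
    using assms M by (simp add: cg_def smod_minus smod_add_ac smod_smult)
  then show ?thesis using assms M smod_submoduleD[OF M W] by (simp add: cg_def)
qed

lemma cg_smult: assumes "cg M W a b" shows "cg M W (s \<odot>\<^bsub>M\<^esub> a) (s \<odot>\<^bsub>M\<^esub> b)"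
  using assms M smod_submoduleD[OF M W] by (simp add: cg_def smod_smult_minus[symmetric])

lemma cg_zero_iff: "cg M W a \<zero>\<^bsub>M\<^esub> \<longleftrightarrow> a \<in> W"
  using M smod_submoduleD[OF M W] by (auto simp: cg_def)

lemma cg_in: "cg M W a b \<Longrightarrow> a \<in> W \<longleftrightarrow> b \<in> W"
  using cg_zero_iff cg_trans cg_sym by metis

lemma cg_mem: "a \<in> W \<Longrightarrow> b \<in> W \<Longrightarrow> cg M W a b"
  using cg_zero_iff cg_trans cg_sym by metis

end

text \<open>The equality that survives in the quotient category: values that differ by torsion count
  as the same.\<close>

abbreviation teq where "teq M \<equiv> cg M (tors M)"

lemma tors_submodule: "smod M \<Longrightarrow> submodule (tors M) S_ring M"
  by (intro sat_submodule zero_submodule)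

lemma teq_eventually:
  assumes "smod M" "a \<in> carrier M" "b \<in> carrier M" "\<forall>\<^sub>F s in irr. teq M (s \<odot>\<^bsub>M\<^esub> a) (s \<odot>\<^bsub>M\<^esub> b)"
  shows "teq M a b"
proof -
  have "\<forall>\<^sub>F s in irr. s \<odot>\<^bsub>M\<^esub> (a \<ominus>\<^bsub>M\<^esub> b) \<in> tors M"
    using assms(4) by (rule eventually_mono) (use assms in \<open>auto simp: cg_def smod_smult_minus\<close>)
  then show ?thesis using assms sat_eventually[OF assms(1), of "a \<ominus>\<^bsub>M\<^esub> b"] by (simp add: cg_def)
qed

lemma sat_cg:
  assumes "smod M" "submodule W S_ring M" "teq M a b" "a \<in> sat M W" shows "b \<in> sat M W"
proof -
  have "tors M \<subseteq> sat M W" using smod_submoduleD[OF assms(1,2)] by (intro sat_mono) auto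
  then have "cg M (sat M W) a b" using assms(3) by (auto simp: cg_def)
  then show ?thesis using cg_in[OF assms(1) sat_submodule[OF assms(1,2)]] assms(4) by blast
qed

section \<open>Graded modules\<close>

lemma finsum_submodule:
  assumes "smod M" "submodule W S_ring M" "finite A" "\<And>a. a \<in> A \<Longrightarrow> f a \<in> W"
  shows "finsum M f A \<in> W"
proof -
  interpret module S_ring M by (rule assms(1))
  note W = smod_submoduleD[OF assms(1,2)]
  show ?thesis using assms(3,4)
  proof (induction A rule: finite_induct)
    case (insert x F)
    then have "f \<in> F \<rightarrow> carrier M" "f x \<in> carrier M" using W by auto
    then show ?case using insert W by simp
  qed (use W in simp)
qed

lemma finsum_smult:
  assumes "smod M" "finite A" "f \<in> A \<rightarrow> carrier M"
  shows "s \<odot>\<^bsub>M\<^esub> finsum M f A = finsum M (\<lambda>a. s \<odot>\<^bsub>M\<^esub> f a) A"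
proof -
  interpret module S_ring M by (rule assms(1))
  show ?thesis using assms(2,3)
  proof (induction A rule: finite_induct)
    case (insert x F)
    then have "f \<in> F \<rightarrow> carrier M" "f x \<in> carrier M" "(\<lambda>a. s \<odot>\<^bsub>M\<^esub> f a) \<in> F \<rightarrow> carrier M"
      by (auto intro!: smod_closed(3)[OF assms(1)])
    then show ?case using insert assms(1) by (simp add: smod_smult smod_closed)
  qed (use assms(1) in simp)
qed

locale weights =
  fixes p q :: nat
  assumes p_pos: "p > 0" and q_pos: "q > 0"
begin

abbreviation L where "L \<equiv> LL p q"
abbreviation V where "V \<equiv> Lvec p q"
abbreviation gm :: "('k::alg_closed_field poly poly, 'm) graded_module \<Rightarrow> bool" where
  "gm M \<equiv> L_graded_module p q M"
abbreviation comp :: "('k::alg_closed_field poly poly, 'm) graded_module \<Rightarrow> 'm \<Rightarrow> (int \<times> int) set \<Rightarrow> 'm"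
  where "comp M m \<equiv> component p q M m"

lemma S_piece_const [simp]: "[:[:c:]:] \<in> S_piece p q (V 0 0)"
  by (auto simp: S_piece_def coeff_pCons split: nat.splits)

lemma S_piece_x1: "S_x1 ^ k \<in> S_piece p q (V (int k) 0)"
proof -
  have "S_x1 ^ k = ([:monom 1 k:] :: 'a poly poly)"
  proof (induction k)
    case (Suc k)
    then show ?case by (simp add: S_x1_def monom_Suc)
  qed (simp add: one_pCons monom_0)
  then show ?thesis by (auto simp: S_piece_def coeff_pCons split: nat.splits if_splits)
qed

lemma S_piece_x2: "S_x2 ^ k \<in> S_piece p q (V 0 (int k))"
proof -
  have "S_x2 ^ k = (monom 1 k :: 'a poly poly)"
    by (simp add: S_x2_def monom_altdef)
  then show ?thesis by (auto simp: S_piece_def coeff_monom split: if_splits)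
qed

context
  fixes M :: "('k::alg_closed_field poly poly, 'm) graded_module"
  assumes gmM: "gm M"
begin

lemma gm_smod: "smod M"
  using gmM by (simp add: L_graded_module_def)

interpretation module S_ring M by (rule gm_smod)

lemma piece_subgroup: "d \<in> carrier L \<Longrightarrow> subgroup (piece M d) (add_monoid M)"
  using gmM by (simp add: L_graded_module_def)

lemma piece_zero: "d \<in> carrier L \<Longrightarrow> \<zero>\<^bsub>M\<^esub> \<in> piece M d"
  using subgroup.one_closed[OF piece_subgroup] by simp

lemma piece_add: "d \<in> carrier L \<Longrightarrow> a \<in> piece M d \<Longrightarrow> b \<in> piece M d \<Longrightarrow> a \<oplus>\<^bsub>M\<^esub> b \<in> piece M d"
  using subgroup.m_closed[OF piece_subgroup] by simp

lemma piece_carrier: "d \<in> carrier L \<Longrightarrow> a \<in> piece M d \<Longrightarrow> a \<in> carrier M"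
  using subgroup.subset[OF piece_subgroup] by auto

lemma piece_smult: "s \<in> S_piece p q e \<Longrightarrow> e \<in> carrier L \<Longrightarrow> d \<in> carrier L \<Longrightarrow> a \<in> piece M d \<Longrightarrow>
    s \<odot>\<^bsub>M\<^esub> a \<in> piece M (e \<otimes>\<^bsub>L\<^esub> d)"
  using gmM by (simp add: L_graded_module_def)

lemma piece_minus: "d \<in> carrier L \<Longrightarrow> a \<in> piece M d \<Longrightarrow> b \<in> piece M d \<Longrightarrow> a \<ominus>\<^bsub>M\<^esub> b \<in> piece M d"
  using subgroup.m_inv_closed[OF piece_subgroup] piece_add by (simp add: a_minus_def a_inv_def)

lemma decomposition_comp: "m \<in> carrier M \<Longrightarrow> decomposition p q M m (comp M m)"
  using gmM theI'[of "decomposition p q M m"] by (auto simp: component_def L_graded_module_def)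

lemma comp_piece: "m \<in> carrier M \<Longrightarrow> d \<in> carrier L \<Longrightarrow> comp M m d \<in> piece M d"
  using decomposition_comp by (auto simp: decomposition_def)

lemma comp_carrier: "m \<in> carrier M \<Longrightarrow> d \<in> carrier L \<Longrightarrow> comp M m d \<in> carrier M"
  using comp_piece piece_carrier by blast

lemma comp_finite: "m \<in> carrier M \<Longrightarrow> finite {d \<in> carrier L. comp M m d \<noteq> \<zero>\<^bsub>M\<^esub>}"
  using decomposition_comp by (auto simp: decomposition_def)

lemma comp_sum: "m \<in> carrier M \<Longrightarrow> m = finsum M (comp M m) {d \<in> carrier L. comp M m d \<noteq> \<zero>\<^bsub>M\<^esub>}"
  using decomposition_comp[of m] by (simp add: decomposition_def)

lemma comp_sum':
  assumes "m \<in> carrier M" "finite D" "D \<subseteq> carrier L" "{d \<in> carrier L. comp M m d \<noteq> \<zero>\<^bsub>M\<^esub>} \<subseteq> D"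
  shows "m = finsum M (comp M m) D"
proof -
  have "finsum M (comp M m) {d \<in> carrier L. comp M m d \<noteq> \<zero>\<^bsub>M\<^esub>} = finsum M (comp M m) D"
    by (rule add.finprod_mono_neutral_cong_left) (use assms comp_carrier in auto)
  then show ?thesis using comp_sum[OF assms(1)] by simp
qed

text \<open>Components are given by a definite description; exhibiting any finite homogeneous
  decomposition determines them. All later computations of components go through this.\<close>

lemma comp_unique:
  assumes D: "finite D" "D \<subseteq> carrier L" and c: "\<And>d. d \<in> carrier L \<Longrightarrow> c d \<in> piece M d"
    and z: "\<And>d. d \<in> carrier L \<Longrightarrow> d \<notin> D \<Longrightarrow> c d = \<zero>\<^bsub>M\<^esub>" and m: "m = finsum M c D" and d: "d \<in> carrier L"
  shows "comp M m d = c d"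
proof -
  let ?c = "restrict c (carrier L)"
  have cc: "c d \<in> carrier M" if "d \<in> carrier L" for d using c[OF that] piece_carrier that by blast
  have mc: "m \<in> carrier M" unfolding m by (rule finsum_closed) (use D cc in auto)
  have "{d \<in> carrier L. ?c d \<noteq> \<zero>\<^bsub>M\<^esub>} \<subseteq> D" using z by auto
  moreover have "finsum M ?c {d \<in> carrier L. ?c d \<noteq> \<zero>\<^bsub>M\<^esub>} = finsum M c D"
    by (rule add.finprod_mono_neutral_cong_left) (use D z cc in auto)
  ultimately have "finite {d \<in> carrier L. ?c d \<noteq> \<zero>\<^bsub>M\<^esub>}"
      "m = finsum M ?c {d \<in> carrier L. ?c d \<noteq> \<zero>\<^bsub>M\<^esub>}"
    using D(1) m by (simp_all only: finite_subset)
  moreover have "?c \<in> (\<Pi>\<^sub>E d\<in>carrier L. piece M d)" using c by auto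
  ultimately have "decomposition p q M m ?c"
    unfolding decomposition_def by blast
  moreover have "\<exists>!c. decomposition p q M m c"
    using gmM mc by (simp add: L_graded_module_def)
  ultimately have "comp M m = ?c"
    unfolding component_def by (rule the1_equality[rotated])
  then show ?thesis using d by simp
qed

lemma comp_add:
  assumes "m \<in> carrier M" "n \<in> carrier M" "d \<in> carrier L"
  shows "comp M (m \<oplus>\<^bsub>M\<^esub> n) d = comp M m d \<oplus>\<^bsub>M\<^esub> comp M n d"
proof (rule comp_unique)
  let ?S = "\<lambda>m. {d \<in> carrier L. comp M m d \<noteq> \<zero>\<^bsub>M\<^esub>}"
  show "finite (?S m \<union> ?S n)" using comp_finite assms by blast
  then have "m = finsum M (comp M m) (?S m \<union> ?S n)" "n = finsum M (comp M n) (?S m \<union> ?S n)"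
    using assms by (auto intro!: comp_sum')
  then have "m \<oplus>\<^bsub>M\<^esub> n = finsum M (comp M m) (?S m \<union> ?S n) \<oplus>\<^bsub>M\<^esub> finsum M (comp M n) (?S m \<union> ?S n)"
    by simp
  also have "\<dots> = finsum M (\<lambda>d. comp M m d \<oplus>\<^bsub>M\<^esub> comp M n d) (?S m \<union> ?S n)"
    by (rule finsum_addf[symmetric]) (use assms comp_carrier in auto)
  finally show "m \<oplus>\<^bsub>M\<^esub> n = finsum M (\<lambda>d. comp M m d \<oplus>\<^bsub>M\<^esub> comp M n d) (?S m \<union> ?S n)" .
qed (use assms comp_piece piece_add in auto)

lemma comp_of_piece:
  assumes "m \<in> piece M d" "d \<in> carrier L" "e \<in> carrier L"
  shows "comp M m e = (if e = d then m else \<zero>\<^bsub>M\<^esub>)"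
proof (rule comp_unique[where D = "{d}"])
  have "m \<in> carrier M" using assms piece_carrier by blast
  then have "finsum M (\<lambda>e. if e = d then m else \<zero>\<^bsub>M\<^esub>) {d} = m" by simp
  then show "m = finsum M (\<lambda>e. if e = d then m else \<zero>\<^bsub>M\<^esub>) {d}" ..
qed (use assms piece_zero in auto)

lemma comp_zero [simp]: "d \<in> carrier L \<Longrightarrow> comp M \<zero>\<^bsub>M\<^esub> d = \<zero>\<^bsub>M\<^esub>"
  using comp_of_piece[OF piece_zero] by simp

text \<open>Multiplying the homogeneous decomposition of \<open>m\<close> by \<open>s\<close> shifts
  every degree by \<open>e\<close>. The result is again a homogeneous decomposition, so
  \<open>comp_unique\<close> reads off the components.\<close>

lemma comp_smult:
  assumes "s \<in> S_piece p q e" "e \<in> carrier L" "m \<in> carrier M" "d \<in> carrier L"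
  shows "comp M (s \<odot>\<^bsub>M\<^esub> m) d = s \<odot>\<^bsub>M\<^esub> comp M m (inv\<^bsub>L\<^esub> e \<otimes>\<^bsub>L\<^esub> d)"
proof -
  interpret LG: comm_group L by (rule comm_group_LL)
  let ?S = "{d \<in> carrier L. comp M m d \<noteq> \<zero>\<^bsub>M\<^esub>}"
  let ?c = "\<lambda>d. s \<odot>\<^bsub>M\<^esub> comp M m (inv\<^bsub>L\<^esub> e \<otimes>\<^bsub>L\<^esub> d)"
  have fin: "finite ?S" using comp_finite assms by blast
  have inj: "inj_on (\<lambda>d. e \<otimes>\<^bsub>L\<^esub> d) ?S" using assms by (auto simp: inj_on_def)
  have bk: "inv\<^bsub>L\<^esub> e \<otimes>\<^bsub>L\<^esub> (e \<otimes>\<^bsub>L\<^esub> d) = d" if "d \<in> carrier L" for d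
    using that assms by (simp add: LG.m_assoc[symmetric])
  have forth: "e \<otimes>\<^bsub>L\<^esub> (inv\<^bsub>L\<^esub> e \<otimes>\<^bsub>L\<^esub> d) = d" if "d \<in> carrier L" for d
    using that assms by (simp add: LG.m_assoc[symmetric])
  show ?thesis
  proof (rule comp_unique)
    show "finite ((\<lambda>d. e \<otimes>\<^bsub>L\<^esub> d) ` ?S)" using fin by simp
    show "?c d \<in> piece M d" if d: "d \<in> carrier L" for d
      using piece_smult[OF assms(1,2) _ comp_piece[OF assms(3)], of "inv\<^bsub>L\<^esub> e \<otimes>\<^bsub>L\<^esub> d"] assms(2) d forth[OF d]
      by simp
    show "?c d = \<zero>\<^bsub>M\<^esub>" if d: "d \<in> carrier L" "d \<notin> (\<lambda>d. e \<otimes>\<^bsub>L\<^esub> d) ` ?S" for d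
    proof -
      have "comp M m (inv\<^bsub>L\<^esub> e \<otimes>\<^bsub>L\<^esub> d) = \<zero>\<^bsub>M\<^esub>"
      proof (rule ccontr)
        assume "comp M m (inv\<^bsub>L\<^esub> e \<otimes>\<^bsub>L\<^esub> d) \<noteq> \<zero>\<^bsub>M\<^esub>"
        then have "inv\<^bsub>L\<^esub> e \<otimes>\<^bsub>L\<^esub> d \<in> ?S" using d assms by simp
        then have "e \<otimes>\<^bsub>L\<^esub> (inv\<^bsub>L\<^esub> e \<otimes>\<^bsub>L\<^esub> d) \<in> (\<lambda>d. e \<otimes>\<^bsub>L\<^esub> d) ` ?S" by (rule imageI)
        then show False using d forth by simp
      qed
      then show ?thesis using gm_smod by simp
    qed
    have "finsum M ?c ((\<lambda>d. e \<otimes>\<^bsub>L\<^esub> d) ` ?S) = finsum M (\<lambda>d. ?c (e \<otimes>\<^bsub>L\<^esub> d)) ?S"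
      using assms comp_carrier inj gm_smod by (intro finsum_reindex) auto
    also have "\<dots> = finsum M (\<lambda>d. s \<odot>\<^bsub>M\<^esub> comp M m d) ?S"
      using assms comp_carrier gm_smod by (intro finsum_cong') (auto simp: bk)
    also have "\<dots> = s \<odot>\<^bsub>M\<^esub> finsum M (comp M m) ?S"
      using assms comp_carrier fin by (intro finsum_smult[OF gm_smod, symmetric]) auto
    also have "\<dots> = s \<odot>\<^bsub>M\<^esub> m" using comp_sum[OF assms(3)] by simp
    finally show "s \<odot>\<^bsub>M\<^esub> m = finsum M ?c ((\<lambda>d. e \<otimes>\<^bsub>L\<^esub> d) ` ?S)" by simp
  qed (use assms in auto)
qed

lemma comp_minus:
  assumes "m \<in> carrier M" "n \<in> carrier M" "d \<in> carrier L"
  shows "comp M (m \<ominus>\<^bsub>M\<^esub> n) d = comp M m d \<ominus>\<^bsub>M\<^esub> comp M n d"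
proof -
  have "(-1 :: 'k poly poly) = [:[:-1:]:]" by (simp add: one_pCons)
  then have "comp M ((-1) \<odot>\<^bsub>M\<^esub> n) d = (-1) \<odot>\<^bsub>M\<^esub> comp M n d"
    using comp_smult[OF S_piece_const _ assms(2,3), of "-1"] assms comm_group_LL[of p q]
      group.is_monoid[of L] monoid.l_one[of L d]
    by (auto simp: one_LL comm_group_def)
  then show ?thesis
    using assms gm_smod by (simp add: smod_minus comp_add comp_carrier)
qed

lemma comps_in_submodule:
  assumes "submodule W S_ring M" "m \<in> carrier M" "\<And>d. d \<in> carrier L \<Longrightarrow> comp M m d \<in> W"
  shows "m \<in> W"
proof -
  have "finsum M (comp M m) {d \<in> carrier L. comp M m d \<noteq> \<zero>\<^bsub>M\<^esub>} \<in> W"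
    using assms comp_finite by (intro finsum_submodule[OF gm_smod]) auto
  then show ?thesis using comp_sum[OF assms(2)] by simp
qed

lemma comp_finsum_zero:
  assumes "finite B" "\<And>b. b \<in> B \<Longrightarrow> f b \<in> carrier M" "\<And>b. b \<in> B \<Longrightarrow> comp M (f b) d = \<zero>\<^bsub>M\<^esub>" "d \<in> carrier L"
  shows "comp M (finsum M f B) d = \<zero>\<^bsub>M\<^esub>"
  using assms(1-3)
proof (induction B rule: finite_induct)
  case (insert x F)
  then have "f \<in> F \<rightarrow> carrier M" "f x \<in> carrier M" by auto
  then show ?case using insert assms(4) gm_smod by (simp add: comp_add)
qed (use assms(4) in simp)

text \<open>Both generators of the grading group have infinite order, because both weights are
  positive. High powers of a variable therefore move finitely many degrees off any given finite
  set.\<close>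

lemma shift_avoids:
  assumes "finite A" "A \<subseteq> carrier L" "finite D"
  shows "\<exists>K. \<forall>k\<ge>K. \<forall>d\<in>A. V (int k) 0 \<otimes>\<^bsub>L\<^esub> d \<notin> D \<and> V 0 (int k) \<otimes>\<^bsub>L\<^esub> d \<notin> D"
proof -
  have inj: "inj (\<lambda>k. V (int k) 0 \<otimes>\<^bsub>L\<^esub> d)" "inj (\<lambda>k. V 0 (int k) \<otimes>\<^bsub>L\<^esub> d)" if "d \<in> A" for d
  proof -
    have "d \<in> carrier L" using that assms by blast
    then obtain a b where "d = V a b" by (rule LL_E)
    then show "inj (\<lambda>k. V (int k) 0 \<otimes>\<^bsub>L\<^esub> d)" "inj (\<lambda>k. V 0 (int k) \<otimes>\<^bsub>L\<^esub> d)"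
      using p_pos q_pos by (auto simp: inj_def Lvec_eq_iff)
  qed
  let ?B = "\<Union>d\<in>A. (\<lambda>k. V (int k) 0 \<otimes>\<^bsub>L\<^esub> d) -` D \<union> (\<lambda>k. V 0 (int k) \<otimes>\<^bsub>L\<^esub> d) -` D"
  have "finite ?B" using assms inj by (auto intro!: finite_vimageI)
  then obtain K where "?B \<subseteq> {..<K}" using finite_nat_bounded by blast
  then show ?thesis by (intro exI[of _ K]) fastforce
qed

text \<open>A finite set spanning \<open>X\<close> modulo \<open>W\<close> has components in a
  finite set \<open>D\<close> of degrees only. A high power of a variable moves the degrees of
  \<open>v\<close> out of \<open>D\<close>, and outside \<open>D\<close> a component of a member of
  \<open>X\<close> already lies in \<open>W\<close>.\<close>

lemma finite_dim_quotient_imp_sat: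
  assumes fd: "finite_dim_quotient M X W" and X: "submodule X S_ring M" and W: "submodule W S_ring M"
    and gr: "\<And>w d. w \<in> W \<Longrightarrow> d \<in> carrier L \<Longrightarrow> comp M w d \<in> W" and v: "v \<in> X"
  shows "v \<in> sat M W"
proof -
  note [simp] = gm_smod
  note Xs = smod_submoduleD[OF gm_smod X] and Ws = smod_submoduleD[OF gm_smod W]
  interpret LG: comm_group L by (rule comm_group_LL)
  obtain B where B: "finite B" "B \<subseteq> X"
      "\<And>v. v \<in> X \<Longrightarrow> \<exists>c. v \<ominus>\<^bsub>M\<^esub> finsum M (\<lambda>b. [:[:c b:]:] \<odot>\<^bsub>M\<^esub> b) B \<in> W"
    using fd unfolding finite_dim_quotient_def by blast
  have Bc: "b \<in> carrier M" if "b \<in> B" for b using that B Xs by blast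
  define D where "D = (\<Union>b\<in>B. {d \<in> carrier L. comp M b d \<noteq> \<zero>\<^bsub>M\<^esub>})"
  have fD: "finite D" using B Bc comp_finite by (auto simp: D_def)
  have vc: "v \<in> carrier M" using v Xs by blast
  let ?A = "{d \<in> carrier L. comp M v d \<noteq> \<zero>\<^bsub>M\<^esub>}"
  obtain K where K: "\<And>k d. k \<ge> K \<Longrightarrow> d \<in> ?A \<Longrightarrow> V (int k) 0 \<otimes>\<^bsub>L\<^esub> d \<notin> D \<and> V 0 (int k) \<otimes>\<^bsub>L\<^esub> d \<notin> D"
    using shift_avoids[of ?A D] comp_finite[OF vc] fD by auto
  have main: "s \<odot>\<^bsub>M\<^esub> v \<in> W"
    if s: "s \<in> S_piece p q e" "e \<in> carrier L" and av: "\<And>d. d \<in> ?A \<Longrightarrow> e \<otimes>\<^bsub>L\<^esub> d \<notin> D" for s e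
  proof (rule comps_in_submodule[OF W])
    show sv: "s \<odot>\<^bsub>M\<^esub> v \<in> carrier M" using vc by simp
    fix d assume d: "d \<in> carrier L"
    show "comp M (s \<odot>\<^bsub>M\<^esub> v) d \<in> W"
    proof (cases "d \<in> D")
      case True
      have "inv\<^bsub>L\<^esub> e \<otimes>\<^bsub>L\<^esub> d \<notin> ?A"
      proof
        assume "inv\<^bsub>L\<^esub> e \<otimes>\<^bsub>L\<^esub> d \<in> ?A"
        from av[OF this] True d s show False by (simp add: LG.m_assoc[symmetric])
      qed
      then show ?thesis using s d vc Ws by (auto simp: comp_smult)
    next
      case False
      obtain c where c: "s \<odot>\<^bsub>M\<^esub> v \<ominus>\<^bsub>M\<^esub> finsum M (\<lambda>b. [:[:c b:]:] \<odot>\<^bsub>M\<^esub> b) B \<in> W"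
        using B(3)[OF Xs(4)[OF v]] by blast
      \<comment> \<open>No element of \<open>B\<close> has a component in degree \<open>d\<close>,
        so the component of the multiple of \<open>v\<close> equals that of an element of the graded
        submodule \<open>W\<close>.\<close>
      have z: "comp M (finsum M (\<lambda>b. [:[:c b:]:] \<odot>\<^bsub>M\<^esub> b) B) d = \<zero>\<^bsub>M\<^esub>"
      proof (rule comp_finsum_zero[OF B(1) _ _ d])
        fix b assume b: "b \<in> B"
        then show "[:[:c b:]:] \<odot>\<^bsub>M\<^esub> b \<in> carrier M" using Bc by simp
        have "comp M b d = \<zero>\<^bsub>M\<^esub>" using False b d by (auto simp: D_def)
        moreover have "inv\<^bsub>L\<^esub> (V 0 0) \<otimes>\<^bsub>L\<^esub> d = d" using d LG.l_one by (simp add: one_LL)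
        ultimately show "comp M ([:[:c b:]:] \<odot>\<^bsub>M\<^esub> b) d = \<zero>\<^bsub>M\<^esub>"
          using comp_smult[OF S_piece_const[of "c b"] _ Bc[OF b] d] by simp
      qed
      have fc: "finsum M (\<lambda>b. [:[:c b:]:] \<odot>\<^bsub>M\<^esub> b) B \<in> carrier M"
        using Bc by (intro finsum_closed) auto
      show ?thesis
        using gr[OF c d] z comp_minus[OF sv fc d] comp_carrier[OF sv d] by simp
    qed
  qed
  have "S_x1 ^ K \<odot>\<^bsub>M\<^esub> v \<in> W" using K[of K] by (intro main[OF S_piece_x1]) auto
  moreover have "S_x2 ^ K \<odot>\<^bsub>M\<^esub> v \<in> W" using K[of K] by (intro main[OF S_piece_x2]) auto
  ultimately show ?thesis using satI[OF gm_smod W vc] by blast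
qed

text \<open>Multiplication by a power of a variable only shifts the degrees, so the powers that move
  \<open>m\<close> into \<open>W\<close> do the same to its components.\<close>

lemma sat_graded:
  assumes "submodule W S_ring M" "\<And>w d. w \<in> W \<Longrightarrow> d \<in> carrier L \<Longrightarrow> comp M w d \<in> W"
    "m \<in> sat M W" "d \<in> carrier L"
  shows "comp M m d \<in> sat M W"
proof -
  interpret LG: comm_group L by (rule comm_group_LL)
  have m: "m \<in> carrier M" "\<forall>\<^sub>F s in irr. s \<odot>\<^bsub>M\<^esub> m \<in> W" using assms(3) by (auto simp: sat_def)
  obtain k where k: "S_x1 ^ k \<odot>\<^bsub>M\<^esub> m \<in> W" "S_x2 ^ k \<odot>\<^bsub>M\<^esub> m \<in> W"
    using eventually_irr_ex[OF m(2)] by blast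
  have *: "s \<odot>\<^bsub>M\<^esub> comp M m d \<in> W" if "s \<in> S_piece p q e" "e \<in> carrier L" "s \<odot>\<^bsub>M\<^esub> m \<in> W" for s e
  proof -
    have "inv\<^bsub>L\<^esub> e \<otimes>\<^bsub>L\<^esub> (e \<otimes>\<^bsub>L\<^esub> d) = d" using that assms by (simp add: LG.m_assoc[symmetric])
    then show ?thesis
      using assms(2)[OF that(3), of "e \<otimes>\<^bsub>L\<^esub> d"] that assms(4) m comp_smult[OF that(1,2), of m "e \<otimes>\<^bsub>L\<^esub> d"] by simp
  qed
  show ?thesis
    using satI[OF gm_smod assms(1) comp_carrier[OF m(1) assms(4)] *[OF S_piece_x1 _ k(1)] *[OF S_piece_x2 _ k(2)]]
    by simp
qed

end

text \<open>Serves to show that a subspace stable under both variables is stable under all of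
  \<open>S\<close>.\<close>

lemma poly_poly_induct [case_names const x1 x2 add]:
  fixes P :: "'k::alg_closed_field poly poly \<Rightarrow> bool"
  assumes "\<And>c. P [:[:c:]:]" "\<And>s. P s \<Longrightarrow> P (S_x1 * s)" "\<And>s. P s \<Longrightarrow> P (S_x2 * s)"
    "\<And>s t. P s \<Longrightarrow> P t \<Longrightarrow> P (s + t)"
  shows "P s"
proof (induction s)
  case 0
  show ?case using assms(1)[of 0] by simp
next
  case (pCons a s)
  have "P [:a:]"
  proof (induction a)
    case 0
    show ?case using assms(1)[of 0] by simp
  next
    case (pCons c a)
    have "[:pCons c a:] = [:[:c:]:] + S_x1 * [:a:]" by (simp add: S_x1_def)
    then show ?case using assms pCons by metis
  qed
  moreover have "pCons a s = [:a:] + S_x2 * s" by (simp add: S_x2_def)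
  ultimately show ?case using assms pCons by metis
qed

text \<open>If the \<open>k\<close>-th powers of both variables move all generators into
  \<open>W\<close>, then \<open>X\<close> is spanned modulo \<open>W\<close> by the generators
  multiplied by monomials with both exponents below \<open>k\<close>.\<close>

lemma finite_dim_quotientI:
  fixes M :: "('k::alg_closed_field poly poly, 'm) graded_module"
  assumes M: "smod M" and X: "submodule X S_ring M" and W: "submodule W S_ring M"
    and G: "finite G" "G \<subseteq> X" "\<And>N. submodule N S_ring M \<Longrightarrow> G \<subseteq> N \<Longrightarrow> X \<subseteq> N"
    and XW: "X \<subseteq> sat M W"
  shows "finite_dim_quotient M X W"
proof -
  interpret module S_ring M by (rule M)
  note [simp] = M
  note Xs = smod_submoduleD[OF M X] and Ws = smod_submoduleD[OF M W]
  have "\<forall>\<^sub>F s in irr. \<forall>g\<in>G. s \<odot>\<^bsub>M\<^esub> g \<in> W"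
    using G XW by (intro eventually_ball_finite) (auto simp: sat_def)
  then obtain k where k: "\<And>g. g \<in> G \<Longrightarrow> S_x1 ^ k \<odot>\<^bsub>M\<^esub> g \<in> W" "\<And>g. g \<in> G \<Longrightarrow> S_x2 ^ k \<odot>\<^bsub>M\<^esub> g \<in> W"
    using eventually_irr_ex by (metis (no_types, lifting))
  define b where "b = (\<lambda>(i, j, g). (S_x1 ^ i * S_x2 ^ j) \<odot>\<^bsub>M\<^esub> g)"
  define B where "B = b ` ({..<k} \<times> {..<k} \<times> G)"
  have Gc: "g \<in> carrier M" if "g \<in> G" for g using that G Xs by blast
  have Bc: "x \<in> carrier M" if "x \<in> B" for x using that Gc by (auto simp: B_def b_def)
  have fB: "finite B" using G by (simp add: B_def)
  \<comment> \<open>The linear span of \<open>B\<close> modulo \<open>W\<close>. It is shown to be a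
    submodule over \<open>S\<close>; as it contains the generators, it contains
    \<open>X\<close>.\<close>
  define K where "K = {u \<in> carrier M. \<exists>c. cg M W u (finsum M (\<lambda>b. [:[:c b:]:] \<odot>\<^bsub>M\<^esub> b) B)}"
  have fc: "finsum M (\<lambda>b. [:[:c b:]:] \<odot>\<^bsub>M\<^esub> b) B \<in> carrier M" for c
    using Bc by (intro finsum_closed) auto
  have KI: "u \<in> K" if "cg M W u (finsum M (\<lambda>b. [:[:c b:]:] \<odot>\<^bsub>M\<^esub> b) B)" for u c
    using that cg_carrier[OF M W that] by (auto simp: K_def)
  have KE: "\<exists>c. cg M W u (finsum M (\<lambda>b. [:[:c b:]:] \<odot>\<^bsub>M\<^esub> b) B)" if "u \<in> K" for u
    using that by (simp add: K_def)
  have Kc: "u \<in> carrier M" if "u \<in> K" for u using that by (simp add: K_def)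
  have Kcg: "u \<in> K" if "cg M W u v" "v \<in> K" for u v
    using KE[OF that(2)] KI cg_trans[OF M W that(1)] by blast
  have Kadd: "u \<oplus>\<^bsub>M\<^esub> v \<in> K" if uv: "u \<in> K" "v \<in> K" for u v
  proof -
    obtain c d where cd: "cg M W u (finsum M (\<lambda>b. [:[:c b:]:] \<odot>\<^bsub>M\<^esub> b) B)"
      "cg M W v (finsum M (\<lambda>b. [:[:d b:]:] \<odot>\<^bsub>M\<^esub> b) B)" using KE uv by meson
    have "finsum M (\<lambda>b. [:[:c b:]:] \<odot>\<^bsub>M\<^esub> b) B \<oplus>\<^bsub>M\<^esub> finsum M (\<lambda>b. [:[:d b:]:] \<odot>\<^bsub>M\<^esub> b) B =
      finsum M (\<lambda>b. [:[:c b:]:] \<odot>\<^bsub>M\<^esub> b \<oplus>\<^bsub>M\<^esub> [:[:d b:]:] \<odot>\<^bsub>M\<^esub> b) B"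
      using Bc by (intro finsum_addf[symmetric]) auto
    also have "\<dots> = finsum M (\<lambda>b. [:[:c b + d b:]:] \<odot>\<^bsub>M\<^esub> b) B"
      using Bc by (intro finsum_cong') (auto simp: smod_smult[symmetric])
    finally show ?thesis using cg_add[OF M W cd] KI by simp
  qed
  have Kscal: "[:[:a:]:] \<odot>\<^bsub>M\<^esub> u \<in> K" if u: "u \<in> K" for u a
  proof -
    obtain c where c: "cg M W u (finsum M (\<lambda>b. [:[:c b:]:] \<odot>\<^bsub>M\<^esub> b) B)" using KE u by meson
    have "[:[:a:]:] \<odot>\<^bsub>M\<^esub> finsum M (\<lambda>b. [:[:c b:]:] \<odot>\<^bsub>M\<^esub> b) B = finsum M (\<lambda>b. [:[:a:]:] \<odot>\<^bsub>M\<^esub> ([:[:c b:]:] \<odot>\<^bsub>M\<^esub> b)) B"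
      using Bc fB by (intro finsum_smult) auto
    also have "\<dots> = finsum M (\<lambda>b. [:[:a * c b:]:] \<odot>\<^bsub>M\<^esub> b) B"
      using Bc by (intro finsum_cong') (auto simp: smod_smult)
    finally show ?thesis using cg_smult[OF M W c, of "[:[:a:]:]"] KI by simp
  qed
  have K0: "\<zero>\<^bsub>M\<^esub> \<in> K"
  proof -
    have "finsum M (\<lambda>b. [:[:0:]:] \<odot>\<^bsub>M\<^esub> b) B = finsum M (\<lambda>b. \<zero>\<^bsub>M\<^esub>) B"
      using Bc by (intro finsum_cong') auto
    also have "\<dots> = \<zero>\<^bsub>M\<^esub>" by simp
    finally show ?thesis using KI[of "\<zero>\<^bsub>M\<^esub>" "\<lambda>_. 0"] cg_refl[OF M W, of "\<zero>\<^bsub>M\<^esub>"] by simp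
  qed
  have KW: "w \<in> K" if "w \<in> W" for w using Kcg[OF _ K0] cg_zero_iff[OF M W] that by blast
  have KB: "x \<in> K" if x: "x \<in> B" for x
  proof -
    have "finsum M (\<lambda>b. [:[:if b = x then 1 else 0:]:] \<odot>\<^bsub>M\<^esub> b) B = finsum M (\<lambda>b. if x = b then b else \<zero>\<^bsub>M\<^esub>) B"
      using Bc by (intro finsum_cong') (auto simp: one_pCons[symmetric])
    also have "\<dots> = x" using finsum_singleton[OF x fB, of "\<lambda>b. b"] Bc by auto
    finally show ?thesis using KI[of x "\<lambda>b. if b = x then 1 else 0"] cg_refl[OF M W] Bc x by simp
  qed
  have Ksum: "finsum M f F \<in> K" if "finite F" "\<And>x. x \<in> F \<Longrightarrow> f x \<in> K" for f F
    using that
  proof (induction F rule: finite_induct)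
    case (insert x F)
    then have "f \<in> F \<rightarrow> carrier M" "f x \<in> carrier M" using Kc by auto
    then show ?case using insert Kadd by simp
  qed (use K0 in simp)
  have Kmult: "t \<odot>\<^bsub>M\<^esub> u \<in> K" if u: "u \<in> K" and t: "\<And>x. x \<in> B \<Longrightarrow> t \<odot>\<^bsub>M\<^esub> x \<in> K" for t u
  proof -
    obtain c where c: "cg M W u (finsum M (\<lambda>b. [:[:c b:]:] \<odot>\<^bsub>M\<^esub> b) B)" using KE u by meson
    have "t \<odot>\<^bsub>M\<^esub> finsum M (\<lambda>b. [:[:c b:]:] \<odot>\<^bsub>M\<^esub> b) B = finsum M (\<lambda>b. t \<odot>\<^bsub>M\<^esub> ([:[:c b:]:] \<odot>\<^bsub>M\<^esub> b)) B"
      using Bc fB by (intro finsum_smult) auto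
    also have "\<dots> = finsum M (\<lambda>b. [:[:c b:]:] \<odot>\<^bsub>M\<^esub> (t \<odot>\<^bsub>M\<^esub> b)) B"
      using Bc by (intro finsum_cong') (auto simp: smod_smult mult.commute[of t])
    also have "\<dots> \<in> K" by (intro Ksum[OF fB] Kscal t)
    finally show ?thesis using Kcg[OF cg_smult[OF M W c]] by blast
  qed
  have Kx: "S_x1 \<odot>\<^bsub>M\<^esub> u \<in> K" "S_x2 \<odot>\<^bsub>M\<^esub> u \<in> K" if u: "u \<in> K" for u
  proof -
    have "S_x1 \<odot>\<^bsub>M\<^esub> x \<in> K \<and> S_x2 \<odot>\<^bsub>M\<^esub> x \<in> K" if xB: "x \<in> B" for x
    proof -
      obtain i j g where x: "i < k" "j < k" "g \<in> G" "x = (S_x1 ^ i * S_x2 ^ j) \<odot>\<^bsub>M\<^esub> g"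
        using xB unfolding B_def b_def by force
      have e1: "S_x1 \<odot>\<^bsub>M\<^esub> x = (S_x1 ^ Suc i * S_x2 ^ j) \<odot>\<^bsub>M\<^esub> g"
        using x Gc by (simp add: smod_smult mult.assoc)
      have e2: "S_x2 \<odot>\<^bsub>M\<^esub> x = (S_x1 ^ i * S_x2 ^ Suc j) \<odot>\<^bsub>M\<^esub> g"
        using x Gc by (simp add: smod_smult mult_ac)
      have "S_x1 \<odot>\<^bsub>M\<^esub> x \<in> K"
      \<comment> \<open>Raising the exponent either gives another member of \<open>B\<close> or
        reaches \<open>k\<close>, and then the element lies in \<open>W\<close>.\<close>
      proof (cases "Suc i < k")
        case True
        then have "S_x1 \<odot>\<^bsub>M\<^esub> x \<in> B" unfolding e1 B_def b_def using x by force
        then show ?thesis by (rule KB)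
      next
        case False
        then have "Suc i = k" using x by simp
        then have "S_x1 \<odot>\<^bsub>M\<^esub> x = S_x2 ^ j \<odot>\<^bsub>M\<^esub> (S_x1 ^ k \<odot>\<^bsub>M\<^esub> g)"
          unfolding e1 using Gc x by (simp only: smod_smult(3)[OF M] mult.commute)
        then show ?thesis using k(1)[OF x(3)] Ws KW by simp
      qed
      moreover have "S_x2 \<odot>\<^bsub>M\<^esub> x \<in> K"
      proof (cases "Suc j < k")
        case True
        then have "S_x2 \<odot>\<^bsub>M\<^esub> x \<in> B" unfolding e2 B_def b_def using x by force
        then show ?thesis by (rule KB)
      next
        case False
        then have "Suc j = k" using x by simp
        then have "S_x2 \<odot>\<^bsub>M\<^esub> x = S_x1 ^ i \<odot>\<^bsub>M\<^esub> (S_x2 ^ k \<odot>\<^bsub>M\<^esub> g)"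
          unfolding e2 using Gc x by (simp only: smod_smult(3)[OF M])
        then show ?thesis using k(2)[OF x(3)] Ws KW by simp
      qed
      ultimately show ?thesis by blast
    qed
    then show "S_x1 \<odot>\<^bsub>M\<^esub> u \<in> K" "S_x2 \<odot>\<^bsub>M\<^esub> u \<in> K" using Kmult u by blast+
  qed
  have "s \<odot>\<^bsub>M\<^esub> u \<in> K" if u: "u \<in> K" for s u
    using Kc[OF u]
  proof (induction s rule: poly_poly_induct)
    case (const c)
    show ?case using Kscal u by blast
  next
    case (x1 s)
    then show ?case using Kx(1)[of "s \<odot>\<^bsub>M\<^esub> u"] by (simp add: smod_smult)
  next
    case (x2 s)
    then show ?case using Kx(2)[of "s \<odot>\<^bsub>M\<^esub> u"] by (simp add: smod_smult)
  next
    case (add s t)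
    then show ?case using Kadd by (simp add: smod_smult)
  qed
  then have "submodule K S_ring M"
    using K0 Kadd Kc by (auto simp: smod_submodule_iff)
  moreover have "G \<subseteq> K"
  proof
    fix g assume g: "g \<in> G"
    show "g \<in> K"
    \<comment> \<open>For \<open>k = 0\<close> the set \<open>B\<close> is empty, but then the
      generators themselves lie in \<open>W\<close>.\<close>
    proof (cases "k = 0")
      case True
      then show ?thesis using k(1)[OF g] KW Gc[OF g] by simp
    next
      case False
      then have "b (0, 0, g) \<in> B" using g by (auto simp: B_def)
      then show ?thesis using KB Gc[OF g] by (simp add: b_def)
    qed
  qed
  ultimately have XK: "X \<subseteq> K" by (rule G(3))
  have "B \<subseteq> X" using G(2) Xs(4) by (auto simp: B_def b_def)
  then show ?thesis
    unfolding finite_dim_quotient_def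
  proof (intro exI[of _ B] conjI ballI)
    fix v assume "v \<in> X"
    then have "v \<in> K" using XK by blast
    then show "\<exists>c. v \<ominus>\<^bsub>M\<^esub> finsum M (\<lambda>b. [:[:c b:]:] \<odot>\<^bsub>M\<^esub> b) B \<in> W"
      using KE unfolding cg_def by blast
  qed (use fB in auto)
qed

end

section \<open>Morphisms as relations\<close>

lemma teq_refl [simp]: "smod M \<Longrightarrow> a \<in> carrier M \<Longrightarrow> teq M a a"
  by (rule cg_refl[OF _ tors_submodule])

lemma teq_sym: "smod M \<Longrightarrow> teq M a b \<Longrightarrow> teq M b a"
  by (rule cg_sym[OF _ tors_submodule])

lemma teq_trans: "smod M \<Longrightarrow> teq M a b \<Longrightarrow> teq M b c \<Longrightarrow> teq M a c"
  by (rule cg_trans[OF _ tors_submodule])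

lemma teq_smult: "smod M \<Longrightarrow> teq M a b \<Longrightarrow> teq M (s \<odot>\<^bsub>M\<^esub> a) (s \<odot>\<^bsub>M\<^esub> b)"
  by (rule cg_smult[OF _ tors_submodule])

lemma teq_zero_iff: "smod M \<Longrightarrow> teq M a \<zero>\<^bsub>M\<^esub> \<longleftrightarrow> a \<in> tors M"
  by (rule cg_zero_iff[OF _ tors_submodule])

lemma teq_tors: "smod M \<Longrightarrow> teq M a b \<Longrightarrow> a \<in> tors M \<longleftrightarrow> b \<in> tors M"
  by (rule cg_in[OF _ tors_submodule])

lemma tors_eventually: "smod M \<Longrightarrow> a \<in> carrier M \<Longrightarrow> \<forall>\<^sub>F s in irr. s \<odot>\<^bsub>M\<^esub> a \<in> tors M \<Longrightarrow> a \<in> tors M"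
  by (rule sat_eventually)

lemma tors_teq: "smod M \<Longrightarrow> a \<in> tors M \<Longrightarrow> b \<in> tors M \<Longrightarrow> teq M a b"
  by (rule cg_mem[OF _ tors_submodule])

lemma zero_tors [simp]: "smod M \<Longrightarrow> \<zero>\<^bsub>M\<^esub> \<in> tors M"
  by (rule smod_submoduleD(2)[OF _ tors_submodule])

context weights
begin

definition obj :: "('k::alg_closed_field poly poly, 'm) graded_module \<Rightarrow> bool" where
  "obj M \<longleftrightarrow> gm M \<and> finitely_generated M"

lemma obj_gm [simp]: "obj M \<Longrightarrow> gm M"
  by (simp add: obj_def)

lemma obj_smod [simp]: "obj M \<Longrightarrow> smod M"
  by (simp add: gm_smod)

definition grel :: "('k::alg_closed_field poly poly, 'm) graded_module \<Rightarrow>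
    ('k poly poly, 'm) graded_module \<Rightarrow> ('m \<times> 'm) set \<Rightarrow> bool" where
  "grel M N R \<longleftrightarrow> R \<subseteq> carrier M \<times> carrier N \<and> (\<zero>\<^bsub>M\<^esub>, \<zero>\<^bsub>N\<^esub>) \<in> R \<and>
     (\<forall>(m, n)\<in>R. \<forall>(m', n')\<in>R. (m \<oplus>\<^bsub>M\<^esub> m', n \<oplus>\<^bsub>N\<^esub> n') \<in> R) \<and>
     (\<forall>s. \<forall>(m, n)\<in>R. (s \<odot>\<^bsub>M\<^esub> m, s \<odot>\<^bsub>N\<^esub> n) \<in> R) \<and>
     (\<forall>(m, n)\<in>R. \<forall>d\<in>carrier L. (comp M m d, comp N n d) \<in> R)"

lemma grelD:
  assumes "grel M N R"
  shows "(m, n) \<in> R \<Longrightarrow> m \<in> carrier M" "(m, n) \<in> R \<Longrightarrow> n \<in> carrier N"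
    "(\<zero>\<^bsub>M\<^esub>, \<zero>\<^bsub>N\<^esub>) \<in> R"
    "(m, n) \<in> R \<Longrightarrow> (m', n') \<in> R \<Longrightarrow> (m \<oplus>\<^bsub>M\<^esub> m', n \<oplus>\<^bsub>N\<^esub> n') \<in> R"
    "(m, n) \<in> R \<Longrightarrow> (s \<odot>\<^bsub>M\<^esub> m, s \<odot>\<^bsub>N\<^esub> n) \<in> R"
    "(m, n) \<in> R \<Longrightarrow> d \<in> carrier L \<Longrightarrow> (comp M m d, comp N n d) \<in> R"
  using assms by (auto simp: grel_def)

lemma grelI:
  assumes "\<And>m n. (m, n) \<in> R \<Longrightarrow> m \<in> carrier M" "\<And>m n. (m, n) \<in> R \<Longrightarrow> n \<in> carrier N"
    "(\<zero>\<^bsub>M\<^esub>, \<zero>\<^bsub>N\<^esub>) \<in> R"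
    "\<And>m n m' n'. (m, n) \<in> R \<Longrightarrow> (m', n') \<in> R \<Longrightarrow> (m \<oplus>\<^bsub>M\<^esub> m', n \<oplus>\<^bsub>N\<^esub> n') \<in> R"
    "\<And>s m n. (m, n) \<in> R \<Longrightarrow> (s \<odot>\<^bsub>M\<^esub> m, s \<odot>\<^bsub>N\<^esub> n) \<in> R"
    "\<And>m n d. (m, n) \<in> R \<Longrightarrow> d \<in> carrier L \<Longrightarrow> (comp M m d, comp N n d) \<in> R"
  shows "grel M N R"
  using assms(3) by (auto simp: grel_def intro: assms(4-6) dest: assms(1,2))

lemma grel_converse: "grel M N R \<Longrightarrow> grel N M (R\<inverse>)"
  by (rule grelI) (auto dest: grelD)

lemma grel_comp: assumes "grel M N R" "grel N P T" shows "grel M P (R O T)"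
  by (rule grelI) (auto dest: grelD(1,2)[OF assms(1)] grelD(1,2)[OF assms(2)]
      intro: relcompI[OF grelD(3)[OF assms(1)] grelD(3)[OF assms(2)]]
        relcompI[OF grelD(4)[OF assms(1)] grelD(4)[OF assms(2)]]
        relcompI[OF grelD(5)[OF assms(1)] grelD(5)[OF assms(2)]]
        relcompI[OF grelD(6)[OF assms(1)] grelD(6)[OF assms(2)]])

lemma grel_minus:
  assumes "smod M" "smod N" "grel M N R" "(m, n) \<in> R" "(m', n') \<in> R"
  shows "(m \<ominus>\<^bsub>M\<^esub> m', n \<ominus>\<^bsub>N\<^esub> n') \<in> R"
  using grelD(4)[OF assms(3,4) grelD(5)[OF assms(3,5), of "- 1"]] grelD(1,2)[OF assms(3)] assms
  by (simp add: smod_minus)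

lemma grel_Domain: assumes "smod M" "smod N" "grel M N R" shows "submodule (Domain R) S_ring M"
  unfolding smod_submodule_iff[OF assms(1)] using grelD[OF assms(3)] by blast

lemma grel_Range: assumes "smod M" "smod N" "grel M N R" shows "submodule (Range R) S_ring N"
  using grel_Domain[OF assms(2,1) grel_converse[OF assms(3)]] by simp

text \<open>The indeterminacy of an additive relation, by which its values are ambiguous. Passing to
  the converse exchanges it with the kernel, so each fact about single-valuedness has a dual about
  injectivity.\<close>

definition Ind :: "('k::alg_closed_field poly poly, 'm) graded_module \<Rightarrow> ('m \<times> 'm) set \<Rightarrow> 'm set" where
  "Ind M R = {n. (\<zero>\<^bsub>M\<^esub>, n) \<in> R}"

definition Ker :: "('k::alg_closed_field poly poly, 'm) graded_module \<Rightarrow> ('m \<times> 'm) set \<Rightarrow> 'm set" where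
  "Ker N R = {m. (m, \<zero>\<^bsub>N\<^esub>) \<in> R}"

lemma grel_Ind: assumes "smod M" "smod N" "grel M N R" shows "submodule (Ind M R) S_ring N"
  unfolding smod_submodule_iff[OF assms(2)] Ind_def
proof (intro conjI allI ballI)
  note R = grelD[OF assms(3)] and [simp] = assms(1,2)
  show "{n. (\<zero>\<^bsub>M\<^esub>, n) \<in> R} \<subseteq> carrier N" "\<zero>\<^bsub>N\<^esub> \<in> {n. (\<zero>\<^bsub>M\<^esub>, n) \<in> R}" using R by auto
  fix a assume a: "a \<in> {n. (\<zero>\<^bsub>M\<^esub>, n) \<in> R}"
  show "s \<odot>\<^bsub>N\<^esub> a \<in> {n. (\<zero>\<^bsub>M\<^esub>, n) \<in> R}" for s using R(5)[of "\<zero>\<^bsub>M\<^esub>" a s] a by simp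
  fix b assume b: "b \<in> {n. (\<zero>\<^bsub>M\<^esub>, n) \<in> R}"
  show "a \<oplus>\<^bsub>N\<^esub> b \<in> {n. (\<zero>\<^bsub>M\<^esub>, n) \<in> R}" using R(4)[of "\<zero>\<^bsub>M\<^esub>" a "\<zero>\<^bsub>M\<^esub>" b] a b by simp
qed

lemma Ker_converse: "Ker N R = Ind N (R\<inverse>)"
  by (auto simp: Ker_def Ind_def)

lemma grel_Ker: assumes "smod M" "smod N" "grel M N R" shows "submodule (Ker N R) S_ring M"
  using grel_Ind[OF assms(2,1) grel_converse[OF assms(3)]] by (simp add: Ker_converse)

definition hom :: "('k::alg_closed_field poly poly, 'm) graded_module \<Rightarrow>
    ('k poly poly, 'm) graded_module \<Rightarrow> ('m \<times> 'm) set \<Rightarrow> bool" where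
  "hom M N R \<longleftrightarrow> grel M N R \<and> sat M (Domain R) = carrier M \<and> Ind M R \<subseteq> tors N"

lemma hom_grel: "hom M N R \<Longrightarrow> grel M N R"
  by (simp add: hom_def)

lemma homI:
  assumes "grel M N R" "\<And>m. m \<in> carrier M \<Longrightarrow> \<forall>\<^sub>F s in irr. s \<odot>\<^bsub>M\<^esub> m \<in> Domain R"
    "\<And>n. (\<zero>\<^bsub>M\<^esub>, n) \<in> R \<Longrightarrow> n \<in> tors N"
  shows "hom M N R"
  using assms by (auto simp: hom_def sat_def Ind_def)

lemma hom_dom: "hom M N R \<Longrightarrow> m \<in> carrier M \<Longrightarrow> \<forall>\<^sub>F s in irr. \<exists>n. (s \<odot>\<^bsub>M\<^esub> m, n) \<in> R"
  by (auto simp: hom_def sat_def Domain_iff)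

lemma finitely_generated_E:
  assumes "finitely_generated M"
  obtains G where "finite G" "G \<subseteq> carrier M" "\<And>N. submodule N S_ring M \<Longrightarrow> G \<subseteq> N \<Longrightarrow> carrier M \<subseteq> N"
  using assms unfolding finitely_generated_def by (metis order_refl)

lemma finite_dim_quotient_carrier_iff:
  assumes "obj M" "submodule W S_ring M" "\<And>w d. w \<in> W \<Longrightarrow> d \<in> carrier L \<Longrightarrow> comp M w d \<in> W"
  shows "finite_dim_quotient M (carrier M) W \<longleftrightarrow> sat M W = carrier M"
proof
  assume "finite_dim_quotient M (carrier M) W"
  then have "carrier M \<subseteq> sat M W"
    using finite_dim_quotient_imp_sat[of M "carrier M" W] assms carrier_submodule[of M] by auto
  then show "sat M W = carrier M" by (auto simp: sat_def)
next
  assume *: "sat M W = carrier M"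
  obtain G where "finite G" "G \<subseteq> carrier M" "\<And>N. submodule N S_ring M \<Longrightarrow> G \<subseteq> N \<Longrightarrow> carrier M \<subseteq> N"
    using assms(1) finitely_generated_E by (auto simp: obj_def)
  then show "finite_dim_quotient M (carrier M) W"
    using assms * carrier_submodule[of M] by (intro finite_dim_quotientI[of M _ _ G]) auto
qed

text \<open>Here generators of \<open>W\<close>, and not merely of \<open>M\<close>, have to be
  found: this is where \<open>submodule_fg\<close> is used.\<close>

lemma finite_dim_quotient_zero_iff:
  assumes "obj M" "submodule W S_ring M"
  shows "finite_dim_quotient M W {\<zero>\<^bsub>M\<^esub>} \<longleftrightarrow> W \<subseteq> tors M"
proof
  assume "finite_dim_quotient M W {\<zero>\<^bsub>M\<^esub>}"
  then show "W \<subseteq> tors M"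
    using finite_dim_quotient_imp_sat[of M W "{\<zero>\<^bsub>M\<^esub>}"] assms zero_submodule[of M] by auto
next
  assume *: "W \<subseteq> tors M"
  obtain G where "finite G" "G \<subseteq> W" "\<And>N. submodule N S_ring M \<Longrightarrow> G \<subseteq> N \<Longrightarrow> W \<subseteq> N"
    using submodule_fg[OF _ _ assms(2)] assms(1) by (auto simp: obj_def gm_smod)
  then show "finite_dim_quotient M W {\<zero>\<^bsub>M\<^esub>}"
    using assms * zero_submodule[of M] by (intro finite_dim_quotientI[of M _ _ G]) auto
qed

lemma partial_hom_iff:
  assumes "obj M" "obj N"
  shows "partial_hom p q M N R \<longleftrightarrow> hom M N R"
proof -
  have "partial_hom p q M N R \<longleftrightarrow> grel M N R \<and> finite_dim_quotient M (carrier M) (Domain R) \<and>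
      finite_dim_quotient N (Ind M R) {\<zero>\<^bsub>N\<^esub>}"
    unfolding partial_hom_def grel_def Ind_def by argo
  moreover have "finite_dim_quotient M (carrier M) (Domain R) \<longleftrightarrow> sat M (Domain R) = carrier M"
    if "grel M N R"
    using assms that grel_Domain[of M N R] grelD(6)[OF that]
    by (intro finite_dim_quotient_carrier_iff) auto
  moreover have "finite_dim_quotient N (Ind M R) {\<zero>\<^bsub>N\<^esub>} \<longleftrightarrow> Ind M R \<subseteq> tors N" if "grel M N R"
    using assms that grel_Ind[of M N R] by (intro finite_dim_quotient_zero_iff) auto
  ultimately show ?thesis by (cases "grel M N R") (simp_all only: hom_def simp_thms)
qed

text \<open>A multiplier that kills \<open>m\<close> turns \<open>n\<close> into a value at zero,
  hence into torsion. Torsion after multiplication by high powers is torsion.\<close>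

lemma grel_tors:
  assumes "smod M" "smod N" "grel M N R" "Ind M R \<subseteq> tors N" "(m, n) \<in> R" "m \<in> tors M"
  shows "n \<in> tors N"
proof -
  note R = grelD[OF assms(3)]
  have "\<forall>\<^sub>F s in irr. s \<odot>\<^bsub>N\<^esub> n \<in> tors N"
  proof (rule eventually_mono)
    show "\<forall>\<^sub>F s in irr. s \<odot>\<^bsub>M\<^esub> m = \<zero>\<^bsub>M\<^esub>" using assms(6) by (simp add: sat_def)
    fix s assume "s \<odot>\<^bsub>M\<^esub> m = \<zero>\<^bsub>M\<^esub>"
    then have "(\<zero>\<^bsub>M\<^esub>, s \<odot>\<^bsub>N\<^esub> n) \<in> R" using R(5)[OF assms(5), of s] by simp
    then show "s \<odot>\<^bsub>N\<^esub> n \<in> tors N" using assms(4) by (auto simp: Ind_def)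
  qed
  then show ?thesis by (rule tors_eventually[OF assms(2) R(2)[OF assms(5)]])
qed

lemma hom_tors:
  assumes "smod M" "smod N" "hom M N R" "(m, n) \<in> R" "m \<in> tors M"
  shows "n \<in> tors N"
  using grel_tors[OF assms(1,2) hom_grel[OF assms(3)] _ assms(4,5)] assms(3) by (simp add: hom_def)

lemma hom_teq:
  assumes "smod M" "smod N" "hom M N R" "(m, n) \<in> R" "(m', n') \<in> R" "teq M m m'"
  shows "teq N n n'"
  using hom_tors[OF assms(1-3) grel_minus[OF assms(1,2) hom_grel[OF assms(3)] assms(4,5)]]
    grelD(1,2)[OF hom_grel[OF assms(3)]] assms by (auto simp: cg_def)

text \<open>Relations are compared on their common domain only. For morphisms this suffices, since
  their domains are everything up to torsion. For the same reason transitivity is not formal: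
  arguments must first be multiplied into the domain of the middle relation.\<close>

definition eqv :: "('k::alg_closed_field poly poly, 'm) graded_module \<Rightarrow>
    ('m \<times> 'm) set \<Rightarrow> ('m \<times> 'm) set \<Rightarrow> bool" where
  "eqv N R R' \<longleftrightarrow> (\<forall>m n n'. (m, n) \<in> R \<longrightarrow> (m, n') \<in> R' \<longrightarrow> teq N n n')"

lemma eqvI: "(\<And>m n n'. (m, n) \<in> R \<Longrightarrow> (m, n') \<in> R' \<Longrightarrow> teq N n n') \<Longrightarrow> eqv N R R'"
  by (simp add: eqv_def)

lemma eqvD: "eqv N R R' \<Longrightarrow> (m, n) \<in> R \<Longrightarrow> (m, n') \<in> R' \<Longrightarrow> teq N n n'"
  by (simp add: eqv_def)

lemma eqv_refl: assumes "smod M" "smod N" "hom M N R" shows "eqv N R R"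
  by (rule eqvI, rule hom_teq[OF assms]) (auto intro!: teq_refl assms(1) dest: grelD(1)[OF hom_grel[OF assms(3)]])

lemma eqv_sym: "smod N \<Longrightarrow> eqv N R R' \<Longrightarrow> eqv N R' R"
  by (rule eqvI, rule teq_sym) (auto dest: eqvD)

lemma eqv_trans:
  assumes "smod M" "smod N" "hom M N R" "hom M N R'" "hom M N R''" "eqv N R R'" "eqv N R' R''"
  shows "eqv N R R''"
  unfolding eqv_def
proof (intro allI impI)
  fix m n n'' assume mn: "(m, n) \<in> R" "(m, n'') \<in> R''"
  note R = grelD[OF hom_grel[OF assms(3)]] and R'' = grelD[OF hom_grel[OF assms(5)]]
  have "\<forall>\<^sub>F s in irr. teq N (s \<odot>\<^bsub>N\<^esub> n) (s \<odot>\<^bsub>N\<^esub> n'')"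
  proof (rule eventually_mono[OF hom_dom[OF assms(4), of m]])
    show "m \<in> carrier M" using R(1)[OF mn(1)] .
    fix s assume "\<exists>n'. (s \<odot>\<^bsub>M\<^esub> m, n') \<in> R'"
    then obtain n' where n': "(s \<odot>\<^bsub>M\<^esub> m, n') \<in> R'" by blast
    have "teq N (s \<odot>\<^bsub>N\<^esub> n) n'" by (rule eqvD[OF assms(6) R(5)[OF mn(1)] n'])
    moreover have "teq N n' (s \<odot>\<^bsub>N\<^esub> n'')" by (rule eqvD[OF assms(7) n' R''(5)[OF mn(2)]])
    ultimately show "teq N (s \<odot>\<^bsub>N\<^esub> n) (s \<odot>\<^bsub>N\<^esub> n'')" by (rule teq_trans[OF assms(2)])
  qed
  then show "teq N n n''" by (rule teq_eventually[OF assms(2) R(2)[OF mn(1)] R''(2)[OF mn(2)]])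
qed

text \<open>For the converse direction the witnesses are as large as possible: the common domain for
  \<open>M''\<close> and all of the torsion for \<open>N''\<close>.\<close>

lemma partial_hom_eq_iff:
  assumes "obj M" "obj N" "hom M N R" "hom M N R'"
  shows "partial_hom_eq p q M N R R' \<longleftrightarrow> eqv N R R'"
proof
  note R = grelD[OF hom_grel[OF assms(3)]] and R' = grelD[OF hom_grel[OF assms(4)]]
  note [simp] = assms(1,2)
  {
    assume "partial_hom_eq p q M N R R'"
    then obtain M'' N'' where *: "graded_submodule p q M M''" "graded_submodule p q N N''"
      "finite_dim_quotient M (carrier M) M''" "finite_dim_quotient N N'' {\<zero>\<^bsub>N\<^esub>}"
      "M'' \<subseteq> Domain R \<inter> Domain R'"
      "\<And>m n n'. m \<in> M'' \<Longrightarrow> (m, n) \<in> R \<Longrightarrow> (m, n') \<in> R' \<Longrightarrow> n \<ominus>\<^bsub>N\<^esub> n' \<in> N''"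
      unfolding partial_hom_eq_def by blast
    have sM: "sat M M'' = carrier M"
      using *(1,3) finite_dim_quotient_carrier_iff[OF assms(1), of M''] by (auto simp: graded_submodule_def)
    have tN: "N'' \<subseteq> tors N"
      using *(2,4) finite_dim_quotient_zero_iff[OF assms(2), of N''] by (auto simp: graded_submodule_def)
    show "eqv N R R'"
      unfolding eqv_def
    proof (intro allI impI)
      fix m n n' assume mn: "(m, n) \<in> R" "(m, n') \<in> R'"
      have c: "n \<in> carrier N" "n' \<in> carrier N" using R(2)[OF mn(1)] R'(2)[OF mn(2)] by auto
      have "m \<in> sat M M''" using R(1)[OF mn(1)] sM by simp
      then have "\<forall>\<^sub>F s in irr. s \<odot>\<^bsub>M\<^esub> m \<in> M''" by (simp add: sat_def)
      then have "\<forall>\<^sub>F s in irr. teq N (s \<odot>\<^bsub>N\<^esub> n) (s \<odot>\<^bsub>N\<^esub> n')"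
      proof (rule eventually_mono)
        fix s assume "s \<odot>\<^bsub>M\<^esub> m \<in> M''"
        from *(6)[OF this R(5)[OF mn(1)] R'(5)[OF mn(2)]] tN c
        show "teq N (s \<odot>\<^bsub>N\<^esub> n) (s \<odot>\<^bsub>N\<^esub> n')" by (auto simp: cg_def)
      qed
      then show "teq N n n'" using teq_eventually[of N] c by simp
    qed
  }
  assume e: "eqv N R R'"
  let ?D = "Domain R \<inter> Domain R'"
  have D: "submodule ?D S_ring M"
    using grel_Domain[OF _ _ hom_grel[OF assms(3)]] grel_Domain[OF _ _ hom_grel[OF assms(4)]]
    by (simp add: smod_submodule_iff) blast
  have Dg: "comp M w d \<in> ?D" if "w \<in> ?D" "d \<in> carrier L" for w d
    using that R(6) R'(6) by blast
  have "carrier M \<subseteq> sat M ?D"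
    using eventually_conj[OF hom_dom[OF assms(3)] hom_dom[OF assms(4)]] by (auto simp: sat_def Domain_iff)
  then have Ds: "sat M ?D = carrier M" by (auto simp: sat_def)
  have tg: "comp N w d \<in> tors N" if "w \<in> tors N" "d \<in> carrier L" for w d
    using sat_graded[of N "{\<zero>\<^bsub>N\<^esub>}"] that zero_submodule[of N] by simp
  show "partial_hom_eq p q M N R R'"
    unfolding partial_hom_eq_def
  proof (rule exI[of _ ?D], rule exI[of _ "tors N"], intro conjI ballI allI impI)
    show "graded_submodule p q M ?D" unfolding graded_submodule_def using D Dg by blast
    show "graded_submodule p q N (tors N)"
      unfolding graded_submodule_def using tors_submodule[of N] tg by simp
    show "finite_dim_quotient M (carrier M) ?D"
      using finite_dim_quotient_carrier_iff[OF assms(1) D Dg] Ds by blast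
    show "finite_dim_quotient N (tors N) {\<zero>\<^bsub>N\<^esub>}"
      using finite_dim_quotient_zero_iff[OF assms(2), of "tors N"] tors_submodule[of N] by simp
    show "n \<ominus>\<^bsub>N\<^esub> n' \<in> tors N" if "(m, n) \<in> R \<and> (m, n') \<in> R'" for m n n'
      using e that by (auto simp: eqv_def cg_def)
  qed auto
qed

definition arr :: "('k::alg_closed_field poly poly, 'm) graded_module \<Rightarrow>
    ('k poly poly, 'm) graded_module \<Rightarrow> ('m \<times> 'm) set \<Rightarrow> ('k, 'm) quotient_arrow" where
  "arr M N R = (M, N, quotient_class p q M N R)"

lemma quotient_class_eq:
  assumes "obj M" "obj N" "hom M N R"
  shows "quotient_class p q M N R = {R'. hom M N R' \<and> eqv N R R'}"
  using assms by (auto simp: quotient_class_def partial_hom_iff partial_hom_eq_iff)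

lemma arr_eq_iff:
  assumes "obj M" "obj N" "hom M N R" "hom M N R'"
  shows "arr M N R = arr M N R' \<longleftrightarrow> eqv N R R'"
proof
  assume "arr M N R = arr M N R'"
  then have "R' \<in> {R'. hom M N R' \<and> eqv N R R'}"
    unfolding arr_def quotient_class_eq[OF assms(1-3)] quotient_class_eq[OF assms(1,2,4)]
    using assms(4) eqv_refl[OF obj_smod[OF assms(1)] obj_smod[OF assms(2)] assms(4)] by auto
  then show "eqv N R R'" using assms by (simp add: quotient_class_eq)
next
  assume "eqv N R R'"
  then have "eqv N R' R" by (rule eqv_sym[OF obj_smod[OF assms(2)]])
  have *: "eqv N R X" if "eqv N R' X" "hom M N X" for X
    by (rule eqv_trans[OF obj_smod[OF assms(1)] obj_smod[OF assms(2)] assms(3) assms(4) that(2) \<open>eqv N R R'\<close> that(1)])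
  have **: "eqv N R' X" if "eqv N R X" "hom M N X" for X
    by (rule eqv_trans[OF obj_smod[OF assms(1)] obj_smod[OF assms(2)] assms(4) assms(3) that(2) \<open>eqv N R' R\<close> that(1)])
  show "arr M N R = arr M N R'"
    unfolding arr_def quotient_class_eq[OF assms(1-3)] quotient_class_eq[OF assms(1,2,4)]
    using * ** by blast
qed

lemma hom_comp:
  assumes "obj M" "obj N" "obj P" "hom M N R" "hom N P T"
  shows "hom M P (R O T)"
proof (rule homI)
  note [simp] = assms(1-3)
  note R = grelD[OF hom_grel[OF assms(4)]] and T = grelD[OF hom_grel[OF assms(5)]]
  show "grel M P (R O T)" using grel_comp hom_grel assms by blast
  show "\<forall>\<^sub>F s in irr. s \<odot>\<^bsub>M\<^esub> m \<in> Domain (R O T)" if m: "m \<in> carrier M" for m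
  proof (rule eventually_irr_mult, rule eventually_mono[OF hom_dom[OF assms(4) m]])
    fix s assume "\<exists>n. (s \<odot>\<^bsub>M\<^esub> m, n) \<in> R"
    then obtain n where n: "(s \<odot>\<^bsub>M\<^esub> m, n) \<in> R" by blast
    show "\<forall>\<^sub>F t in irr. (t * s) \<odot>\<^bsub>M\<^esub> m \<in> Domain (R O T)"
      by (rule eventually_mono[OF hom_dom[OF assms(5) R(2)[OF n]]])
        (use R(5)[OF n] m in \<open>auto simp: smod_smult intro: relcompI\<close>)
  qed
  show "l \<in> tors P" if l: "(\<zero>\<^bsub>M\<^esub>, l) \<in> R O T" for l
  proof -
    obtain n where n: "(\<zero>\<^bsub>M\<^esub>, n) \<in> R" "(n, l) \<in> T" using l by blast
    then show ?thesis using hom_tors[of M N R] hom_tors[of N P T] assms(4,5) by simp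
  qed
qed

text \<open>The intermediate values \<open>n\<close> and \<open>n'\<close> differ by torsion. A
  multiple of \<open>n\<close> lies in the domain of \<open>T'\<close>, and its value there links
  the two composites.\<close>

lemma eqv_comp:
  assumes "obj M" "obj N" "obj P" "hom M N R" "hom N P T" "hom M N R'" "hom N P T'"
    "eqv N R R'" "eqv P T T'"
  shows "eqv P (R O T) (R' O T')"
  unfolding eqv_def
proof (intro allI impI)
  note [simp] = assms(1-3)
  fix m l l' assume "(m, l) \<in> R O T" "(m, l') \<in> R' O T'"
  then obtain n n' where n: "(m, n) \<in> R" "(n, l) \<in> T" "(m, n') \<in> R'" "(n', l') \<in> T'" by blast
  note T = grelD[OF hom_grel[OF assms(5)]] and T' = grelD[OF hom_grel[OF assms(7)]]
  have nn: "teq N n n'" by (rule eqvD[OF assms(8) n(1,3)])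
  have "\<forall>\<^sub>F s in irr. teq P (s \<odot>\<^bsub>P\<^esub> l) (s \<odot>\<^bsub>P\<^esub> l')"
  proof (rule eventually_mono[OF hom_dom[OF assms(7) T(1)[OF n(2)]]])
    fix s assume "\<exists>k. (s \<odot>\<^bsub>N\<^esub> n, k) \<in> T'"
    then obtain k where k: "(s \<odot>\<^bsub>N\<^esub> n, k) \<in> T'" by blast
    have "teq P (s \<odot>\<^bsub>P\<^esub> l) k" by (rule eqvD[OF assms(9) T(5)[OF n(2)] k])
    moreover have "teq P k (s \<odot>\<^bsub>P\<^esub> l')"
      by (rule hom_teq[OF _ _ assms(7) k T'(5)[OF n(4)]]) (simp_all add: teq_smult[OF _ nn])
    ultimately show "teq P (s \<odot>\<^bsub>P\<^esub> l) (s \<odot>\<^bsub>P\<^esub> l')" by (rule teq_trans[OF obj_smod[OF assms(3)]])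
  qed
  then show "teq P l l'" by (rule teq_eventually[OF obj_smod[OF assms(3)] T(2)[OF n(2)] T'(2)[OF n(4)]])
qed

abbreviation C where "C \<equiv> coh p q"

lemma Obj_coh: "M \<in> Obj C \<longleftrightarrow> obj M"
  by (simp add: coh_def obj_def)

text \<open>The union over all representatives in \<open>quotient_comp\<close> is a union of equal
  classes, so composition can be computed on any pair of representatives.\<close>

lemma Comp_arr:
  assumes "obj M" "obj N" "obj P" "hom M N R" "hom N P T"
  shows "Comp C (arr N P T) (arr M N R) = arr M P (R O T)"
proof -
  have eq: "quotient_class p q M P (R' O T') = quotient_class p q M P (R O T)"
    if "R' \<in> quotient_class p q M N R" "T' \<in> quotient_class p q N P T" for R' T'
  proof -
    have *: "hom M N R'" "eqv N R R'" "hom N P T'" "eqv P T T'"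
      using that assms by (auto simp: quotient_class_eq)
    have "arr M P (R O T) = arr M P (R' O T')"
      using arr_eq_iff[OF assms(1,3) hom_comp[OF assms] hom_comp[OF assms(1-3) *(1,3)]]
        eqv_comp[OF assms *(1,3,2,4)] by simp
    then show ?thesis by (simp add: arr_def)
  qed
  have "R \<in> quotient_class p q M N R" "T \<in> quotient_class p q N P T"
    using assms eqv_refl[of M N R] eqv_refl[of N P T] by (auto simp: quotient_class_eq)
  then have "(\<Union>R'\<in>quotient_class p q M N R. \<Union>T'\<in>quotient_class p q N P T.
      quotient_class p q M P (R' O T')) = quotient_class p q M P (R O T)"
    using eq by blast
  then show ?thesis by (simp add: coh_def quotient_comp_def arr_def)
qed

lemma Arr_iff:
  assumes "obj M" "obj N"
  shows "f \<in> Arr C M N \<longleftrightarrow> (\<exists>R. hom M N R \<and> f = arr M N R)"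
  using assms by (auto simp: coh_def arr_def partial_hom_iff)

lemma arr_in: "obj M \<Longrightarrow> obj N \<Longrightarrow> hom M N R \<Longrightarrow> arr M N R \<in> Arr C M N"
  by (auto simp: Arr_iff)

lemma hom_Id: "obj M \<Longrightarrow> hom M M (Id_on (carrier M))"
  by (rule homI, rule grelI) (auto simp: comp_carrier)

lemma Ident_coh: "Ident C M = arr M M (Id_on (carrier M))"
proof -
  have "(\<lambda>m. (m, m)) ` carrier M = Id_on (carrier M)" by (auto simp: Id_on_def)
  then show ?thesis by (simp add: coh_def quotient_arrow_of_def arr_def)
qed

lemma hom_zero: "obj M \<Longrightarrow> obj N \<Longrightarrow> hom M N (carrier M \<times> {\<zero>\<^bsub>N\<^esub>})"
  by (rule homI, rule grelI) (auto simp: comp_carrier Domain_iff)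

end

section \<open>Line bundles and quotients\<close>

abbreviation cf :: "'k::zero poly poly \<Rightarrow> nat \<Rightarrow> nat \<Rightarrow> 'k" where
  "cf f a b \<equiv> coeff (coeff f b) a"

lemma cf_eqI: "(\<And>a b. cf f a b = cf g a b) \<Longrightarrow> f = g"
  by (intro poly_eqI) auto

lemma cf_sum: "cf (sum f A) a b = (\<Sum>x\<in>A. cf (f x) a b)"
  by (simp add: coeff_sum)

lemma finite_cf_support: "finite {(a, b). cf f a b \<noteq> 0}"
proof -
  have "{(a, b). cf f a b \<noteq> 0} \<subseteq> (\<Union>b\<le>degree f. (\<lambda>a. (a, b)) ` {..degree (coeff f b)})"
  proof
    fix x assume "x \<in> {(a, b). cf f a b \<noteq> 0}"
    then obtain a b where x: "x = (a, b)" "cf f a b \<noteq> 0" by auto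
    then have "coeff f b \<noteq> 0" by auto
    then show "x \<in> (\<Union>b\<le>degree f. (\<lambda>a. (a, b)) ` {..degree (coeff f b)})"
      using x le_degree[of f b] le_degree[of "coeff f b" a] by auto
  qed
  then show ?thesis by (rule finite_subset) auto
qed

definition part :: "(nat \<Rightarrow> nat \<Rightarrow> bool) \<Rightarrow> 'k::zero poly poly \<Rightarrow> 'k poly poly" where
  "part P f = Abs_poly (\<lambda>b. Abs_poly (\<lambda>a. if P a b then cf f a b else 0))"

lemma cf_part [simp]: "cf (part P f) a b = (if P a b then cf f a b else 0)"
proof -
  have 1: "coeff (Abs_poly (\<lambda>a. if P a b then cf f a b else 0)) = (\<lambda>a. if P a b then cf f a b else 0)" for b
    by (rule coeff_Abs_poly[of "degree (coeff f b)"]) (simp add: coeff_eq_0)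
  have "Abs_poly (\<lambda>a. if P a b then cf f a b else 0) = 0" if "b > degree f" for b
    by (rule poly_eqI) (use that 1 in \<open>simp add: coeff_eq_0\<close>)
  then have "coeff (part P f) = (\<lambda>b. Abs_poly (\<lambda>a. if P a b then cf f a b else 0))"
    unfolding part_def by (intro coeff_Abs_poly[of "degree f"])
  then show ?thesis using 1 by simp
qed

lemma line_bundle_simps [simp]:
  "carrier (line_bundle p q a b) = UNIV" "x \<oplus>\<^bsub>line_bundle p q a b\<^esub> y = x + y"
  "\<zero>\<^bsub>line_bundle p q a b\<^esub> = 0" "s \<odot>\<^bsub>line_bundle p q a b\<^esub> x = s * x"
  "piece (line_bundle p q a b) d = S_piece p q (Lvec p q a b \<otimes>\<^bsub>LL p q\<^esub> d)"
  by (simp_all add: line_bundle_def)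

lemma smod_line [simp]: "smod (line_bundle p q a b :: 'a::alg_closed_field sheaf)"
proof (rule moduleI)
  show "cring (S_ring :: 'a poly poly ring)" by (rule cring_S_ring)
  show "abelian_group (line_bundle p q a b :: 'a sheaf)"
  proof (rule abelian_groupI)
    fix x :: "'a poly poly"
    show "\<exists>y\<in>carrier (line_bundle p q a b :: 'a sheaf). y \<oplus>\<^bsub>line_bundle p q a b\<^esub> x = \<zero>\<^bsub>line_bundle p q a b\<^esub>"
      by (rule bexI[of _ "- x"]) auto
  qed auto
qed (auto simp: algebra_simps)

lemma line_minus [simp]: "x \<ominus>\<^bsub>line_bundle p q a b\<^esub> y = x - y"
  by (simp add: smod_minus)

lemma finsum_line:
  fixes f :: "'i \<Rightarrow> 'a::alg_closed_field poly poly"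
  assumes "finite A" shows "finsum (line_bundle p q a b) f A = sum f A"
proof -
  interpret module S_ring "line_bundle p q a b :: 'a sheaf" by (rule smod_line)
  show ?thesis using assms by (induction A rule: finite_induct) auto
qed

lemma S_piece_add: "f \<in> S_piece p q d \<Longrightarrow> g \<in> S_piece p q d \<Longrightarrow> f + g \<in> S_piece p q d"
  unfolding S_piece_def by (simp add: coeff_add) (metis add.right_neutral add.left_neutral)

lemma S_piece_mult:
  assumes "f \<in> S_piece p q d" "g \<in> S_piece p q e"
  shows "f * g \<in> S_piece p q (d \<otimes>\<^bsub>LL p q\<^esub> e)"
  unfolding S_piece_def
proof (intro CollectI allI impI)
  fix a b assume "cf (f * g) a b \<noteq> 0"
  then have "(\<Sum>j\<le>b. \<Sum>i\<le>a. cf f i j * cf g (a - i) (b - j)) \<noteq> 0"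
    by (simp add: coeff_mult coeff_sum)
  then obtain j where j: "j \<le> b" "(\<Sum>i\<le>a. cf f i j * cf g (a - i) (b - j)) \<noteq> 0"
    by (meson atMost_iff sum.neutral)
  then obtain i where i: "i \<le> a" "cf f i j * cf g (a - i) (b - j) \<noteq> 0"
    by (meson atMost_iff sum.neutral)
  then have "cf f i j \<noteq> 0" "cf g (a - i) (b - j) \<noteq> 0" by auto
  then have "Lvec p q (int i) (int j) = d" "Lvec p q (int (a - i)) (int (b - j)) = e"
    using assms unfolding S_piece_def by blast+
  then have "d \<otimes>\<^bsub>LL p q\<^esub> e = Lvec p q (int i + int (a - i)) (int j + int (b - j))"
    by (simp only: Lvec_mult[symmetric])
  then show "Lvec p q (int a) (int b) = d \<otimes>\<^bsub>LL p q\<^esub> e"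
    using i(1) j(1) by (simp add: of_nat_diff)
qed

lemma S_piece_uminus: "f \<in> S_piece p q d \<Longrightarrow> - f \<in> S_piece p q d"
  by (simp add: S_piece_def)

context weights
begin

abbreviation lb :: "int \<Rightarrow> int \<Rightarrow> 'k::alg_closed_field sheaf" where
  "lb a b \<equiv> line_bundle p q a b"

text \<open>Each monomial thus has exactly one degree in the shifted module, and a homogeneous
  component of a polynomial is obtained by selecting monomials.\<close>

lemma degree_solve:
  assumes "d \<in> carrier L"
  shows "V i j = V a b \<otimes>\<^bsub>L\<^esub> d \<longleftrightarrow> d = V (i - a) (j - b)"
proof -
  interpret LG: comm_group L by (rule comm_group_LL)
  have "d = V (- a) (- b) \<otimes>\<^bsub>L\<^esub> (V a b \<otimes>\<^bsub>L\<^esub> d)"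
    using assms LG.l_one[OF assms] by (simp add: LG.m_assoc[symmetric] one_LL[symmetric])
  moreover have "V i j = V a b \<otimes>\<^bsub>L\<^esub> V (i - a) (j - b)" by simp
  ultimately show ?thesis by (metis Lvec_mult add.commute uminus_add_conv_diff)
qed

lemma decomposition_line_iff:
  "decomposition p q (lb a b) f c \<longleftrightarrow>
     c = restrict (\<lambda>d. part (\<lambda>i j. V (int i) (int j) = V a b \<otimes>\<^bsub>L\<^esub> d) f) (carrier L)"
  (is "_ \<longleftrightarrow> c = ?c0")
proof
  let ?S = "\<lambda>c. {d \<in> carrier L. c d \<noteq> (0 :: 'a poly poly)}"
  {
    assume dec: "decomposition p q (lb a b) f c"
    have fin: "finite (?S c)" and f: "f = sum c (?S c)" and P: "c \<in> (\<Pi>\<^sub>E d\<in>carrier L. piece (lb a b) d)"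
      using dec finsum_line[of "?S c"] unfolding decomposition_def by auto
    have cf_other: "cf (c d) i j = 0" if "d \<in> carrier L" "V (int i) (int j) \<noteq> V a b \<otimes>\<^bsub>L\<^esub> d" for d i j
      using P that by (force simp: S_piece_def PiE_iff)
    have "c d = part (\<lambda>i j. V (int i) (int j) = V a b \<otimes>\<^bsub>L\<^esub> d) f" if d: "d \<in> carrier L" for d
    proof (rule cf_eqI, unfold cf_part, rule sym)
      fix i j
      show "(if V (int i) (int j) = V a b \<otimes>\<^bsub>L\<^esub> d then cf f i j else 0) = cf (c d) i j"
      proof (cases "V (int i) (int j) = V a b \<otimes>\<^bsub>L\<^esub> d")
        case True
        have "cf f i j = (\<Sum>e\<in>?S c. cf (c e) i j)" by (subst f) (rule cf_sum)
        also have "\<dots> = (\<Sum>e\<in>?S c. if e = d then cf (c d) i j else 0)"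
          by (rule sum.cong) (use True d cf_other in \<open>auto simp: degree_solve\<close>)
        also have "\<dots> = cf (c d) i j" using fin d by (auto simp: sum.delta)
        finally show ?thesis using True by simp
      qed (use cf_other d in auto)
    qed
    then show "c = ?c0" using P by (auto simp: fun_eq_iff PiE_iff extensional_def)
  }
  assume c: "c = ?c0"
  have sup: "?S c \<subseteq> (\<lambda>(i, j). V (int i - a) (int j - b)) ` {(i, j). cf f i j \<noteq> 0}"
  proof
    fix d assume d: "d \<in> ?S c"
    then obtain i j where "cf (c d) i j \<noteq> 0" using cf_eqI[of "c d" 0] by auto
    then have "V (int i) (int j) = V a b \<otimes>\<^bsub>L\<^esub> d" "cf f i j \<noteq> 0" using d by (auto simp: c split: if_splits)
    then show "d \<in> (\<lambda>(i, j). V (int i - a) (int j - b)) ` {(i, j). cf f i j \<noteq> 0}"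
      using d by (force simp: degree_solve)
  qed
  have fin: "finite (?S c)" by (rule finite_subset[OF sup]) (intro finite_imageI finite_cf_support)
  have "f = sum c (?S c)"
  proof (rule cf_eqI, unfold cf_sum)
    fix i j
    let ?d = "V (int i - a) (int j - b)"
    have "(\<Sum>e\<in>?S c. cf (c e) i j) = (\<Sum>e\<in>?S c. if e = ?d then cf f i j else 0)"
      by (rule sum.cong) (auto simp: c degree_solve)
    also have "\<dots> = (if ?d \<in> ?S c then cf f i j else 0)" using fin by (simp add: sum.delta)
    also have "\<dots> = cf f i j"
    proof (cases "?d \<in> ?S c")
      case False
      then have "cf (c ?d) i j = 0" by simp
      then show ?thesis by (simp add: c)
    qed simp
    finally show "cf f i j = (\<Sum>e\<in>?S c. cf (c e) i j)" ..
  qed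
  moreover have "c \<in> (\<Pi>\<^sub>E d\<in>carrier L. piece (lb a b) d)" by (auto simp: c S_piece_def)
  ultimately show "decomposition p q (lb a b) f c"
    using fin finsum_line[of "?S c" p q a b c] unfolding decomposition_def by auto
qed

lemma comp_line: "d \<in> carrier L \<Longrightarrow> comp (lb a b) f d = part (\<lambda>i j. V (int i) (int j) = V a b \<otimes>\<^bsub>L\<^esub> d) f"
  by (simp add: component_def decomposition_line_iff)

lemma obj_line [simp]: "obj (lb a b :: 'a::alg_closed_field sheaf)"
proof -
  interpret LG: comm_group L by (rule comm_group_LL)
  have "gm (lb a b :: 'a sheaf)"
    unfolding L_graded_module_def
  proof (intro conjI ballI)
    fix d assume d: "d \<in> carrier L"
    interpret module S_ring "lb a b :: 'a sheaf" by (rule smod_line)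
    show "subgroup (piece (lb a b :: 'a sheaf) d) (add_monoid (lb a b))"
    proof (rule add.subgroupI)
      show "piece (lb a b :: 'a sheaf) d \<noteq> {}" by (auto simp: S_piece_def intro: exI[of _ 0])
    qed (auto simp: S_piece_add S_piece_uminus smod_uminus[of "lb a b"])
    fix e and s m :: "'a poly poly"
    assume e: "e \<in> carrier L" "s \<in> S_piece p q e" "m \<in> piece (lb a b) d"
    then show "s \<odot>\<^bsub>lb a b\<^esub> m \<in> piece (lb a b) (e \<otimes>\<^bsub>L\<^esub> d)"
      using S_piece_mult[OF e(2), of m "V a b \<otimes>\<^bsub>L\<^esub> d"] d by (simp add: LG.m_lcomm)
  qed (auto simp: decomposition_line_iff)
  moreover have "finitely_generated (lb a b :: 'a sheaf)"
    unfolding finitely_generated_def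
  proof (intro exI[of _ "{1}"] conjI allI impI)
    fix N assume N: "submodule N S_ring (lb a b :: 'a sheaf) \<and> {1} \<subseteq> N"
    have "x \<in> N" for x using smod_submoduleD(4)[OF smod_line, of N p q a b 1 x] N by simp
    then show "N = carrier (lb a b)" by auto
  qed auto
  ultimately show ?thesis by (simp add: obj_def)
qed

text \<open>The choice depends on the coset of \<open>m\<close> only, since congruent elements give
  the same predicate under \<open>SOME\<close>.\<close>

definition rep :: "('k::alg_closed_field poly poly, 'm) graded_module \<Rightarrow> 'm set \<Rightarrow> 'm \<Rightarrow> 'm" where
  "rep M W m = (SOME m'. cg M W m' m)"

text \<open>The carrier consists of chosen representatives of the cosets, so that the quotient has the
  same element type.\<close>

definition quot :: "('k::alg_closed_field poly poly, 'm) graded_module \<Rightarrow> 'm set \<Rightarrow>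
    ('k poly poly, 'm) graded_module" where
  "quot M W = \<lparr>carrier = rep M W ` carrier M, monoid.mult = (\<lambda>x y. x), one = \<zero>\<^bsub>M\<^esub>,
     zero = rep M W \<zero>\<^bsub>M\<^esub>, add = (\<lambda>x y. rep M W (x \<oplus>\<^bsub>M\<^esub> y)),
     smult = (\<lambda>s x. rep M W (s \<odot>\<^bsub>M\<^esub> x)), piece = (\<lambda>d. rep M W ` piece M d)\<rparr>"

context
  fixes M :: "('k::alg_closed_field poly poly, 'm) graded_module" and W
  assumes gmM: "gm M" and W: "submodule W S_ring M"
    and gr: "\<And>w d. w \<in> W \<Longrightarrow> d \<in> carrier L \<Longrightarrow> comp M w d \<in> W"
begin

lemma M_smod [simp]: "smod M" using gm_smod[OF gmM] .

lemma rep_cg: "m \<in> carrier M \<Longrightarrow> cg M W (rep M W m) m"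
  unfolding rep_def by (rule someI[of _ m]) (simp add: cg_refl[OF M_smod W])

lemma rep_carrier [simp]: "m \<in> carrier M \<Longrightarrow> rep M W m \<in> carrier M"
  using rep_cg cg_carrier[OF M_smod W] by blast

lemma rep_eqI: "cg M W m n \<Longrightarrow> rep M W m = rep M W n"
proof -
  assume mn: "cg M W m n"
  have "cg M W x m \<longleftrightarrow> cg M W x n" for x
    using cg_trans[OF M_smod W _ mn] cg_trans[OF M_smod W _ cg_sym[OF M_smod W mn]] by blast
  then show ?thesis by (simp add: rep_def)
qed

lemma rep_eq_iff: "m \<in> carrier M \<Longrightarrow> n \<in> carrier M \<Longrightarrow> rep M W m = rep M W n \<longleftrightarrow> cg M W m n"
  using rep_eqI rep_cg cg_trans[OF M_smod W] cg_sym[OF M_smod W] by metis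

lemma quot_simps:
  "carrier (quot M W) = rep M W ` carrier M" "\<zero>\<^bsub>quot M W\<^esub> = rep M W \<zero>\<^bsub>M\<^esub>"
  "x \<oplus>\<^bsub>quot M W\<^esub> y = rep M W (x \<oplus>\<^bsub>M\<^esub> y)" "s \<odot>\<^bsub>quot M W\<^esub> x = rep M W (s \<odot>\<^bsub>M\<^esub> x)"
  "piece (quot M W) d = rep M W ` piece M d"
  by (simp_all add: quot_def)

lemma rep_add:
  assumes "m \<in> carrier M" "n \<in> carrier M"
  shows "rep M W m \<oplus>\<^bsub>quot M W\<^esub> rep M W n = rep M W (m \<oplus>\<^bsub>M\<^esub> n)"
  unfolding quot_simps by (rule rep_eqI[OF cg_add[OF M_smod W rep_cg[OF assms(1)] rep_cg[OF assms(2)]]])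

lemma rep_smult: "m \<in> carrier M \<Longrightarrow> s \<odot>\<^bsub>quot M W\<^esub> rep M W m = rep M W (s \<odot>\<^bsub>M\<^esub> m)"
  unfolding quot_simps by (rule rep_eqI[OF cg_smult[OF M_smod W rep_cg]])

lemma rep_zero: "rep M W \<zero>\<^bsub>M\<^esub> = \<zero>\<^bsub>quot M W\<^esub>"
  by (simp add: quot_simps)

lemma rep_in: "m \<in> carrier M \<Longrightarrow> rep M W m \<in> carrier (quot M W)"
  by (simp add: quot_simps)

lemma quot_E: assumes "x \<in> carrier (quot M W)" obtains m where "m \<in> carrier M" "x = rep M W m"
  using assms by (auto simp: quot_simps)

lemma rep_zero_iff: "m \<in> carrier M \<Longrightarrow> rep M W m = \<zero>\<^bsub>quot M W\<^esub> \<longleftrightarrow> m \<in> W"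
  using rep_eq_iff[of m "\<zero>\<^bsub>M\<^esub>"] cg_zero_iff[OF M_smod W] by (simp add: rep_zero)

lemma smod_quot: "smod (quot M W)"
proof (rule moduleI)
  show "cring (S_ring :: 'k poly poly ring)" by (rule cring_S_ring)
  show "abelian_group (quot M W)"
  proof (rule abelian_groupI)
    fix x assume "x \<in> carrier (quot M W)"
    then obtain m where m: "m \<in> carrier M" "x = rep M W m" by (rule quot_E)
    have "rep M W ((- 1) \<odot>\<^bsub>M\<^esub> m) \<oplus>\<^bsub>quot M W\<^esub> x = \<zero>\<^bsub>quot M W\<^esub>"
      using m by (simp add: rep_add smod_cancel rep_zero)
    then show "\<exists>y\<in>carrier (quot M W). y \<oplus>\<^bsub>quot M W\<^esub> x = \<zero>\<^bsub>quot M W\<^esub>"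
      using m rep_in by (metis M_smod smod_closed(3))
  qed (auto elim!: quot_E simp: rep_add rep_in smod_add_ac rep_zero[symmetric])
qed (auto elim!: quot_E simp: rep_add rep_in rep_smult smod_smult)

lemma finsum_quot:
  assumes "finite A" "\<And>x. x \<in> A \<Longrightarrow> f x \<in> carrier M"
  shows "finsum (quot M W) (\<lambda>x. rep M W (f x)) A = rep M W (finsum M f A)"
proof -
  interpret Q: module S_ring "quot M W" by (rule smod_quot)
  interpret MM: module S_ring M by simp
  show ?thesis using assms
  proof (induction A rule: finite_induct)
    case (insert x F)
    then have "f \<in> F \<rightarrow> carrier M" "f x \<in> carrier M" "(\<lambda>x. rep M W (f x)) \<in> F \<rightarrow> carrier (quot M W)"
      by (auto simp: rep_in)
    then show ?case using insert by (simp add: rep_add rep_in)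
  qed (simp add: rep_zero)
qed

lemma cg_comp: assumes "cg M W m n" "d \<in> carrier L" shows "cg M W (comp M m d) (comp M n d)"
  using assms gr[of "m \<ominus>\<^bsub>M\<^esub> n" d] comp_carrier[OF gmM] comp_minus[OF gmM, of m n d]
  by (auto simp: cg_def)

lemma decomposition_quot_iff:
  assumes m: "m \<in> carrier M"
  shows "decomposition p q (quot M W) (rep M W m) c \<longleftrightarrow>
    c = restrict (\<lambda>d. rep M W (comp M m d)) (carrier L)" (is "_ \<longleftrightarrow> c = ?c0")
proof
  interpret Q: module S_ring "quot M W" by (rule smod_quot)
  interpret MM: module S_ring M by simp
  let ?S = "\<lambda>c. {d \<in> carrier L. c d \<noteq> \<zero>\<^bsub>quot M W\<^esub>}"
  {
    assume dec: "decomposition p q (quot M W) (rep M W m) c"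
    have fin: "finite (?S c)" and f: "rep M W m = finsum (quot M W) c (?S c)"
      and P: "c \<in> (\<Pi>\<^sub>E d\<in>carrier L. piece (quot M W) d)"
      using dec unfolding decomposition_def by auto
    \<comment> \<open>The components in the quotient are lifted to homogeneous elements of
      \<open>M\<close>. Zero is lifted to zero, so that the support stays finite and the lifts can
      be summed.\<close>
    have "\<forall>d. \<exists>y. d \<in> carrier L \<longrightarrow> y \<in> piece M d \<and> rep M W y = c d \<and> (c d = \<zero>\<^bsub>quot M W\<^esub> \<longrightarrow> y = \<zero>\<^bsub>M\<^esub>)"
    proof (intro allI)
      fix d
      show "\<exists>y. d \<in> carrier L \<longrightarrow> y \<in> piece M d \<and> rep M W y = c d \<and> (c d = \<zero>\<^bsub>quot M W\<^esub> \<longrightarrow> y = \<zero>\<^bsub>M\<^esub>)"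
      proof (cases "d \<in> carrier L \<and> c d = \<zero>\<^bsub>quot M W\<^esub>")
        case True
        then show ?thesis using piece_zero[OF gmM, of d] by (intro exI[of _ "\<zero>\<^bsub>M\<^esub>"]) (simp add: rep_zero)
      next
        case False
        then have "d \<in> carrier L \<Longrightarrow> c d \<in> rep M W ` piece M d"
          using P by (auto simp: PiE_iff quot_simps(5))
        then show ?thesis using False by (cases "d \<in> carrier L") (auto simp: image_iff)
      qed
    qed
    then obtain y where y: "\<And>d. d \<in> carrier L \<Longrightarrow> y d \<in> piece M d" "\<And>d. d \<in> carrier L \<Longrightarrow> rep M W (y d) = c d"
      "\<And>d. d \<in> carrier L \<Longrightarrow> c d = \<zero>\<^bsub>quot M W\<^esub> \<Longrightarrow> y d = \<zero>\<^bsub>M\<^esub>" by metis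
    have yc: "y d \<in> carrier M" if "d \<in> carrier L" for d using piece_carrier[OF gmM that y(1)[OF that]] .
    have sc: "finsum M y (?S c) \<in> carrier M" using yc by (intro MM.finsum_closed) auto
    have "finsum (quot M W) c (?S c) = finsum (quot M W) (\<lambda>d. rep M W (y d)) (?S c)"
      using yc by (intro Q.finsum_cong') (auto simp: y(2)[symmetric] rep_in)
    also have "\<dots> = rep M W (finsum M y (?S c))" using fin yc by (intro finsum_quot) auto
    finally have *: "cg M W m (finsum M y (?S c))" using f m sc by (simp add: rep_eq_iff)
    have "c d = rep M W (comp M m d)" if d: "d \<in> carrier L" for d
    proof -
      have "comp M (finsum M y (?S c)) d = y d"
        using y(1,3) fin d by (intro comp_unique[OF gmM, where D = "?S c"]) auto
      then have "cg M W (comp M m d) (y d)" using cg_comp[OF * d] by simp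
      then show ?thesis using rep_eqI y(2)[OF d] by metis
    qed
    then show "c = ?c0" using P by (auto simp: fun_eq_iff PiE_iff extensional_def)
  }
  assume c: "c = ?c0"
  have cc: "d \<in> carrier L \<Longrightarrow> c d = rep M W (comp M m d)" for d by (simp add: c)
  let ?T = "{d \<in> carrier L. comp M m d \<noteq> \<zero>\<^bsub>M\<^esub>}"
  have fT: "finite ?T" by (rule comp_finite[OF gmM m])
  have ST: "?S c \<subseteq> ?T" by (auto simp: c rep_zero)
  have "finsum (quot M W) c (?S c) = finsum (quot M W) (\<lambda>d. rep M W (comp M m d)) ?T"
    by (rule Q.add.finprod_mono_neutral_cong_left)
      (use fT ST comp_carrier[OF gmM m] in \<open>auto simp: cc rep_in\<close>)
  also have "\<dots> = rep M W (finsum M (comp M m) ?T)"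
    using fT comp_carrier[OF gmM m] by (intro finsum_quot) auto
  also have "\<dots> = rep M W m" using comp_sum[OF gmM m] by simp
  finally have "rep M W m = finsum (quot M W) c (?S c)" ..
  moreover have "finite (?S c)" using fT ST finite_subset by blast
  moreover have "c \<in> (\<Pi>\<^sub>E d\<in>carrier L. piece (quot M W) d)"
    using comp_piece[OF gmM m] by (auto simp: c quot_simps(5))
  ultimately show "decomposition p q (quot M W) (rep M W m) c"
    unfolding decomposition_def by blast
qed

lemma comp_quot: "m \<in> carrier M \<Longrightarrow> d \<in> carrier L \<Longrightarrow> comp (quot M W) (rep M W m) d = rep M W (comp M m d)"
  by (simp add: component_def decomposition_quot_iff)

lemma gm_quot: "gm (quot M W)"
  unfolding L_graded_module_def
proof (intro conjI ballI)
  show "smod (quot M W)" by (rule smod_quot)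
  interpret Q: module S_ring "quot M W" by (rule smod_quot)
  show "\<exists>!c. decomposition p q (quot M W) m c" if "m \<in> carrier (quot M W)" for m
    using quot_E[OF that] decomposition_quot_iff by metis
  fix d assume d: "d \<in> carrier L"
  have pc: "a \<in> piece M d \<Longrightarrow> a \<in> carrier M" for a using piece_carrier[OF gmM d] .
  show "subgroup (piece (quot M W) d) (add_monoid (quot M W))"
  proof (rule Q.add.subgroupI)
    show "piece (quot M W) d \<subseteq> carrier (quot M W)" using pc by (auto simp: quot_simps)
    show "piece (quot M W) d \<noteq> {}" using piece_zero[OF gmM d] by (auto simp: quot_simps)
    fix x assume "x \<in> piece (quot M W) d"
    then obtain a where a: "a \<in> piece M d" "x = rep M W a" by (auto simp: quot_simps)
    have "\<ominus>\<^bsub>quot M W\<^esub> x = rep M W (\<zero>\<^bsub>M\<^esub> \<ominus>\<^bsub>M\<^esub> a)"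
      using a pc smod_quot by (simp add: smod_uminus rep_smult rep_in smod_minus)
    then show "\<ominus>\<^bsub>quot M W\<^esub> x \<in> piece (quot M W) d"
      using piece_minus[OF gmM d piece_zero[OF gmM d] a(1)] by (simp add: quot_simps)
    fix y assume "y \<in> piece (quot M W) d"
    then obtain b where b: "b \<in> piece M d" "y = rep M W b" by (auto simp: quot_simps)
    have "x \<oplus>\<^bsub>quot M W\<^esub> y = rep M W (a \<oplus>\<^bsub>M\<^esub> b)" using a b pc by (simp add: rep_add)
    then show "x \<oplus>\<^bsub>quot M W\<^esub> y \<in> piece (quot M W) d"
      using piece_add[OF gmM d a(1) b(1)] by (simp add: quot_simps)
  qed
  fix e x and s :: "'k poly poly"
  assume e: "e \<in> carrier L" "s \<in> S_piece p q e" "x \<in> piece (quot M W) d"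
  then obtain a where a: "a \<in> piece M d" "x = rep M W a" by (auto simp: quot_simps)
  have "s \<odot>\<^bsub>quot M W\<^esub> x = rep M W (s \<odot>\<^bsub>M\<^esub> a)" using a pc by (simp add: rep_smult)
  then show "s \<odot>\<^bsub>quot M W\<^esub> x \<in> piece (quot M W) (e \<otimes>\<^bsub>L\<^esub> d)"
    using piece_smult[OF gmM e(2,1) d a(1)] by (simp add: quot_simps)
qed

lemma finitely_generated_quot:
  assumes "finitely_generated M" shows "finitely_generated (quot M W)"
proof -
  obtain G where G: "finite G" "G \<subseteq> carrier M" "\<And>N. submodule N S_ring M \<Longrightarrow> G \<subseteq> N \<Longrightarrow> carrier M \<subseteq> N"
    using finitely_generated_E[OF assms] by blast
  show ?thesis
    unfolding finitely_generated_def
  proof (intro exI[of _ "rep M W ` G"] conjI allI impI)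
    show "rep M W ` G \<subseteq> carrier (quot M W)" using G rep_in by auto
    fix N assume N: "submodule N S_ring (quot M W) \<and> rep M W ` G \<subseteq> N"
    note Ns = smod_submoduleD[OF smod_quot, of N]
    have "submodule {m \<in> carrier M. rep M W m \<in> N} S_ring M"
      unfolding smod_submodule_iff[OF M_smod] using N Ns
      by (auto simp: rep_zero rep_add[symmetric] rep_smult[symmetric])
    from G(3)[OF this] have "carrier M \<subseteq> {m \<in> carrier M. rep M W m \<in> N}" using G(2) N by blast
    then show "N = carrier (quot M W)" using Ns N by (auto simp: quot_simps(1))
  qed (use G in auto)
qed

end

lemma graded_submoduleD:
  assumes "graded_submodule p q M W"
  shows "submodule W S_ring M" "w \<in> W \<Longrightarrow> d \<in> carrier L \<Longrightarrow> comp M w d \<in> W"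
  using assms by (auto simp: graded_submodule_def)

lemma obj_quot:
  assumes "obj M" "graded_submodule p q M W"
  shows "obj (quot M W)"
  using gm_quot[OF obj_gm[OF assms(1)] graded_submoduleD[OF assms(2)]]
    finitely_generated_quot[OF obj_gm[OF assms(1)] graded_submoduleD[OF assms(2)]] assms(1)
  by (simp add: obj_def)

lemma rep_quot_zero_iff:
  assumes "obj M" "graded_submodule p q M W" "m \<in> carrier M"
  shows "rep M W m = \<zero>\<^bsub>quot M W\<^esub> \<longleftrightarrow> m \<in> W"
  by (rule rep_zero_iff[OF obj_gm[OF assms(1)] graded_submoduleD[OF assms(2)] assms(3)])

definition proj :: "('k::alg_closed_field poly poly, 'm) graded_module \<Rightarrow> 'm set \<Rightarrow> ('m \<times> 'm) set" where
  "proj M W = (\<lambda>m. (m, rep M W m)) ` carrier M"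

lemma proj_hom:
  assumes "obj M" and gs: "graded_submodule p q M W"
  shows "hom M (quot M W) (proj M W)" "Range (proj M W) = carrier (quot M W)"
    "Ker (quot M W) (proj M W) = W"
proof -
  have g: "gm M" "smod M" using assms by auto
  have W: "submodule W S_ring M" and gr: "\<And>w d. w \<in> W \<Longrightarrow> d \<in> carrier L \<Longrightarrow> comp M w d \<in> W"
    using graded_submoduleD[OF gs] by auto
  note q = rep_in[OF g(1) W gr] rep_zero[OF g(1) W gr] rep_add[OF g(1) W gr]
    rep_smult[OF g(1) W gr] comp_quot[OF g(1) W gr]
  show "hom M (quot M W) (proj M W)"
  proof (rule homI, rule grelI)
    show "(\<zero>\<^bsub>M\<^esub>, \<zero>\<^bsub>quot M W\<^esub>) \<in> proj M W"
      using g q(2) by (auto simp: proj_def image_iff intro!: bexI[of _ "\<zero>\<^bsub>M\<^esub>"])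
    show "n \<in> tors (quot M W)" if "(\<zero>\<^bsub>M\<^esub>, n) \<in> proj M W" for n
      using that zero_tors[OF smod_quot[OF g(1) W gr]] q(2) by (auto simp: proj_def)
  qed (use g q comp_carrier[OF g(1)] in \<open>auto simp: proj_def image_iff Domain_iff\<close>)
  show "Range (proj M W) = carrier (quot M W)"
    by (auto simp: proj_def quot_simps[OF g(1) W gr])
  show "Ker (quot M W) (proj M W) = W"
  proof (rule Set.set_eqI)
    fix m
    have "m \<in> Ker (quot M W) (proj M W) \<longleftrightarrow> m \<in> carrier M \<and> rep M W m = \<zero>\<^bsub>quot M W\<^esub>"
      by (auto simp: Ker_def proj_def)
    also have "\<dots> \<longleftrightarrow> m \<in> W"
      using rep_zero_iff[OF g(1) W gr, of m] smod_submoduleD(1)[OF g(2) W, of m] by auto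
    finally show "m \<in> Ker (quot M W) (proj M W) \<longleftrightarrow> m \<in> W" .
  qed
qed

end

section \<open>Monomorphisms, epimorphisms and cokernels\<close>

lemma smult_sum:
  assumes "smod M" "finite A" "m \<in> carrier M"
  shows "sum f A \<odot>\<^bsub>M\<^esub> m = finsum M (\<lambda>a. f a \<odot>\<^bsub>M\<^esub> m) A"
proof -
  interpret module S_ring M by (rule assms(1))
  show ?thesis using assms(2)
  proof (induction A rule: finite_induct)
    case (insert x F)
    then show ?case using assms by (simp add: smod_smult Pi_def)
  qed (use assms in simp)
qed

context weights
begin

text \<open>The homomorphism out of a line bundle that sends \<open>1\<close> to \<open>m\<close>.
  As a set of pairs it is the same for every twist of the source.\<close>

definition mulm :: "('k::alg_closed_field poly poly, 'k poly poly) graded_module \<Rightarrow> 'k poly poly \<Rightarrow>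
    ('k poly poly \<times> 'k poly poly) set" where
  "mulm M m = range (\<lambda>s. (s, s \<odot>\<^bsub>M\<^esub> m))"

lemma mulm_iff [simp]: "(s, n) \<in> mulm M m \<longleftrightarrow> n = s \<odot>\<^bsub>M\<^esub> m"
  by (auto simp: mulm_def)

text \<open>In \<open>lb a b\<close> the generator \<open>1\<close> has degree
  \<open>V (- a) (- b)\<close>, so it may be sent to any element of this degree.\<close>

lemma hom_mulm:
  assumes M: "obj M" and m: "m \<in> piece M (V (- a) (- b))"
  shows "hom (lb a b) M (mulm M m)"
proof -
  interpret LG: comm_group L by (rule comm_group_LL)
  have [simp]: "smod M" using M by simp
  have mc [simp]: "m \<in> carrier M" using piece_carrier[OF obj_gm[OF M] _ m] by simp
  have cmp: "comp M (s \<odot>\<^bsub>M\<^esub> m) d = comp (lb a b) s d \<odot>\<^bsub>M\<^esub> m" if d: "d \<in> carrier L" for s d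
  proof (rule comp_unique[OF obj_gm[OF M]])
    let ?S = "{d \<in> carrier L. comp (lb a b) s d \<noteq> 0}"
    show fin: "finite ?S" using comp_finite[OF obj_gm[OF obj_line], of s a b] by simp
    show "comp (lb a b) s d \<odot>\<^bsub>M\<^esub> m \<in> piece M d" if d: "d \<in> carrier L" for d
    proof -
      have "comp (lb a b) s d \<in> S_piece p q (V a b \<otimes>\<^bsub>L\<^esub> d)"
        using comp_piece[OF obj_gm[OF obj_line], of s a b d] d by simp
      then have "comp (lb a b) s d \<odot>\<^bsub>M\<^esub> m \<in> piece M (V a b \<otimes>\<^bsub>L\<^esub> d \<otimes>\<^bsub>L\<^esub> V (- a) (- b))"
        using piece_smult[OF obj_gm[OF M] _ _ _ m] d by simp
      moreover have "V a b \<otimes>\<^bsub>L\<^esub> d \<otimes>\<^bsub>L\<^esub> V (- a) (- b) = d"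
      proof -
        obtain x y where "d = V x y" using d by (rule LL_E)
        then show ?thesis by simp
      qed
      ultimately show ?thesis by simp
    qed
    have "s = sum (comp (lb a b) s) ?S"
      using comp_sum[OF obj_gm[OF obj_line], of s a b]
      by (simp only: line_bundle_simps UNIV_I finsum_line[OF fin, of p q a b])
    then have "s \<odot>\<^bsub>M\<^esub> m = sum (comp (lb a b) s) ?S \<odot>\<^bsub>M\<^esub> m" by simp
    also have "\<dots> = finsum M (\<lambda>d. comp (lb a b) s d \<odot>\<^bsub>M\<^esub> m) ?S" by (rule smult_sum) (use fin in auto)
    finally show "s \<odot>\<^bsub>M\<^esub> m = finsum M (\<lambda>d. comp (lb a b) s d \<odot>\<^bsub>M\<^esub> m) ?S" .
  qed (use d in auto)
  show ?thesis
    by (rule homI, rule grelI) (auto simp: smod_smult cmp Domain_iff)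
qed

lemma mono_tors:
  assumes "smod M" "smod N" "grel M N R" "Ker N R \<subseteq> tors M" "(m, n) \<in> R" "n \<in> tors N"
  shows "m \<in> tors M"
  using grel_tors[OF assms(2,1) grel_converse[OF assms(3)], of n m] assms(4-6)
  by (simp add: Ker_converse)

lemma mono_teq:
  assumes "smod M" "smod N" "grel M N R" "Ker N R \<subseteq> tors M" "(m, n) \<in> R" "(m', n') \<in> R" "teq N n n'"
  shows "teq M m m'"
  using mono_tors[OF assms(1-4) grel_minus[OF assms(1-3,5,6)]] grelD(1)[OF assms(3)] assms(5-7)
  by (auto simp: cg_def)

lemma sat_Ker_tors:
  assumes "smod M" "smod N" "hom M N R" "(m, n) \<in> R" "m \<in> sat M (Ker N R)"
  shows "n \<in> tors N"
proof -
  note R = grelD[OF hom_grel[OF assms(3)]]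
  have "\<forall>\<^sub>F s in irr. s \<odot>\<^bsub>M\<^esub> m \<in> Ker N R" using assms(5) by (simp add: sat_def)
  then have "\<forall>\<^sub>F s in irr. s \<odot>\<^bsub>N\<^esub> n \<in> tors N"
  proof (rule eventually_mono)
    fix s assume "s \<odot>\<^bsub>M\<^esub> m \<in> Ker N R"
    then have "(s \<odot>\<^bsub>M\<^esub> m, \<zero>\<^bsub>N\<^esub>) \<in> R" by (simp add: Ker_def)
    then have "teq N (s \<odot>\<^bsub>N\<^esub> n) \<zero>\<^bsub>N\<^esub>"
      by (rule hom_teq[OF assms(1-3) R(5)[OF assms(4)]])
        (rule teq_refl[OF assms(1) smod_closed(3)[OF assms(1) R(1)[OF assms(4)]]])
    then show "s \<odot>\<^bsub>N\<^esub> n \<in> tors N" using teq_zero_iff[OF assms(2)] by blast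
  qed
  then show ?thesis by (rule tors_eventually[OF assms(2) R(2)[OF assms(4)]])
qed

lemma tors_sat_Ker:
  assumes "smod M" "smod N" "grel M N R" "(m, n) \<in> R" "n \<in> tors N"
  shows "m \<in> sat M (Ker N R)"
proof -
  have "\<forall>\<^sub>F s in irr. s \<odot>\<^bsub>N\<^esub> n = \<zero>\<^bsub>N\<^esub>" using assms(5) by (simp add: sat_def)
  then have "\<forall>\<^sub>F s in irr. s \<odot>\<^bsub>M\<^esub> m \<in> Ker N R"
    by (rule eventually_mono) (use grelD(5)[OF assms(3,4)] in \<open>metis Ker_def mem_Collect_eq\<close>)
  then show ?thesis using grelD(1)[OF assms(3,4)] by (simp add: sat_def)
qed

lemma sat_Ker_iff:
  assumes "smod M" "smod N" "hom M N R" "(m, n) \<in> R"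
  shows "m \<in> sat M (Ker N R) \<longleftrightarrow> n \<in> tors N"
  using sat_Ker_tors[OF assms] tors_sat_Ker[OF assms(1,2) hom_grel[OF assms(3)] assms(4)] by blast

text \<open>The map induced on the target of a surjection is the relation
  \<open>G\<inverse> O H\<close>: go back along \<open>G\<close> by any preimage and apply
  \<open>H\<close>. Two preimages differ by the kernel of \<open>G\<close>, which \<open>H\<close>
  sends to torsion.\<close>

lemma hom_descend:
  assumes "obj B" "obj T" "obj X" "hom B T G" "hom B X H" "sat T (Range G) = carrier T"
    "Ker T G \<subseteq> sat B (Ker X H)"
  shows "hom T X (G\<inverse> O H)" "arr B X (G O (G\<inverse> O H)) = arr B X H"
proof -
  note [simp] = assms(1-3)
  note G = grelD[OF hom_grel[OF assms(4)]] and H = grelD[OF hom_grel[OF assms(5)]]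
  have key: "\<xi> \<in> tors X" if "(b, \<xi>) \<in> H" "b \<in> Ker T G" for b \<xi>
    by (rule sat_Ker_tors[OF _ _ assms(5) that(1)]) (use that assms(7) in auto)
  show h: "hom T X (G\<inverse> O H)"
  proof (rule homI)
    show "grel T X (G\<inverse> O H)"
      by (rule grel_comp[OF grel_converse[OF hom_grel[OF assms(4)]] hom_grel[OF assms(5)]])
    show "\<forall>\<^sub>F s in irr. s \<odot>\<^bsub>T\<^esub> t \<in> Domain (G\<inverse> O H)" if t: "t \<in> carrier T" for t
    proof -
      have "\<forall>\<^sub>F s in irr. s \<odot>\<^bsub>T\<^esub> t \<in> Range G" using t assms(6) by (auto simp: sat_def)
      then have "\<forall>\<^sub>F s in irr. \<forall>\<^sub>F u in irr. (u * s) \<odot>\<^bsub>T\<^esub> t \<in> Domain (G\<inverse> O H)"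
      proof (rule eventually_mono)
        fix s assume "s \<odot>\<^bsub>T\<^esub> t \<in> Range G"
        then obtain b where b: "(b, s \<odot>\<^bsub>T\<^esub> t) \<in> G" by blast
        show "\<forall>\<^sub>F u in irr. (u * s) \<odot>\<^bsub>T\<^esub> t \<in> Domain (G\<inverse> O H)"
        proof (rule eventually_mono[OF hom_dom[OF assms(5) G(1)[OF b]]])
          fix u assume "\<exists>\<xi>. (u \<odot>\<^bsub>B\<^esub> b, \<xi>) \<in> H"
          moreover have "(u \<odot>\<^bsub>B\<^esub> b, (u * s) \<odot>\<^bsub>T\<^esub> t) \<in> G" using G(5)[OF b, of u] t by (simp add: smod_smult)
          ultimately show "(u * s) \<odot>\<^bsub>T\<^esub> t \<in> Domain (G\<inverse> O H)" by blast
        qed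
      qed
      then show ?thesis by (rule eventually_irr_mult)
    qed
    show "\<xi> \<in> tors X" if "(\<zero>\<^bsub>T\<^esub>, \<xi>) \<in> G\<inverse> O H" for \<xi>
      using that key by (auto simp: Ker_def)
  qed
  show "arr B X (G O (G\<inverse> O H)) = arr B X H"
    unfolding arr_eq_iff[OF assms(1,3) hom_comp[OF assms(1-3,4) h] assms(5)]
  proof (rule eqvI)
    fix b \<xi> \<xi>' assume "(b, \<xi>) \<in> G O (G\<inverse> O H)" and \<xi>': "(b, \<xi>') \<in> H"
    then obtain t b' where t: "(b, t) \<in> G" "(b', t) \<in> G" "(b', \<xi>) \<in> H" by blast
    have "(b \<ominus>\<^bsub>B\<^esub> b', t \<ominus>\<^bsub>T\<^esub> t) \<in> G" by (rule grel_minus[OF _ _ hom_grel[OF assms(4)] t(1,2)]) simp_all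
    then have "b' \<ominus>\<^bsub>B\<^esub> b \<in> Ker T G"
      using grel_minus[OF _ _ hom_grel[OF assms(4)] t(2,1)] G(2)[OF t(1)] by (simp add: Ker_def)
    moreover have "(b' \<ominus>\<^bsub>B\<^esub> b, \<xi> \<ominus>\<^bsub>X\<^esub> \<xi>') \<in> H"
      by (rule grel_minus[OF _ _ hom_grel[OF assms(5)] t(3) \<xi>']) simp_all
    ultimately show "teq X \<xi> \<xi>'" using key H(2)[OF t(3)] H(2)[OF \<xi>'] by (auto simp: cg_def)
  qed
qed

text \<open>Dual to \<open>hom_descend\<close>: a map whose range lies in that of an injective
  \<open>B\<close>, up to saturation, is lifted by going back along \<open>B\<close>.\<close>

lemma hom_lift:
  assumes "obj X" "obj K" "obj E" "hom X E A" "hom K E B" "Ker E B \<subseteq> tors K" "Range A \<subseteq> sat E (Range B)"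
  shows "hom X K (A O B\<inverse>)" "arr X E ((A O B\<inverse>) O B) = arr X E A"
proof -
  note [simp] = assms(1-3)
  note A = grelD[OF hom_grel[OF assms(4)]] and B = grelD[OF hom_grel[OF assms(5)]]
  show h: "hom X K (A O B\<inverse>)"
  proof (rule homI)
    show "grel X K (A O B\<inverse>)"
      by (rule grel_comp[OF hom_grel[OF assms(4)] grel_converse[OF hom_grel[OF assms(5)]]])
    show "\<forall>\<^sub>F s in irr. s \<odot>\<^bsub>X\<^esub> x \<in> Domain (A O B\<inverse>)" if x: "x \<in> carrier X" for x
    proof (rule eventually_irr_mult, rule eventually_mono[OF hom_dom[OF assms(4) x]])
      fix s assume "\<exists>e. (s \<odot>\<^bsub>X\<^esub> x, e) \<in> A"
      then obtain e where e: "(s \<odot>\<^bsub>X\<^esub> x, e) \<in> A" by blast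
      then have "\<forall>\<^sub>F u in irr. u \<odot>\<^bsub>E\<^esub> e \<in> Range B" using assms(7) by (auto simp: sat_def)
      then show "\<forall>\<^sub>F u in irr. (u * s) \<odot>\<^bsub>X\<^esub> x \<in> Domain (A O B\<inverse>)"
      proof (rule eventually_mono)
        fix u assume "u \<odot>\<^bsub>E\<^esub> e \<in> Range B"
        moreover have "((u * s) \<odot>\<^bsub>X\<^esub> x, u \<odot>\<^bsub>E\<^esub> e) \<in> A" using A(5)[OF e, of u] x by (simp add: smod_smult)
        ultimately show "(u * s) \<odot>\<^bsub>X\<^esub> x \<in> Domain (A O B\<inverse>)" by blast
      qed
    qed
    show "k \<in> tors K" if "(\<zero>\<^bsub>X\<^esub>, k) \<in> A O B\<inverse>" for k
    proof -
      obtain e where e: "(\<zero>\<^bsub>X\<^esub>, e) \<in> A" "(k, e) \<in> B" using \<open>(\<zero>\<^bsub>X\<^esub>, k) \<in> A O B\<inverse>\<close> by blast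
      then have "e \<in> tors E" using assms(4) by (auto simp: hom_def Ind_def)
      then show ?thesis using mono_tors[OF _ _ hom_grel[OF assms(5)] assms(6) e(2)] by simp
    qed
  qed
  show "arr X E ((A O B\<inverse>) O B) = arr X E A"
    unfolding arr_eq_iff[OF assms(1,3) hom_comp[OF assms(1-3) h assms(5)] assms(4)]
  proof (rule eqvI)
    fix x e e' assume "(x, e) \<in> (A O B\<inverse>) O B" and e': "(x, e') \<in> A"
    then obtain e1 k where *: "(x, e1) \<in> A" "(k, e1) \<in> B" "(k, e) \<in> B" by blast
    have "teq E e e1" by (rule hom_teq[OF _ _ assms(5) *(3,2)]) (use B(1)[OF *(2)] in auto)
    moreover have "teq E e1 e'" by (rule hom_teq[OF _ _ assms(4) *(1) e']) (use A(1)[OF e'] in auto)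
    ultimately show "teq E e e'" by (rule teq_trans[OF obj_smod[OF assms(3)]])
  qed
qed

lemma Comp_Id:
  assumes "obj A" "obj B" "hom A B R"
  shows "Comp C (arr A B R) (Ident C A) = arr A B R" "Comp C (Ident C B) (arr A B R) = arr A B R"
proof -
  have "Id_on (carrier A) O R = R" "R O Id_on (carrier B) = R"
    using grelD(1,2)[OF hom_grel[OF assms(3)]] by auto
  then show "Comp C (arr A B R) (Ident C A) = arr A B R" "Comp C (Ident C B) (arr A B R) = arr A B R"
    using assms Comp_arr[OF assms(1,1,2) hom_Id[OF assms(1)] assms(3)]
      Comp_arr[OF assms(1,2,2) assms(3) hom_Id[OF assms(2)]] by (simp_all add: Ident_coh)
qed

lemma zero_object_iff:
  "zero_object C Z \<longleftrightarrow> obj (Z :: 'k::alg_closed_field sheaf) \<and> carrier Z \<subseteq> tors Z"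
proof
  assume z: "zero_object C Z"
  then have Z: "obj Z" and u: "\<exists>!f. f \<in> Arr C Z Z" by (auto simp: zero_object_def Obj_coh)
  have "arr Z Z (Id_on (carrier Z)) = arr Z Z (carrier Z \<times> {\<zero>\<^bsub>Z\<^esub>})"
    using u arr_in[OF Z Z hom_Id[OF Z]] arr_in[OF Z Z hom_zero[OF Z Z]] by blast
  then have "eqv Z (Id_on (carrier Z)) (carrier Z \<times> {\<zero>\<^bsub>Z\<^esub>})"
    using arr_eq_iff[OF Z Z hom_Id[OF Z] hom_zero[OF Z Z]] by simp
  then have "teq Z z \<zero>\<^bsub>Z\<^esub>" if "z \<in> carrier Z" for z by (rule eqvD) (use that in auto)
  then show "obj Z \<and> carrier Z \<subseteq> tors Z" using Z teq_zero_iff[of Z] by auto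
next
  assume "obj Z \<and> carrier Z \<subseteq> tors Z"
  then have Z: "obj Z" and t: "carrier Z \<subseteq> tors Z" by auto
  note [simp] = Z
  show "zero_object C Z"
    unfolding zero_object_def Obj_coh
  proof (intro conjI ballI)
    fix X :: "'k sheaf" assume "X \<in> Obj C"
    then have X: "obj X" by (simp add: Obj_coh)
    note [simp] = X
    show "\<exists>!f. f \<in> Arr C X Z"
    proof (rule ex1I[of _ "arr X Z (carrier X \<times> {\<zero>\<^bsub>Z\<^esub>})"])
      show "arr X Z (carrier X \<times> {\<zero>\<^bsub>Z\<^esub>}) \<in> Arr C X Z" by (simp add: arr_in hom_zero)
      fix f assume "f \<in> Arr C X Z"
      then obtain R where R: "hom X Z R" "f = arr X Z R" by (auto simp: Arr_iff)
      show "f = arr X Z (carrier X \<times> {\<zero>\<^bsub>Z\<^esub>})"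
        unfolding R(2) arr_eq_iff[OF X Z R(1) hom_zero[OF X Z]]
      proof (rule eqvI)
        fix m n n' assume "(m, n) \<in> R" "(m, n') \<in> carrier X \<times> {\<zero>\<^bsub>Z\<^esub>}"
        then show "teq Z n n'" using grelD(2)[OF hom_grel[OF R(1)]] t by (intro tors_teq) auto
      qed
    qed
    show "\<exists>!f. f \<in> Arr C Z X"
    proof (rule ex1I[of _ "arr Z X (carrier Z \<times> {\<zero>\<^bsub>X\<^esub>})"])
      show "arr Z X (carrier Z \<times> {\<zero>\<^bsub>X\<^esub>}) \<in> Arr C Z X" by (simp add: arr_in hom_zero)
      fix f assume "f \<in> Arr C Z X"
      then obtain R where R: "hom Z X R" "f = arr Z X R" by (auto simp: Arr_iff)
      show "f = arr Z X (carrier Z \<times> {\<zero>\<^bsub>X\<^esub>})"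
        unfolding R(2) arr_eq_iff[OF Z X R(1) hom_zero[OF Z X]]
      proof (rule eqvI)
        fix m n n' assume mn: "(m, n) \<in> R" "(m, n') \<in> carrier Z \<times> {\<zero>\<^bsub>X\<^esub>}"
        have "n \<in> tors X" by (rule hom_tors[OF _ _ R(1) mn(1)]) (use mn t in auto)
        then show "teq X n n'" using mn by (intro tors_teq) auto
      qed
    qed
  qed (rule Z)
qed

lemma zero_object_exists: "\<exists>Z :: 'k::alg_closed_field sheaf. zero_object C Z"
proof -
  let ?M = "lb 0 0 :: 'k sheaf" and ?Z = "quot (lb 0 0 :: 'k sheaf) UNIV"
  have s: "graded_submodule p q ?M UNIV" using carrier_submodule[of ?M] by (simp add: graded_submodule_def)
  have Z: "obj ?Z" by (rule obj_quot[OF obj_line s])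
  have "carrier ?Z \<subseteq> {\<zero>\<^bsub>?Z\<^esub>}"
  proof
    fix x assume "x \<in> carrier ?Z"
    then obtain m where "x = rep ?M UNIV m" by (auto simp: quot_def)
    then show "x \<in> {\<zero>\<^bsub>?Z\<^esub>}" using rep_quot_zero_iff[OF obj_line s, of m] by simp
  qed
  then have "carrier ?Z \<subseteq> tors ?Z" using zero_tors[OF obj_smod[OF Z]] by auto
  then show ?thesis using Z zero_object_iff by blast
qed

lemma zero_arrow_iff:
  fixes A B :: "'k::alg_closed_field sheaf"
  assumes A: "obj A" and B: "obj B" and R: "hom A B R"
  shows "zero_arrow C A B (arr A B R) \<longleftrightarrow> Range R \<subseteq> tors B"
proof
  note [simp] = A B
  assume "zero_arrow C A B (arr A B R)"
  then obtain Z u v where Z: "obj Z" "carrier Z \<subseteq> tors Z" and uv: "u \<in> Arr C A Z" "v \<in> Arr C Z B"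
    "arr A B R = Comp C v u" unfolding zero_arrow_def zero_object_iff by blast
  obtain U W where U: "hom A Z U" "u = arr A Z U" and W: "hom Z B W" "v = arr Z B W"
    using uv(1,2) Z(1) by (auto simp: Arr_iff)
  have e: "eqv B R (U O W)"
    using uv(3) arr_eq_iff[OF A B R hom_comp[OF A Z(1) B U(1) W(1)]] Comp_arr[OF A Z(1) B U(1) W(1)]
    by (simp add: U(2) W(2))
  show "Range R \<subseteq> tors B"
  proof
    fix b assume "b \<in> Range R"
    then obtain a where ab: "(a, b) \<in> R" by blast
    note Rd = grelD[OF hom_grel[OF R]]
    have "\<forall>\<^sub>F s in irr. s \<odot>\<^bsub>B\<^esub> b \<in> tors B"
    proof (rule eventually_mono[OF hom_dom[OF hom_comp[OF A Z(1) B U(1) W(1)] Rd(1)[OF ab]]])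
      fix s assume "\<exists>n. (s \<odot>\<^bsub>A\<^esub> a, n) \<in> U O W"
      then obtain n z where n: "(s \<odot>\<^bsub>A\<^esub> a, n) \<in> U O W" "(z, n) \<in> W" by blast
      have "n \<in> tors B" by (rule hom_tors[OF _ _ W(1) n(2)]) (use Z grelD(1)[OF hom_grel[OF W(1)] n(2)] in auto)
      moreover have "teq B (s \<odot>\<^bsub>B\<^esub> b) n" by (rule eqvD[OF e Rd(5)[OF ab] n(1)])
      ultimately show "s \<odot>\<^bsub>B\<^esub> b \<in> tors B" using teq_tors[of B] by simp
    qed
    then show "b \<in> tors B" by (rule tors_eventually[OF obj_smod[OF B] Rd(2)[OF ab]])
  qed
next
  note [simp] = A B
  assume t: "Range R \<subseteq> tors B"
  obtain Z :: "'k sheaf" where Zz: "zero_object C Z" using zero_object_exists by blast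
  then have Z: "obj Z" by (simp add: zero_object_iff)
  let ?U = "carrier A \<times> {\<zero>\<^bsub>Z\<^esub>}" and ?W = "carrier Z \<times> {\<zero>\<^bsub>B\<^esub>}"
  have U: "hom A Z ?U" and W: "hom Z B ?W" using hom_zero[OF A Z] hom_zero[OF Z B] by auto
  have "arr A B R = arr A B (?U O ?W)"
    unfolding arr_eq_iff[OF A B R hom_comp[OF A Z B U W]]
  proof (rule eqvI)
    fix m n n' assume "(m, n) \<in> R" "(m, n') \<in> ?U O ?W"
    then show "teq B n n'" using t by (intro tors_teq) auto
  qed
  then have "arr A B R = Comp C (arr Z B ?W) (arr A Z ?U)" using Comp_arr[OF A Z B U W] by simp
  then show "zero_arrow C A B (arr A B R)"
    unfolding zero_arrow_def using Zz arr_in[OF A Z U] arr_in[OF Z B W] by blast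
qed

text \<open>Line bundles suffice as test objects: a homogeneous element of the kernel is the image
  of \<open>1\<close> under a map from a line bundle. Composed with the monomorphism this map
  becomes zero, so it was zero and the element is torsion.\<close>

lemma mono_iff:
  fixes A B :: "'k::alg_closed_field sheaf"
  assumes A: "obj A" and B: "obj B" and R: "hom A B R"
  shows "is_monomorphism C A B (arr A B R) \<longleftrightarrow> Ker B R \<subseteq> tors A"
proof
  note [simp] = A B and Rd = grelD[OF hom_grel[OF R]]
  assume mono: "is_monomorphism C A B (arr A B R)"
  show "Ker B R \<subseteq> tors A"
  proof
    fix \<kappa> assume "\<kappa> \<in> Ker B R"
    then have \<kappa>: "(\<kappa>, \<zero>\<^bsub>B\<^esub>) \<in> R" by (simp add: Ker_def)
    show "\<kappa> \<in> tors A"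
    proof (rule comps_in_submodule[OF obj_gm[OF A] tors_submodule[OF obj_smod[OF A]] Rd(1)[OF \<kappa>]])
      fix d assume d: "d \<in> carrier L"
      obtain x y where xy: "d = V x y" using d by (rule LL_E)
      let ?m = "comp A \<kappa> d" and ?X = "lb (- x) (- y) :: 'k sheaf"
      have m: "?m \<in> piece A (V (- (- x)) (- (- y)))"
        using comp_piece[OF obj_gm[OF A] Rd(1)[OF \<kappa>] d] xy by simp
      have mR: "(?m, \<zero>\<^bsub>B\<^esub>) \<in> R" using Rd(6)[OF \<kappa> d] d by simp
      have G: "hom ?X A (mulm A ?m)" by (rule hom_mulm[OF A m])
      have H: "hom ?X A (carrier ?X \<times> {\<zero>\<^bsub>A\<^esub>})" by (rule hom_zero[OF obj_line A])
      have "arr ?X B (mulm A ?m O R) = arr ?X B ((carrier ?X \<times> {\<zero>\<^bsub>A\<^esub>}) O R)"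
        unfolding arr_eq_iff[OF obj_line B hom_comp[OF obj_line A B G R] hom_comp[OF obj_line A B H R]]
      proof (rule eqvI)
        fix s l l' assume l: "(s, l) \<in> mulm A ?m O R" "(s, l') \<in> (carrier ?X \<times> {\<zero>\<^bsub>A\<^esub>}) O R"
        then have "(s \<odot>\<^bsub>A\<^esub> ?m, l) \<in> R" "(\<zero>\<^bsub>A\<^esub>, l') \<in> R" by auto
        moreover have "(s \<odot>\<^bsub>A\<^esub> ?m, \<zero>\<^bsub>B\<^esub>) \<in> R" using Rd(5)[OF mR, of s] by simp
        ultimately have "teq B l \<zero>\<^bsub>B\<^esub>" "teq B \<zero>\<^bsub>B\<^esub> l'"
          using hom_teq[OF _ _ R, of "s \<odot>\<^bsub>A\<^esub> ?m" l "s \<odot>\<^bsub>A\<^esub> ?m" "\<zero>\<^bsub>B\<^esub>"]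
            hom_teq[OF _ _ R, of "\<zero>\<^bsub>A\<^esub>" "\<zero>\<^bsub>B\<^esub>" "\<zero>\<^bsub>A\<^esub>" l'] Rd(1)[OF mR] Rd(3) by auto
        then show "teq B l l'" by (rule teq_trans[OF obj_smod[OF B]])
      qed
      then have "Comp C (arr A B R) (arr ?X A (mulm A ?m)) = Comp C (arr A B R) (arr ?X A (carrier ?X \<times> {\<zero>\<^bsub>A\<^esub>}))"
        by (simp only: Comp_arr[OF obj_line A B G R] Comp_arr[OF obj_line A B H R])
      then have "arr ?X A (mulm A ?m) = arr ?X A (carrier ?X \<times> {\<zero>\<^bsub>A\<^esub>})"
        using mono arr_in[OF obj_line A G] arr_in[OF obj_line A H]
        unfolding is_monomorphism_def by (metis Obj_coh obj_line)
      then have "eqv A (mulm A ?m) (carrier ?X \<times> {\<zero>\<^bsub>A\<^esub>})" using arr_eq_iff[OF obj_line A G H] by simp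
      from eqvD[OF this, of 1 ?m "\<zero>\<^bsub>A\<^esub>"] have "teq A ?m \<zero>\<^bsub>A\<^esub>"
        using Rd(1)[OF mR] by simp
      then show "?m \<in> tors A" using teq_zero_iff[of A] by simp
    qed
  qed
next
  note [simp] = A B and Rd = grelD[OF hom_grel[OF R]]
  assume K: "Ker B R \<subseteq> tors A"
  show "is_monomorphism C A B (arr A B R)"
    unfolding is_monomorphism_def
  proof (intro conjI ballI impI)
    show "arr A B R \<in> Arr C A B" by (rule arr_in[OF A B R])
    fix X g h assume "X \<in> Obj C" "g \<in> Arr C X A" "h \<in> Arr C X A" and eq: "Comp C (arr A B R) g = Comp C (arr A B R) h"
    then obtain G H where X: "obj X" and G: "hom X A G" "g = arr X A G" and H: "hom X A H" "h = arr X A H"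
      by (auto simp: Obj_coh Arr_iff)
    have e: "eqv B (G O R) (H O R)"
      using eq Comp_arr[OF X A B G(1) R] Comp_arr[OF X A B H(1) R] G(2) H(2)
        arr_eq_iff[OF X B hom_comp[OF X A B G(1) R] hom_comp[OF X A B H(1) R]] by simp
    have "eqv A G H"
    proof (rule eqvI)
      fix x a a' assume a: "(x, a) \<in> G" "(x, a') \<in> H"
      have ac: "a \<in> carrier A" "a' \<in> carrier A"
        using grelD(2)[OF hom_grel[OF G(1)] a(1)] grelD(2)[OF hom_grel[OF H(1)] a(2)] .
      have "\<forall>\<^sub>F s in irr. teq A (s \<odot>\<^bsub>A\<^esub> a) (s \<odot>\<^bsub>A\<^esub> a')"
      proof (rule eventually_mono[OF eventually_conj[OF hom_dom[OF R ac(1)] hom_dom[OF R ac(2)]]])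
        fix s assume "(\<exists>b. (s \<odot>\<^bsub>A\<^esub> a, b) \<in> R) \<and> (\<exists>b. (s \<odot>\<^bsub>A\<^esub> a', b) \<in> R)"
        then obtain b b' where b: "(s \<odot>\<^bsub>A\<^esub> a, b) \<in> R" "(s \<odot>\<^bsub>A\<^esub> a', b') \<in> R" by blast
        have "(s \<odot>\<^bsub>X\<^esub> x, b) \<in> G O R" "(s \<odot>\<^bsub>X\<^esub> x, b') \<in> H O R"
          using grelD(5)[OF hom_grel[OF G(1)] a(1), of s] grelD(5)[OF hom_grel[OF H(1)] a(2), of s] b by auto
        then have "teq B b b'" by (rule eqvD[OF e])
        then show "teq A (s \<odot>\<^bsub>A\<^esub> a) (s \<odot>\<^bsub>A\<^esub> a')"
          by (rule mono_teq[OF obj_smod[OF A] obj_smod[OF B] hom_grel[OF R] K b])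
      qed
      then show "teq A a a'" by (rule teq_eventually[OF obj_smod[OF A] ac])
    qed
    then show "g = h" using G(2) H(2) arr_eq_iff[OF X A G(1) H(1)] by simp
  qed
qed

lemma proj_tors_iff:
  assumes "obj M" "graded_submodule p q M W" "m \<in> carrier M"
  shows "rep M W m \<in> tors (quot M W) \<longleftrightarrow> m \<in> sat M W"
proof -
  have "(m, rep M W m) \<in> proj M W" using assms(3) by (auto simp: proj_def)
  from sat_Ker_iff[OF _ _ proj_hom(1)[OF assms(1,2)] this] show ?thesis
    using assms(1) obj_smod[OF obj_quot[OF assms(1,2)]] by (simp add: proj_hom(3)[OF assms(1,2)])
qed

lemma Range_graded:
  assumes "obj M" "obj N" "grel M N R" shows "graded_submodule p q N (Range R)"
  unfolding graded_submodule_def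
  using grel_Range[OF obj_smod[OF assms(1)] obj_smod[OF assms(2)] assms(3)] grelD(6)[OF assms(3)]
  by (auto simp: Range_iff)

text \<open>The test object for an epimorphism is \<open>quot B (Range R)\<close>: its projection
  and the zero map agree after \<open>R\<close>, hence are equal.\<close>

lemma epi_iff:
  fixes A B :: "'k::alg_closed_field sheaf"
  assumes A: "obj A" and B: "obj B" and R: "hom A B R"
  shows "is_epimorphism C A B (arr A B R) \<longleftrightarrow> sat B (Range R) = carrier B"
proof
  note [simp] = A B and Rd = grelD[OF hom_grel[OF R]]
  assume epi: "is_epimorphism C A B (arr A B R)"
  note W = Range_graded[OF A B hom_grel[OF R]]
  let ?Q = "quot B (Range R)"
  have Q: "obj ?Q" by (rule obj_quot[OF B W])
  note G = proj_hom(1)[OF B W] and H = hom_zero[OF B Q]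
  have "arr A ?Q (R O proj B (Range R)) = arr A ?Q (R O (carrier B \<times> {\<zero>\<^bsub>?Q\<^esub>}))"
    unfolding arr_eq_iff[OF A Q hom_comp[OF A B Q R G] hom_comp[OF A B Q R H]]
  proof (rule eqvI)
    fix a x x' assume "(a, x) \<in> R O proj B (Range R)" and x': "(a, x') \<in> R O (carrier B \<times> {\<zero>\<^bsub>?Q\<^esub>})"
    then obtain b where b: "(a, b) \<in> R" "x = rep B (Range R) b" by (auto simp: proj_def)
    then have "x = \<zero>\<^bsub>?Q\<^esub>" using rep_quot_zero_iff[OF B W Rd(2)[OF b(1)]] by auto
    moreover have "x' = \<zero>\<^bsub>?Q\<^esub>" using x' by auto
    ultimately show "teq ?Q x x'" using Q by simp
  qed
  then have "Comp C (arr B ?Q (proj B (Range R))) (arr A B R) =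
      Comp C (arr B ?Q (carrier B \<times> {\<zero>\<^bsub>?Q\<^esub>})) (arr A B R)"
    by (simp only: Comp_arr[OF A B Q R G] Comp_arr[OF A B Q R H])
  then have "arr B ?Q (proj B (Range R)) = arr B ?Q (carrier B \<times> {\<zero>\<^bsub>?Q\<^esub>})"
    using epi arr_in[OF B Q G] arr_in[OF B Q H] Q
    unfolding is_epimorphism_def by (metis Obj_coh)
  then have e: "eqv ?Q (proj B (Range R)) (carrier B \<times> {\<zero>\<^bsub>?Q\<^esub>})" using arr_eq_iff[OF B Q G H] by simp
  have "b \<in> sat B (Range R)" if b: "b \<in> carrier B" for b
  proof -
    have "teq ?Q (rep B (Range R) b) \<zero>\<^bsub>?Q\<^esub>" by (rule eqvD[OF e, of b]) (use b in \<open>auto simp: proj_def\<close>)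
    then have "rep B (Range R) b \<in> tors ?Q" using teq_zero_iff[OF obj_smod[OF Q]] by blast
    then show ?thesis using proj_tors_iff[OF B W b] by simp
  qed
  then show "sat B (Range R) = carrier B" by (auto simp: sat_def)
next
  note [simp] = A B and Rd = grelD[OF hom_grel[OF R]]
  assume S: "sat B (Range R) = carrier B"
  show "is_epimorphism C A B (arr A B R)"
    unfolding is_epimorphism_def
  proof (intro conjI ballI impI)
    show "arr A B R \<in> Arr C A B" by (rule arr_in[OF A B R])
    fix X g h assume "X \<in> Obj C" "g \<in> Arr C B X" "h \<in> Arr C B X" and eq: "Comp C g (arr A B R) = Comp C h (arr A B R)"
    then obtain G H where X: "obj X" and G: "hom B X G" "g = arr B X G" and H: "hom B X H" "h = arr B X H"
      by (auto simp: Obj_coh Arr_iff)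
    have e: "eqv X (R O G) (R O H)"
      using eq Comp_arr[OF A B X R G(1)] Comp_arr[OF A B X R H(1)] G(2) H(2)
        arr_eq_iff[OF A X hom_comp[OF A B X R G(1)] hom_comp[OF A B X R H(1)]] by simp
    have "eqv X G H"
    proof (rule eqvI)
      fix b x x' assume x: "(b, x) \<in> G" "(b, x') \<in> H"
      note Gd = grelD[OF hom_grel[OF G(1)] ] and Hd = grelD[OF hom_grel[OF H(1)]]
      have "\<forall>\<^sub>F s in irr. s \<odot>\<^bsub>B\<^esub> b \<in> Range R" using S Gd(1)[OF x(1)] by (auto simp: sat_def)
      then have "\<forall>\<^sub>F s in irr. teq X (s \<odot>\<^bsub>X\<^esub> x) (s \<odot>\<^bsub>X\<^esub> x')"
      proof (rule eventually_mono)
        fix s assume "s \<odot>\<^bsub>B\<^esub> b \<in> Range R"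
        then obtain a where "(a, s \<odot>\<^bsub>B\<^esub> b) \<in> R" by blast
        then have "(a, s \<odot>\<^bsub>X\<^esub> x) \<in> R O G" "(a, s \<odot>\<^bsub>X\<^esub> x') \<in> R O H"
          using Gd(5)[OF x(1), of s] Hd(5)[OF x(2), of s] by auto
        then show "teq X (s \<odot>\<^bsub>X\<^esub> x) (s \<odot>\<^bsub>X\<^esub> x')" by (rule eqvD[OF e])
      qed
      then show "teq X x x'" by (rule teq_eventually[OF obj_smod[OF X] Gd(2)[OF x(1)] Hd(2)[OF x(2)]])
    qed
    then show "g = h" using G(2) H(2) arr_eq_iff[OF B X G(1) H(1)] by simp
  qed
qed

lemma iso_if:
  fixes A B :: "'k::alg_closed_field sheaf"
  assumes A: "obj A" and B: "obj B" and R: "hom A B R" and K: "Ker B R \<subseteq> tors A"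
    and S: "sat B (Range R) = carrier B"
  shows "hom B A (R\<inverse>)" "arr A A (R O R\<inverse>) = Ident C A" "arr B B (R\<inverse> O R) = Ident C B"
    "is_isomorphism C A B (arr A B R)"
proof -
  note [simp] = A B and Rd = grelD[OF hom_grel[OF R]]
  show h: "hom B A (R\<inverse>)"
    unfolding hom_def using grel_converse[OF hom_grel[OF R]] K S by (simp add: Ker_converse)
  show 1: "arr A A (R O R\<inverse>) = Ident C A"
    unfolding Ident_coh arr_eq_iff[OF A A hom_comp[OF A B A R h] hom_Id[OF A]]
  proof (rule eqvI)
    fix a a' a'' assume "(a, a') \<in> R O R\<inverse>" "(a, a'') \<in> Id_on (carrier A)"
    then obtain b where b: "(a', b) \<in> R" "(a'', b) \<in> R" by auto
    show "teq A a' a''"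
      by (rule mono_teq[OF _ _ hom_grel[OF R] K b]) (use Rd(2)[OF b(1)] in auto)
  qed
  show 2: "arr B B (R\<inverse> O R) = Ident C B"
    unfolding Ident_coh arr_eq_iff[OF B B hom_comp[OF B A B h R] hom_Id[OF B]]
  proof (rule eqvI)
    fix a a' a'' assume "(a, a') \<in> R\<inverse> O R" "(a, a'') \<in> Id_on (carrier B)"
    then obtain b where b: "(b, a') \<in> R" "(b, a'') \<in> R" by auto
    show "teq B a' a''"
      by (rule hom_teq[OF _ _ R b]) (use Rd(1)[OF b(1)] in auto)
  qed
  show "is_isomorphism C A B (arr A B R)"
    unfolding is_isomorphism_def
    by (intro conjI bexI[OF _ arr_in[OF B A h]] arr_in[OF A B R])
      (simp_all only: Comp_arr[OF A B A R h] Comp_arr[OF B A B h R] 1 2)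
qed

lemma Comp_assoc:
  assumes "obj A" "obj B" "obj D" "obj E" "f \<in> Arr C A B" "g \<in> Arr C B D" "h \<in> Arr C D E"
  shows "Comp C h (Comp C g f) = Comp C (Comp C h g) f" "Comp C g f \<in> Arr C A D"
proof -
  obtain F G H where FGH: "hom A B F" "f = arr A B F" "hom B D G" "g = arr B D G" "hom D E H" "h = arr D E H"
    using assms by (auto simp: Arr_iff)
  have gf: "hom A D (F O G)" and hg: "hom B E (G O H)"
    using hom_comp[OF assms(1,2,3) FGH(1,3)] hom_comp[OF assms(2,3,4) FGH(3,5)] .
  show "Comp C h (Comp C g f) = Comp C (Comp C h g) f" "Comp C g f \<in> Arr C A D"
    unfolding FGH(2,4,6) Comp_arr[OF assms(1,2,3) FGH(1,3)] Comp_arr[OF assms(2,3,4) FGH(3,5)]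
      Comp_arr[OF assms(1,3,4) gf FGH(5)] Comp_arr[OF assms(1,2,4) FGH(1) hg]
    using arr_in[OF assms(1,3) gf] by (simp_all add: O_assoc)
qed

lemma iso_epi:
  fixes A B :: "'k::alg_closed_field sheaf"
  assumes A: "obj A" and B: "obj B" and f: "is_isomorphism C A B f"
  shows "is_epimorphism C A B f"
proof -
  obtain g where g: "g \<in> Arr C B A" "Comp C f g = Ident C B" and fA: "f \<in> Arr C A B"
    using f unfolding is_isomorphism_def by blast
  show ?thesis
    unfolding is_epimorphism_def
  proof (intro conjI ballI impI)
    fix X u v assume "X \<in> Obj C" and uv: "u \<in> Arr C B X" "v \<in> Arr C B X" "Comp C u f = Comp C v f"
    then have X: "obj X" by (simp add: Obj_coh)
    have "Comp C w (Comp C f g) = w" if "w \<in> Arr C B X" for w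
      using that B X Comp_Id(1)[OF B X] by (auto simp: g(2) Arr_iff)
    then have "u = Comp C (Comp C u f) g" "v = Comp C (Comp C v f) g"
      using Comp_assoc(1)[OF B A B X g(1) fA uv(1)] Comp_assoc(1)[OF B A B X g(1) fA uv(2)] uv(1,2) by auto
    then show "u = v" using uv(3) by simp
  qed (rule fA)
qed

text \<open>From left to right, the universal property is applied to the projection onto
  \<open>quot B (Range F)\<close>, which bounds the kernel of \<open>G\<close> by the saturated
  range of \<open>F\<close>. From right to left, \<open>hom_descend\<close> supplies the induced
  map.\<close>

lemma cokernel_iff:
  fixes A B T :: "'k::alg_closed_field sheaf"
  assumes A: "obj A" and B: "obj B" and T: "obj T" and F: "hom A B F" and G: "hom B T G"
  shows "is_cokernel C A B (arr A B F) T (arr B T G) \<longleftrightarrow>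
    sat T (Range G) = carrier T \<and> sat B (Ker T G) = sat B (Range F)" (is "?L \<longleftrightarrow> ?R")
proof
  note [simp] = A B T and Fd = grelD[OF hom_grel[OF F]] and Gd = grelD[OF hom_grel[OF G]]
  have W: "submodule (Range F) S_ring B" by (rule grel_Range[OF _ _ hom_grel[OF F]]) simp_all
  have KG: "submodule (Ker T G) S_ring B" by (rule grel_Ker[OF _ _ hom_grel[OF G]]) simp_all
  note Wg = Range_graded[OF A B hom_grel[OF F]]
  have FG: "hom A T (F O G)" by (rule hom_comp[OF A B T F G])
  {
    assume L: ?L
    have zz: "Range (F O G) \<subseteq> tors T"
      using L zero_arrow_iff[OF A T FG] Comp_arr[OF A B T F G] by (simp add: is_cokernel_def)
    have univ: "\<exists>!u. u \<in> Arr C T X \<and> Comp C u (arr B T G) = x"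
      if "obj X" "x \<in> Arr C B X" "zero_arrow C A X (Comp C x (arr A B F))" for X x
      using L that by (auto simp: is_cokernel_def Obj_coh)
    \<comment> \<open>Uniqueness in the universal property makes a cokernel map an epimorphism;
      \<open>epi_iff\<close> translates this into surjectivity up to torsion.\<close>
    have "is_epimorphism C B T (arr B T G)"
      unfolding is_epimorphism_def
    proof (intro conjI ballI impI)
      show "arr B T G \<in> Arr C B T" by (rule arr_in[OF B T G])
      fix X g h assume "X \<in> Obj C" and g: "g \<in> Arr C T X" and h: "h \<in> Arr C T X"
        and eq: "Comp C g (arr B T G) = Comp C h (arr B T G)"
      then have X: "obj X" by (simp add: Obj_coh)
      obtain G' where G': "hom T X G'" "g = arr T X G'" using g X by (auto simp: Arr_iff)
      have GG': "hom B X (G O G')" by (rule hom_comp[OF B T X G G'(1)])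
      have "Range (F O (G O G')) \<subseteq> tors X"
      proof
        fix x assume "x \<in> Range (F O (G O G'))"
        then obtain t where "t \<in> Range (F O G)" "(t, x) \<in> G'" by blast
        then show "x \<in> tors X" using zz X by (intro hom_tors[OF _ _ G'(1)]) auto
      qed
      then have "zero_arrow C A X (Comp C (Comp C g (arr B T G)) (arr A B F))"
        unfolding G'(2) Comp_arr[OF B T X G G'(1)] Comp_arr[OF A B X F GG']
          zero_arrow_iff[OF A X hom_comp[OF A B X F GG']] .
      moreover have "Comp C g (arr B T G) \<in> Arr C B X"
        unfolding G'(2) Comp_arr[OF B T X G G'(1)] by (rule arr_in[OF B X GG'])
      ultimately show "g = h" using univ[OF X] g h eq by metis
    qed
    then have S: "sat T (Range G) = carrier T" using epi_iff[OF B T G] by simp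
    have "Range F \<subseteq> sat B (Ker T G)"
    proof
      fix b assume "b \<in> Range F"
      then obtain a where ab: "(a, b) \<in> F" by blast
      show "b \<in> sat B (Ker T G)"
      proof (rule sat_eventually[OF _ Fd(2)[OF ab]])
        show "\<forall>\<^sub>F s in irr. s \<odot>\<^bsub>B\<^esub> b \<in> sat B (Ker T G)"
        proof (rule eventually_mono[OF hom_dom[OF G Fd(2)[OF ab]]])
          fix s assume "\<exists>t. (s \<odot>\<^bsub>B\<^esub> b, t) \<in> G"
          then obtain t where t: "(s \<odot>\<^bsub>B\<^esub> b, t) \<in> G" by blast
          then have "t \<in> tors T" using zz Fd(5)[OF ab, of s] by blast
          then show "s \<odot>\<^bsub>B\<^esub> b \<in> sat B (Ker T G)" using tors_sat_Ker[OF _ _ hom_grel[OF G] t] by simp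
        qed
      qed simp
    qed
    then have 1: "sat B (Range F) \<subseteq> sat B (Ker T G)"
      using sat_mono[of "Range F" "sat B (Ker T G)" B] sat_sat[OF _ KG] by simp
    let ?Q = "quot B (Range F)"
    have Q: "obj ?Q" by (rule obj_quot[OF B Wg])
    note P = proj_hom(1)[OF B Wg]
    have "Range (F O proj B (Range F)) \<subseteq> tors ?Q"
    proof
      fix x assume "x \<in> Range (F O proj B (Range F))"
      then obtain a b where "(a, b) \<in> F" "x = rep B (Range F) b" by (auto simp: proj_def)
      then have "x = \<zero>\<^bsub>?Q\<^esub>" using rep_quot_zero_iff[OF B Wg Fd(2)] by auto
      then show "x \<in> tors ?Q" using Q by simp
    qed
    then have "zero_arrow C A ?Q (Comp C (arr B ?Q (proj B (Range F))) (arr A B F))"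
      unfolding Comp_arr[OF A B Q F P] zero_arrow_iff[OF A Q hom_comp[OF A B Q F P]] .
    then obtain u where "u \<in> Arr C T ?Q" "Comp C u (arr B T G) = arr B ?Q (proj B (Range F))"
      using univ[OF Q arr_in[OF B Q P]] by blast
    then obtain U where U: "hom T ?Q U" "Comp C (arr T ?Q U) (arr B T G) = arr B ?Q (proj B (Range F))"
      using T Q by (auto simp: Arr_iff)
    then have e: "eqv ?Q (G O U) (proj B (Range F))"
      using Comp_arr[OF B T Q G U(1)] arr_eq_iff[OF B Q hom_comp[OF B T Q G U(1)] P] by simp
    have "Ker T G \<subseteq> sat B (Range F)"
    proof
      fix b assume "b \<in> Ker T G"
      then have b: "(b, \<zero>\<^bsub>T\<^esub>) \<in> G" by (simp add: Ker_def)
      have "(b, \<zero>\<^bsub>?Q\<^esub>) \<in> G O U" using b grelD(3)[OF hom_grel[OF U(1)]] by blast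
      moreover have "(b, rep B (Range F) b) \<in> proj B (Range F)" using Gd(1)[OF b] by (auto simp: proj_def)
      ultimately have "teq ?Q \<zero>\<^bsub>?Q\<^esub> (rep B (Range F) b)" by (rule eqvD[OF e])
      then have "rep B (Range F) b \<in> tors ?Q" using teq_tors[OF obj_smod[OF Q]] zero_tors[OF obj_smod[OF Q]] by blast
      then show "b \<in> sat B (Range F)" using proj_tors_iff[OF B Wg Gd(1)[OF b]] by simp
    qed
    then have "sat B (Ker T G) \<subseteq> sat B (Range F)"
      using sat_mono[of "Ker T G" "sat B (Range F)" B] sat_sat[OF _ W] by simp
    then show ?R using S 1 by blast
  }
  assume R: ?R
  then have S: "sat T (Range G) = carrier T" and K: "sat B (Ker T G) = sat B (Range F)" by auto
  show ?L
    unfolding is_cokernel_def Obj_coh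
  proof (intro conjI ballI impI)
    show "arr A B F \<in> Arr C A B" "obj T" "arr B T G \<in> Arr C B T"
      by (simp_all add: arr_in F G)
    have "Range (F O G) \<subseteq> tors T"
    proof
      fix t assume "t \<in> Range (F O G)"
      then obtain b where b: "b \<in> Range F" "(b, t) \<in> G" by blast
      then have "b \<in> sat B (Ker T G)" using K sat_incl[OF _ W] by auto
      then show "t \<in> tors T" by (rule sat_Ker_tors[OF _ _ G b(2), rotated 2]) simp_all
    qed
    then show "zero_arrow C A T (Comp C (arr B T G) (arr A B F))"
      unfolding Comp_arr[OF A B T F G] zero_arrow_iff[OF A T FG] .
    fix X x assume "X \<in> Obj C" "x \<in> Arr C B X" and z: "zero_arrow C A X (Comp C x (arr A B F))"
    then obtain H where X: "obj X" and H: "hom B X H" "x = arr B X H" by (auto simp: Obj_coh Arr_iff)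
    have FH: "Range (F O H) \<subseteq> tors X"
      using z unfolding H(2) Comp_arr[OF A B X F H(1)] zero_arrow_iff[OF A X hom_comp[OF A B X F H(1)]] .
    have KH: "submodule (Ker X H) S_ring B" by (rule grel_Ker[OF _ _ hom_grel[OF H(1)]]) (use X in simp_all)
    have "Range F \<subseteq> sat B (Ker X H)"
    proof
      fix b assume "b \<in> Range F"
      then obtain a where ab: "(a, b) \<in> F" by blast
      show "b \<in> sat B (Ker X H)"
      proof (rule sat_eventually[OF _ Fd(2)[OF ab]])
        show "\<forall>\<^sub>F s in irr. s \<odot>\<^bsub>B\<^esub> b \<in> sat B (Ker X H)"
        proof (rule eventually_mono[OF hom_dom[OF H(1) Fd(2)[OF ab]]])
          fix s assume "\<exists>t. (s \<odot>\<^bsub>B\<^esub> b, t) \<in> H"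
          then obtain t where t: "(s \<odot>\<^bsub>B\<^esub> b, t) \<in> H" by blast
          then have "t \<in> tors X" using FH Fd(5)[OF ab, of s] by blast
          then show "s \<odot>\<^bsub>B\<^esub> b \<in> sat B (Ker X H)" using tors_sat_Ker[OF _ _ hom_grel[OF H(1)] t] X by simp
        qed
      qed simp
    qed
    then have "sat B (Range F) \<subseteq> sat B (Ker X H)"
      using sat_mono[of "Range F" "sat B (Ker X H)" B] sat_sat[OF _ KH] by simp
    then have KK: "Ker T G \<subseteq> sat B (Ker X H)" using K sat_incl[OF _ KG] by auto
    note U = hom_descend[OF B T X G H(1) S KK]
    show "\<exists>!u. u \<in> Arr C T X \<and> Comp C u (arr B T G) = x"
    proof (rule ex1I[of _ "arr T X (G\<inverse> O H)"])
      show u: "arr T X (G\<inverse> O H) \<in> Arr C T X \<and> Comp C (arr T X (G\<inverse> O H)) (arr B T G) = x"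
        using arr_in[OF T X U(1)] Comp_arr[OF B T X G U(1)] U(2) H(2) by simp
      fix v assume v: "v \<in> Arr C T X \<and> Comp C v (arr B T G) = x"
      have "is_epimorphism C B T (arr B T G)" using epi_iff[OF B T G] S by simp
      then show "v = arr T X (G\<inverse> O H)" using u v X unfolding is_epimorphism_def by (metis Obj_coh)
    qed
  qed
qed

text \<open>The order of subobjects becomes inclusion of ranges up to saturation. This turns
  uniseriality into a statement about submodules.\<close>

lemma factors_through_iff:
  fixes X K E :: "'k::alg_closed_field sheaf"
  assumes X: "obj X" and K: "obj K" and E: "obj E" and A: "hom X E A" and B: "hom K E B"
    and mono: "Ker E B \<subseteq> tors K"
  shows "factors_through C X (arr X E A) K (arr K E B) \<longleftrightarrow> Range A \<subseteq> sat E (Range B)"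
proof
  note [simp] = X K E and Ad = grelD[OF hom_grel[OF A]]
  have W: "submodule (Range B) S_ring E" by (rule grel_Range[OF _ _ hom_grel[OF B]]) simp_all
  assume "factors_through C X (arr X E A) K (arr K E B)"
  then obtain u where u: "u \<in> Arr C X K" "arr X E A = Comp C (arr K E B) u"
    unfolding factors_through_def by blast
  then obtain U where U: "hom X K U" "u = arr X K U" by (auto simp: Arr_iff)
  have e: "eqv E A (U O B)"
    using u(2) Comp_arr[OF X K E U(1) B] arr_eq_iff[OF X E A hom_comp[OF X K E U(1) B]] U(2) by simp
  show "Range A \<subseteq> sat E (Range B)"
  proof
    fix e assume "e \<in> Range A"
    then obtain x where xe: "(x, e) \<in> A" by blast
    show "e \<in> sat E (Range B)"
    proof (rule sat_eventually[OF _ Ad(2)[OF xe]])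
      show "\<forall>\<^sub>F s in irr. s \<odot>\<^bsub>E\<^esub> e \<in> sat E (Range B)"
      proof (rule eventually_mono[OF hom_dom[OF hom_comp[OF X K E U(1) B] Ad(1)[OF xe]]])
        fix s assume "\<exists>y. (s \<odot>\<^bsub>X\<^esub> x, y) \<in> U O B"
        then obtain y where y: "(s \<odot>\<^bsub>X\<^esub> x, y) \<in> U O B" by blast
        have "teq E (s \<odot>\<^bsub>E\<^esub> e) y" by (rule eqvD[OF \<open>eqv E A (U O B)\<close> Ad(5)[OF xe] y])
        moreover have "y \<in> sat E (Range B)" using y sat_incl[OF _ W] by auto
        ultimately show "s \<odot>\<^bsub>E\<^esub> e \<in> sat E (Range B)"
          by (rule sat_cg[OF obj_smod[OF E] W teq_sym[OF obj_smod[OF E]]])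
      qed
    qed simp
  qed
next
  assume "Range A \<subseteq> sat E (Range B)"
  note U = hom_lift[OF X K E A B mono this]
  show "factors_through C X (arr X E A) K (arr K E B)"
    unfolding factors_through_def
    by (rule bexI[OF _ arr_in[OF X K U(1)]]) (simp only: Comp_arr[OF X K E U(1) B] U(2))
qed

end

section \<open>Homogeneous ideals up to saturation\<close>

lemma S_x1_power: "S_x1 ^ n = [:monom 1 n:]"
  by (induction n) (simp_all add: S_x1_def monom_Suc one_pCons monom_0)

lemma S_x2_power: "S_x2 ^ n = monom 1 n"
  by (simp add: S_x2_def monom_altdef)

lemma cf_x1: "cf (S_x1 ^ n * f) a b = (if a < n then 0 else cf f (a - n) b)"
  by (simp add: S_x1_power coeff_monom_mult)

lemma cf_x2: "cf (S_x2 ^ n * f) a b = (if b < n then 0 else cf f a (b - n))"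
  by (simp add: S_x2_power coeff_monom_mult)

text \<open>\<open>sw\<close> exchanges the roles of the two variables, so that both exceptional points are treated at
  once.\<close>

locale side = weights p q for p q :: nat +
  fixes sw :: bool
begin

definition X :: "'k::alg_closed_field poly poly" where "X = (if sw then S_x2 else S_x1)"
definition Y :: "'k::alg_closed_field poly poly" where "Y = (if sw then S_x1 else S_x2)"
definition co :: "'k::zero poly poly \<Rightarrow> nat \<Rightarrow> nat \<Rightarrow> 'k" where
  "co f a b = (if sw then cf f b a else cf f a b)"
definition Vs :: "int \<Rightarrow> int \<Rightarrow> (int \<times> int) set" where
  "Vs a b = (if sw then V b a else V a b)"
definition LB :: "int \<Rightarrow> int \<Rightarrow> 'k::alg_closed_field sheaf" where
  "LB i b = (if sw then lb b i else lb i b)"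
text \<open>The weights of the two variables: \<open>wX\<close> times the degree of \<open>X\<close>
  equals \<open>wY\<close> times the degree of \<open>Y\<close>, the defining relation of the
  grading group.\<close>

definition wX :: int where "wX = (if sw then int q else int p)"
definition wY :: int where "wY = (if sw then int p else int q)"

lemma co_eqI: assumes "\<And>a b. co f a b = co g a b" shows "f = g"
proof (rule cf_eqI)
  show "cf f a b = cf g a b" for a b
    using assms[of a b] assms[of b a] by (auto simp: co_def split: if_splits)
qed

lemma co_simps [simp]:
  "co (f + g) a b = co f a b + co g a b" "co (f - g) a b = co f a b - co g a b" "co 0 a b = 0"
  "co ([:[:c:]:] * f) a b = c * co f a b"
  "co (Polynomial.smult [:c:] f) a b = c * co f a b"
  by (simp_all add: co_def)

lemma co_X: "co (X ^ n * f) a b = (if a < n then 0 else co f (a - n) b)"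
  by (simp add: co_def X_def cf_x1 cf_x2)

lemma co_Y: "co (Y ^ n * f) a b = (if b < n then 0 else co f a (b - n))"
  by (simp add: co_def Y_def cf_x1 cf_x2)

lemma co_one: "co 1 a b = (if a = 0 \<and> b = 0 then 1 else 0)"
  by (auto simp: co_def one_pCons coeff_pCons split: nat.splits)

lemma co_Y_power: "co (Y ^ n) a b = (if a = 0 \<and> b = n then 1 else 0)"
  using co_Y[of n 1 a b] by (auto simp: co_one)

lemma X_dvd_iff: "X ^ n dvd f \<longleftrightarrow> (\<forall>a<n. \<forall>b. co f a b = 0)"
proof
  assume "X ^ n dvd f"
  then obtain g where "f = X ^ n * g" by (rule dvdE)
  then show "\<forall>a<n. \<forall>b. co f a b = 0" by (simp add: co_X)
next
  assume *: "\<forall>a<n. \<forall>b. co f a b = 0"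
  \<comment> \<open>Division by \<open>X ^ n\<close> shifts coefficients down: those of the outer
    polynomial if \<open>X\<close> is the outer variable, those of every inner one
    otherwise.\<close>
  define g where "g = (if sw then poly_shift n f else map_poly (poly_shift n) f)"
  have "co g a b = co f (a + n) b" for a b
    by (auto simp: g_def co_def coeff_poly_shift coeff_map_poly)
  then have "f = X ^ n * g" using * by (intro co_eqI) (auto simp: co_X)
  then show "X ^ n dvd f" by simp
qed

lemma X_not_dvd_Y [simp]: "\<not> X dvd Y ^ n"
  using X_dvd_iff[of 1 "Y ^ n"] by (auto simp: co_Y_power dest: spec[of _ n])

text \<open>\<open>Y\<close> is not a zero divisor modulo a power of \<open>X\<close>. This is the
  algebraic side of the freedom in the second twist.\<close>

lemma X_dvd_Y_mult [simp]: "X ^ l dvd Y ^ n * f \<longleftrightarrow> X ^ l dvd f"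
proof
  assume *: "X ^ l dvd Y ^ n * f"
  have "co f a b = 0" if "a < l" for a b
    using * that co_Y[of n f a "b + n"] by (auto simp: X_dvd_iff)
  then show "X ^ l dvd f" by (simp add: X_dvd_iff)
qed auto

lemma X_dvd_X_mult: "a \<le> l \<Longrightarrow> X ^ l dvd s * X ^ a \<longleftrightarrow> X ^ (l - a) dvd s"
proof -
  assume a: "a \<le> l"
  show ?thesis
  proof
    assume *: "X ^ l dvd s * X ^ a"
    have "co s i j = 0" if "i < l - a" for i j
      using * that co_X[of a s "i + a" j] by (auto simp: X_dvd_iff mult.commute)
    then show "X ^ (l - a) dvd s" by (simp add: X_dvd_iff)
  next
    assume "X ^ (l - a) dvd s"
    then have "X ^ (l - a) * X ^ a dvd s * X ^ a" by (rule mult_dvd_mono) simp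
    then show "X ^ l dvd s * X ^ a" using a by (simp flip: power_add)
  qed
qed

lemma Vs_in [simp]: "Vs a b \<in> carrier L"
  by (simp add: Vs_def)

lemma Vs_mult [simp]: "Vs a b \<otimes>\<^bsub>L\<^esub> Vs c d = Vs (a + c) (b + d)"
  by (simp add: Vs_def)

text \<open>The degree of \<open>Y\<close> has infinite order since the weights are positive. Hence
  a homogeneous polynomial contains at most one monomial for each exponent of
  \<open>X\<close>.\<close>

lemma Vs_inj: "Vs a b = Vs a b' \<Longrightarrow> b = b'"
  using p_pos q_pos by (auto simp: Vs_def Lvec_eq_iff split: if_splits)

lemma S_piece_iff: "f \<in> S_piece p q d \<longleftrightarrow> (\<forall>a b. co f a b \<noteq> 0 \<longrightarrow> Vs (int a) (int b) = d)"
proof (cases sw)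
  case True
  then show ?thesis unfolding S_piece_def co_def Vs_def by simp (rule all_comm)
next
  case False
  then show ?thesis unfolding S_piece_def co_def Vs_def by simp
qed

lemma S_piece_X: "X ^ n \<in> S_piece p q (Vs (int n) 0)" and S_piece_Y: "Y ^ n \<in> S_piece p q (Vs 0 (int n))"
  using S_piece_x1 S_piece_x2 by (auto simp: X_def Y_def Vs_def)

lemma S_piece_XY: "X ^ m * Y ^ n \<in> S_piece p q (Vs (int m) (int n))"
  using S_piece_mult[OF S_piece_X S_piece_Y] by simp

lemma LB_simps [simp]:
  "carrier (LB i b) = UNIV" "x \<oplus>\<^bsub>LB i b\<^esub> y = x + y" "\<zero>\<^bsub>LB i b\<^esub> = 0" "s \<odot>\<^bsub>LB i b\<^esub> x = s * x"
  "x \<ominus>\<^bsub>LB i b\<^esub> y = x - y"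
  "piece (LB i b) d = S_piece p q (Vs i b \<otimes>\<^bsub>L\<^esub> d)" "obj (LB i b)"
  by (simp_all add: LB_def Vs_def)

lemma co_comp_LB:
  "d \<in> carrier L \<Longrightarrow> co (comp (LB i b) f d) a c = (if Vs (int a) (int c) = Vs i b \<otimes>\<^bsub>L\<^esub> d then co f a c else 0)"
  by (simp add: LB_def Vs_def co_def comp_line)

lemma LB_periodic: "LB (i + k * wX) b = LB i (b + k * wY)"
proof -
  have "V (i + k * int p) b = V i (b + k * int q)" "V b (i + k * int q) = V (b + k * int p) i" for i b k
    by (auto simp: Lvec_eq_iff intro: exI[of _ "- k"] exI[of _ k])
  then show ?thesis by (simp add: LB_def wX_def wY_def line_bundle_def)
qed

lemma hom_mul:
  assumes "obj M" "m \<in> piece M (Vs (- i) (- b))" shows "hom (LB i b) M (mulm M m)"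
  using hom_mulm[OF assms(1), of m] assms(2) by (auto simp: LB_def Vs_def)

lemma eventually_XY: "eventually P irr \<longleftrightarrow> (\<exists>k0. \<forall>k\<ge>k0. P (X ^ k) \<and> P (Y ^ k))"
  by (auto simp: eventually_irr X_def Y_def)

lemma eventually_XY_ex: assumes "eventually P irr" obtains k where "P (X ^ k)" "P (Y ^ k)"
  using assms by (auto simp: eventually_XY)

lemma satI_XY:
  assumes "smod M" "submodule W S_ring M" "m \<in> carrier M" "X ^ i \<odot>\<^bsub>M\<^esub> m \<in> sat M W" "Y ^ j \<odot>\<^bsub>M\<^esub> m \<in> sat M W"
  shows "m \<in> sat M W"
proof -
  have "m \<in> sat M (sat M W)"
    using satI[OF assms(1) sat_submodule[OF assms(1,2)] assms(3)] assms(4,5)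
    by (simp add: X_def Y_def split: if_splits)
  then show ?thesis using sat_sat[OF assms(1,2)] by simp
qed

lemma graded_X_ideal: "graded_submodule p q (LB i b) {f. X ^ l dvd f}"
  unfolding graded_submodule_def
proof
  show "submodule {f. X ^ l dvd f} S_ring (LB i b)"
    by (auto simp: smod_submodule_iff[OF obj_smod[OF LB_simps(7)]])
  show "\<forall>n\<in>{f. X ^ l dvd f}. \<forall>d\<in>carrier L. comp (LB i b) n d \<in> {f. X ^ l dvd f}"
    by (auto simp: X_dvd_iff co_comp_LB)
qed

lemma sat_X_ideal: "sat (LB i b) {f. X ^ l dvd f} = {f. X ^ l dvd f}"
proof
  show "sat (LB i b) {f. X ^ l dvd f} \<subseteq> {f. X ^ l dvd f}"
    by (auto simp: sat_def eventually_XY)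
  show "{f. X ^ l dvd f} \<subseteq> sat (LB i b) {f. X ^ l dvd f}"
    by (rule sat_incl[OF _ graded_submoduleD(1)[OF graded_X_ideal]]) simp
qed

text \<open>Here \<open>e\<close> is the order of vanishing along \<open>X\<close>. By
  \<open>Vs_inj\<close> the terms of this order form a single monomial, so after division by
  \<open>X ^ e\<close> the rest is a power of \<open>Y\<close> modulo \<open>X\<close>, a unit at
  the exceptional point.\<close>

lemma homogeneous_form:
  fixes f :: "'k::alg_closed_field poly poly"
  assumes "f \<in> S_piece p q d" "f \<noteq> 0"
  obtains e n c h where "c \<noteq> 0" "f = X ^ e * ([:[:c:]:] * Y ^ n + X * h)"
proof -
  have "\<exists>a b. co f a b \<noteq> 0" using assms(2) co_eqI[of f 0] by auto
  then have ex: "\<exists>a. \<exists>b. co f a b \<noteq> 0" .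
  define e where "e = (LEAST a. \<exists>b. co f a b \<noteq> 0)"
  obtain n where n: "co f e n \<noteq> 0" using LeastI_ex[OF ex] by (auto simp: e_def)
  have "co f a b = 0" if "a < e" for a b using not_less_Least[of a "\<lambda>a. \<exists>b. co f a b \<noteq> 0"] that by (auto simp: e_def)
  then have "X ^ e dvd f" by (simp add: X_dvd_iff)
  then obtain g where g: "f = X ^ e * g" by (rule dvdE)
  have cg: "co g a b = co f (a + e) b" for a b by (simp add: g co_X)
  have "co g 0 b = 0" if "b \<noteq> n" for b
  proof (rule ccontr)
    assume "co g 0 b \<noteq> 0"
    then have "Vs (int e) (int b) = d" "Vs (int e) (int n) = d"
      using n assms(1) by (auto simp: cg S_piece_iff)
    then show False using Vs_inj[of "int e" "int b" "int n"] that by simp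
  qed
  then have "X ^ 1 dvd g - [:[:co g 0 n:]:] * Y ^ n"
    unfolding X_dvd_iff by (auto simp: co_Y_power)
  then obtain h where "g - [:[:co g 0 n:]:] * Y ^ n = X * h" by (auto elim: dvdE)
  then have "f = X ^ e * ([:[:co g 0 n:]:] * Y ^ n + X * h)" by (simp add: g algebra_simps)
  moreover have "co g 0 n \<noteq> 0" using n by (simp add: cg)
  ultimately show ?thesis using that by blast
qed

lemma comp_LB_piece: "d \<in> carrier L \<Longrightarrow> comp (LB i b) f d \<in> S_piece p q (Vs i b \<otimes>\<^bsub>L\<^esub> d)"
  using comp_piece[OF obj_gm[OF LB_simps(7)], of f i b d] by simp

lemma power_dvd_sum: "(a :: 'a::comm_ring_1) + b dvd a ^ n - (- b) ^ n"
  using power_diff_sumr2[of a n "- b"] by simp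

text \<open>At the exceptional point the homogeneous local ring has \<open>X\<close> as its only
  prime up to units, and an ideal containing a power of \<open>X\<close> is trivial elsewhere. So
  only one order of vanishing can be decisive.\<close>

lemma sat_ideal:
  fixes J :: "'k::alg_closed_field poly poly set"
  assumes gJ: "graded_submodule p q (LB i b) J" and l: "X ^ l \<in> sat (LB i b) J"
  obtains a where "a \<le> l" "sat (LB i b) J = {f. X ^ a dvd f}"
proof -
  have Js: "submodule J S_ring (LB i b)" by (rule graded_submoduleD(1)[OF gJ])
  note Jc = smod_submoduleD[OF obj_smod[OF LB_simps(7)] Js, simplified]
  note Sc = smod_submoduleD[OF obj_smod[OF LB_simps(7)] sat_submodule[OF obj_smod[OF LB_simps(7)] Js], simplified]
  have ev: "\<forall>\<^sub>F s in irr. s * X ^ l \<in> J" using l by (simp add: sat_def)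
  obtain k where k: "X ^ k * X ^ l \<in> J" "Y ^ k * X ^ l \<in> J" using eventually_XY_ex[OF ev] by blast
  \<comment> \<open>Multiplication by powers of \<open>Y\<close> should not matter, so
    \<open>a\<close> is the least exponent for which \<open>X ^ a\<close> lies in \<open>J\<close>
    after such a multiplication.\<close>
  let ?P = "\<lambda>a. \<exists>n. X ^ a * Y ^ n \<in> J"
  define a where "a = (LEAST a. ?P a)"
  have Pl: "?P l" using k(2) by (auto simp: mult.commute)
  have Pa: "?P a" and al: "a \<le> l" using LeastI[of ?P, OF Pl] Least_le[of ?P, OF Pl] by (auto simp: a_def)
  have min: "a \<le> e" if "X ^ e * Y ^ n \<in> J" for e n using Least_le[of ?P e] that by (auto simp: a_def)
  have Xa: "X ^ a \<in> sat (LB i b) J"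
  proof -
    obtain n where n: "X ^ a * Y ^ n \<in> J" using Pa by blast
    have "X ^ (k + (l - a)) * X ^ a = (X ^ k * X ^ l :: 'k poly poly)" using al by (simp flip: power_add)
    then have "X ^ (k + (l - a)) * X ^ a \<in> J" using k by simp
    moreover have "Y ^ n * X ^ a \<in> J" using n by (simp add: mult.commute)
    ultimately have "X ^ (k + (l - a)) \<odot>\<^bsub>LB i b\<^esub> X ^ a \<in> sat (LB i b) J" "Y ^ n \<odot>\<^bsub>LB i b\<^esub> X ^ a \<in> sat (LB i b) J"
      using sat_incl[OF obj_smod[OF LB_simps(7)] Js] by (simp_all add: subset_iff)
    then show ?thesis by (rule satI_XY[OF obj_smod[OF LB_simps(7)] Js, rotated]) simp
  qed
  have "sat (LB i b) J = {f. X ^ a dvd f}"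
  proof
    show "{f. X ^ a dvd f} \<subseteq> sat (LB i b) J"
    proof (intro subsetI, elim CollectE dvdE)
      fix f g :: "'k poly poly" assume "f = X ^ a * g"
      then show "f \<in> sat (LB i b) J" using Sc(4)[OF Xa, of g] by (simp add: mult.commute)
    qed
    show "sat (LB i b) J \<subseteq> {f. X ^ a dvd f}"
    proof (rule subsetI, rule CollectI, rule ccontr)
      fix f assume f: "f \<in> sat (LB i b) J" "\<not> X ^ a dvd f"
      then obtain a' b' where ab: "a' < a" "co f a' b' \<noteq> 0" by (auto simp: X_dvd_iff)
      \<comment> \<open>The degree of the offending monomial of \<open>f\<close>: its homogeneous
        component still contains that monomial, so it has order of vanishing below \<open>a\<close>
        and the normal form applies.\<close>
      define d where "d = Vs (int a' - i) (int b' - b)"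
      have d: "d \<in> carrier L" "Vs (int a') (int b') = Vs i b \<otimes>\<^bsub>L\<^esub> d" by (simp_all add: d_def)
      define g where "g = comp (LB i b) f d"
      have gS: "g \<in> sat (LB i b) J" unfolding g_def
        by (rule sat_graded[OF obj_gm[OF LB_simps(7)] Js _ f(1) d(1)]) (rule graded_submoduleD(2)[OF gJ])
      have cg: "co g a' b' \<noteq> 0" using ab d by (simp add: g_def co_comp_LB)
      then have "g \<noteq> 0" by auto
      have gp: "g \<in> S_piece p q (Vs i b \<otimes>\<^bsub>L\<^esub> d)" unfolding g_def by (rule comp_LB_piece[OF d(1)])
      obtain e n c h where g: "c \<noteq> 0" "g = X ^ e * ([:[:c:]:] * Y ^ n + X * h)"
        by (rule homogeneous_form[OF gp \<open>g \<noteq> 0\<close>])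
      have ea: "e < a" using cg ab(1) unfolding g(2) co_X by (auto split: if_splits)
      have evg: "\<forall>\<^sub>F s in irr. s * g \<in> J" using gS by (simp add: sat_def)
      obtain j where j: "Y ^ j * g \<in> J" using eventually_XY_ex[OF evg] by blast
      let ?A = "[:[:c:]:] * Y ^ n" and ?B = "X * h"
      \<comment> \<open>Inversion of the unit modulo \<open>X ^ l\<close>: since \<open>?B\<close>
        is divisible by \<open>X\<close>, the power \<open>?A ^ l\<close> is a multiple of
        \<open>?A + ?B\<close> up to a multiple of \<open>X ^ l\<close>. As \<open>J\<close>
        contains \<open>X ^ l\<close> up to a power of \<open>Y\<close>, it contains a monomial with
        exponent \<open>e\<close> at \<open>X\<close>, against the choice of
        \<open>a\<close>.\<close>
      obtain t where t: "?A ^ l - (- ?B) ^ l = (?A + ?B) * t" using power_dvd_sum[of ?A ?B l] by (auto elim: dvdE)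
      have cl: "[:[:c:]:] ^ l = [:[:c ^ l:]:]" by (induction l) (simp_all add: one_pCons)
      have "Y ^ (j + k) * X ^ e * ?A ^ l
          = (Y ^ k * t) * (Y ^ j * g) + (Y ^ j * X ^ e * (- h) ^ l) * (Y ^ k * X ^ l)"
      proof -
        have "?A ^ l = (?A + ?B) * t + (- ?B) ^ l" using t by (simp add: algebra_simps)
        moreover have "(- ?B) ^ l = X ^ l * (- h) ^ l" by (simp flip: power_mult_distrib)
        ultimately show ?thesis unfolding g(2) by (simp add: algebra_simps power_add)
      qed
      also have "\<dots> \<in> J" by (intro Jc(3) Jc(4) j k(2))
      finally have "[:[:inverse (c ^ l):]:] * (Y ^ (j + k) * X ^ e * ?A ^ l) \<in> J" by (rule Jc(4))
      moreover have "[:[:inverse (c ^ l):]:] * (Y ^ (j + k) * X ^ e * ?A ^ l) = X ^ e * Y ^ (j + k + n * l)"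
      proof -
        have "[:[:inverse (c ^ l):]:] * [:[:c ^ l:]:] = 1" using g(1) by (simp add: one_pCons)
        moreover have "?A ^ l = [:[:c ^ l:]:] * Y ^ (n * l)" by (simp only: power_mult_distrib cl power_mult)
        then have "[:[:inverse (c ^ l):]:] * (Y ^ (j + k) * X ^ e * ?A ^ l)
            = ([:[:inverse (c ^ l):]:] * [:[:c ^ l:]:]) * (X ^ e * Y ^ (j + k + n * l))"
          by (simp only: power_add ac_simps)
        ultimately show ?thesis by simp
      qed
      ultimately have "a \<le> e" using min by metis
      then show False using ea by simp
    qed
  qed
  then show ?thesis using that al by blast
qed

end

section \<open>Presentations of the tubes\<close>

context weights
begin

lemma grel_preimage:
  assumes A: "obj A" and E: "obj E" and R: "grel A E R" and N: "graded_submodule p q E N"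
  shows "graded_submodule p q A (R\<inverse> `` N)"
  unfolding graded_submodule_def smod_submodule_iff[OF obj_smod[OF A]]
proof (intro conjI ballI allI)
  note Rd = grelD[OF R] and Nd = smod_submoduleD[OF obj_smod[OF E] graded_submoduleD(1)[OF N]]
  show "R\<inverse> `` N \<subseteq> carrier A" using Rd(1) by auto
  show "\<zero>\<^bsub>A\<^esub> \<in> R\<inverse> `` N" using Rd(3) Nd(2) by auto
  fix a assume "a \<in> R\<inverse> `` N"
  then obtain e where e: "e \<in> N" "(a, e) \<in> R" by auto
  show "s \<odot>\<^bsub>A\<^esub> a \<in> R\<inverse> `` N" for s using Rd(5)[OF e(2), of s] Nd(4)[OF e(1), of s] by auto
  show "comp A a d \<in> R\<inverse> `` N" if "d \<in> carrier L" for d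
    using Rd(6)[OF e(2) that] graded_submoduleD(2)[OF N e(1) that] by auto
  fix b assume "b \<in> R\<inverse> `` N"
  then obtain e' where e': "e' \<in> N" "(b, e') \<in> R" by auto
  show "a \<oplus>\<^bsub>A\<^esub> b \<in> R\<inverse> `` N" using Rd(4)[OF e(2) e'(2)] Nd(3)[OF e(1) e'(1)] by auto
qed

text \<open>One value decides for the argument, because any other value of the same argument differs
  by torsion, which every saturation contains.\<close>

lemma mem_sat_preimage:
  assumes A: "obj A" and E: "obj E" and R: "hom A E R" and N: "graded_submodule p q E N" and fe: "(f, e) \<in> R"
  shows "f \<in> sat A (R\<inverse> `` N) \<longleftrightarrow> e \<in> sat E N"
proof
  note Rd = grelD[OF hom_grel[OF R]]
  have Ns: "submodule N S_ring E" by (rule graded_submoduleD(1)[OF N])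
  assume "f \<in> sat A (R\<inverse> `` N)"
  then have "\<forall>\<^sub>F s in irr. s \<odot>\<^bsub>A\<^esub> f \<in> R\<inverse> `` N" by (simp add: sat_def)
  then have "\<forall>\<^sub>F s in irr. s \<odot>\<^bsub>E\<^esub> e \<in> sat E N"
  proof (rule eventually_mono)
    fix s assume "s \<odot>\<^bsub>A\<^esub> f \<in> R\<inverse> `` N"
    then obtain n where n: "n \<in> N" "(s \<odot>\<^bsub>A\<^esub> f, n) \<in> R" by auto
    have "teq E n (s \<odot>\<^bsub>E\<^esub> e)"
      by (rule hom_teq[OF obj_smod[OF A] obj_smod[OF E] R n(2) Rd(5)[OF fe]])
        (rule teq_refl[OF obj_smod[OF A] Rd(1)[OF n(2)]])
    then show "s \<odot>\<^bsub>E\<^esub> e \<in> sat E N"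
      by (rule sat_cg[OF obj_smod[OF E] Ns]) (use sat_incl[OF obj_smod[OF E] Ns] n in auto)
  qed
  then show "e \<in> sat E N" by (rule sat_eventually[OF obj_smod[OF E] Rd(2)[OF fe]])
next
  note Rd = grelD[OF hom_grel[OF R]]
  assume "e \<in> sat E N"
  then have "\<forall>\<^sub>F s in irr. s \<odot>\<^bsub>E\<^esub> e \<in> N" by (simp add: sat_def)
  then have "\<forall>\<^sub>F s in irr. s \<odot>\<^bsub>A\<^esub> f \<in> R\<inverse> `` N"
    by (rule eventually_mono) (use Rd(5)[OF fe] in auto)
  then show "f \<in> sat A (R\<inverse> `` N)" using Rd(1)[OF fe] by (simp add: sat_def)
qed

lemma sat_preimage_mono:
  assumes A: "obj A" and E: "obj E" and R: "hom A E R" and N: "graded_submodule p q E N"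
    and N': "graded_submodule p q E N'" and sub: "N \<subseteq> sat E N'"
  shows "sat A (R\<inverse> `` N) \<subseteq> sat A (R\<inverse> `` N')"
proof
  fix f assume f: "f \<in> sat A (R\<inverse> `` N)"
  then have "\<forall>\<^sub>F s in irr. s \<odot>\<^bsub>A\<^esub> f \<in> R\<inverse> `` N" by (simp add: sat_def)
  then have "\<forall>\<^sub>F s in irr. s \<odot>\<^bsub>A\<^esub> f \<in> sat A (R\<inverse> `` N')"
  proof (rule eventually_mono)
    fix s assume "s \<odot>\<^bsub>A\<^esub> f \<in> R\<inverse> `` N"
    then obtain n where n: "n \<in> N" "(s \<odot>\<^bsub>A\<^esub> f, n) \<in> R" by auto
    then show "s \<odot>\<^bsub>A\<^esub> f \<in> sat A (R\<inverse> `` N')"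
      using mem_sat_preimage[OF A E R N' n(2)] sub by auto
  qed
  then show "f \<in> sat A (R\<inverse> `` N')" by (rule sat_eventually[OF obj_smod[OF A] sat_carrier[OF f]])
qed

text \<open>Together with \<open>sat_preimage_mono\<close> this reduces the comparison of submodules
  of \<open>E\<close> to that of their preimages, which will be ideals of \<open>S\<close>.\<close>

lemma submodule_le_of_preimage:
  assumes A: "obj A" and E: "obj E" and R: "hom A E R" and S: "sat E (Range R) = carrier E"
    and N: "graded_submodule p q E N" and N': "graded_submodule p q E N'"
    and sub: "sat A (R\<inverse> `` N) \<subseteq> sat A (R\<inverse> `` N')"
  shows "N \<subseteq> sat E N'"
proof
  note Rd = grelD[OF hom_grel[OF R]] and Nd = smod_submoduleD[OF obj_smod[OF E] graded_submoduleD(1)[OF N]]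
  fix n assume n: "n \<in> N"
  have nc: "n \<in> carrier E" using Nd(1)[OF n] .
  then have "\<forall>\<^sub>F s in irr. s \<odot>\<^bsub>E\<^esub> n \<in> Range R" using S by (auto simp: sat_def)
  then have "\<forall>\<^sub>F s in irr. s \<odot>\<^bsub>E\<^esub> n \<in> sat E N'"
  proof (rule eventually_mono)
    fix s assume "s \<odot>\<^bsub>E\<^esub> n \<in> Range R"
    then obtain f where f: "(f, s \<odot>\<^bsub>E\<^esub> n) \<in> R" by blast
    have "s \<odot>\<^bsub>E\<^esub> n \<in> sat E N"
      using sat_incl[OF obj_smod[OF E] graded_submoduleD(1)[OF N]] Nd(4)[OF n] by auto
    then have "f \<in> sat A (R\<inverse> `` N)" using mem_sat_preimage[OF A E R N f] by simp
    then show "s \<odot>\<^bsub>E\<^esub> n \<in> sat E N'" using sub mem_sat_preimage[OF A E R N' f] by auto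
  qed
  then show "n \<in> sat E N'" by (rule sat_eventually[OF obj_smod[OF E] nc])
qed

lemma Ker_graded:
  assumes "obj A" "obj E" "grel A E R" shows "graded_submodule p q A (Ker E R)"
proof -
  have "graded_submodule p q E {\<zero>\<^bsub>E\<^esub>}"
    using zero_submodule[OF obj_smod[OF assms(2)]] assms(2) by (auto simp: graded_submodule_def)
  from grel_preimage[OF assms this] show ?thesis by (simp add: Ker_def Image_def)
qed

lemma carrier_graded: "obj E \<Longrightarrow> graded_submodule p q E (carrier E)"
  by (auto simp: graded_submodule_def carrier_submodule comp_carrier)

lemma Ker_relcomp: "Ker T (R O G) = R\<inverse> `` Ker T G"
  by (auto simp: Ker_def)

lemma Range_relcomp_sat:
  assumes A: "obj A" and B: "obj B" and D: "obj D" and R: "hom A B R" and T: "hom B D T"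
    and SR: "sat B (Range R) = carrier B" and ST: "sat D (Range T) = carrier D"
  shows "sat D (Range (R O T)) = carrier D"
proof
  note Td = grelD[OF hom_grel[OF T]]
  show "sat D (Range (R O T)) \<subseteq> carrier D" by (auto simp: sat_def)
  show "carrier D \<subseteq> sat D (Range (R O T))"
  proof
    fix x assume x: "x \<in> carrier D"
    then have "\<forall>\<^sub>F s in irr. s \<odot>\<^bsub>D\<^esub> x \<in> Range T" using ST by (auto simp: sat_def)
    then have "\<forall>\<^sub>F s in irr. \<forall>\<^sub>F t in irr. (t * s) \<odot>\<^bsub>D\<^esub> x \<in> Range (R O T)"
    proof (rule eventually_mono)
      fix s assume "s \<odot>\<^bsub>D\<^esub> x \<in> Range T"
      then obtain b where b: "(b, s \<odot>\<^bsub>D\<^esub> x) \<in> T" by blast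
      then have "\<forall>\<^sub>F t in irr. t \<odot>\<^bsub>B\<^esub> b \<in> Range R" using SR Td(1)[OF b] by (auto simp: sat_def)
      then show "\<forall>\<^sub>F t in irr. (t * s) \<odot>\<^bsub>D\<^esub> x \<in> Range (R O T)"
      proof (rule eventually_mono)
        fix t assume "t \<odot>\<^bsub>B\<^esub> b \<in> Range R"
        moreover have "(t \<odot>\<^bsub>B\<^esub> b, (t * s) \<odot>\<^bsub>D\<^esub> x) \<in> T"
          using Td(5)[OF b, of t] x D by (simp add: smod_smult)
        ultimately show "(t * s) \<odot>\<^bsub>D\<^esub> x \<in> Range (R O T)" by blast
      qed
    qed
    then have "\<forall>\<^sub>F s in irr. s \<odot>\<^bsub>D\<^esub> x \<in> Range (R O T)" by (rule eventually_irr_mult)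
    then show "x \<in> sat D (Range (R O T))" using x by (simp add: sat_def)
  qed
qed

lemma sat_Ker_relcomp_mono:
  assumes A: "obj A" and B: "obj B" and D: "obj D" and R: "hom A B R" and T: "hom B D T"
    and K: "Ker D T \<subseteq> tors B"
  shows "sat A (Ker D (R O T)) = sat A (Ker B R)"
proof
  note Td = grelD[OF hom_grel[OF T]]
  have "Ker D (R O T) \<subseteq> sat A (Ker B R)"
  proof
    fix a assume "a \<in> Ker D (R O T)"
    then obtain b where b: "(a, b) \<in> R" "b \<in> Ker D T" by (auto simp: Ker_def)
    then show "a \<in> sat A (Ker B R)"
      using tors_sat_Ker[OF obj_smod[OF A] obj_smod[OF B] hom_grel[OF R] b(1)] K by auto
  qed
  then show "sat A (Ker D (R O T)) \<subseteq> sat A (Ker B R)"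
    using sat_mono[of "Ker D (R O T)" "sat A (Ker B R)" A]
      sat_sat[OF obj_smod[OF A] graded_submoduleD(1)[OF Ker_graded[OF A B hom_grel[OF R]]]] by simp
  have "Ker B R \<subseteq> Ker D (R O T)" using Td(3) by (auto simp: Ker_def)
  then show "sat A (Ker B R) \<subseteq> sat A (Ker D (R O T))" by (rule sat_mono)
qed

end

context side
begin

text \<open>A presentation of \<open>E\<close> as a line bundle modulo \<open>X ^ l\<close>. The
  kernel is prescribed up to saturation only, since the kernel of a representing relation is not an
  invariant of the morphism.\<close>

definition pres :: "int \<Rightarrow> int \<Rightarrow> nat \<Rightarrow> 'k::alg_closed_field sheaf \<Rightarrow> ('k poly poly \<times> 'k poly poly) set \<Rightarrow> bool" where
  "pres i b l E R \<longleftrightarrow> hom (LB i b) E R \<and> sat E (Range R) = carrier E \<and>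
     sat (LB i b) (Ker E R) = {f. X ^ l dvd f}"

lemma presD:
  assumes "pres i b l E R"
  shows "hom (LB i b) E R" "sat E (Range R) = carrier E" "sat (LB i b) (Ker E R) = {f. X ^ l dvd f}"
  using assms by (auto simp: pres_def)

lemma pres_periodic: "pres (i + k * wX) b l E R \<longleftrightarrow> pres i (b + k * wY) l E R"
  by (simp add: pres_def LB_periodic)

definition Std :: "int \<Rightarrow> int \<Rightarrow> nat \<Rightarrow> 'k::alg_closed_field sheaf" where
  "Std i b l = quot (LB i b) {f. X ^ l dvd f}"

lemma obj_Std [simp]: "obj (Std i b l)"
  unfolding Std_def by (rule obj_quot[OF LB_simps(7) graded_X_ideal])

lemma pres_Std: "\<exists>R. pres i b l (Std i b l :: 'k::alg_closed_field sheaf) R"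
proof -
  note P = proj_hom[OF LB_simps(7) graded_X_ideal, of i b l, folded Std_def]
  have "pres i b l (Std i b l :: 'k sheaf) (proj (LB i b) {f. X ^ l dvd f})"
    unfolding pres_def P(2,3) sat_X_ideal
    using P(1) sat_incl[OF obj_smod[OF obj_Std] carrier_submodule[OF obj_smod[OF obj_Std]], of i b l]
    by (auto simp: sat_def)
  then show ?thesis by blast
qed

lemma hom_XY:
  "hom (LB i b) (LB (i + int m) (b + int n)) (mulm (LB (i + int m) (b + int n)) (X ^ m * Y ^ n))"
  using S_piece_XY[of m n] by (intro hom_mul) simp_all

lemma sat_Ker_mul:
  "sat (LB i' b') (Ker E (mulm (LB i b) g O R)) = {s. s * g \<in> sat (LB i b) (Ker E R)}"
proof -
  have "Ker E (mulm (LB i b) g O R) = {s. s * g \<in> Ker E R}" by (auto simp: Ker_def)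
  then show ?thesis by (simp add: sat_def mult.assoc)
qed

text \<open>Multiplication by \<open>Y ^ n\<close> does not change divisibility by
  \<open>X ^ l\<close>, so the kernel is as required. It is surjective up to torsion because
  \<open>Y ^ n\<close> moves any value into the range while \<open>X ^ l\<close> makes it
  torsion.\<close>

lemma pres_down:
  assumes E: "obj E" and P: "pres i (b + int n) l E R"
  shows "pres i b l E (mulm (LB i (b + int n)) (Y ^ n) O R)"
proof -
  note R = presD[OF P] and Rd = grelD[OF hom_grel[OF presD(1)[OF P]]]
  note [simp] = E
  let ?M = "mulm (LB i (b + int n)) (Y ^ n) :: ('a poly poly \<times> 'a poly poly) set"
  have M: "hom (LB i b) (LB i (b + int n)) ?M" using hom_XY[of i b 0 n] by simp
  have h: "hom (LB i b) E (?M O R)" by (rule hom_comp[OF _ _ E M R(1)]) simp_all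
  have "sat (LB i b) (Ker E (?M O R)) = {f. X ^ l dvd f}"
    unfolding sat_Ker_mul R(3) by (auto simp: mult.commute[of _ "Y ^ n"])
  moreover have "sat E (Range (?M O R)) = carrier E"
  proof
    let ?W = "Range (?M O R)"
    have W: "submodule ?W S_ring E" by (rule grel_Range[OF _ _ hom_grel[OF h]]) simp_all
    show "sat E ?W \<subseteq> carrier E" by (auto simp: sat_def)
    have *: "e \<in> sat E ?W" if fe: "(f, e) \<in> R" for f e
    proof (rule satI_XY[OF obj_smod[OF E] W Rd(2)[OF fe]])
      have "(f, f * Y ^ n) \<in> ?M" "(f * Y ^ n, Y ^ n \<odot>\<^bsub>E\<^esub> e) \<in> R"
        using Rd(5)[OF fe, of "Y ^ n"] by (simp_all add: mult.commute)
      then have "Y ^ n \<odot>\<^bsub>E\<^esub> e \<in> ?W" by blast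
      then show "Y ^ n \<odot>\<^bsub>E\<^esub> e \<in> sat E ?W" using sat_incl[OF _ W] by auto
      have "X ^ l * f \<in> sat (LB i (b + int n)) (Ker E R)" by (simp add: R(3))
      moreover have "(X ^ l * f, X ^ l \<odot>\<^bsub>E\<^esub> e) \<in> R" using Rd(5)[OF fe, of "X ^ l"] by simp
      ultimately have "X ^ l \<odot>\<^bsub>E\<^esub> e \<in> tors E" by (intro sat_Ker_tors[OF _ _ R(1)]) simp_all
      moreover have "tors E \<subseteq> sat E ?W" using smod_submoduleD(2)[OF _ W] by (intro sat_mono) simp
      ultimately show "X ^ l \<odot>\<^bsub>E\<^esub> e \<in> sat E ?W" by blast
    qed
    show "carrier E \<subseteq> sat E ?W"
    proof
      fix e assume e: "e \<in> carrier E"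
      then have "\<forall>\<^sub>F s in irr. s \<odot>\<^bsub>E\<^esub> e \<in> Range R" using R(2) by (auto simp: sat_def)
      then have "\<forall>\<^sub>F s in irr. s \<odot>\<^bsub>E\<^esub> e \<in> sat E ?W" by (rule eventually_mono) (use * in auto)
      then show "e \<in> sat E ?W" by (rule sat_eventually[OF obj_smod[OF E] e])
    qed
  qed
  ultimately show ?thesis using h by (simp add: pres_def)
qed

lemma pres_comp:
  assumes M: "obj M" and E: "obj E" and P: "pres i b l M R" and U: "hom M E U" "Ker E U \<subseteq> tors M"
    "sat E (Range U) = carrier E"
  shows "pres i b l E (R O U)"
  unfolding pres_def
  using hom_comp[OF LB_simps(7) M E presD(1)[OF P] U(1)]
    Range_relcomp_sat[OF LB_simps(7) M E presD(1)[OF P] U(1) presD(2)[OF P] U(3)]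
    sat_Ker_relcomp_mono[OF LB_simps(7) M E presD(1)[OF P] U(1,2)] presD(3)[OF P] by simp

lemma pres_descend:
  assumes E: "obj E" and E': "obj E'" and R: "hom (LB i b) E R" "sat E (Range R) = carrier E"
    "sat (LB i b) (Ker E R) \<subseteq> {f. X ^ l dvd f}" and P': "pres i b l E' R'"
  shows "hom E E' (R\<inverse> O R')" "arr (LB i b) E' (R O (R\<inverse> O R')) = arr (LB i b) E' R'"
    "sat E' (Range (R\<inverse> O R')) = carrier E'"
proof -
  note R' = presD[OF P']
  have "Ker E R \<subseteq> sat (LB i b) (Ker E R)"
    by (rule sat_incl[OF _ graded_submoduleD(1)[OF Ker_graded[OF LB_simps(7) E hom_grel[OF R(1)]]]]) simp
  also have "\<dots> \<subseteq> sat (LB i b) (Ker E' R')" unfolding R'(3) by (rule R(3))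
  finally have K: "Ker E R \<subseteq> sat (LB i b) (Ker E' R')" .
  note U = hom_descend[OF LB_simps(7) E E' R(1) R'(1) R(2) K]
  show "hom E E' (R\<inverse> O R')" "arr (LB i b) E' (R O (R\<inverse> O R')) = arr (LB i b) E' R'" using U .
  have "is_epimorphism C (LB i b) E' (arr (LB i b) E' (R O (R\<inverse> O R')))"
    unfolding U(2) epi_iff[OF LB_simps(7) E' R'(1)] by (rule R'(2))
  then have s: "sat E' (Range (R O (R\<inverse> O R'))) = carrier E'"
    using epi_iff[OF LB_simps(7) E' hom_comp[OF LB_simps(7) E E' R(1) U(1)]] by simp
  have "sat E' (Range (R O (R\<inverse> O R'))) \<subseteq> sat E' (Range (R\<inverse> O R'))" by (rule sat_mono) blast
  then show "sat E' (Range (R\<inverse> O R')) = carrier E'" unfolding s by (auto simp: sat_def)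
qed

text \<open>The converse of the descended relation is the relation descended in the opposite
  direction. Being a morphism as well, it is single-valued up to torsion, which is
  injectivity.\<close>

lemma pres_iso:
  assumes E: "obj E" and E': "obj E'" and P: "pres i b l E R" and P': "pres i b l E' R'"
  shows "hom E E' (R\<inverse> O R')" "Ker E' (R\<inverse> O R') \<subseteq> tors E" "sat E' (Range (R\<inverse> O R')) = carrier E'"
proof -
  note U = pres_descend[OF E E' presD(1,2)[OF P] _ P'] and U' = pres_descend(1)[OF E' E presD(1,2)[OF P'] _ P]
  show "hom E E' (R\<inverse> O R')" "sat E' (Range (R\<inverse> O R')) = carrier E'" using U(1,3) presD(3)[OF P] by auto
  have "hom E' E ((R\<inverse> O R')\<inverse>)" using U' presD(3)[OF P'] by (simp add: converse_relcomp)
  then show "Ker E' (R\<inverse> O R') \<subseteq> tors E" by (simp add: hom_def Ker_converse)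
qed

text \<open>\<open>pres_down\<close> only lowers the twist. So \<open>E\<close> and the standard
  object with twist \<open>b'\<close> are both presented with a common lower twist, which makes them
  isomorphic, and the presentation of the latter is carried over.\<close>

lemma pres_any:
  assumes E: "obj E" and P: "pres i b l E R"
  shows "\<exists>R'. pres i b' l E R'"
proof -
  \<comment> \<open>The minimum of both twists is reached from either one by multiplication with a
    power of \<open>Y\<close>.\<close>
  define b0 where "b0 = min b b'"
  define n m where "n = nat (b - b0)" and "m = nat (b' - b0)"
  have nm: "b = b0 + int n" "b' = b0 + int m" by (simp_all add: n_def m_def b0_def)
  obtain Q where Q: "pres i b' l (Std i b' l :: 'a sheaf) Q" using pres_Std by blast
  have "pres i b0 l E (mulm (LB i b) (Y ^ n) O R)" using pres_down[OF E, of i b0 n l R] P nm by simp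
  note 1 = this
  have "pres i b0 l (Std i b' l) (mulm (LB i b') (Y ^ m) O Q)"
    using pres_down[OF obj_Std, of i b0 m l i b' l Q] Q nm by simp
  from pres_comp[OF obj_Std E Q pres_iso[OF obj_Std E this 1]] show ?thesis by (rule exI)
qed

definition tube :: "int \<Rightarrow> nat \<Rightarrow> 'k::alg_closed_field sheaf \<Rightarrow> bool" where
  "tube i l E \<longleftrightarrow> obj E \<and> (\<exists>b R. pres i b l E R)"

lemma tube_obj: "tube i l E \<Longrightarrow> obj E"
  by (simp add: tube_def)

lemma tubeE: assumes "tube i l E" obtains R where "pres i b l E R"
  using assms pres_any unfolding tube_def by blast

lemma tubeI: "obj E \<Longrightarrow> pres i b l E R \<Longrightarrow> tube i l E"
  by (auto simp: tube_def)

lemma tube_Std: "tube i l (Std i b l)"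
  using pres_Std tubeI obj_Std by blast

text \<open>By the relation in the grading group, a full period in the first twist is a change of
  the second, and the second is free.\<close>

lemma tube_periodic: "tube (i + k * wX) l E \<longleftrightarrow> tube i l E"
proof
  show "tube (i + k * wX) l E \<Longrightarrow> tube i l E" unfolding tube_def pres_periodic by blast
  assume t: "tube i l E"
  obtain R where "pres i (0 + k * wY) l E R" using t by (rule tubeE)
  then have "pres (i + k * wX) 0 l E R" unfolding pres_periodic .
  then show "tube (i + k * wX) l E" using tube_obj[OF t] tubeI by blast
qed

text \<open>The preimage of a graded submodule contains the kernel, hence \<open>X ^ l\<close> up to
  saturation, and \<open>sat_ideal\<close> classifies it. Subobjects of \<open>E\<close> thus form a
  chain indexed by \<open>a\<close>.\<close>

lemma pres_submodule:
  assumes E: "obj E" and P: "pres i b l E R" and N: "graded_submodule p q E N"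
  obtains a where "a \<le> l" "sat (LB i b) (R\<inverse> `` N) = {f. X ^ a dvd f}"
proof -
  note R = presD[OF P]
  have "Ker E R \<subseteq> R\<inverse> `` N"
    using smod_submoduleD(2)[OF obj_smod[OF E] graded_submoduleD(1)[OF N]] by (auto simp: Ker_def)
  then have "{f. X ^ l dvd f} \<subseteq> sat (LB i b) (R\<inverse> `` N)" unfolding R(3)[symmetric] by (rule sat_mono)
  then have "X ^ l \<in> sat (LB i b) (R\<inverse> `` N)" by auto
  with grel_preimage[OF LB_simps(7) E hom_grel[OF R(1)] N] show ?thesis using sat_ideal that by metis
qed

lemma tube_submodule_chain:
  assumes t: "tube i l E" and N: "graded_submodule p q E N" and N': "graded_submodule p q E N'"
  shows "N \<subseteq> sat E N' \<or> N' \<subseteq> sat E N"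
proof -
  have E: "obj E" by (rule tube_obj[OF t])
  obtain R where P: "pres i 0 l E R" using t by (rule tubeE)
  note R = presD[OF P]
  obtain a where a: "sat (LB i 0) (R\<inverse> `` N) = {f. X ^ a dvd f}" by (rule pres_submodule[OF E P N])
  obtain a' where a': "sat (LB i 0) (R\<inverse> `` N') = {f. X ^ a' dvd f}" by (rule pres_submodule[OF E P N'])
  show ?thesis
  proof (cases "a \<le> a'")
    case True
    then have "sat (LB i 0) (R\<inverse> `` N') \<subseteq> sat (LB i 0) (R\<inverse> `` N)" unfolding a a' by (auto intro: power_le_dvd)
    then show ?thesis using submodule_le_of_preimage[OF LB_simps(7) E R(1,2) N' N] by simp
  next
    case False
    then have "sat (LB i 0) (R\<inverse> `` N) \<subseteq> sat (LB i 0) (R\<inverse> `` N')" unfolding a a' by (auto intro: power_le_dvd)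
    then show ?thesis using submodule_le_of_preimage[OF LB_simps(7) E R(1,2) N N'] by simp
  qed
qed

lemma monoE:
  assumes "obj K" "obj E" "is_monomorphism C K E m"
  obtains B where "hom K E B" "m = arr K E B" "Ker E B \<subseteq> tors K" "graded_submodule p q E (Range B)"
proof -
  obtain B where B: "hom K E B" "m = arr K E B"
    using assms by (auto simp: is_monomorphism_def Arr_iff)
  then show ?thesis
    using that[OF B] mono_iff[OF assms(1,2) B(1)] Range_graded[OF assms(1,2) hom_grel[OF B(1)]] assms(3)
    by simp
qed

lemma tube_uniserial:
  assumes t: "tube i l E" shows "uniserial C E"
  unfolding uniserial_def
proof (intro ballI allI impI, elim conjE)
  fix K L' :: "'a sheaf" and k k'
  assume "K \<in> Obj C" "L' \<in> Obj C" and k: "is_monomorphism C K E k" and k': "is_monomorphism C L' E k'"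
  then have K: "obj K" and L': "obj L'" by (simp_all add: Obj_coh)
  have E: "obj E" by (rule tube_obj[OF t])
  obtain B where B: "hom K E B" "k = arr K E B" "Ker E B \<subseteq> tors K" "graded_submodule p q E (Range B)"
    by (rule monoE[OF K E k])
  obtain B' where B': "hom L' E B'" "k' = arr L' E B'" "Ker E B' \<subseteq> tors L'" "graded_submodule p q E (Range B')"
    by (rule monoE[OF L' E k'])
  show "factors_through C K k L' k' \<or> factors_through C L' k' K k"
    unfolding B(2) B'(2) factors_through_iff[OF K L' E B(1) B'(1,3)] factors_through_iff[OF L' K E B'(1) B(1,3)]
    by (rule tube_submodule_chain[OF t B(4) B'(4)])
qed

text \<open>The subobject is the image of \<open>X ^ a\<close>. Multiplication by
  \<open>X ^ a\<close> starts at the line bundle twisted down by \<open>a\<close>, which explains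
  the new top, and its kernel on \<open>E\<close> is divisibility by \<open>X ^ (l - a)\<close>,
  which explains the new length.\<close>

lemma pres_subobject:
  assumes K: "obj K" and E: "obj E" and P: "pres i b l E R" and B: "hom K E B" and Bk: "Ker E B \<subseteq> tors K"
    and a: "a \<le> l" "sat (LB i b) (R\<inverse> `` Range B) = {f. X ^ a dvd f}"
  shows "tube (i - int a) (l - a) K"
proof -
  note R = presD[OF P] and Rd = grelD[OF hom_grel[OF presD(1)[OF P]]] and Bd = grelD[OF hom_grel[OF B]]
  note [simp] = K E
  note RB = Range_graded[OF K E hom_grel[OF B]]
  let ?M = "mulm (LB i b) (X ^ a) :: ('a poly poly \<times> 'a poly poly) set"
  let ?A = "?M O R"
  have M: "hom (LB (i - int a) b) (LB i b) ?M" using hom_XY[of "i - int a" b a 0] by simp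
  have A: "hom (LB (i - int a) b) E ?A" by (rule hom_comp[OF _ _ E M R(1)]) simp_all
  have AB: "Range ?A \<subseteq> sat E (Range B)"
  proof
    fix e assume "e \<in> Range ?A"
    then obtain s where s: "(s * X ^ a, e) \<in> R" by auto
    have "s * X ^ a \<in> sat (LB i b) (R\<inverse> `` Range B)" unfolding a(2) by simp
    then show "e \<in> sat E (Range B)" using mem_sat_preimage[OF LB_simps(7) E R(1) RB s] by blast
  qed
  note U = hom_lift[OF LB_simps(7) K E A B Bk AB]
  have KA: "sat (LB (i - int a) b) (Ker E ?A) = {f. X ^ (l - a) dvd f}"
    unfolding sat_Ker_mul R(3) using a(1) by (simp add: X_dvd_X_mult)
  have "Ker K (?A O B\<inverse>) \<subseteq> sat (LB (i - int a) b) (Ker E ?A)"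
  proof
    fix s assume "s \<in> Ker K (?A O B\<inverse>)"
    then obtain e where e: "(s, e) \<in> ?A" "(\<zero>\<^bsub>K\<^esub>, e) \<in> B" by (auto simp: Ker_def)
    then have "e \<in> tors E" using B by (auto simp: hom_def Ind_def)
    then show "s \<in> sat (LB (i - int a) b) (Ker E ?A)"
      by (rule tors_sat_Ker[OF obj_smod[OF LB_simps(7)] obj_smod[OF E] hom_grel[OF A] e(1)])
  qed
  then have 1: "sat (LB (i - int a) b) (Ker K (?A O B\<inverse>)) \<subseteq> {f. X ^ (l - a) dvd f}"
    using sat_mono[of "Ker K (?A O B\<inverse>)" "{f. X ^ (l - a) dvd f}" "LB (i - int a) b"]
    unfolding KA sat_X_ideal by simp
  have "Ker E ?A \<subseteq> Ker K (?A O B\<inverse>)" using Bd(3) by (auto simp: Ker_def)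
  then have 2: "{f. X ^ (l - a) dvd f} \<subseteq> sat (LB (i - int a) b) (Ker K (?A O B\<inverse>))"
    unfolding KA[symmetric] by (rule sat_mono)
  have "carrier K \<subseteq> sat K (Range (?A O B\<inverse>))"
  proof
    fix k assume k: "k \<in> carrier K"
    have "\<forall>\<^sub>F t in irr. \<forall>\<^sub>F u in irr. (u * t) \<odot>\<^bsub>K\<^esub> k \<in> Range (?A O B\<inverse>)"
    proof (rule eventually_mono[OF hom_dom[OF B k]])
      fix t assume "\<exists>e. (t \<odot>\<^bsub>K\<^esub> k, e) \<in> B"
      then obtain e where e: "(t \<odot>\<^bsub>K\<^esub> k, e) \<in> B" by blast
      then have "\<forall>\<^sub>F u in irr. u \<odot>\<^bsub>E\<^esub> e \<in> Range R" using Bd(2)[OF e] R(2) by (auto simp: sat_def)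
      then show "\<forall>\<^sub>F u in irr. (u * t) \<odot>\<^bsub>K\<^esub> k \<in> Range (?A O B\<inverse>)"
      proof (rule eventually_mono)
        fix u assume "u \<odot>\<^bsub>E\<^esub> e \<in> Range R"
        then obtain f where f: "(f, u \<odot>\<^bsub>E\<^esub> e) \<in> R" by blast
        have ub: "((u * t) \<odot>\<^bsub>K\<^esub> k, u \<odot>\<^bsub>E\<^esub> e) \<in> B" using Bd(5)[OF e, of u] k by (simp add: smod_smult)
        then have "f \<in> R\<inverse> `` Range B" using f by blast
        then have "f \<in> sat (LB i b) (R\<inverse> `` Range B)"
          using sat_incl[OF _ graded_submoduleD(1)[OF grel_preimage[OF LB_simps(7) E hom_grel[OF R(1)] RB]]] by auto
        then obtain g where "f = g * X ^ a" unfolding a(2) by (metis dvdE mem_Collect_eq mult.commute)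
        then have "(g, f) \<in> ?M" by simp
        then show "(u * t) \<odot>\<^bsub>K\<^esub> k \<in> Range (?A O B\<inverse>)" using f ub by blast
      qed
    qed
    then have "\<forall>\<^sub>F s in irr. s \<odot>\<^bsub>K\<^esub> k \<in> Range (?A O B\<inverse>)" by (rule eventually_irr_mult)
    then show "k \<in> sat K (Range (?A O B\<inverse>))" using k by (simp add: sat_def)
  qed
  then have "sat K (Range (?A O B\<inverse>)) = carrier K" by (auto simp: sat_def)
  then have "pres (i - int a) b (l - a) K (?A O B\<inverse>)" using U(1) 1 2 by (auto simp: pres_def)
  then show ?thesis using K tubeI by blast
qed

lemma pres_quotient:
  assumes E: "obj E" and T: "obj T" and P: "pres i b l E R" and G: "hom E T G" and S: "sat T (Range G) = carrier T"
    and N: "graded_submodule p q E N" "sat E (Ker T G) = sat E N" and a: "sat (LB i b) (R\<inverse> `` N) = {f. X ^ a dvd f}"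
  shows "pres i b a T (R O G)"
proof -
  note R = presD[OF P]
  note KG = Ker_graded[OF E T hom_grel[OF G]]
  have 1: "N \<subseteq> sat E (Ker T G)" "Ker T G \<subseteq> sat E N"
    using sat_incl[OF obj_smod[OF E] graded_submoduleD(1)[OF N(1)]]
      sat_incl[OF obj_smod[OF E] graded_submoduleD(1)[OF KG]] N(2) by auto
  have "sat (LB i b) (Ker T (R O G)) = {f. X ^ a dvd f}"
    unfolding Ker_relcomp a[symmetric]
    using sat_preimage_mono[OF LB_simps(7) E R(1) N(1) KG 1(1)] sat_preimage_mono[OF LB_simps(7) E R(1) KG N(1) 1(2)] by blast
  then show ?thesis
    using hom_comp[OF LB_simps(7) E T R(1) G] Range_relcomp_sat[OF LB_simps(7) E T R(1) G R(2) S] by (simp add: pres_def)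
qed

text \<open>Converse to \<open>pres_subobject\<close>: multiplication by \<open>X ^ a\<close> on
  line bundles has the kernel of \<open>P'\<close> as its kernel into \<open>E\<close>, so it
  descends along \<open>P'\<close> to an injection.\<close>

lemma pres_embed:
  assumes K: "obj K" and E: "obj E" and P: "pres i b l E R" and a: "a \<le> l" and Q: "pres (i - int a) b (l - a) K P'"
  defines "B \<equiv> P'\<inverse> O (mulm (LB i b) (X ^ a) O R)"
  shows "hom K E B" "Ker E B \<subseteq> tors K" "sat (LB i b) (R\<inverse> `` Range B) = {f. X ^ a dvd f}"
proof -
  note R = presD[OF P] and Rd = grelD[OF hom_grel[OF presD(1)[OF P]]] and Ps = presD[OF Q]
  note [simp] = K E
  let ?M = "mulm (LB i b) (X ^ a) :: ('a poly poly \<times> 'a poly poly) set"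
  let ?A = "?M O R"
  have M: "hom (LB (i - int a) b) (LB i b) ?M" using hom_XY[of "i - int a" b a 0] by simp
  have A: "hom (LB (i - int a) b) E ?A" by (rule hom_comp[OF _ _ E M R(1)]) simp_all
  have KA: "sat (LB (i - int a) b) (Ker E ?A) = {f. X ^ (l - a) dvd f}"
    unfolding sat_Ker_mul R(3) using a(1) by (simp add: X_dvd_X_mult)
  have "Ker K P' \<subseteq> sat (LB (i - int a) b) (Ker K P')"
    by (rule sat_incl[OF _ graded_submoduleD(1)[OF Ker_graded[OF LB_simps(7) K hom_grel[OF Ps(1)]]]]) simp
  then have "Ker K P' \<subseteq> sat (LB (i - int a) b) (Ker E ?A)" unfolding KA Ps(3) .
  note D = hom_descend[OF LB_simps(7) K E Ps(1) A Ps(2) this]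
  show h: "hom K E B" unfolding B_def by (rule D(1))
  have "Ker E B \<subseteq> tors K"
  proof
    fix k assume "k \<in> Ker E B"
    then obtain s where s: "(s, k) \<in> P'" "(s, \<zero>\<^bsub>E\<^esub>) \<in> ?A" unfolding B_def by (auto simp: Ker_def)
    have "s \<in> Ker E ?A" using s(2) by (simp add: Ker_def)
    then have "s \<in> sat (LB (i - int a) b) (Ker E ?A)"
      using sat_incl[OF _ graded_submoduleD(1)[OF Ker_graded[OF LB_simps(7) E hom_grel[OF A]]]] by auto
    then have "s \<in> sat (LB (i - int a) b) (Ker K P')" unfolding KA Ps(3) .
    then show "k \<in> tors K" by (rule sat_Ker_tors[OF _ _ Ps(1) s(1), rotated 2]) simp_all
  qed
  then show "Ker E B \<subseteq> tors K" .
  note RB = Range_graded[OF K E hom_grel[OF h]]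
  have "R\<inverse> `` Range B \<subseteq> {f. X ^ a dvd f}"
  proof
    fix f assume "f \<in> R\<inverse> `` Range B"
    then obtain e s where e: "(f, e) \<in> R" "(s * X ^ a, e) \<in> R" unfolding B_def by auto
    \<comment> \<open>Both arguments have the value \<open>e\<close>, so their difference lies in
      the kernel, hence is divisible by \<open>X ^ l\<close> and, as \<open>a \<le> l\<close>, by
      \<open>X ^ a\<close>.\<close>
    have "(f - s * X ^ a, e \<ominus>\<^bsub>E\<^esub> e) \<in> R"
      using grel_minus[OF _ _ hom_grel[OF R(1)] e] by simp
    then have "f - s * X ^ a \<in> Ker E R" using Rd(2)[OF e(1)] by (simp add: Ker_def)
    then have "f - s * X ^ a \<in> sat (LB i b) (Ker E R)"
      using sat_incl[OF _ graded_submoduleD(1)[OF Ker_graded[OF LB_simps(7) E hom_grel[OF R(1)]]]] by auto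
    then have "X ^ a dvd f - s * X ^ a" unfolding R(3) using power_le_dvd[OF _ a] by blast
    then have "X ^ a dvd (f - s * X ^ a) + s * X ^ a" by (rule dvd_add) simp
    then show "f \<in> {f. X ^ a dvd f}" by simp
  qed
  then have 1: "sat (LB i b) (R\<inverse> `` Range B) \<subseteq> {f. X ^ a dvd f}"
    using sat_mono[of _ "{f. X ^ a dvd f}" "LB i b"] unfolding sat_X_ideal by blast
  have pg: "submodule (R\<inverse> `` Range B) S_ring (LB i b)"
    by (rule graded_submoduleD(1)[OF grel_preimage[OF LB_simps(7) E hom_grel[OF R(1)] RB]])
  have Xa: "X ^ a \<in> sat (LB i b) (R\<inverse> `` Range B)"
  proof (rule sat_eventually)
    have P1: "\<forall>\<^sub>F s in irr. \<exists>k. (s, k) \<in> P'" using hom_dom[OF Ps(1), of 1] by simp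
    have "\<forall>\<^sub>F s in irr. \<exists>e. (s, e) \<in> ?A" using hom_dom[OF A, of 1] by simp
    with P1 have "\<forall>\<^sub>F s in irr. (\<exists>k. (s, k) \<in> P') \<and> (\<exists>e. (s, e) \<in> ?A)" by (rule eventually_conj)
    then have "\<forall>\<^sub>F s in irr. s * X ^ a \<in> R\<inverse> `` Range B"
    proof (rule eventually_mono, elim conjE exE)
      fix s k e assume "(s, k) \<in> P'" "(s, e) \<in> ?A"
      then have "(s * X ^ a, e) \<in> R" "e \<in> Range B" unfolding B_def by auto
      then show "s * X ^ a \<in> R\<inverse> `` Range B" by blast
    qed
    then show "\<forall>\<^sub>F s in irr. s \<odot>\<^bsub>LB i b\<^esub> X ^ a \<in> sat (LB i b) (R\<inverse> `` Range B)"
      by (rule eventually_mono) (use sat_incl[OF _ pg] in auto)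
  qed simp_all
  have "{f. X ^ a dvd f} \<subseteq> sat (LB i b) (R\<inverse> `` Range B)"
  proof (intro subsetI, elim CollectE dvdE)
    fix f g :: "'a poly poly" assume "f = X ^ a * g"
    then show "f \<in> sat (LB i b) (R\<inverse> `` Range B)"
      using smod_submoduleD(4)[OF _ sat_submodule[OF _ pg] Xa, of g] by (simp add: mult.commute)
  qed
  with 1 show "sat (LB i b) (R\<inverse> `` Range B) = {f. X ^ a dvd f}" by blast
qed

end

section \<open>The uniserial objects\<close>

context weights
begin

text \<open>The injections of a coproduct are split monomorphisms, so one of them factors through
  the other. The projection that splits the first kills the second, hence its identity is zero and
  the first summand vanishes.\<close>

lemma uniserial_indecomposable:
  fixes E :: "'k::alg_closed_field sheaf"
  assumes E: "obj E" and uni: "uniserial C E" and nz: "\<not> zero_object C E"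
  shows "indecomposable C E"
  unfolding indecomposable_def
proof (intro conjI ballI allI impI)
  show "E \<in> Obj C" using E by (simp add: Obj_coh)
  fix A B i j assume "A \<in> Obj C" "B \<in> Obj C" and cop: "is_coproduct C A B E i j"
  then have A: "obj A" and B: "obj B" by (simp_all add: Obj_coh)
  have i: "i \<in> Arr C A E" and j: "j \<in> Arr C B E" using cop by (simp_all add: is_coproduct_def)
  have univ: "\<exists>u. u \<in> Arr C E X \<and> Comp C u i = a \<and> Comp C u j = b"
    if "obj X" "a \<in> Arr C A X" "b \<in> Arr C B X" for X a b
    using cop that by (intro ex1_implies_ex) (simp add: is_coproduct_def Obj_coh)
  define z where "z A B = arr A B (carrier A \<times> {\<zero>\<^bsub>B\<^esub>})" for A B :: "'k sheaf"
  have z: "z A B \<in> Arr C A B" if "obj A" "obj B" for A B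
    unfolding z_def by (rule arr_in[OF that hom_zero[OF that]])
  have id: "Ident C A \<in> Arr C A A" if "obj A" for A :: "'k sheaf"
    unfolding Ident_coh by (rule arr_in[OF that that hom_Id[OF that]])
  have key: "zero_object C A'"
    if A': "obj A'" and B': "obj B'" and i': "i' \<in> Arr C A' E" and j': "j' \<in> Arr C B' E"
      and u: "u \<in> Arr C E A'" "Comp C u i' = Ident C A'" "Comp C u j' = z B' A'"
      and f: "factors_through C A' i' B' j'" for A' B' i' j' u
  proof -
    obtain w where w: "w \<in> Arr C A' B'" "i' = Comp C j' w" using f unfolding factors_through_def by blast
    then obtain W where W: "hom A' B' W" "w = arr A' B' W" using A' B' by (auto simp: Arr_iff)
    have h: "hom A' A' (W O (carrier B' \<times> {\<zero>\<^bsub>A'\<^esub>}))" by (rule hom_comp[OF A' B' A' W(1) hom_zero[OF B' A']])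
    have "Ident C A' = Comp C (z B' A') w"
      using Comp_assoc(1)[OF A' B' E A' w(1) j' u(1)] u(2,3) w(2) by simp
    also have "\<dots> = arr A' A' (W O (carrier B' \<times> {\<zero>\<^bsub>A'\<^esub>}))"
      unfolding z_def W(2) by (rule Comp_arr[OF A' B' A' W(1) hom_zero[OF B' A']])
    finally have "zero_arrow C A' A' (arr A' A' (Id_on (carrier A')))"
      unfolding Ident_coh by (simp only: zero_arrow_iff[OF A' A' h]) (use A' in auto)
    then show ?thesis using zero_arrow_iff[OF A' A' hom_Id[OF A']] A' by (auto simp: zero_object_iff)
  qed
  obtain u where u: "u \<in> Arr C E A" "Comp C u i = Ident C A" "Comp C u j = z B A"
    using univ[OF A id[OF A] z[OF B A]] by blast
  obtain v where v: "v \<in> Arr C E B" "Comp C v i = z A B" "Comp C v j = Ident C B"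
    using univ[OF B z[OF A B] id[OF B]] by blast
  have split_mono: "is_monomorphism C A' E i'"
    if A': "obj A'" and i': "i' \<in> Arr C A' E" and u: "u \<in> Arr C E A'" "Comp C u i' = Ident C A'" for A' i' u
    unfolding is_monomorphism_def
  proof (intro conjI ballI impI)
    fix X g h assume "X \<in> Obj C" and gh: "g \<in> Arr C X A'" "h \<in> Arr C X A'" "Comp C i' g = Comp C i' h"
    then have X: "obj X" by (simp add: Obj_coh)
    have "Comp C u (Comp C i' x) = x" if "x \<in> Arr C X A'" for x
      using Comp_assoc(1)[OF X A' E A' that i' u(1)] u(2) that X A' Comp_Id(2)[OF X A'] by (auto simp: Arr_iff)
    then show "g = h" using gh by metis
  qed (rule i')
  have "factors_through C A i B j \<or> factors_through C B j A i"
    using uni[unfolded uniserial_def, rule_format, of A B i j] split_mono[OF A i u(1,2)] split_mono[OF B j v(1,3)] A B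
    by (simp add: Obj_coh)
  then show "zero_object C A \<or> zero_object C B"
    using key[OF A B i j u] key[OF B A j i v(1,3,2)] by blast
qed (rule nz)

lemma image_object:
  fixes E :: "'k::alg_closed_field sheaf"
  assumes A: "obj A" and E: "obj E" and F: "hom A E F"
  shows "\<exists>K B. obj K \<and> hom K E B \<and> Ker E B \<subseteq> tors K \<and> Range B = Range F"
proof -
  note Fd = grelD[OF hom_grel[OF F]]
  note KF = Ker_graded[OF A E hom_grel[OF F]]
  let ?K = "quot A (Ker E F)" and ?B = "(proj A (Ker E F))\<inverse> O F"
  have K: "obj ?K" by (rule obj_quot[OF A KF])
  note P = proj_hom[OF A KF]
  have "sat ?K (Range (proj A (Ker E F))) = carrier ?K"
    unfolding P(2) using sat_incl[OF obj_smod[OF K] carrier_submodule[OF obj_smod[OF K]]] by (auto simp: sat_def)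
  moreover have "Ker ?K (proj A (Ker E F)) \<subseteq> sat A (Ker E F)"
    unfolding P(3) by (rule sat_incl[OF obj_smod[OF A] graded_submoduleD(1)[OF KF]])
  ultimately have B: "hom ?K E ?B" by (rule hom_descend(1)[OF A K E P(1) F])
  have "Ker E ?B \<subseteq> tors ?K"
  proof
    fix x assume "x \<in> Ker E ?B"
    then obtain a where a: "x = rep A (Ker E F) a" "(a, \<zero>\<^bsub>E\<^esub>) \<in> F" by (auto simp: Ker_def proj_def)
    then have "x = \<zero>\<^bsub>?K\<^esub>" using rep_quot_zero_iff[OF A KF Fd(1)[OF a(2)]] by (simp add: Ker_def)
    then show "x \<in> tors ?K" using K by simp
  qed
  moreover have "Range ?B = Range F" using Fd(1) by (force simp: proj_def)
  ultimately show ?thesis using K B by blast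
qed

text \<open>Uniseriality speaks of monomorphisms; replacing morphisms by their images extends it to
  arbitrary morphisms into \<open>E\<close>.\<close>

lemma uniserial_ranges:
  fixes E :: "'k::alg_closed_field sheaf"
  assumes A: "obj A" and A': "obj A'" and E: "obj E" and F: "hom A E F" and F': "hom A' E F'"
    and uni: "uniserial C E"
  shows "Range F \<subseteq> sat E (Range F') \<or> Range F' \<subseteq> sat E (Range F)"
proof -
  obtain K B where B: "obj K" "hom K E B" "Ker E B \<subseteq> tors K" "Range B = Range F"
    using image_object[OF A E F] by blast
  obtain K' B' where B': "obj K'" "hom K' E B'" "Ker E B' \<subseteq> tors K'" "Range B' = Range F'"
    using image_object[OF A' E F'] by blast
  have "factors_through C K (arr K E B) K' (arr K' E B') \<or> factors_through C K' (arr K' E B') K (arr K E B)"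
    using uni[unfolded uniserial_def, rule_format, of K K' "arr K E B" "arr K' E B'"]
      mono_iff[OF B(1) E B(2)] mono_iff[OF B'(1) E B'(2)] B(1,3) B'(1,3) by (simp add: Obj_coh)
  then show ?thesis
    unfolding factors_through_iff[OF B(1) B'(1) E B(2) B'(2,3)] factors_through_iff[OF B'(1) B(1) E B'(2) B(2,3)]
      B(4) B'(4) .
qed

end

context side
begin

lemma tube_zero_iff:
  assumes t: "tube i l E" shows "zero_object C E \<longleftrightarrow> l = 0"
proof -
  have E: "obj E" by (rule tube_obj[OF t])
  obtain R where P: "pres i 0 l E R" using t by (rule tubeE)
  note R = presD[OF P] and Rd = grelD[OF hom_grel[OF presD(1)[OF P]]]
  have "carrier E \<subseteq> tors E \<longleftrightarrow> l = 0"
  proof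
    assume *: "carrier E \<subseteq> tors E"
    have ev: "\<forall>\<^sub>F s in irr. \<exists>e. (s, e) \<in> R" using hom_dom[OF R(1), of 1] by simp
    obtain k e where e: "(Y ^ k, e) \<in> R" using eventually_XY_ex[OF ev] by blast
    have "e \<in> tors E" using Rd(2)[OF e] * by blast
    then have "Y ^ k \<in> sat (LB i 0) (Ker E R)"
      by (rule tors_sat_Ker[OF _ obj_smod[OF E] hom_grel[OF R(1)] e, rotated]) simp
    then have "X ^ l dvd (Y ^ k :: 'a poly poly)" unfolding R(3) by simp
    then show "l = 0" using X_not_dvd_Y[of k, where 'a='a] by (metis dvd_power dvd_trans neq0_conv)
  next
    assume l: "l = 0"
    show "carrier E \<subseteq> tors E"
    proof
      fix e assume e: "e \<in> carrier E"
      then have "\<forall>\<^sub>F s in irr. s \<odot>\<^bsub>E\<^esub> e \<in> Range R" using R(2) by (auto simp: sat_def)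
      then have "\<forall>\<^sub>F s in irr. s \<odot>\<^bsub>E\<^esub> e \<in> tors E"
      proof (rule eventually_mono)
        fix s assume "s \<odot>\<^bsub>E\<^esub> e \<in> Range R"
        then obtain f where f: "(f, s \<odot>\<^bsub>E\<^esub> e) \<in> R" by blast
        show "s \<odot>\<^bsub>E\<^esub> e \<in> tors E"
          by (rule sat_Ker_tors[OF _ obj_smod[OF E] R(1) f]) (simp_all add: R(3) l)
      qed
      then show "e \<in> tors E" by (rule tors_eventually[OF obj_smod[OF E] e])
    qed
  qed
  then show ?thesis using E by (simp add: zero_object_iff)
qed

lemma X_dvd_one [simp]: "X ^ a dvd (1 :: 'k::alg_closed_field poly poly) \<longleftrightarrow> a = 0"
  using X_not_dvd_Y[of 0, where 'a='k] by (metis dvd_power dvd_trans neq0_conv one_dvd power_0)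

lemma pres_preimage_full:
  assumes E: "obj E" and P: "pres i b l E R" and N: "graded_submodule p q E N"
    and J: "sat (LB i b) (R\<inverse> `` N) = UNIV"
  shows "sat E N = carrier E"
proof -
  note R = presD[OF P]
  have "carrier E \<subseteq> sat E N"
    by (rule submodule_le_of_preimage[OF LB_simps(7) E R(1,2) carrier_graded[OF E] N]) (simp add: J)
  then show ?thesis by (auto simp: sat_def)
qed

text \<open>For \<open>l > 1\<close> the image of \<open>X\<close> is a proper nonzero subobject.
  For \<open>l = 1\<close> the preimage of a subobject is generated by \<open>1\<close> or by
  \<open>X\<close>, so the subobject is everything or zero.\<close>

lemma tube_simple_iff:
  assumes t: "tube i l E" shows "simple_object C E \<longleftrightarrow> l = 1"
proof
  have E: "obj E" by (rule tube_obj[OF t])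
  obtain R where P: "pres i 0 l E R" using t by (rule tubeE)
  note R = presD[OF P]
  {
    assume s: "simple_object C E"
    have l0: "l \<noteq> 0" using s tube_zero_iff[OF t] by (simp add: simple_object_def)
    obtain P' where P': "pres (i - int 1) 0 (l - 1) (Std (i - int 1) 0 (l - 1) :: 'a sheaf) P'"
      using pres_Std by blast
    let ?K = "Std (i - int 1) 0 (l - 1) :: 'a sheaf"
    obtain B where B: "hom ?K E B" "Ker E B \<subseteq> tors ?K" "sat (LB i 0) (R\<inverse> `` Range B) = {f. X ^ 1 dvd f}"
      using pres_embed[OF obj_Std E P _ P'] l0 by (metis One_nat_def Suc_leI neq0_conv)
    have "is_monomorphism C ?K E (arr ?K E B)" using mono_iff[OF obj_Std E B(1)] B(2) by simp
    then have "zero_object C ?K \<or> is_isomorphism C ?K E (arr ?K E B)"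
    proof -
      have "\<forall>K\<in>Obj C. \<forall>m. is_monomorphism C K E m \<longrightarrow> zero_object C K \<or> is_isomorphism C K E m"
        using s unfolding simple_object_def by blast
      moreover have "?K \<in> Obj C" by (simp add: Obj_coh)
      moreover assume "is_monomorphism C ?K E (arr ?K E B)"
      ultimately show ?thesis by blast
    qed
    moreover have "\<not> is_isomorphism C ?K E (arr ?K E B)"
    proof
      assume "is_isomorphism C ?K E (arr ?K E B)"
      then have S: "sat E (Range B) = carrier E"
        using iso_epi[OF obj_Std E] epi_iff[OF obj_Std E B(1)] by simp
      have "sat (LB i 0) (R\<inverse> `` carrier E) \<subseteq> sat (LB i 0) (R\<inverse> `` Range B)"
        by (rule sat_preimage_mono[OF LB_simps(7) E R(1) carrier_graded[OF E] Range_graded[OF obj_Std E hom_grel[OF B(1)]]])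
          (simp add: S)
      moreover have "R\<inverse> `` carrier E = Domain R" using grelD(2)[OF hom_grel[OF R(1)]] by auto
      ultimately have "(1 :: 'a poly poly) \<in> sat (LB i 0) (R\<inverse> `` Range B)"
        using R(1) by (auto simp: hom_def)
      then show False using B(3) X_dvd_one[of 1, where 'k='a] by simp
    qed
    ultimately have "l - 1 = 0" using tube_zero_iff[OF tube_Std] by blast
    then show "l = 1" using l0 by simp
  }
  assume l: "l = 1"
  show "simple_object C E"
    unfolding simple_object_def Obj_coh
  proof (intro conjI ballI allI impI)
    show "\<not> zero_object C E" using tube_zero_iff[OF t] l by simp
    fix K m assume "K \<in> Obj C" and m: "is_monomorphism C K E m"
    then have K: "obj K" by (simp add: Obj_coh)
    obtain B where B: "hom K E B" "m = arr K E B" "Ker E B \<subseteq> tors K" "graded_submodule p q E (Range B)"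
      by (rule monoE[OF K E m])
    obtain a where a: "a \<le> l" "sat (LB i 0) (R\<inverse> `` Range B) = {f. X ^ a dvd f}"
      by (rule pres_submodule[OF E P B(4)])
    show "zero_object C K \<or> is_isomorphism C K E m"
    proof (cases "a = 0")
      case True
      then have "sat E (Range B) = carrier E" using pres_preimage_full[OF E P B(4)] a(2) by simp
      then show ?thesis using iso_if(4)[OF K E B(1,3)] B(2) by simp
    next
      case False
      then have "tube (i - int a) 0 K" using pres_subobject[OF K E P B(1,3) a] a(1) l by simp
      then show ?thesis using tube_zero_iff by blast
    qed
  qed (rule E)
qed

text \<open>The cokernel is presented by the preimage of the subobject, so its simplicity fixes the
  exponent. Hence all maximal subobjects have the same preimage.\<close>

lemma cokernel_simple_preimage:
  assumes E: "obj E" and P: "pres i b l E R" and K: "obj K" and B: "hom K E B"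
    and c: "is_cokernel C K E (arr K E B) T c" and s: "simple_object C T"
  shows "l \<ge> 1" "sat (LB i b) (R\<inverse> `` Range B) = {f. X ^ 1 dvd f}"
proof -
  note RB = Range_graded[OF K E hom_grel[OF B]]
  obtain a where a: "a \<le> l" "sat (LB i b) (R\<inverse> `` Range B) = {f. X ^ a dvd f}"
    by (rule pres_submodule[OF E P RB])
  have T: "obj T" and "c \<in> Arr C E T" using c by (auto simp: is_cokernel_def Obj_coh)
  then obtain G where G: "hom E T G" "c = arr E T G" using E by (auto simp: Arr_iff)
  have *: "sat T (Range G) = carrier T" "sat E (Ker T G) = sat E (Range B)"
    using c cokernel_iff[OF K E T B G(1)] G(2) by auto
  have "tube i a T" using tubeI[OF T pres_quotient[OF E T P G(1) *(1) RB *(2) a(2)]] .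
  then have "a = 1" using tube_simple_iff s by blast
  then show "l \<ge> 1" "sat (LB i b) (R\<inverse> `` Range B) = {f. X ^ 1 dvd f}" using a by auto
qed

lemma tube_radical:
  assumes t: "tube i l E" and l: "l \<ge> 1"
  obtains R K B where "pres i 0 l E R" "obj K" "tube (i - 1) (l - 1) K" "hom K E B" "Ker E B \<subseteq> tors K"
    "sat (LB i 0) (R\<inverse> `` Range B) = {f. X ^ 1 dvd f}"
proof -
  have E: "obj E" by (rule tube_obj[OF t])
  obtain R where P: "pres i 0 l E R" using t by (rule tubeE)
  let ?K = "Std (i - int 1) 0 (l - 1) :: 'a sheaf"
  obtain P' where P': "pres (i - int 1) 0 (l - 1) ?K P'" using pres_Std by blast
  from pres_embed[OF obj_Std E P l P'] that[OF P obj_Std _] tube_Std[of "i - int 1" "l - 1" 0]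
  show ?thesis by simp
qed

text \<open>The quotient by the image of \<open>X\<close> has a presentation of length 1 with the
  same twist; by \<open>pres_iso\<close> any \<open>T\<close> with such a presentation may replace
  it as cokernel.\<close>

lemma tube_simple_quotient:
  assumes E: "obj E" and P: "pres i b l E R" and K: "obj K" and B: "hom K E B"
    and J: "sat (LB i b) (R\<inverse> `` Range B) = {f. X ^ 1 dvd f}" and T: "tube i 1 T"
  shows "simple_object C T" "\<exists>c. is_cokernel C K E (arr K E B) T c"
proof -
  show "simple_object C T" using tube_simple_iff[OF T] by simp
  have Tobj: "obj T" by (rule tube_obj[OF T])
  note RB = Range_graded[OF K E hom_grel[OF B]]
  let ?Q = "quot E (Range B)"
  have Q: "obj ?Q" by (rule obj_quot[OF E RB])
  note Pr = proj_hom[OF E RB]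
  have S: "sat ?Q (Range (proj E (Range B))) = carrier ?Q"
    unfolding Pr(2) using sat_incl[OF obj_smod[OF Q] carrier_submodule[OF obj_smod[OF Q]]] by (auto simp: sat_def)
  have pq: "pres i b 1 ?Q (R O proj E (Range B))"
    by (rule pres_quotient[OF E Q P Pr(1) S RB _ J]) (simp add: Pr(3))
  obtain R' where pT: "pres i b 1 T R'" using T by (rule tubeE)
  let ?U = "(R O proj E (Range B))\<inverse> O R'"
  note U = pres_iso[OF Q Tobj pq pT]
  have h: "hom E T (proj E (Range B) O ?U)" by (rule hom_comp[OF E Q Tobj Pr(1) U(1)])
  have "is_cokernel C K E (arr K E B) T (arr E T (proj E (Range B) O ?U))"
    unfolding cokernel_iff[OF K E Tobj B h]
    using Range_relcomp_sat[OF E Q Tobj Pr(1) U(1) S U(3)] sat_Ker_relcomp_mono[OF E Q Tobj Pr(1) U(1,2)]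
    by (simp add: Pr(3))
  then show "\<exists>c. is_cokernel C K E (arr K E B) T c" by blast
qed

text \<open>\<open>has_length\<close> asserts only that some composition series exists. The
  equivalence makes the length unique on tubes, and this later fixes the exponent of a recognised
  object.\<close>

lemma tube_has_length_iff:
  assumes "tube i l E" shows "has_length C n E \<longleftrightarrow> n = l"
  using assms
proof (induction n arbitrary: i l E)
  case 0
  then show ?case using tube_zero_iff[of i l E] by auto
next
  case (Suc n)
  have E: "obj E" by (rule tube_obj[OF Suc.prems])
  obtain R where P: "pres i 0 l E R" using Suc.prems by (rule tubeE)
  show ?case
  proof
    assume "has_length C (Suc n) E"
    then obtain K m T c where K: "K \<in> Obj C" "has_length C n K" and m: "is_monomorphism C K E m"
      and c: "is_cokernel C K E m T c" and s: "simple_object C T"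
      by auto
    have K': "obj K" using K by (simp add: Obj_coh)
    obtain B where B: "hom K E B" "m = arr K E B" "Ker E B \<subseteq> tors K" "graded_submodule p q E (Range B)"
      by (rule monoE[OF K' E m])
    note * = cokernel_simple_preimage[OF E P K' B(1) c[unfolded B(2)] s]
    have "tube (i - int 1) (l - 1) K" by (rule pres_subobject[OF K' E P B(1,3) *])
    then have "n = l - 1" using Suc.IH K(2) by blast
    then show "Suc n = l" using *(1) by simp
  next
    assume l: "Suc n = l"
    then have "l \<ge> 1" by simp
    then obtain R K B where P: "pres i 0 l E R" and K: "obj K" "tube (i - 1) (l - 1) K" and B: "hom K E B" "Ker E B \<subseteq> tors K"
      "sat (LB i 0) (R\<inverse> `` Range B) = {f. X ^ 1 dvd f}"
      by (rule tube_radical[OF Suc.prems])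
    have "tube i 1 (Std i 0 1 :: 'a sheaf)" by (rule tube_Std)
    note T = tube_simple_quotient[OF E P K(1) B(1,3) this]
    have "has_length C n K" using Suc.IH[OF K(2)] l by simp
    moreover have "is_monomorphism C K E (arr K E B)" using mono_iff[OF K(1) E B(1)] B(2) by simp
    moreover have "E \<in> Obj C" "K \<in> Obj C" using E K(1) by (simp_all add: Obj_coh)
    ultimately show "has_length C (Suc n) E" unfolding has_length.simps using T by blast
  qed
qed

text \<open>All maximal subobjects have the preimage generated by \<open>X\<close>, so they agree up
  to saturation with the image of \<open>X\<close>, which is therefore the radical.\<close>

lemma tube_top:
  assumes t: "tube i l E" and l: "l \<ge> 1" and T: "tube i 1 T"
  shows "is_top C E T"
proof -
  have E: "obj E" by (rule tube_obj[OF t])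
  obtain R K B where P: "pres i 0 l E R" and K: "obj K" and B: "hom K E B" "Ker E B \<subseteq> tors K"
    "sat (LB i 0) (R\<inverse> `` Range B) = {f. X ^ 1 dvd f}"
    using tube_radical[OF t l] by metis
  note R = presD[OF P]
  note RB = Range_graded[OF K E hom_grel[OF B(1)]]
  note Tq = tube_simple_quotient[OF E P K B(1,3) T]
  obtain c where c: "is_cokernel C K E (arr K E B) T c" using Tq(2) by blast
  have mono: "is_monomorphism C K E (arr K E B)" using mono_iff[OF K E B(1)] B(2) by simp
  have "is_radical C E K (arr K E B)"
    unfolding is_radical_def Obj_coh
  proof (intro conjI ballI)
    fix Z x assume "Z \<in> Obj C" and x: "x \<in> Arr C Z E"
    then have Z: "obj Z" by (simp add: Obj_coh)
    obtain A where A: "hom Z E A" "x = arr Z E A" using x Z E by (auto simp: Arr_iff)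
    show "factors_through C Z x K (arr K E B) \<longleftrightarrow>
        (\<forall>K' m. maximal_subobject C E K' m \<longrightarrow> factors_through C Z x K' m)"
    proof
      assume "factors_through C Z x K (arr K E B)"
      then have AB: "Range A \<subseteq> sat E (Range B)"
        unfolding A(2) factors_through_iff[OF Z K E A(1) B(1,2)] .
      show "\<forall>K' m. maximal_subobject C E K' m \<longrightarrow> factors_through C Z x K' m"
      proof (intro allI impI)
        fix K' m assume "maximal_subobject C E K' m"
        then obtain T' c' where K': "obj K'" and m: "is_monomorphism C K' E m"
          and c': "is_cokernel C K' E m T' c'" "simple_object C T'"
          by (auto simp: maximal_subobject_def Obj_coh)
        obtain B' where B': "hom K' E B'" "m = arr K' E B'" "Ker E B' \<subseteq> tors K'" "graded_submodule p q E (Range B')"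
          by (rule monoE[OF K' E m])
        have "sat (LB i 0) (R\<inverse> `` Range B') = {f. X ^ 1 dvd f}"
          by (rule cokernel_simple_preimage(2)[OF E P K' B'(1) c'(1)[unfolded B'(2)] c'(2)])
        then have "Range B \<subseteq> sat E (Range B')"
          using submodule_le_of_preimage[OF LB_simps(7) E R(1,2) RB B'(4)] B(3) by simp
        then have "sat E (Range B) \<subseteq> sat E (Range B')"
          using sat_mono[of "Range B" "sat E (Range B')" E]
            sat_sat[OF obj_smod[OF E] graded_submoduleD(1)[OF B'(4)]] by simp
        then have "Range A \<subseteq> sat E (Range B')" using AB by blast
        then show "factors_through C Z x K' m"
          unfolding A(2) B'(2) factors_through_iff[OF Z K' E A(1) B'(1,3)] .
      qed
    next
      assume *: "\<forall>K' m. maximal_subobject C E K' m \<longrightarrow> factors_through C Z x K' m"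
      have "maximal_subobject C E K (arr K E B)"
        unfolding maximal_subobject_def Obj_coh using K mono c Tq(1) by blast
      then show "factors_through C Z x K (arr K E B)" using * by blast
    qed
  qed (use K mono in auto)
  then show ?thesis using c unfolding is_top_def by blast
qed

lemma tube_uniserial_with_top:
  assumes t: "tube i l E" and l: "l \<ge> 1" and T: "tube i 1 T"
  shows "is_uniserial_with_top C T l E"
  unfolding is_uniserial_with_top_def
  using uniserial_indecomposable[OF tube_obj[OF t] tube_uniserial[OF t]] tube_zero_iff[OF t] l
    tube_uniserial[OF t] tube_has_length_iff[OF t] tube_top[OF t l T] by simp

section \<open>Exceptional simple sheaves and recognition of tubes by their tops\<close>

definition is_S :: "int \<Rightarrow> 'k::alg_closed_field sheaf \<Rightarrow> bool" where
  "is_S i T \<longleftrightarrow> (\<exists>c. is_cokernel C (LB (i - 1) 0) (LB i 0)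
     (quotient_arrow_of p q (LB (i - 1) 0) (LB i 0) (\<lambda>s. X * s)) T c)"

lemma quotient_arrow_of_X:
  "quotient_arrow_of p q (LB (i - 1) 0 :: 'a::alg_closed_field sheaf) (LB i 0) (\<lambda>s. X * s) = arr (LB (i - 1) 0) (LB i 0) (mulm (LB i 0) X)"
proof -
  have "(\<lambda>m. (m, X * m)) ` carrier (LB (i - 1) 0) = mulm (LB i 0 :: 'a sheaf) X"
    by (auto simp: mult.commute image_iff)
  then show ?thesis by (simp add: quotient_arrow_of_def arr_def)
qed

lemma cokernel_X_iff:
  fixes T :: "'a::alg_closed_field sheaf"
  assumes T: "obj T" and G: "hom (LB i 0) T G"
  shows "is_cokernel C (LB (i - 1) 0) (LB i 0) (arr (LB (i - 1) 0) (LB i 0) (mulm (LB i 0) X)) T (arr (LB i 0) T G)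
    \<longleftrightarrow> pres i 0 1 T G"
proof -
  have h: "hom (LB (i - 1) 0) (LB i 0) (mulm (LB i 0) X)" using hom_XY[of "i - 1" 0 1 0] by simp
  have "Range (mulm (LB i 0) X) = {f :: 'a poly poly. X ^ 1 dvd f}" by (auto elim!: dvdE simp: mult.commute Range_iff)
  then show ?thesis
    unfolding cokernel_iff[OF LB_simps(7) LB_simps(7) T h G] pres_def using G sat_X_ideal[of i 0 1, where 'a='a] by simp
qed

lemma is_S_tube:
  assumes "is_S i T" shows "tube i 1 T"
proof -
  obtain c where c: "is_cokernel C (LB (i - 1) 0) (LB i 0) (arr (LB (i - 1) 0) (LB i 0) (mulm (LB i 0) X)) T c"
    using assms unfolding is_S_def quotient_arrow_of_X by blast
  then have T: "obj T" and "c \<in> Arr C (LB i 0) T" by (auto simp: is_cokernel_def Obj_coh)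
  then obtain G where G: "hom (LB i 0) T G" "c = arr (LB i 0) T G" by (auto simp: Arr_iff)
  show ?thesis using c cokernel_X_iff[OF T G(1)] G(2) tubeI[OF T] by blast
qed

lemma is_S_exists: "\<exists>T :: 'k::alg_closed_field sheaf. is_S i T"
proof -
  obtain G where G: "pres i 0 1 (Std i 0 1 :: 'k sheaf) G" using pres_Std by blast
  then show ?thesis
    unfolding is_S_def quotient_arrow_of_X
    using cokernel_X_iff[OF obj_Std presD(1)[OF G]] by blast
qed

text \<open>Nakayama's argument: a lift \<open>m\<close> of a generator of the top is not in the
  radical, so by uniseriality the subobject it generates contains the radical, and then everything.
  It remains to find a power of \<open>X\<close> in the saturated annihilator \<open>I\<close> of
  \<open>m\<close>, for \<open>sat_ideal\<close> to apply. Uniseriality provides it by two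
  comparisons of multiples of \<open>m\<close>: that by \<open>X\<close> with that by
  \<open>Y\<close>, and that by \<open>X ^ e'\<close> with that by some \<open>v\<close> not
  divisible by \<open>X\<close>.\<close>

lemma uniserial_with_top_tube:
  fixes E T :: "'k::alg_closed_field sheaf"
  assumes T1: "tube i 1 T" and u: "is_uniserial_with_top C T j E"
  shows "tube i j E"
proof -
  have T: "obj T" by (rule tube_obj[OF T1])
  obtain Q where P: "pres i 0 1 T Q" using T1 by (rule tubeE)
  note Q = presD[OF P] and Qd = grelD[OF hom_grel[OF presD(1)[OF P]]]
  have E: "obj E" and uni: "uniserial C E" and len: "has_length C j E" and top: "is_top C E T"
    using u by (auto simp: is_uniserial_with_top_def indecomposable_def Obj_coh)
  note [simp] = E T
  obtain R0 r t where R0: "obj R0" "is_monomorphism C R0 E r" and t: "is_cokernel C R0 E r T t"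
    using top by (auto simp: is_top_def is_radical_def Obj_coh)
  obtain B0 where B0: "hom R0 E B0" "r = arr R0 E B0" "graded_submodule p q E (Range B0)"
    using monoE[OF R0(1) E R0(2)] by metis
  have "t \<in> Arr C E T" using t by (simp add: is_cokernel_def)
  then obtain \<tau> where \<tau>: "hom E T \<tau>" "t = arr E T \<tau>" by (auto simp: Arr_iff)
  have cok: "sat T (Range \<tau>) = carrier T" "sat E (Ker T \<tau>) = sat E (Range B0)"
    using t cokernel_iff[OF R0(1) E T B0(1) \<tau>(1)] unfolding B0(2) \<tau>(2) by auto
  note \<tau>d = grelD[OF hom_grel[OF \<tau>(1)]]
  \<comment> \<open>A homogeneous element \<open>m\<close> of \<open>E\<close> lifts a generator of the top.\<close>
  have "\<forall>\<^sub>F s in irr. \<exists>w. (s, w) \<in> Q" using hom_dom[OF Q(1), of 1] by simp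
  then obtain k w0 where k: "(Y ^ k, w0) \<in> Q" by (auto elim: eventually_XY_ex)
  have "\<forall>\<^sub>F s in irr. s \<odot>\<^bsub>T\<^esub> w0 \<in> Range \<tau>" using cok(1) Qd(2)[OF k] by (auto simp: sat_def)
  then obtain k' m0 where k': "(m0, Y ^ k' \<odot>\<^bsub>T\<^esub> w0) \<in> \<tau>" by (auto elim: eventually_XY_ex)
  \<comment> \<open>Neither need \<open>1\<close> lie in the domain of \<open>Q\<close> nor its
    value in the range of \<open>\<tau>\<close>. Two powers of \<open>Y\<close> repair this, so
    \<open>m\<close> lifts a value at \<open>Y ^ K\<close> instead of one at
    \<open>1\<close>.\<close>
  define K where "K = k' + k"
  define d where "d = Vs (- i) (int K)"
  have d: "d \<in> carrier L" by (simp add: d_def)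
  define m where "m = comp E m0 d"
  define w where "w = comp T (Y ^ k' \<odot>\<^bsub>T\<^esub> w0) d"
  have mw: "(m, w) \<in> \<tau>" unfolding m_def w_def by (rule \<tau>d(6)[OF k' d])
  have Yw: "(Y ^ K, w) \<in> Q"
  proof -
    have "(Y ^ K, Y ^ k' \<odot>\<^bsub>T\<^esub> w0) \<in> Q" using Qd(5)[OF k, of "Y ^ k'"] by (simp add: K_def power_add)
    then have "(comp (LB i 0) (Y ^ K) d, w) \<in> Q" unfolding w_def by (rule Qd(6)[OF _ d])
    moreover have "comp (LB i 0) (Y ^ K) d = (Y ^ K :: 'k poly poly)"
      using comp_of_piece[OF obj_gm[OF LB_simps(7)], of "Y ^ K" i 0 d d] S_piece_Y[of K] by (simp add: d_def)
    ultimately show ?thesis by simp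
  qed
  have mp: "m \<in> piece E (Vs (- i) (int K))"
    unfolding m_def d_def[symmetric] by (rule comp_piece[OF obj_gm[OF E] \<tau>d(1)[OF k'] d])
  have mc [simp]: "m \<in> carrier E" and wc [simp]: "w \<in> carrier T" using \<tau>d(1,2)[OF mw] .
  \<comment> \<open>Up to torsion the annihilator of the image of \<open>m\<close> in the top is
    generated by \<open>X\<close>, since the factor \<open>Y ^ K\<close> does not affect
    divisibility by \<open>X\<close>.\<close>
  have key: "s \<odot>\<^bsub>E\<^esub> m \<in> sat E (Ker T \<tau>) \<longleftrightarrow> X dvd s" for s
  proof -
    have "s \<odot>\<^bsub>E\<^esub> m \<in> sat E (Ker T \<tau>) \<longleftrightarrow> s \<odot>\<^bsub>T\<^esub> w \<in> tors T"
      by (rule sat_Ker_iff[OF _ _ \<tau>(1) \<tau>d(5)[OF mw]]) simp_all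
    also have "\<dots> \<longleftrightarrow> s * Y ^ K \<in> sat (LB i 0) (Ker T Q)"
      using sat_Ker_iff[OF _ _ Q(1) Qd(5)[OF Yw, of s]] by simp
    also have "\<dots> \<longleftrightarrow> X dvd s" unfolding Q(3) using X_dvd_Y_mult[of 1 K s] by (simp add: mult.commute)
    finally show ?thesis .
  qed
  have homg: "hom (LB (i - x) (- int K - y)) E (mulm E (g \<odot>\<^bsub>E\<^esub> m))" if g: "g \<in> S_piece p q (Vs x y)" for g x y
  proof (rule hom_mul[OF E])
    have "g \<odot>\<^bsub>E\<^esub> m \<in> piece E (Vs x y \<otimes>\<^bsub>L\<^esub> Vs (- i) (int K))"
      using piece_smult[OF obj_gm[OF E] g _ _ mp] by simp
    then show "g \<odot>\<^bsub>E\<^esub> m \<in> piece E (Vs (- (i - x)) (- (- int K - y)))" by (simp add: algebra_simps)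
  qed
  let ?A = "mulm E m"
  have A: "hom (LB i (- int K)) E ?A" using homg[of 1 0 0] S_piece_X[of 0] by simp
  have RangeA: "s \<odot>\<^bsub>E\<^esub> m \<in> Range ?A" for s by auto
  have As: "submodule (Range ?A) S_ring E" by (rule grel_Range[OF _ _ hom_grel[OF A]]) simp_all
  have sA: "submodule (sat E (Range ?A)) S_ring E" by (rule sat_submodule[OF _ As]) simp
  \<comment> \<open>By \<open>key\<close> for \<open>s = 1\<close>, the element \<open>m\<close> is
    outside the radical; uniseriality then puts the radical inside the span of
    \<open>m\<close>.\<close>
  have "\<not> Range ?A \<subseteq> sat E (Range B0)"
    using key[of 1] RangeA[of 1] X_dvd_one[of 1, where 'k='k] unfolding cok(2) by auto
  then have "Range B0 \<subseteq> sat E (Range ?A)" using uniserial_ranges[OF LB_simps(7) R0(1) E A B0(1) uni] by blast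
  then have KA: "sat E (Ker T \<tau>) \<subseteq> sat E (Range ?A)"
    unfolding cok(2) using sat_mono[of "Range B0" "sat E (Range ?A)" E] sat_sat[OF _ As] by simp
  \<comment> \<open>For \<open>e\<close> whose value in the top comes from \<open>f\<close>, both
    variables lead into the span of \<open>m\<close>: \<open>X\<close> moves \<open>e\<close> into
    the radical, and \<open>Y ^ K\<close> times \<open>e\<close> is congruent to \<open>f\<close>
    times \<open>m\<close> modulo the radical.\<close>
  have in_A: "e \<in> sat E (Range ?A)" if ev: "(e, v) \<in> \<tau>" and fv: "(f, v) \<in> Q" for e v f
  proof (rule satI_XY[OF _ As \<tau>d(1)[OF ev]])
    have "X * f \<in> sat (LB i 0) (Ker T Q)" by (simp add: Q(3))
    then have "X \<odot>\<^bsub>T\<^esub> v \<in> tors T" using sat_Ker_iff[OF _ _ Q(1) Qd(5)[OF fv, of X]] by simp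
    then have "X \<odot>\<^bsub>E\<^esub> e \<in> sat E (Ker T \<tau>)" using sat_Ker_iff[OF _ _ \<tau>(1) \<tau>d(5)[OF ev, of X]] by simp
    then show "X ^ 1 \<odot>\<^bsub>E\<^esub> e \<in> sat E (Range ?A)" using KA by auto
    have ec: "e \<in> carrier E" by (rule \<tau>d(1)[OF ev])
    have "(Y ^ K * f, Y ^ K \<odot>\<^bsub>T\<^esub> v) \<in> Q" "(Y ^ K * f, f \<odot>\<^bsub>T\<^esub> w) \<in> Q"
      using Qd(5)[OF fv, of "Y ^ K"] Qd(5)[OF Yw, of f] by (simp_all add: mult.commute)
    then have "teq T (Y ^ K \<odot>\<^bsub>T\<^esub> v) (f \<odot>\<^bsub>T\<^esub> w)"
      by (rule hom_teq[OF obj_smod[OF LB_simps(7)] obj_smod[OF T] Q(1)])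
        (rule teq_refl[OF obj_smod[OF LB_simps(7)]], simp)
    then have "Y ^ K \<odot>\<^bsub>T\<^esub> v \<ominus>\<^bsub>T\<^esub> f \<odot>\<^bsub>T\<^esub> w \<in> tors T" by (simp add: cg_def)
    moreover have "(Y ^ K \<odot>\<^bsub>E\<^esub> e \<ominus>\<^bsub>E\<^esub> f \<odot>\<^bsub>E\<^esub> m, Y ^ K \<odot>\<^bsub>T\<^esub> v \<ominus>\<^bsub>T\<^esub> f \<odot>\<^bsub>T\<^esub> w) \<in> \<tau>"
      by (rule grel_minus[OF _ _ hom_grel[OF \<tau>(1)] \<tau>d(5)[OF ev] \<tau>d(5)[OF mw]]) simp_all
    ultimately have "Y ^ K \<odot>\<^bsub>E\<^esub> e \<ominus>\<^bsub>E\<^esub> f \<odot>\<^bsub>E\<^esub> m \<in> sat E (Range ?A)"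
      using sat_Ker_iff[OF _ _ \<tau>(1)] KA by auto
    then have "cg E (sat E (Range ?A)) (Y ^ K \<odot>\<^bsub>E\<^esub> e) (f \<odot>\<^bsub>E\<^esub> m)" using ec by (simp add: cg_def)
    moreover have "f \<odot>\<^bsub>E\<^esub> m \<in> sat E (Range ?A)" using RangeA sat_incl[OF _ As] by auto
    ultimately show "Y ^ K \<odot>\<^bsub>E\<^esub> e \<in> sat E (Range ?A)" using cg_in[OF _ sA] by simp
  qed simp
  have "carrier E \<subseteq> sat E (Range ?A)"
  proof
    fix e assume e: "e \<in> carrier E"
    show "e \<in> sat E (Range ?A)"
    proof (rule sat_eventually[OF _ e], simp)
      show "\<forall>\<^sub>F s in irr. s \<odot>\<^bsub>E\<^esub> e \<in> sat E (Range ?A)"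
      proof (rule eventually_mono[OF hom_dom[OF \<tau>(1) e]])
        fix s assume "\<exists>v. (s \<odot>\<^bsub>E\<^esub> e, v) \<in> \<tau>"
        then obtain v where v: "(s \<odot>\<^bsub>E\<^esub> e, v) \<in> \<tau>" by blast
        show "s \<odot>\<^bsub>E\<^esub> e \<in> sat E (Range ?A)"
        proof (rule sat_eventually[OF _ \<tau>d(1)[OF v]], simp)
          have "\<forall>\<^sub>F u in irr. u \<odot>\<^bsub>T\<^esub> v \<in> Range Q" using Q(2) \<tau>d(2)[OF v] by (auto simp: sat_def)
          then show "\<forall>\<^sub>F u in irr. u \<odot>\<^bsub>E\<^esub> (s \<odot>\<^bsub>E\<^esub> e) \<in> sat E (Range ?A)"
            by (rule eventually_mono) (use in_A[OF \<tau>d(5)[OF v]] in auto)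
        qed
      qed
    qed
  qed
  then have SA: "sat E (Range ?A) = carrier E" by (auto simp: sat_def)
  \<comment> \<open>Hence \<open>E\<close> is cyclic up to torsion; uniseriality now determines the annihilator of \<open>m\<close>.\<close>
  define I where "I = Ker E ?A"
  have I: "s \<in> I \<longleftrightarrow> s \<odot>\<^bsub>E\<^esub> m = \<zero>\<^bsub>E\<^esub>" for s by (auto simp: I_def Ker_def)
  have Ig: "graded_submodule p q (LB i (- int K)) I" unfolding I_def by (rule Ker_graded[OF LB_simps(7) E hom_grel[OF A]])
  note Is = smod_submoduleD[OF obj_smod[OF LB_simps(7)] graded_submoduleD(1)[OF Ig], simplified]
  have IX: "X dvd s" if "s \<in> I" for s
  proof -
    have "s \<odot>\<^bsub>E\<^esub> m \<in> sat E (Ker T \<tau>)" using that smod_submoduleD(2)[OF _ sat_submodule[OF _ graded_submoduleD(1)[OF Ker_graded[OF E T hom_grel[OF \<tau>(1)]]]]]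
      by (simp add: I)
    then show ?thesis using key by simp
  qed
  \<comment> \<open>An inclusion between spans up to saturation, written as two relations in the
    annihilator, one for a power of each variable.\<close>
  have cmpE: "\<exists>k s s'. X ^ k * g - s * h \<in> I \<and> Y ^ k * g - s' * h \<in> I"
    if "g \<odot>\<^bsub>E\<^esub> m \<in> sat E (Range (mulm E (h \<odot>\<^bsub>E\<^esub> m)))" for g h
  proof -
    have "\<forall>\<^sub>F u in irr. u \<odot>\<^bsub>E\<^esub> (g \<odot>\<^bsub>E\<^esub> m) \<in> Range (mulm E (h \<odot>\<^bsub>E\<^esub> m))" using that by (simp add: sat_def)
    then obtain k where k: "X ^ k \<odot>\<^bsub>E\<^esub> (g \<odot>\<^bsub>E\<^esub> m) \<in> Range (mulm E (h \<odot>\<^bsub>E\<^esub> m))"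
      "Y ^ k \<odot>\<^bsub>E\<^esub> (g \<odot>\<^bsub>E\<^esub> m) \<in> Range (mulm E (h \<odot>\<^bsub>E\<^esub> m))" by (rule eventually_XY_ex)
    have "\<exists>s. u * g - s * h \<in> I" if ug: "u \<odot>\<^bsub>E\<^esub> (g \<odot>\<^bsub>E\<^esub> m) \<in> Range (mulm E (h \<odot>\<^bsub>E\<^esub> m))" for u
    proof -
      obtain s where "u \<odot>\<^bsub>E\<^esub> (g \<odot>\<^bsub>E\<^esub> m) = s \<odot>\<^bsub>E\<^esub> (h \<odot>\<^bsub>E\<^esub> m)" using ug by (auto simp: Range_iff)
      then have "(u * g) \<odot>\<^bsub>E\<^esub> m = (s * h) \<odot>\<^bsub>E\<^esub> m" by (simp add: smod_smult)
      moreover have "(u * g - s * h) \<odot>\<^bsub>E\<^esub> m = (u * g) \<odot>\<^bsub>E\<^esub> m \<ominus>\<^bsub>E\<^esub> (s * h) \<odot>\<^bsub>E\<^esub> m"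
        using smod_smult(1)[OF obj_smod[OF E] mc, of "u * g" "- 1 * (s * h)"] by (simp add: smod_minus smod_smult)
      ultimately have "(u * g - s * h) \<odot>\<^bsub>E\<^esub> m = \<zero>\<^bsub>E\<^esub>" by simp
      then show ?thesis by (auto simp: I intro!: exI[of _ s])
    qed
    then show ?thesis using k by blast
  qed
  have cmp: "g \<odot>\<^bsub>E\<^esub> m \<in> sat E (Range (mulm E (h \<odot>\<^bsub>E\<^esub> m))) \<or> h \<odot>\<^bsub>E\<^esub> m \<in> sat E (Range (mulm E (g \<odot>\<^bsub>E\<^esub> m)))"
    if "g \<in> S_piece p q (Vs x y)" "h \<in> S_piece p q (Vs x' y')" for g h x y x' y'
  proof -
    have "f \<odot>\<^bsub>E\<^esub> m \<in> Range (mulm E (f \<odot>\<^bsub>E\<^esub> m))" for f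
    proof -
      have "(1, f \<odot>\<^bsub>E\<^esub> m) \<in> mulm E (f \<odot>\<^bsub>E\<^esub> m)" by simp
      then show ?thesis by blast
    qed
    then show ?thesis using uniserial_ranges[OF LB_simps(7) LB_simps(7) E homg[OF that(1)] homg[OF that(2)] uni] by blast
  qed
  have nY: "\<not> Y \<odot>\<^bsub>E\<^esub> m \<in> sat E (Range (mulm E (X \<odot>\<^bsub>E\<^esub> m)))"
  proof
    assume "Y \<odot>\<^bsub>E\<^esub> m \<in> sat E (Range (mulm E (X \<odot>\<^bsub>E\<^esub> m)))"
    then obtain k s where "Y ^ k * Y - s * X \<in> I" using cmpE by blast
    then have "X dvd (Y ^ k * Y - s * X) + s * X" using IX by (intro dvd_add) auto
    then show False using X_not_dvd_Y[of "Suc k", where 'a='k] by (simp add: mult.commute)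
  qed
  \<comment> \<open>The multiple of \<open>m\<close> by \<open>Y\<close> is not in the span of that
    by \<open>X\<close>, so the opposite inclusion holds. It shows that \<open>I\<close> contains a
    power of \<open>X\<close> plus a multiple of \<open>Y\<close>, in particular that
    \<open>I\<close> is not zero.\<close>
  then have "X \<odot>\<^bsub>E\<^esub> m \<in> sat E (Range (mulm E (Y \<odot>\<^bsub>E\<^esub> m)))"
    using cmp[of X 1 0 Y 0 1] S_piece_XY[of 1 0, where 'a='k] S_piece_XY[of 0 1, where 'a='k] by simp
  then obtain n s where f0: "X ^ n * X - s * Y \<in> I" using cmpE by blast
  \<comment> \<open>The degree of \<open>X ^ (n + 1)\<close> in \<open>LB i (- int K)\<close>. The
    multiple of \<open>Y\<close> cannot cancel this monomial, so the component \<open>f1\<close> is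
    a nonzero homogeneous member of \<open>I\<close>.\<close>
  define d1 where "d1 = Vs (int n + 1 - i) (int K)"
  define f1 where "f1 = comp (LB i (- int K)) (X ^ n * X - s * Y) d1"
  have f1I: "f1 \<in> I" unfolding f1_def by (rule graded_submoduleD(2)[OF Ig f0]) (simp add: d1_def)
  have f1S: "f1 \<in> S_piece p q (Vs (int n + 1) 0)"
    unfolding f1_def using comp_LB_piece[of d1 i "- int K"] by (simp add: d1_def)
  have "co f1 (Suc n) 0 = 1"
    unfolding f1_def using co_X[of "Suc n" "1 :: 'k poly poly" "Suc n" 0] co_Y[of 1 s "Suc n" 0]
    by (simp add: co_comp_LB d1_def co_one mult.commute add.commute)
  then have "f1 \<noteq> 0" by auto
  obtain e' n' c h where f1: "c \<noteq> 0" "f1 = X ^ e' * ([:[:c:]:] * Y ^ n' + X * h)"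
    by (rule homogeneous_form[OF f1S \<open>f1 \<noteq> 0\<close>])
  define v where "v = [:[:c:]:] * Y ^ n' + X * h"
  have cv: "co v 0 n' = c" using co_X[of 1 h 0 n'] by (simp add: v_def co_Y_power)
  have nX: "\<not> X dvd v" using X_dvd_iff[of 1 v] cv f1(1) by auto
  \<comment> \<open>Members of \<open>I\<close> are divisible by \<open>X\<close> while
    \<open>v\<close> is not, so \<open>f1\<close> must contain a factor \<open>X\<close>.\<close>
  have e': "e' \<ge> 1" using IX[OF f1I] nX unfolding f1(2) v_def[symmetric] by (cases e') auto
  have vS: "v \<in> S_piece p q (Vs (int n + 1 - int e') 0)"
    unfolding S_piece_iff
  proof (intro allI impI)
    fix a b assume "co v a b \<noteq> 0"
    then have "co f1 (a + e') b \<noteq> 0" unfolding f1(2) v_def[symmetric] co_X by simp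
    then have "Vs (int (a + e')) (int b) = Vs (int n + 1) 0" using f1S unfolding S_piece_iff by blast
    then have "Vs (- int e') 0 \<otimes>\<^bsub>L\<^esub> Vs (int (a + e')) (int b) = Vs (- int e') 0 \<otimes>\<^bsub>L\<^esub> Vs (int n + 1) 0" by simp
    then show "Vs (int a) (int b) = Vs (int n + 1 - int e') 0" by (simp add: algebra_simps)
  qed
  \<comment> \<open>Otherwise \<open>Y ^ k * v\<close> would be congruent modulo \<open>I\<close> to
    a multiple of \<open>X ^ e'\<close>, hence divisible by \<open>X\<close>.\<close>
  have "\<not> v \<odot>\<^bsub>E\<^esub> m \<in> sat E (Range (mulm E (X ^ e' \<odot>\<^bsub>E\<^esub> m)))"
  proof
    assume "v \<odot>\<^bsub>E\<^esub> m \<in> sat E (Range (mulm E (X ^ e' \<odot>\<^bsub>E\<^esub> m)))"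
    then obtain k s where "Y ^ k * v - s * X ^ e' \<in> I" using cmpE by blast
    then have "X dvd (Y ^ k * v - s * X ^ e') + s * X ^ e'" using IX e' by (intro dvd_add) auto
    then show False using nX X_dvd_Y_mult[of 1 k v] by simp
  qed
  then have "X ^ e' \<odot>\<^bsub>E\<^esub> m \<in> sat E (Range (mulm E (v \<odot>\<^bsub>E\<^esub> m)))"
    using cmp[OF vS S_piece_X[of e']] by blast
  then obtain k2 s2 s2' where k2: "X ^ k2 * X ^ e' - s2 * v \<in> I" "Y ^ k2 * X ^ e' - s2' * v \<in> I" using cmpE by blast
  \<comment> \<open>Multiplication by \<open>X ^ e'\<close> turns \<open>v\<close> into
    \<open>f1\<close>, which lies in \<open>I\<close>. Hence the doubled exponent.\<close>
  have X2: "z * X ^ (2 * e') \<in> I" if "z * X ^ e' - s * v \<in> I" for z s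
  proof -
    have "X ^ e' * (z * X ^ e' - s * v) + s * f1 \<in> I" by (intro Is(3) Is(4) that f1I)
    moreover have "X ^ (2 * e') = (X ^ e' * X ^ e' :: 'k poly poly)" by (simp add: mult_2 power_add)
    ultimately show ?thesis unfolding f1(2) v_def[symmetric] by (simp add: algebra_simps)
  qed
  have "X ^ (2 * e') \<in> sat (LB i (- int K)) I"
  proof (rule satI_XY[OF obj_smod[OF LB_simps(7)] graded_submoduleD(1)[OF Ig]])
    have "I \<subseteq> sat (LB i (- int K)) I" by (rule sat_incl[OF obj_smod[OF LB_simps(7)] graded_submoduleD(1)[OF Ig]])
    then show "X ^ k2 \<odot>\<^bsub>LB i (- int K)\<^esub> X ^ (2 * e') \<in> sat (LB i (- int K)) I"
      "Y ^ k2 \<odot>\<^bsub>LB i (- int K)\<^esub> X ^ (2 * e') \<in> sat (LB i (- int K)) I"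
      using X2[OF k2(1)] X2[OF k2(2)] by auto
  qed simp
  then obtain l where "sat (LB i (- int K)) I = {f. X ^ l dvd f}" by (rule sat_ideal[OF Ig])
  then have "pres i (- int K) l E ?A" using A SA by (simp add: pres_def I_def)
  then have tl: "tube i l E" by (rule tubeI[OF E])
  then show ?thesis using tube_has_length_iff[OF tl] len by simp
qed

end

section \<open>The factorization\<close>

context weights
begin

text \<open>As \<open>e\<close> is an epimorphism, the range of \<open>m\<close> is that of the
  composite up to saturation, and this is contained in the range of \<open>m'\<close>.\<close>

lemma factors_through_of_factorizations:
  fixes A B E Z :: "'k::alg_closed_field sheaf"
  assumes A: "obj A" and B: "obj B" and E: "obj E" and Z: "obj Z"
    and e: "is_epimorphism C A E e" and m: "is_monomorphism C E B m"
    and e': "e' \<in> Arr C A Z" and m': "is_monomorphism C Z B m'" and eq: "Comp C m e = Comp C m' e'"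
  shows "factors_through C E m Z m'"
proof -
  obtain U where U: "hom A E U" "e = arr A E U" using e A E by (auto simp: is_epimorphism_def Arr_iff)
  obtain U' where U': "hom A Z U'" "e' = arr A Z U'" using e' A Z by (auto simp: Arr_iff)
  have M: "\<exists>T. hom E B T \<and> m = arr E B T" "\<exists>T. hom Z B T \<and> m' = arr Z B T"
    using m m' E Z B by (auto simp: is_monomorphism_def Arr_iff)
  obtain T where T: "hom E B T" "m = arr E B T" using M(1) by blast
  obtain T' where T': "hom Z B T'" "m' = arr Z B T'" using M(2) by blast
  note UT = hom_comp[OF A E B U(1) T(1)] and UT' = hom_comp[OF A Z B U'(1) T'(1)]
  have ee: "eqv B (U O T) (U' O T')"
    using eq unfolding U(2) U'(2) T(2) T'(2) Comp_arr[OF A E B U(1) T(1)] Comp_arr[OF A Z B U'(1) T'(1)]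
      arr_eq_iff[OF A B UT UT'] .
  have S: "sat E (Range U) = carrier E" using e epi_iff[OF A E U(1)] by (simp add: U(2))
  have K': "Ker B T' \<subseteq> tors Z" using m' mono_iff[OF Z B T'(1)] by (simp add: T'(2))
  note Td = grelD[OF hom_grel[OF T(1)]] and Ud = grelD[OF hom_grel[OF U(1)]]
  note W = graded_submoduleD(1)[OF Range_graded[OF Z B hom_grel[OF T'(1)]]]
  have "Range T \<subseteq> sat B (Range T')"
  proof
    fix x assume "x \<in> Range T"
    then obtain \<epsilon> where x: "(\<epsilon>, x) \<in> T" by blast
    have "\<forall>\<^sub>F s in irr. s \<odot>\<^bsub>E\<^esub> \<epsilon> \<in> Range U" using S Td(1)[OF x] by (auto simp: sat_def)
    then have "\<forall>\<^sub>F s in irr. s \<odot>\<^bsub>B\<^esub> x \<in> sat B (Range T')"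
    proof (rule eventually_mono)
      fix s assume "s \<odot>\<^bsub>E\<^esub> \<epsilon> \<in> Range U"
      then obtain a where a: "(a, s \<odot>\<^bsub>E\<^esub> \<epsilon>) \<in> U" by blast
      then have ax: "(a, s \<odot>\<^bsub>B\<^esub> x) \<in> U O T" using Td(5)[OF x, of s] by blast
      show "s \<odot>\<^bsub>B\<^esub> x \<in> sat B (Range T')"
      proof (rule sat_eventually[OF obj_smod[OF B] Td(2)[OF Td(5)[OF x]]])
        show "\<forall>\<^sub>F t in irr. t \<odot>\<^bsub>B\<^esub> (s \<odot>\<^bsub>B\<^esub> x) \<in> sat B (Range T')"
        proof (rule eventually_mono[OF hom_dom[OF UT' Ud(1)[OF a]]])
          fix t assume "\<exists>y. (t \<odot>\<^bsub>A\<^esub> a, y) \<in> U' O T'"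
          then obtain y where y: "(t \<odot>\<^bsub>A\<^esub> a, y) \<in> U' O T'" by blast
          have "teq B (t \<odot>\<^bsub>B\<^esub> (s \<odot>\<^bsub>B\<^esub> x)) y"
            by (rule eqvD[OF ee grelD(5)[OF hom_grel[OF UT] ax] y])
          moreover have "y \<in> sat B (Range T')" using y sat_incl[OF obj_smod[OF B] W] by auto
          ultimately show "t \<odot>\<^bsub>B\<^esub> (s \<odot>\<^bsub>B\<^esub> x) \<in> sat B (Range T')"
            by (rule sat_cg[OF obj_smod[OF B] W teq_sym[OF obj_smod[OF B]]])
        qed
      qed
    qed
    then show "x \<in> sat B (Range T')" by (rule sat_eventually[OF obj_smod[OF B] Td(2)[OF x]])
  qed
  then show ?thesis unfolding T(2) T'(2) factors_through_iff[OF E Z B T(1) T'(1) K'] .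
qed

text \<open>The two monomorphisms factor through each other; cancelling them shows that the
  factoring maps are mutually inverse and compatible with the epimorphisms.\<close>

lemma factorization_unique:
  fixes A B E Z :: "'k::alg_closed_field sheaf"
  assumes A: "obj A" and B: "obj B"
    and f: "epi_mono_factorization C A B f E e m" and f': "epi_mono_factorization C A B f Z e' m'"
  shows "\<exists>u. is_isomorphism C E Z u \<and> Comp C u e = e' \<and> Comp C m' u = m"
proof -
  have E: "obj E" and e: "is_epimorphism C A E e" and m: "is_monomorphism C E B m" and fe: "f = Comp C m e"
    using f by (auto simp: epi_mono_factorization_def Obj_coh)
  have Z: "obj Z" and e': "is_epimorphism C A Z e'" and m': "is_monomorphism C Z B m'" and fe': "f = Comp C m' e'"
    using f' by (auto simp: epi_mono_factorization_def Obj_coh)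
  have eA: "e \<in> Arr C A E" "e' \<in> Arr C A Z" and mA: "m \<in> Arr C E B" "m' \<in> Arr C Z B"
    using e e' m m' by (auto simp: is_epimorphism_def is_monomorphism_def)
  have eq: "Comp C m e = Comp C m' e'" using fe fe' by simp
  obtain u where u: "u \<in> Arr C E Z" "m = Comp C m' u"
    using factors_through_of_factorizations[OF A B E Z e m eA(2) m' eq] unfolding factors_through_def by (rule bexE)
  obtain u' where u': "u' \<in> Arr C Z E" "m' = Comp C m u'"
    using factors_through_of_factorizations[OF A B Z E e' m' eA(1) m eq[symmetric]] unfolding factors_through_def by (rule bexE)
  have cancel: "g = h" if "obj W" "is_monomorphism C D B n" "g \<in> Arr C W D" "h \<in> Arr C W D" "Comp C n g = Comp C n h"
    for W D n g h
    using that(2)[unfolded is_monomorphism_def, THEN conjunct2, rule_format, of W g h] that by (simp add: Obj_coh)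
  have id: "Ident C W \<in> Arr C W W" if "obj W" for W :: "'k sheaf"
    unfolding Ident_coh by (rule arr_in[OF that that hom_Id[OF that]])
  have idr: "Comp C n (Ident C W) = n" if W: "obj W" and n: "n \<in> Arr C W B" for W n
  proof -
    obtain R where "hom W B R" "n = arr W B R" using n unfolding Arr_iff[OF W B] by blast
    then show ?thesis using Comp_Id(1)[OF W B] by simp
  qed
  have "Comp C u' u = Ident C E"
  proof (rule cancel[OF E m _ id[OF E]])
    show "Comp C u' u \<in> Arr C E E" by (rule Comp_assoc(2)[OF E Z E B u(1) u'(1) mA(1)])
    show "Comp C m (Comp C u' u) = Comp C m (Ident C E)"
      unfolding Comp_assoc(1)[OF E Z E B u(1) u'(1) mA(1)] u'(2)[symmetric] u(2)[symmetric] idr[OF E mA(1)] ..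
  qed
  moreover have "Comp C u u' = Ident C Z"
  proof (rule cancel[OF Z m' _ id[OF Z]])
    show "Comp C u u' \<in> Arr C Z Z" by (rule Comp_assoc(2)[OF Z E Z B u'(1) u(1) mA(2)])
    show "Comp C m' (Comp C u u') = Comp C m' (Ident C Z)"
      unfolding Comp_assoc(1)[OF Z E Z B u'(1) u(1) mA(2)] u(2)[symmetric] u'(2)[symmetric] idr[OF Z mA(2)] ..
  qed
  ultimately have "is_isomorphism C E Z u" using u(1) u'(1) unfolding is_isomorphism_def by blast
  moreover have "Comp C u e = e'"
  proof (rule cancel[OF A m' _ eA(2)])
    show "Comp C u e \<in> Arr C A Z" by (rule Comp_assoc(2)[OF A E Z B eA(1) u(1) mA(2)])
    show "Comp C m' (Comp C u e) = Comp C m' e'"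
      unfolding Comp_assoc(1)[OF A E Z B eA(1) u(1) mA(2)] u(2)[symmetric] by (rule eq)
  qed
  ultimately show ?thesis using u(2)[symmetric] by (intro exI[of _ u] conjI)
qed

definition factors_uniquely :: "'k::alg_closed_field sheaf \<Rightarrow> 'k sheaf \<Rightarrow> 'k sheaf \<Rightarrow> bool" where
  "factors_uniquely E\<^sub>1 E E\<^sub>2 \<longleftrightarrow> (\<exists>f\<in>Arr C E\<^sub>1 E\<^sub>2. \<not> zero_arrow C E\<^sub>1 E\<^sub>2 f \<and>
      (\<exists>e m. epi_mono_factorization C E\<^sub>1 E\<^sub>2 f E e m \<and>
        (\<forall>X e' m'. epi_mono_factorization C E\<^sub>1 E\<^sub>2 f X e' m' \<longrightarrow>
          (\<exists>u. is_isomorphism C E X u \<and> Comp C u e = e' \<and> Comp C m' u = m))))"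

end

context side
begin

text \<open>The line bundle \<open>LB i b\<close> covers both \<open>E\<^sub>1\<close> and
  \<open>E\<close>. The kernel of the first cover lies in that of the second, so
  \<open>E\<^sub>1\<close> maps onto \<open>E\<close>, while \<open>E\<close> is the image of
  \<open>X ^ k\<close> in \<open>E\<^sub>2\<close>. The composite is nonzero because
  \<open>l \<ge> 1\<close> makes \<open>E\<close> nonzero.\<close>

lemma factors_uniquely_of_cover:
  fixes E E\<^sub>1 E\<^sub>2 :: "'k::alg_closed_field sheaf"
  assumes E1: "obj E\<^sub>1" and R: "hom (LB i b) E\<^sub>1 R" "sat E\<^sub>1 (Range R) = carrier E\<^sub>1"
    "sat (LB i b) (Ker E\<^sub>1 R) \<subseteq> {f. X ^ l dvd f}"
    and t: "tube i l E" and t2: "tube (i + int k) (l + k) E\<^sub>2" and l: "l \<ge> 1"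
  shows "factors_uniquely E\<^sub>1 E E\<^sub>2"
proof -
  have E: "obj E" and E2: "obj E\<^sub>2" using tube_obj t t2 by blast+
  obtain P where P: "pres i b l E P" using t by (rule tubeE)
  obtain P2 where P2: "pres (i + int k) b (l + k) E\<^sub>2 P2" using t2 by (rule tubeE)
  define U where "U = R\<inverse> O P"
  note U = pres_descend[OF E1 E R P, folded U_def]
  \<comment> \<open>Top and length of \<open>E\<close> are written as those of
    \<open>E\<^sub>2\<close> lowered by \<open>k\<close>, the form in which
    \<open>pres_embed\<close> expects a subobject.\<close>
  have P': "pres (i + int k - int k) b (l + k - k) E P" using P by simp
  define B where "B = P\<inverse> O (mulm (LB (i + int k) b) (X ^ k) O P2)"
  note B = pres_embed(1,2)[OF E E2 P2 _ P', folded B_def, simplified]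
  note UB = hom_comp[OF E1 E E2 U(1) B(1)]
  let ?f = "arr E\<^sub>1 E\<^sub>2 (U O B)"
  note Ud = grelD[OF hom_grel[OF U(1)]] and Bd = grelD[OF hom_grel[OF B(1)]]
  have nz: "\<not> zero_arrow C E\<^sub>1 E\<^sub>2 ?f"
  proof
    assume "zero_arrow C E\<^sub>1 E\<^sub>2 ?f"
    then have z: "Range (U O B) \<subseteq> tors E\<^sub>2" using zero_arrow_iff[OF E1 E2 UB] by simp
    have "carrier E \<subseteq> tors E"
    proof
      fix x assume x: "x \<in> carrier E"
      then have "\<forall>\<^sub>F s in irr. s \<odot>\<^bsub>E\<^esub> x \<in> Range U" using U(3) by (auto simp: sat_def)
      then have "\<forall>\<^sub>F s in irr. s \<odot>\<^bsub>E\<^esub> x \<in> tors E"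
      proof (rule eventually_mono)
        fix s assume "s \<odot>\<^bsub>E\<^esub> x \<in> Range U"
        then obtain a where a: "(a, s \<odot>\<^bsub>E\<^esub> x) \<in> U" by blast
        have "\<forall>\<^sub>F t in irr. t \<odot>\<^bsub>E\<^esub> (s \<odot>\<^bsub>E\<^esub> x) \<in> tors E"
        proof (rule eventually_mono[OF hom_dom[OF B(1) Ud(2)[OF a]]])
          fix t assume "\<exists>y. (t \<odot>\<^bsub>E\<^esub> (s \<odot>\<^bsub>E\<^esub> x), y) \<in> B"
          then obtain y where y: "(t \<odot>\<^bsub>E\<^esub> (s \<odot>\<^bsub>E\<^esub> x), y) \<in> B" by blast
          then have "y \<in> tors E\<^sub>2" using z Ud(5)[OF a, of t] by blast
          then show "t \<odot>\<^bsub>E\<^esub> (s \<odot>\<^bsub>E\<^esub> x) \<in> tors E"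
            by (rule mono_tors[OF obj_smod[OF E] obj_smod[OF E2] hom_grel[OF B(1)] B(2) y])
        qed
        then show "s \<odot>\<^bsub>E\<^esub> x \<in> tors E" by (rule tors_eventually[OF obj_smod[OF E] Ud(2)[OF a]])
      qed
      then show "x \<in> tors E" by (rule tors_eventually[OF obj_smod[OF E] x])
    qed
    then show False using tube_zero_iff[OF t] l E by (simp add: zero_object_iff)
  qed
  have fac: "epi_mono_factorization C E\<^sub>1 E\<^sub>2 ?f E (arr E\<^sub>1 E U) (arr E E\<^sub>2 B)"
    unfolding epi_mono_factorization_def Obj_coh epi_iff[OF E1 E U(1)] mono_iff[OF E E2 B(1)]
      Comp_arr[OF E1 E E2 U(1) B(1)]
    using E U(3) B(2) by simp
  show ?thesis
    unfolding factors_uniquely_def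
    using arr_in[OF E1 E2 UB] nz fac factorization_unique[OF E1 E2 fac] by blast
qed

lemma factors_uniquely_line_bundle:
  assumes "tube i l E" "tube (i + int k) (l + k) E\<^sub>2" "l \<ge> 1"
  shows "factors_uniquely (LB i b) E E\<^sub>2"
proof (rule factors_uniquely_of_cover[OF LB_simps(7) hom_Id[OF LB_simps(7)] _ _ assms])
  show "sat (LB i b) (Range (Id_on (carrier (LB i b)))) = carrier (LB i b)"
    using sat_incl[OF obj_smod[OF LB_simps(7)] carrier_submodule[OF obj_smod[OF LB_simps(7)]], of i b]
    by (auto simp: sat_def)
  have "Ker (LB i b) (Id_on (carrier (LB i b))) \<subseteq> {f. X ^ l dvd f}" by (auto simp: Ker_def)
  then show "sat (LB i b) (Ker (LB i b) (Id_on (carrier (LB i b)))) \<subseteq> {f. X ^ l dvd f}"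
    using sat_mono[of _ "{f. X ^ l dvd f}" "LB i b"] unfolding sat_X_ideal by blast
qed

lemma factors_uniquely_tube:
  assumes t1: "tube i l\<^sub>1 E\<^sub>1" and "tube i l E" "tube (i + int k) (l + k) E\<^sub>2" "l \<ge> 1" "l \<le> l\<^sub>1"
  shows "factors_uniquely E\<^sub>1 E E\<^sub>2"
proof -
  obtain R where R: "pres i 0 l\<^sub>1 E\<^sub>1 R" using t1 by (rule tubeE)
  show ?thesis
  proof (rule factors_uniquely_of_cover[OF tube_obj[OF t1] presD(1,2)[OF R] _ assms(2-4)])
    show "sat (LB i 0) (Ker E\<^sub>1 R) \<subseteq> {f. X ^ l dvd f}"
      unfolding presD(3)[OF R] using assms(5) by (auto intro: power_le_dvd)
  qed
qed

text \<open>From here on the categorical description of the tubes is replaced by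
  presentations.\<close>

lemma is_tube_iff:
  assumes "j \<ge> 1"
  shows "(\<exists>T. is_S i T \<and> is_uniserial_with_top C T j E) \<longleftrightarrow> tube i j E"
proof
  assume "\<exists>T. is_S i T \<and> is_uniserial_with_top C T j E"
  then show "tube i j E" using uniserial_with_top_tube is_S_tube by blast
next
  assume t: "tube i j E"
  obtain T :: "'a sheaf" where "is_S i T" using is_S_exists by blast
  then show "\<exists>T. is_S i T \<and> is_uniserial_with_top C T j E"
    using tube_uniserial_with_top[OF t assms is_S_tube] by blast
qed

end

section \<open>The sheaves attached to arcs and their factorizations\<close>

context weights
begin

sublocale inf: side p q False ..
sublocale zero: side p q True ..

lemma inf_LB: "inf.LB i b = lb i b" and zero_LB: "zero.LB i b = lb b i"
  by (simp_all add: inf.LB_def zero.LB_def)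

lemma is_tube_inf_iff: "j \<ge> 1 \<Longrightarrow> is_tube_inf p q i j E \<longleftrightarrow> inf.tube i j E"
  using inf.is_tube_iff[of j i E]
  by (simp add: is_tube_inf_def is_S_inf_def inf.is_S_def inf_LB inf.X_def Let_def)

lemma is_tube_zero_iff: "j \<ge> 1 \<Longrightarrow> is_tube_zero p q i j E \<longleftrightarrow> zero.tube i j E"
  using zero.is_tube_iff[of j i E]
  by (simp add: is_tube_zero_def is_S_zero_def zero.is_S_def zero_LB zero.X_def Let_def)

lemma translate_zero [simp]: "translate_point p q 0 x = x"
  by (cases x) auto

lemma annulus_arc_eq:
  assumes "annulus_arc p q \<gamma> = annulus_arc p q \<gamma>'"
  obtains k where "\<gamma> = map_prod (translate_point p q k) (translate_point p q k) \<gamma>'"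
proof -
  have "\<gamma> = map_prod (translate_point p q 0) (translate_point p q 0) \<gamma>" by (cases \<gamma>) simp
  then have "\<gamma> \<in> annulus_arc p q \<gamma>" unfolding annulus_arc_def by blast
  then show ?thesis using assms that by (auto simp: annulus_arc_def)
qed

text \<open>The standard object shows that the choice in \<open>phi\<close> has a candidate. The
  chosen sheaf may belong to another lift of the arc, but lifts differ by a full period, which
  \<open>tube_periodic\<close> absorbs; the kinds of endpoints rule out the other two
  clauses.\<close>

lemma phi_upper:
  assumes "b - a \<ge> 2"
  shows "inf.tube b (nat (b - a - 1)) (phi p q (annulus_arc p q (upper_arc a b)) :: 'k::alg_closed_field sheaf)"
proof -
  let ?A = "annulus_arc p q (upper_arc a b)" and ?j = "nat (b - a - 1)"
  have j: "?j \<ge> 1" using assms by simp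
  have "represents p q ?A (inf.Std b 0 ?j :: 'k sheaf)"
    unfolding represents_def
    by (rule disjI2, rule disjI1, rule exI[of _ b], rule exI[of _ ?j])
      (use assms in \<open>simp add: is_tube_inf_iff[OF j] inf.tube_Std\<close>)
  then have "represents p q ?A (phi p q ?A :: 'k sheaf)" unfolding phi_def by (rule someI)
  then consider (bridge) i j where "?A = annulus_arc p q (bridging_arc i j)"
    | (upper) i j where "j \<ge> 1" "?A = annulus_arc p q (upper_arc (i - int j - 1) i)" "is_tube_inf p q i j (phi p q ?A :: 'k sheaf)"
    | (lower) i j where "?A = annulus_arc p q (lower_arc (- i) (int j - i + 1))"
    unfolding represents_def by blast
  then show ?thesis
  proof cases
    case bridge
    then show ?thesis by (rule annulus_arc_eq) (simp add: upper_arc_def bridging_arc_def)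
  next
    case upper
    from upper(2) obtain k where "upper_arc a b = map_prod (translate_point p q k) (translate_point p q k) (upper_arc (i - int j - 1) i)"
      by (rule annulus_arc_eq)
    then have "b = i + k * inf.wX" "?j = j" by (auto simp: upper_arc_def inf.wX_def)
    then show ?thesis using upper(3) is_tube_inf_iff[OF upper(1)] inf.tube_periodic by metis
  next
    case lower
    then show ?thesis by (rule annulus_arc_eq) (simp add: upper_arc_def lower_arc_def)
  qed
qed

text \<open>On the lower boundary the top is governed by the starting point with reversed sign,
  whereas on the upper boundary it is the ending point.\<close>

lemma phi_lower:
  assumes "b - a \<ge> 2"
  shows "zero.tube (- a) (nat (b - a - 1)) (phi p q (annulus_arc p q (lower_arc a b)) :: 'k::alg_closed_field sheaf)"
proof -
  let ?A = "annulus_arc p q (lower_arc a b)" and ?j = "nat (b - a - 1)"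
  have j: "?j \<ge> 1" using assms by simp
  have "represents p q ?A (zero.Std (- a) 0 ?j :: 'k sheaf)"
    unfolding represents_def
    by (rule disjI2, rule disjI2, rule exI[of _ "- a"], rule exI[of _ ?j])
      (use assms in \<open>simp add: is_tube_zero_iff[OF j] zero.tube_Std\<close>)
  then have "represents p q ?A (phi p q ?A :: 'k sheaf)" unfolding phi_def by (rule someI)
  then consider (bridge) i j where "?A = annulus_arc p q (bridging_arc i j)"
    | (upper) i j where "?A = annulus_arc p q (upper_arc (i - int j - 1) i)"
    | (lower) i j where "j \<ge> 1" "?A = annulus_arc p q (lower_arc (- i) (int j - i + 1))" "is_tube_zero p q i j (phi p q ?A :: 'k sheaf)"
    unfolding represents_def by blast
  then show ?thesis
  proof cases
    case bridge
    then show ?thesis by (rule annulus_arc_eq) (simp add: lower_arc_def bridging_arc_def)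
  next
    case lower
    from lower(2) obtain k where "lower_arc a b = map_prod (translate_point p q k) (translate_point p q k) (lower_arc (- i) (int j - i + 1))"
      by (rule annulus_arc_eq)
    then have "- a = i + (- k) * zero.wX" "?j = j" by (auto simp: lower_arc_def zero.wX_def)
    then show ?thesis using lower(3) is_tube_zero_iff[OF lower(1)] zero.tube_periodic by metis
  next
    case upper
    then show ?thesis by (rule annulus_arc_eq) (simp add: upper_arc_def lower_arc_def)
  qed
qed

text \<open>Here the sheaf is determined as a record and not merely up to isomorphism: translating
  the arc does not change \<open>V i (- j)\<close>, and the twist enters the module only through
  this degree.\<close>

lemma phi_bridging:
  "phi p q (annulus_arc p q (bridging_arc i j)) = (line_bundle p q i (- j) :: 'k::alg_closed_field sheaf)"
proof -
  let ?A = "annulus_arc p q (bridging_arc i j)"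
  have "represents p q ?A (lb i (- j) :: 'k sheaf)"
    unfolding represents_def by blast
  then have "represents p q ?A (phi p q ?A :: 'k sheaf)" unfolding phi_def by (rule someI)
  then consider (bridge) i' j' where "?A = annulus_arc p q (bridging_arc i' j')" "(phi p q ?A :: 'k sheaf) = lb i' (- j')"
    | (upper) i j where "?A = annulus_arc p q (upper_arc (i - int j - 1) i)"
    | (lower) i j where "?A = annulus_arc p q (lower_arc (- i) (int j - i + 1))"
    unfolding represents_def by blast
  then show ?thesis
  proof cases
    case bridge
    from bridge(1) obtain k where "bridging_arc i j = map_prod (translate_point p q k) (translate_point p q k) (bridging_arc i' j')"
      by (rule annulus_arc_eq)
    then have "i = i' + k * int p" "j = j' + k * int q" by (auto simp: bridging_arc_def)
    then have "V i' (- j') = V i (- j)" by (auto simp: Lvec_eq_iff)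
    then show ?thesis unfolding bridge(2) by (simp add: line_bundle_def)
  next
    case upper
    then show ?thesis by (rule annulus_arc_eq) (simp add: upper_arc_def bridging_arc_def)
  next
    case lower
    then show ?thesis by (rule annulus_arc_eq) (simp add: lower_arc_def bridging_arc_def)
  qed
qed

text \<open>Both peripheral arcs on the right start at \<open>a\<close>, so their tops
  \<open>d\<close>, \<open>b\<close> and their lengths \<open>d - a - 1\<close>,
  \<open>b - a - 1\<close> differ by the same \<open>k = b - d\<close>. The arcs on the left end at
  \<open>d\<close>, which gives them the twist or top needed for the common cover.\<close>

lemma factors_uniquely_upper:
  assumes "a + 2 \<le> d" "d < b"
  defines "\<Phi> \<equiv> \<lambda>\<gamma>. phi p q (annulus_arc p q \<gamma>) :: 'k::alg_closed_field sheaf"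
  shows "factors_uniquely (\<Phi> (bridging_arc d c)) (\<Phi> (upper_arc a d)) (\<Phi> (upper_arc a b))"
    and "c < a \<Longrightarrow> factors_uniquely (\<Phi> (upper_arc c d)) (\<Phi> (upper_arc a d)) (\<Phi> (upper_arc a b))"
proof -
  let ?l = "nat (d - a - 1)" and ?k = "nat (b - d)"
  have t: "inf.tube d ?l (\<Phi> (upper_arc a d))" unfolding \<Phi>_def by (rule phi_upper) (use assms(1) in simp)
  have "inf.tube b (nat (b - a - 1)) (\<Phi> (upper_arc a b))" unfolding \<Phi>_def by (rule phi_upper) (use assms in simp)
  moreover have "b = d + int ?k" "nat (b - a - 1) = ?l + ?k" using assms(1,2) by auto
  ultimately have t2: "inf.tube (d + int ?k) (?l + ?k) (\<Phi> (upper_arc a b))" by metis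
  have l: "?l \<ge> 1" using assms(1) by simp
  show "factors_uniquely (\<Phi> (bridging_arc d c)) (\<Phi> (upper_arc a d)) (\<Phi> (upper_arc a b))"
    using inf.factors_uniquely_line_bundle[OF t t2 l, of "- c"] unfolding \<Phi>_def phi_bridging inf_LB .
  assume c: "c < a"
  have "inf.tube d (nat (d - c - 1)) (\<Phi> (upper_arc c d))" unfolding \<Phi>_def by (rule phi_upper) (use c assms(1) in simp)
  then show "factors_uniquely (\<Phi> (upper_arc c d)) (\<Phi> (upper_arc a d)) (\<Phi> (upper_arc a b))"
    by (rule inf.factors_uniquely_tube[OF _ t t2 l]) (use c in auto)
qed

text \<open>Mirror image: the two peripheral arcs on the right share their ending point
  \<open>b\<close>, the left arcs share the starting point \<open>c\<close>, and
  \<open>k = c - a\<close>.\<close>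

lemma factors_uniquely_lower:
  assumes "a < c" "c + 2 \<le> b"
  defines "\<Phi> \<equiv> \<lambda>\<gamma>. phi p q (annulus_arc p q \<gamma>) :: 'k::alg_closed_field sheaf"
  shows "factors_uniquely (\<Phi> (bridging_arc d c)) (\<Phi> (lower_arc c b)) (\<Phi> (lower_arc a b))"
    and "b < d \<Longrightarrow> factors_uniquely (\<Phi> (lower_arc c d)) (\<Phi> (lower_arc c b)) (\<Phi> (lower_arc a b))"
proof -
  let ?l = "nat (b - c - 1)" and ?k = "nat (c - a)"
  have t: "zero.tube (- c) ?l (\<Phi> (lower_arc c b))" unfolding \<Phi>_def by (rule phi_lower) (use assms(2) in simp)
  have "zero.tube (- a) (nat (b - a - 1)) (\<Phi> (lower_arc a b))" unfolding \<Phi>_def by (rule phi_lower) (use assms in simp)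
  moreover have "- a = - c + int ?k" "nat (b - a - 1) = ?l + ?k" using assms(1,2) by auto
  ultimately have t2: "zero.tube (- c + int ?k) (?l + ?k) (\<Phi> (lower_arc a b))" by metis
  have l: "?l \<ge> 1" using assms(2) by simp
  show "factors_uniquely (\<Phi> (bridging_arc d c)) (\<Phi> (lower_arc c b)) (\<Phi> (lower_arc a b))"
    using zero.factors_uniquely_line_bundle[OF t t2 l, of d] unfolding \<Phi>_def phi_bridging zero_LB .
  assume d: "b < d"
  have "zero.tube (- c) (nat (d - c - 1)) (\<Phi> (lower_arc c d))" unfolding \<Phi>_def by (rule phi_lower) (use d assms(2) in simp)
  then show "factors_uniquely (\<Phi> (lower_arc c d)) (\<Phi> (lower_arc c b)) (\<Phi> (lower_arc a b))"
    by (rule zero.factors_uniquely_tube[OF _ t t2 l]) (use d in auto)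
qed

end

section \<open>Crossing arcs\<close>

text \<open>One formula for all representatives used: a segment for \<open>\<kappa> = 0\<close>, and
  for equal end heights a parabolic bump with \<open>\<kappa>\<close> controlling its height and
  direction.\<close>

definition quadratic_curve :: "real \<Rightarrow> real \<Rightarrow> real \<Rightarrow> real \<Rightarrow> real \<Rightarrow> real \<Rightarrow> real \<times> real" where
  "quadratic_curve \<alpha> \<beta> y\<^sub>0 y\<^sub>1 \<kappa> t = (\<alpha> + t * (\<beta> - \<alpha>), y\<^sub>0 + t * (y\<^sub>1 - y\<^sub>0) + \<kappa> * (t * (1 - t)))"

lemma quadratic_curve_derivative:
  "(quadratic_curve \<alpha> \<beta> y\<^sub>0 y\<^sub>1 \<kappa> has_vector_derivative (\<beta> - \<alpha>, y\<^sub>1 - y\<^sub>0 + \<kappa> * (1 - 2 * t))) (at t)"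
  unfolding quadratic_curve_def
  by (rule has_vector_derivative_Pair; rule has_real_derivative_iff_has_vector_derivative[THEN iffD1];
      (rule derivative_eq_intros refl | simp add: algebra_simps)+)

lemma interior_strip: "interior strip = {z. 0 < snd z \<and> snd z < 1}"
proof -
  have *: "strip = UNIV \<times> {0..1}" by (auto simp: strip_def)
  show ?thesis unfolding * interior_Times by auto
qed

text \<open>The third assumption ensures regularity: if the horizontal speed vanishes, the curve has
  to be a genuine vertical segment.\<close>

lemma quadratic_curve_in_arc_curves:
  assumes "position p q (fst \<gamma>) = (\<alpha>, y\<^sub>0)" "position p q (snd \<gamma>) = (\<beta>, y\<^sub>1)"
    and "\<beta> \<noteq> \<alpha> \<or> y\<^sub>1 \<noteq> y\<^sub>0 \<and> \<kappa> = 0"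
    and "\<And>t. 0 < t \<Longrightarrow> t < 1 \<Longrightarrow> 0 < y\<^sub>0 + t * (y\<^sub>1 - y\<^sub>0) + \<kappa> * (t * (1 - t)) \<and>
      y\<^sub>0 + t * (y\<^sub>1 - y\<^sub>0) + \<kappa> * (t * (1 - t)) < 1"
  shows "quadratic_curve \<alpha> \<beta> y\<^sub>0 y\<^sub>1 \<kappa> \<in> arc_curves p q \<gamma>"
  unfolding arc_curves_def
proof (intro CollectI conjI)
  let ?g = "quadratic_curve \<alpha> \<beta> y\<^sub>0 y\<^sub>1 \<kappa>"
  show "?g C1_differentiable_on {0..1}"
    unfolding C1_differentiable_on_def
    by (intro exI[of _ "\<lambda>t. (\<beta> - \<alpha>, y\<^sub>1 - y\<^sub>0 + \<kappa> * (1 - 2 * t))"] conjI ballI quadratic_curve_derivative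
        continuous_intros)
  show "\<forall>t\<in>{0..1}. vector_derivative ?g (at t) \<noteq> 0"
    using assms(3) by (auto simp: vector_derivative_at[OF quadratic_curve_derivative] zero_prod_def)
  show "?g ` {0<..<1} \<subseteq> interior strip"
    using assms(4) by (auto simp: interior_strip quadratic_curve_def)
  show "pathstart ?g = position p q (fst \<gamma>)" "pathfinish ?g = position p q (snd \<gamma>)"
    using assms(1,2) by (simp_all add: pathstart_def pathfinish_def quadratic_curve_def)
qed

lemma I_plus_eq_0:
  assumes "g \<in> arc_curves p q \<gamma>" "h \<in> arc_curves p q \<gamma>'" "transversal g h" "positive_crossings g h = {}"
  shows "I_plus p q \<gamma> \<gamma>' = 0"
  unfolding I_plus_def by (rule Least_eq_0) (use assms in force)

lemma I_plus_eq_0_disjoint: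
  assumes "g \<in> arc_curves p q \<gamma>" "h \<in> arc_curves p q \<gamma>'" "crossings g h = {}"
  shows "I_plus p q \<gamma> \<gamma>' = 0"
  using assms by (intro I_plus_eq_0[of g p q \<gamma> h]) (auto simp: transversal_def positive_crossings_def)

lemma quadratic_bounds: "0 < t \<Longrightarrow> t < 1 \<Longrightarrow> 0 < t * (1 - t) \<and> t * (1 - t) < (1::real)"
  using mult_strict_mono[of t 1 "1 - t" 1] by auto

text \<open>The sign \<open>\<epsilon>\<close> makes the bump point into the strip, upwards from the
  lower and downwards from the upper boundary.\<close>

lemma bump_in_arc_curves:
  assumes "position p q (fst \<gamma>) = (\<alpha>, y)" "position p q (snd \<gamma>) = (\<beta>, y)" "\<alpha> < \<beta>" "0 < \<kappa>" "\<kappa> \<le> 1"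
    and "y = 0 \<and> \<epsilon> = 1 \<or> y = 1 \<and> \<epsilon> = - 1"
  shows "quadratic_curve \<alpha> \<beta> y y (\<epsilon> * \<kappa>) \<in> arc_curves p q \<gamma>"
proof (rule quadratic_curve_in_arc_curves[OF assms(1,2)])
  fix t :: real assume "0 < t" "t < 1"
  then have t: "0 < t * (1 - t)" "t * (1 - t) < 1" using quadratic_bounds by auto
  then have "0 < \<kappa> * (t * (1 - t))" "\<kappa> * (t * (1 - t)) < 1"
    using assms(4,5) mult_strict_mono[of "t * (1 - t)" 1 \<kappa> 1]
      mult_right_mono[of \<kappa> 1 "t * (1 - t)"] by auto
  then show "0 < y + t * (y - y) + \<epsilon> * \<kappa> * (t * (1 - t)) \<and> y + t * (y - y) + \<epsilon> * \<kappa> * (t * (1 - t)) < 1"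
    using assms(6) by auto
qed (use assms(3) in auto)

lemma segment_in_arc_curves:
  assumes "position p q (fst \<gamma>) = (\<alpha>, 0)" "position p q (snd \<gamma>) = (\<beta>, 1)"
  shows "quadratic_curve \<alpha> \<beta> 0 1 0 \<in> arc_curves p q \<gamma>"
  by (rule quadratic_curve_in_arc_curves[OF assms]) auto

text \<open>The two bumps are graphs of quadratic polynomials with the same leading coefficient, so
  they meet at most once.\<close>

lemma bumps_cross:
  fixes y :: real
  assumes ab: "\<alpha> < \<beta>" and cd: "\<gamma> < \<delta>" and ne: "\<alpha> \<noteq> \<gamma> \<or> \<beta> \<noteq> \<delta>" and K: "0 < K" and \<epsilon>: "\<epsilon> = 1 \<or> \<epsilon> = (- 1 :: real)"
  defines "g \<equiv> quadratic_curve \<alpha> \<beta> y y (\<epsilon> * (K * (\<beta> - \<alpha>)\<^sup>2))"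
    and "h \<equiv> quadratic_curve \<gamma> \<delta> y y (\<epsilon> * (K * (\<delta> - \<gamma>)\<^sup>2))"
  shows "transversal g h"
    and "(s, t) \<in> positive_crossings g h \<Longrightarrow> 0 < \<epsilon> * (\<gamma> + \<delta> - \<alpha> - \<beta>) \<and>
      (\<exists>x. \<alpha> < x \<and> x < \<beta> \<and> \<gamma> < x \<and> x < \<delta> \<and> (x - \<gamma>) * (\<delta> - x) = (x - \<alpha>) * (\<beta> - x))"
proof -
  \<comment> \<open>Twice the displacement of the midpoints. The difference of the two quadratics is
    linear with this slope, up to the common factor.\<close>
  let ?\<sigma> = "\<gamma> + \<delta> - \<alpha> - \<beta>"
  have cross: "\<exists>x. x = \<alpha> + s * (\<beta> - \<alpha>) \<and> x = \<gamma> + t * (\<delta> - \<gamma>) \<and> \<alpha> < x \<and> x < \<beta> \<and> \<gamma> < x \<and> x < \<delta> \<and>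
      (x - \<gamma>) * (\<delta> - x) = (x - \<alpha>) * (\<beta> - x)" if "(s, t) \<in> crossings g h" for s t
  proof -
    let ?x = "\<alpha> + s * (\<beta> - \<alpha>)"
    have st: "0 < s" "s < 1" "0 < t" "t < 1" and x: "?x = \<gamma> + t * (\<delta> - \<gamma>)"
      and yy: "\<epsilon> * (K * (\<beta> - \<alpha>)\<^sup>2) * (s * (1 - s)) = \<epsilon> * (K * (\<delta> - \<gamma>)\<^sup>2) * (t * (1 - t))"
      using that by (auto simp: crossings_def g_def h_def quadratic_curve_def)
    have "(\<beta> - \<alpha>)\<^sup>2 * (s * (1 - s)) = (\<delta> - \<gamma>)\<^sup>2 * (t * (1 - t))" using yy K \<epsilon> by auto
    moreover have "(?x - \<alpha>) * (\<beta> - ?x) = (\<beta> - \<alpha>)\<^sup>2 * (s * (1 - s))" by (simp add: power2_eq_square algebra_simps)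
    moreover have "(?x - \<gamma>) * (\<delta> - ?x) = (\<delta> - \<gamma>)\<^sup>2 * (t * (1 - t))" unfolding x by (simp add: power2_eq_square algebra_simps)
    moreover have between: "u < u + r * (v - u) \<and> u + r * (v - u) < v" if "0 < r" "r < 1" "u < v" for r u v :: real
    proof -
      have "0 < r * (v - u)" "0 < (1 - r) * (v - u)" using that by simp_all
      then show ?thesis by (simp add: algebra_simps)
    qed
    have "\<alpha> < ?x" "?x < \<beta>" using between st ab by auto
    moreover have "\<gamma> < ?x" "?x < \<delta>" unfolding x using between st cd by auto
    ultimately show ?thesis using x by (intro exI[of _ ?x]) auto
  qed
  have lin: "?\<sigma> * x = \<gamma> * \<delta> - \<alpha> * \<beta>" if "(x - \<gamma>) * (\<delta> - x) = (x - \<alpha>) * (\<beta> - x)" for x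
    using that by (simp add: algebra_simps)
  \<comment> \<open>If the midpoints agreed at a meeting point, then sum and product of the
    endpoints would agree, and the two intervals would coincide.\<close>
  have \<sigma>: "?\<sigma> \<noteq> 0" if st: "(s, t) \<in> crossings g h" for s t
  proof
    assume 0: "?\<sigma> = 0"
    obtain x where "(x - \<gamma>) * (\<delta> - x) = (x - \<alpha>) * (\<beta> - x)" using cross[OF st] by blast
    then have eq: "\<gamma> * \<delta> = \<alpha> * \<beta>" using lin[of x] 0 by simp
    have \<delta>: "\<delta> = \<alpha> + \<beta> - \<gamma>" using 0 by simp
    have "(\<gamma> - \<alpha>) * (\<gamma> - \<beta>) = 0" using eq unfolding \<delta> by (simp add: algebra_simps)
    then show False using ne ab cd \<delta> by auto
  qed
  \<comment> \<open>At a crossing the two expressions for \<open>x\<close> make the determinant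
    independent of the position, so its sign is that of \<open>\<epsilon>\<close> times the
    displacement.\<close>
  have det: "det2 (vector_derivative g (at s)) (vector_derivative h (at t)) = \<epsilon> * K * (\<beta> - \<alpha>) * (\<delta> - \<gamma>) * ?\<sigma>"
    if st: "(s, t) \<in> crossings g h" for s t
  proof -
    obtain x where x: "x = \<alpha> + s * (\<beta> - \<alpha>)" "x = \<gamma> + t * (\<delta> - \<gamma>)" using cross[OF st] by blast
    have "det2 (vector_derivative g (at s)) (vector_derivative h (at t)) =
        \<epsilon> * K * (\<beta> - \<alpha>) * (\<delta> - \<gamma>) * ((\<delta> - \<gamma>) * (1 - 2 * t) - (\<beta> - \<alpha>) * (1 - 2 * s))"
      unfolding g_def h_def vector_derivative_at[OF quadratic_curve_derivative]
      by (simp add: det2_def power2_eq_square algebra_simps)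
    also have "(\<delta> - \<gamma>) * (1 - 2 * t) - (\<beta> - \<alpha>) * (1 - 2 * s) = ?\<sigma>" using x by (simp add: algebra_simps)
    finally show ?thesis .
  qed
  have "finite (crossings g h)"
  proof -
    have "c = c'" if cc: "c \<in> crossings g h" "c' \<in> crossings g h" for c c'
    proof -
      obtain s t s' t' where c: "c = (s, t)" "c' = (s', t')" by (cases c, cases c')
      obtain x where x: "x = \<alpha> + s * (\<beta> - \<alpha>)" "x = \<gamma> + t * (\<delta> - \<gamma>)" "(x - \<gamma>) * (\<delta> - x) = (x - \<alpha>) * (\<beta> - x)"
        using cross cc(1) c by metis
      obtain x' where x': "x' = \<alpha> + s' * (\<beta> - \<alpha>)" "x' = \<gamma> + t' * (\<delta> - \<gamma>)" "(x' - \<gamma>) * (\<delta> - x') = (x' - \<alpha>) * (\<beta> - x')"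
        using cross cc(2) c by metis
      have "?\<sigma> * x = ?\<sigma> * x'" using lin[OF x(3)] lin[OF x'(3)] by simp
      then have "x = x'" using \<sigma> cc(1) c by auto
      then have "s * (\<beta> - \<alpha>) = s' * (\<beta> - \<alpha>)" "t * (\<delta> - \<gamma>) = t' * (\<delta> - \<gamma>)"
        using x(1,2) x'(1,2) by linarith+
      then show ?thesis using ab cd c by simp
    qed
    then have "crossings g h = {} \<or> (\<exists>c. crossings g h = {c})" by blast
    then show ?thesis by auto
  qed
  then show "transversal g h"
    unfolding transversal_def using det \<sigma> ab cd K \<epsilon> by fastforce
  assume pos: "(s, t) \<in> positive_crossings g h"
  then have st: "(s, t) \<in> crossings g h" by (simp add: positive_crossings_def)
  have "0 < \<epsilon> * K * (\<beta> - \<alpha>) * (\<delta> - \<gamma>) * ?\<sigma>" using pos det[OF st] by (simp add: positive_crossings_def)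
  then have "0 < (K * (\<beta> - \<alpha>) * (\<delta> - \<gamma>)) * (\<epsilon> * ?\<sigma>)" by (simp add: ac_simps)
  moreover have "0 < K * (\<beta> - \<alpha>) * (\<delta> - \<gamma>)" using K ab cd by simp
  ultimately have "0 < \<epsilon> * ?\<sigma>" using zero_less_mult_pos by blast
  then show "0 < \<epsilon> * ?\<sigma> \<and> (\<exists>x. \<alpha> < x \<and> x < \<beta> \<and> \<gamma> < x \<and> x < \<delta> \<and> (x - \<gamma>) * (\<delta> - x) = (x - \<alpha>) * (\<beta> - x))"
    using cross[OF st] by blast
qed

text \<open>The difference of the two quadratics is linear, increasing and zero at \<open>x\<close>.
  Hence it is negative at \<open>\<alpha>\<close> and positive at \<open>\<beta>\<close>; the second
  quadratic vanishes at both, so the sign of the first tells where these points lie relative to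
  \<open>\<gamma>\<close> and \<open>\<delta>\<close>.\<close>

lemma interleaved:
  fixes \<alpha> \<beta> \<gamma> \<delta> x :: real
  assumes "0 < \<gamma> + \<delta> - \<alpha> - \<beta>" "\<alpha> < x" "x < \<beta>" "\<gamma> < x" "x < \<delta>"
    and eq: "(x - \<gamma>) * (\<delta> - x) = (x - \<alpha>) * (\<beta> - x)"
  shows "\<alpha> < \<gamma>" "\<beta> < \<delta>"
proof -
  have lin: "(z - \<gamma>) * (\<delta> - z) - (z - \<alpha>) * (\<beta> - z) = (\<gamma> + \<delta> - \<alpha> - \<beta>) * (z - x)" for z
    using eq by (simp add: algebra_simps)
  show "\<alpha> < \<gamma>"
  proof (rule ccontr)
    assume "\<not> \<alpha> < \<gamma>"
    then have "0 \<le> (\<alpha> - \<gamma>) * (\<delta> - \<alpha>)" using assms by (intro mult_nonneg_nonneg) auto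
    moreover have "(\<gamma> + \<delta> - \<alpha> - \<beta>) * (\<alpha> - x) < 0" using assms by (intro mult_pos_neg) auto
    ultimately show False using lin[of \<alpha>] by simp
  qed
  show "\<beta> < \<delta>"
  proof (rule ccontr)
    assume "\<not> \<beta> < \<delta>"
    then have "(\<beta> - \<gamma>) * (\<delta> - \<beta>) \<le> 0" using assms by (intro mult_nonneg_nonpos) auto
    moreover have "0 < (\<gamma> + \<delta> - \<alpha> - \<beta>) * (\<beta> - x)" using assms by (intro mult_pos_pos) auto
    ultimately show False using lin[of \<beta>] by simp
  qed
qed

lemma I_plus_bumps:
  assumes pos: "position p q A = (\<alpha>, y)" "position p q B = (\<beta>, y)" "position p q A' = (\<gamma>, y)" "position p q B' = (\<delta>, y)"
    and ab: "\<alpha> < \<beta>" and cd: "\<gamma> < \<delta>" and ye: "y = 0 \<and> \<epsilon> = 1 \<or> y = 1 \<and> \<epsilon> = - 1"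
    and I: "I_plus p q (A, B) (A', B') \<noteq> 0"
  shows "\<exists>x. 0 < \<epsilon> * (\<gamma> + \<delta> - \<alpha> - \<beta>) \<and> \<alpha> < x \<and> x < \<beta> \<and> \<gamma> < x \<and> x < \<delta> \<and>
    (x - \<gamma>) * (\<delta> - x) = (x - \<alpha>) * (\<beta> - x)"
proof (cases "\<alpha> = \<gamma> \<and> \<beta> = \<delta>")
  case True
  \<comment> \<open>Over the same interval, bumps of different heights meet only at the ends, which
    do not count as crossings.\<close>
  have *: "quadratic_curve \<alpha> \<beta> y y (\<epsilon> * 1) \<in> arc_curves p q (A, B)"
      "quadratic_curve \<gamma> \<delta> y y (\<epsilon> * (1/2)) \<in> arc_curves p q (A', B')"
    using pos ab cd ye by (intro bump_in_arc_curves; simp)+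
  have "crossings (quadratic_curve \<alpha> \<beta> y y (\<epsilon> * 1)) (quadratic_curve \<gamma> \<delta> y y (\<epsilon> * (1/2))) = {}"
    using True ab ye by (auto simp: crossings_def quadratic_curve_def)
  then show ?thesis using I_plus_eq_0_disjoint[OF *] I by simp
next
  case False
  \<comment> \<open>A common leading coefficient small enough for both bumps to have height
    parameter at most 1 and so stay inside the strip.\<close>
  define K where "K = 1 / ((\<beta> - \<alpha>)\<^sup>2 + (\<delta> - \<gamma>)\<^sup>2)"
  have p: "0 < (\<beta> - \<alpha>)\<^sup>2" "0 < (\<delta> - \<gamma>)\<^sup>2" using ab cd by simp_all
  then have "0 < (\<beta> - \<alpha>)\<^sup>2 + (\<delta> - \<gamma>)\<^sup>2" by (rule add_pos_pos)
  with p have K: "0 < K" "K * (\<beta> - \<alpha>)\<^sup>2 \<le> 1" "K * (\<delta> - \<gamma>)\<^sup>2 \<le> 1" by (simp_all add: K_def)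
  let ?g = "quadratic_curve \<alpha> \<beta> y y (\<epsilon> * (K * (\<beta> - \<alpha>)\<^sup>2))"
  let ?h = "quadratic_curve \<gamma> \<delta> y y (\<epsilon> * (K * (\<delta> - \<gamma>)\<^sup>2))"
  have *: "?g \<in> arc_curves p q (A, B)" "?h \<in> arc_curves p q (A', B')"
    using pos ab cd ye K p by (intro bump_in_arc_curves; simp)+
  have ne: "\<alpha> \<noteq> \<gamma> \<or> \<beta> \<noteq> \<delta>" and e: "\<epsilon> = 1 \<or> \<epsilon> = - 1" using False ye by auto
  have "positive_crossings ?g ?h \<noteq> {}"
    using I_plus_eq_0[OF * bumps_cross(1)[OF ab cd ne K(1) e]] I by auto
  then obtain s t where "(s, t) \<in> positive_crossings ?g ?h" by auto
  from bumps_cross(2)[OF ab cd ne K(1) e this] show ?thesis by blast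
qed

text \<open>At height \<open>t\<close> the segment has moved horizontally by at most
  \<open>t\<close> times its total displacement. On the bump
  \<open>t = \<kappa> * (s * (1 - s))\<close>, so this is less than the distance from the point of
  the bump to either end of its interval, and a segment starting outside cannot have
  arrived.\<close>

lemma flat_bump_avoids:
  fixes \<alpha> \<beta> \<gamma> \<delta> s t \<kappa> :: real
  assumes ab: "\<alpha> < \<beta>" and out: "\<gamma> \<le> \<alpha> \<or> \<beta> \<le> \<gamma>" and \<kappa>: "0 < \<kappa>" "\<kappa> * \<bar>\<delta> - \<gamma>\<bar> < \<beta> - \<alpha>" and s: "0 < s" "s < 1"
    and x: "\<alpha> + s * (\<beta> - \<alpha>) = \<gamma> + t * (\<delta> - \<gamma>)" and t: "t = \<kappa> * (s * (1 - s))"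
  shows False
proof -
  have t0: "0 \<le> t" unfolding t using s \<kappa> by simp
  have le: "t * \<bar>\<delta> - \<gamma>\<bar> = s * (1 - s) * (\<kappa> * \<bar>\<delta> - \<gamma>\<bar>)" by (simp add: t)
  have lt: "s * (1 - s) * (\<kappa> * \<bar>\<delta> - \<gamma>\<bar>) < s * (1 - s) * (\<beta> - \<alpha>)"
    by (rule mult_strict_left_mono[OF \<kappa>(2)]) (use s in simp)
  have "t * (\<delta> - \<gamma>) \<le> t * \<bar>\<delta> - \<gamma>\<bar>" "t * - (\<delta> - \<gamma>) \<le> t * \<bar>\<delta> - \<gamma>\<bar>"
    by (rule mult_left_mono[OF abs_ge_self t0], rule mult_left_mono[OF abs_ge_minus_self t0])
  then have bounds: "t * (\<delta> - \<gamma>) \<le> t * \<bar>\<delta> - \<gamma>\<bar>" "- (t * (\<delta> - \<gamma>)) \<le> t * \<bar>\<delta> - \<gamma>\<bar>"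
    by (simp_all only: mult_minus_right)
  have sm: "s * (1 - s) * (\<beta> - \<alpha>) \<le> s * (\<beta> - \<alpha>)" "s * (1 - s) * (\<beta> - \<alpha>) \<le> (1 - s) * (\<beta> - \<alpha>)"
    using s ab by (simp_all add: mult_left_le mult_right_le_one_le mult_right_mono)
  from out show False
  proof
    assume "\<gamma> \<le> \<alpha>"
    then have "s * (\<beta> - \<alpha>) \<le> t * (\<delta> - \<gamma>)" using x by simp
    then show False using bounds(1) le lt sm(1) by linarith
  next
    assume "\<beta> \<le> \<gamma>"
    then have "(1 - s) * (\<beta> - \<alpha>) \<le> - (t * (\<delta> - \<gamma>))" using x by (simp add: algebra_simps)
    then show False using bounds(2) le lt sm(2) by linarith
  qed
qed

lemma flat_height:
  fixes \<alpha> \<beta> D :: real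
  assumes "\<alpha> < \<beta>" "0 \<le> D"
  obtains \<kappa> where "0 < \<kappa>" "\<kappa> \<le> 1" "\<kappa> * D < \<beta> - \<alpha>"
proof
  \<comment> \<open>\<open>D + 1\<close> keeps the denominator positive for \<open>D = 0\<close>;
    the minimum with 1 keeps the bump inside the strip.\<close>
  let ?k = "min 1 ((\<beta> - \<alpha>) / (2 * (D + 1)))"
  show "0 < ?k" "?k \<le> 1" using assms by auto
  have "?k * D \<le> ((\<beta> - \<alpha>) / (2 * (D + 1))) * D" using assms by (intro mult_right_mono) auto
  also have "\<dots> = (\<beta> - \<alpha>) * (D / (2 * (D + 1)))" by simp
  also have "\<dots> < (\<beta> - \<alpha>) * 1" by (rule mult_strict_left_mono) (use assms in \<open>simp_all add: divide_simps\<close>)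
  also have "\<dots> = \<beta> - \<alpha>" by simp
  finally show "?k * D < \<beta> - \<alpha>" .
qed

text \<open>If the segment starts outside the open interval, possibly at one of its ends, a
  sufficiently flat bump is disjoint from it; so a nonzero count forces the start strictly
  inside.\<close>

lemma I_plus_lower_bridging:
  assumes p: "p > 0" and q: "q > 0" and ab: "a < b" and I: "I_plus p q (lower_arc a b) (bridging_arc d c) \<noteq> 0"
  shows "a < c" "c < b"
proof -
  let ?\<alpha> = "a / real q" and ?\<beta> = "b / real q" and ?\<gamma> = "c / real q" and ?\<delta> = "d / real p"
  have ab': "?\<alpha> < ?\<beta>" using ab q by (simp add: divide_strict_right_mono)
  obtain \<kappa> where \<kappa>: "0 < \<kappa>" "\<kappa> \<le> 1" "\<kappa> * \<bar>?\<delta> - ?\<gamma>\<bar> < ?\<beta> - ?\<alpha>" by (rule flat_height[OF ab' abs_ge_zero])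
  have g: "quadratic_curve ?\<alpha> ?\<beta> 0 0 (1 * \<kappa>) \<in> arc_curves p q (lower_arc a b)"
    by (rule bump_in_arc_curves[OF _ _ ab' \<kappa>(1,2)]) (simp_all add: lower_arc_def)
  have h: "quadratic_curve ?\<gamma> ?\<delta> 0 1 0 \<in> arc_curves p q (bridging_arc d c)"
    by (rule segment_in_arc_curves) (simp_all add: bridging_arc_def)
  have "\<not> (?\<gamma> \<le> ?\<alpha> \<or> ?\<beta> \<le> ?\<gamma>)"
  proof
    assume out: "?\<gamma> \<le> ?\<alpha> \<or> ?\<beta> \<le> ?\<gamma>"
    have "crossings (quadratic_curve ?\<alpha> ?\<beta> 0 0 (1 * \<kappa>)) (quadratic_curve ?\<gamma> ?\<delta> 0 1 0) = {}"
      using flat_bump_avoids[OF ab' out \<kappa>(1,3)] by (auto simp: crossings_def quadratic_curve_def)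
    then show False using I_plus_eq_0_disjoint[OF g h] I by simp
  qed
  then show "a < c" "c < b" using q by (auto simp: divide_le_cancel not_le)
qed

lemma I_plus_upper_bridging:
  assumes p: "p > 0" and q: "q > 0" and ab: "a < b" and I: "I_plus p q (upper_arc a b) (bridging_arc d c) \<noteq> 0"
  shows "a < d" "d < b"
proof -
  let ?\<alpha> = "a / real p" and ?\<beta> = "b / real p" and ?\<gamma> = "c / real q" and ?\<delta> = "d / real p"
  have ab': "?\<alpha> < ?\<beta>" using ab p by (simp add: divide_strict_right_mono)
  obtain \<kappa> where \<kappa>: "0 < \<kappa>" "\<kappa> \<le> 1" "\<kappa> * \<bar>?\<gamma> - ?\<delta>\<bar> < ?\<beta> - ?\<alpha>" by (rule flat_height[OF ab' abs_ge_zero])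
  have g: "quadratic_curve ?\<alpha> ?\<beta> 1 1 ((- 1) * \<kappa>) \<in> arc_curves p q (upper_arc a b)"
    by (rule bump_in_arc_curves[OF _ _ ab' \<kappa>(1,2)]) (simp_all add: upper_arc_def)
  have h: "quadratic_curve ?\<gamma> ?\<delta> 0 1 0 \<in> arc_curves p q (bridging_arc d c)"
    by (rule segment_in_arc_curves) (simp_all add: bridging_arc_def)
  have "\<not> (?\<delta> \<le> ?\<alpha> \<or> ?\<beta> \<le> ?\<delta>)"
  proof
    assume out: "?\<delta> \<le> ?\<alpha> \<or> ?\<beta> \<le> ?\<delta>"
    have "(s, t) \<notin> crossings (quadratic_curve ?\<alpha> ?\<beta> 1 1 ((- 1) * \<kappa>)) (quadratic_curve ?\<gamma> ?\<delta> 0 1 0)" for s t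
    proof
      assume "(s, t) \<in> crossings (quadratic_curve ?\<alpha> ?\<beta> 1 1 ((- 1) * \<kappa>)) (quadratic_curve ?\<gamma> ?\<delta> 0 1 0)"
      then have st: "0 < s" "s < 1" "?\<alpha> + s * (?\<beta> - ?\<alpha>) = ?\<gamma> + t * (?\<delta> - ?\<gamma>)" "1 - t = \<kappa> * (s * (1 - s))"
        by (auto simp: crossings_def quadratic_curve_def)
      \<comment> \<open>The segment is read backwards from its upper end, with \<open>1 - t\<close>
        as distance from the upper boundary. This reduces the case to the lemma for the lower
        one.\<close>
      have "u + t * (v - u) = v + (1 - t) * (u - v)" for u v :: real by (simp add: algebra_simps)
      then have "?\<gamma> + t * (?\<delta> - ?\<gamma>) = ?\<delta> + (1 - t) * (?\<gamma> - ?\<delta>)" .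
      then show False using flat_bump_avoids[OF ab' out \<kappa>(1,3) st(1,2) _ st(4)] st(3) by simp
    qed
    then have "crossings (quadratic_curve ?\<alpha> ?\<beta> 1 1 ((- 1) * \<kappa>)) (quadratic_curve ?\<gamma> ?\<delta> 0 1 0) = {}" by auto
    then show False using I_plus_eq_0_disjoint[OF g h] I by simp
  qed
  then show "a < d" "d < b" using p by (auto simp: divide_le_cancel not_le)
qed

lemma I_plus_lower_lower:
  assumes q: "q > 0" and ab: "a < b" and cd: "c < d" and I: "I_plus p q (lower_arc a b) (lower_arc c d) \<noteq> 0"
  shows "a < c" "c < b" "b < d"
proof -
  let ?\<alpha> = "a / real q" and ?\<beta> = "b / real q" and ?\<gamma> = "c / real q" and ?\<delta> = "d / real q"
  have lt: "?\<alpha> < ?\<beta>" "?\<gamma> < ?\<delta>" using ab cd q by (simp_all add: divide_strict_right_mono)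
  obtain x where x: "0 < 1 * (?\<gamma> + ?\<delta> - ?\<alpha> - ?\<beta>)" "?\<alpha> < x" "x < ?\<beta>" "?\<gamma> < x" "x < ?\<delta>"
    "(x - ?\<gamma>) * (?\<delta> - x) = (x - ?\<alpha>) * (?\<beta> - x)"
    using I_plus_bumps[of p q "Lower a" ?\<alpha> 0 "Lower b" ?\<beta> "Lower c" ?\<gamma> "Lower d" ?\<delta> 1] lt I
    by (auto simp: lower_arc_def)
  have "?\<alpha> < ?\<gamma>" "?\<beta> < ?\<delta>" by (rule interleaved[of ?\<gamma> ?\<delta> ?\<alpha> ?\<beta> x]; use x in simp)+
  moreover have "?\<gamma> < ?\<beta>" using x by linarith
  ultimately show "a < c" "c < b" "b < d" using q by (simp_all add: divide_less_cancel)
qed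

lemma I_plus_upper_upper:
  assumes p: "p > 0" and ab: "a < b" and cd: "c < d" and I: "I_plus p q (upper_arc a b) (upper_arc c d) \<noteq> 0"
  shows "c < a" "a < d" "d < b"
proof -
  let ?\<alpha> = "a / real p" and ?\<beta> = "b / real p" and ?\<gamma> = "c / real p" and ?\<delta> = "d / real p"
  have lt: "?\<alpha> < ?\<beta>" "?\<gamma> < ?\<delta>" using ab cd p by (simp_all add: divide_strict_right_mono)
  obtain x where x: "0 < - 1 * (?\<gamma> + ?\<delta> - ?\<alpha> - ?\<beta>)" "?\<alpha> < x" "x < ?\<beta>" "?\<gamma> < x" "x < ?\<delta>"
    "(x - ?\<gamma>) * (?\<delta> - x) = (x - ?\<alpha>) * (?\<beta> - x)"
    using I_plus_bumps[of p q "Upper a" ?\<alpha> 1 "Upper b" ?\<beta> "Upper c" ?\<gamma> "Upper d" ?\<delta> "- 1"] lt I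
    by (auto simp: upper_arc_def)
  \<comment> \<open>Bumps on the upper boundary hang down, so the sign of the displacement is
    reversed and the two arcs exchange roles.\<close>
  have "?\<gamma> < ?\<alpha>" "?\<delta> < ?\<beta>" by (rule interleaved[of ?\<alpha> ?\<beta> ?\<gamma> ?\<delta> x]; use x in simp)+
  moreover have "?\<alpha> < ?\<delta>" using x by linarith
  ultimately show "c < a" "a < d" "d < b" using p by (simp_all add: divide_less_cancel)
qed

lemma I_plus_lower_upper:
  assumes p: "p > 0" and q: "q > 0" and ab: "a < b" and cd: "c < d"
  shows "I_plus p q (lower_arc a b) (upper_arc c d) = 0" "I_plus p q (upper_arc c d) (lower_arc a b) = 0"
proof -
  \<comment> \<open>With parameter \<open>1/4\<close> the lower bump stays below height
    \<open>1/4\<close> and the upper one above \<open>3/4\<close>.\<close>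
  let ?g = "quadratic_curve (a / real q) (b / real q) 0 0 (1 * (1/4))"
  let ?h = "quadratic_curve (c / real p) (d / real p) 1 1 ((- 1) * (1/4))"
  have g: "?g \<in> arc_curves p q (lower_arc a b)"
    by (rule bump_in_arc_curves) (use ab q in \<open>simp_all add: lower_arc_def divide_strict_right_mono\<close>)
  have h: "?h \<in> arc_curves p q (upper_arc c d)"
    by (rule bump_in_arc_curves) (use cd p in \<open>simp_all add: upper_arc_def divide_strict_right_mono\<close>)
  have bounds: "snd (?g s) < 1/4" "snd (?h s) > 3/4" if "0 < s" "s < 1" for s
    using quadratic_bounds[OF that] by (auto simp: quadratic_curve_def)
  have ne: "?g s \<noteq> ?h t" if "0 < s" "s < 1" "0 < t" "t < 1" for s t
  proof
    assume "?g s = ?h t"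
    then have "snd (?g s) = snd (?h t)" by (rule arg_cong)
    then show False using bounds(1)[OF that(1,2)] bounds(2)[OF that(3,4)] by linarith
  qed
  have crossD: "0 < fst z \<and> fst z < 1 \<and> 0 < snd z \<and> snd z < 1 \<and> g (fst z) = h (snd z)"
    if "z \<in> crossings g h" for z g h
    using that by (auto simp: crossings_def)
  have "crossings ?g ?h = {}"
  proof (rule equals0I)
    fix z assume "z \<in> crossings ?g ?h"
    from crossD[OF this] ne[of "fst z" "snd z"] show False by blast
  qed
  then show "I_plus p q (lower_arc a b) (upper_arc c d) = 0" by (rule I_plus_eq_0_disjoint[OF g h])
  have "crossings ?h ?g = {}"
  proof (rule equals0I)
    fix z assume "z \<in> crossings ?h ?g"
    from crossD[OF this] ne[of "snd z" "fst z"] show False by metis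
  qed
  then show "I_plus p q (upper_arc c d) (lower_arc a b) = 0" by (rule I_plus_eq_0_disjoint[OF h g])
qed

theorem theorem3p5:
  fixes p q :: nat
    and \<gamma> \<gamma>\<^sub>1 \<gamma>\<^sub>2 :: arc
    and g\<^sub>1 g\<^sub>2 :: "real \<Rightarrow> real \<times> real"
    and M :: "real \<times> real"
    and E E\<^sub>1 E\<^sub>2 :: "'k::alg_closed_field sheaf"
  assumes "p > 0" and "q > 0"
    and "positive_bridging \<gamma>\<^sub>1 \<or> peripheral \<gamma>\<^sub>1"
    and "peripheral \<gamma>\<^sub>2"
    and "I_plus p q \<gamma>\<^sub>2 \<gamma>\<^sub>1 = 1"
    and "minimal_position p q \<gamma>\<^sub>2 \<gamma>\<^sub>1 g\<^sub>2 g\<^sub>1"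
    and "M \<in> positive_crossings g\<^sub>2 g\<^sub>1"
    and "admissible \<gamma>\<^sub>1 \<gamma>\<^sub>2 g\<^sub>1 g\<^sub>2 M"
    and "\<gamma> = smoothing \<gamma>\<^sub>1 \<gamma>\<^sub>2"
    and "E\<^sub>1 = phi p q (annulus_arc p q \<gamma>\<^sub>1)"
    and "E\<^sub>2 = phi p q (annulus_arc p q \<gamma>\<^sub>2)"
    and "E = phi p q (annulus_arc p q \<gamma>)"
  shows "peripheral \<gamma> \<and> contained_in \<gamma> \<gamma>\<^sub>2 \<and>
    (\<exists>f\<in>Arr (coh p q) E\<^sub>1 E\<^sub>2. \<not> zero_arrow (coh p q) E\<^sub>1 E\<^sub>2 f \<and>
      (\<exists>e m. epi_mono_factorization (coh p q) E\<^sub>1 E\<^sub>2 f E e m \<and>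
        (\<forall>X e' m'. epi_mono_factorization (coh p q) E\<^sub>1 E\<^sub>2 f X e' m' \<longrightarrow>
          (\<exists>u. is_isomorphism (coh p q) E X u \<and>
             Comp (coh p q) u e = e' \<and> Comp (coh p q) m' u = m))))"
proof -
  interpret weights p q using assms(1,2) by unfold_locales
  note p = assms(1) and q = assms(2)
  \<comment> \<open>A single pair of curves without positive crossings would make the minimum 0.
    Every case below uses this to order the endpoints.\<close>
  have I: "I_plus p q \<gamma>\<^sub>2 \<gamma>\<^sub>1 \<noteq> 0" using assms(5) by simp
  have adm: "\<not> (\<exists>a b. \<gamma>\<^sub>2 = lower_arc a b \<and> fst \<gamma>\<^sub>1 = Lower (b - 1))"
      "\<not> (\<exists>a b. \<gamma>\<^sub>2 = upper_arc a b \<and> snd \<gamma>\<^sub>1 = Upper (a + 1))"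
    using assms(8) by (auto simp: admissible_def)
  have peri: "peripheral (upper_arc a d)" "peripheral (lower_arc a d)" if "a + 2 \<le> d" for a d
    using that unfolding peripheral_def by force+
  have cont: "a' \<le> a \<Longrightarrow> b \<le> b' \<Longrightarrow> contained_in (upper_arc a b) (upper_arc a' b')"
      "a' \<le> a \<Longrightarrow> b \<le> b' \<Longrightarrow> contained_in (lower_arc a b) (lower_arc a' b')" for a b a' b'
    unfolding contained_in_def by blast+
  have "peripheral \<gamma> \<and> contained_in \<gamma> \<gamma>\<^sub>2 \<and> factors_uniquely E\<^sub>1 E E\<^sub>2"
  proof -
    consider (upper) a b where "\<gamma>\<^sub>2 = upper_arc a b" "b - a \<ge> 2" | (lower) a b where "\<gamma>\<^sub>2 = lower_arc a b" "b - a \<ge> 2"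
      using assms(4) unfolding peripheral_def by blast
    then show ?thesis
    proof cases
      case upper
      have ab: "a < b" using upper(2) by simp
      have sm: "\<gamma> = (Upper a, snd \<gamma>\<^sub>1)"
        using assms(9) upper(1) by (auto simp: smoothing_def upper_arc_def)
      consider (bridging) d c where "\<gamma>\<^sub>1 = bridging_arc d c" | (up) c d where "\<gamma>\<^sub>1 = upper_arc c d" "d - c \<ge> 2"
        | (low) c d where "\<gamma>\<^sub>1 = lower_arc c d" "d - c \<ge> 2"
        using assms(3) unfolding peripheral_def positive_bridging_def by blast
      then show ?thesis
      proof cases
        case bridging
        have "a < d" "d < b" using I_plus_upper_bridging[OF p q ab] I unfolding upper(1) bridging by auto
        \<comment> \<open>The excluded configuration, in which the smoothed arc from
          \<open>a\<close> to \<open>d\<close> would join neighbouring marked points. Together with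
          \<open>a < d\<close> it leaves \<open>a + 2 \<le> d\<close>, that is, positive
          length.\<close>
        moreover have "d \<noteq> a + 1" using adm(2) upper(1) bridging by (auto simp: bridging_arc_def)
        ultimately have d: "a + 2 \<le> d" "d < b" by simp_all
        have \<gamma>: "\<gamma> = upper_arc a d" using sm bridging by (simp add: bridging_arc_def upper_arc_def)
        show ?thesis
          using factors_uniquely_upper(1)[OF d, of c, where 'k='k] d peri cont
          unfolding assms(10-12) \<gamma> upper(1) bridging by simp
      next
        case up
        have cd: "c < d" using up(2) by simp
        have c: "c < a" "a < d" "d < b" using I_plus_upper_upper[OF p ab cd] I unfolding upper(1) up(1) by auto
        moreover have "d \<noteq> a + 1" using adm(2) upper(1) up by (auto simp: upper_arc_def)
        ultimately have d: "a + 2 \<le> d" "d < b" by simp_all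
        have \<gamma>: "\<gamma> = upper_arc a d" using sm up by (simp add: upper_arc_def)
        show ?thesis
          using factors_uniquely_upper(2)[OF d c(1), where 'k='k] d peri cont
          unfolding assms(10-12) \<gamma> upper(1) up(1) by simp
      next
        case low
        then show ?thesis using I_plus_lower_upper(2)[OF p q _ ab, of c d] I upper(1) by simp
      qed
    next
      case lower
      have ab: "a < b" using lower(2) by simp
      have sm: "\<gamma> = (fst \<gamma>\<^sub>1, Lower b)"
        using assms(9) lower(1) by (auto simp: smoothing_def upper_arc_def lower_arc_def)
      consider (bridging) d c where "\<gamma>\<^sub>1 = bridging_arc d c" | (up) c d where "\<gamma>\<^sub>1 = upper_arc c d" "d - c \<ge> 2"
        | (low) c d where "\<gamma>\<^sub>1 = lower_arc c d" "d - c \<ge> 2"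
        using assms(3) unfolding peripheral_def positive_bridging_def by blast
      then show ?thesis
      proof cases
        case bridging
        have "a < c" "c < b" using I_plus_lower_bridging[OF p q ab] I unfolding lower(1) bridging by auto
        \<comment> \<open>On the lower boundary the excluded start is the neighbour of
          \<open>b\<close>, because here the smoothed arc runs from \<open>c\<close> to
          \<open>b\<close>.\<close>
        moreover have "c \<noteq> b - 1" using adm(1) lower(1) bridging by (auto simp: bridging_arc_def)
        ultimately have c: "a < c" "c + 2 \<le> b" by simp_all
        have \<gamma>: "\<gamma> = lower_arc c b" using sm bridging by (simp add: bridging_arc_def lower_arc_def)
        show ?thesis
          using factors_uniquely_lower(1)[OF c, of d, where 'k='k] c peri cont
          unfolding assms(10-12) \<gamma> lower(1) bridging by simp
      next
        case low
        have cd: "c < d" using low(2) by simp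
        have c: "a < c" "c < b" "b < d" using I_plus_lower_lower[OF q ab cd] I unfolding lower(1) low(1) by auto
        moreover have "c \<noteq> b - 1" using adm(1) lower(1) low by (auto simp: lower_arc_def)
        ultimately have c': "a < c" "c + 2 \<le> b" by simp_all
        have \<gamma>: "\<gamma> = lower_arc c b" using sm low by (simp add: lower_arc_def)
        show ?thesis
          using factors_uniquely_lower(2)[OF c' c(3), where 'k='k] c' peri cont
          unfolding assms(10-12) \<gamma> lower(1) low(1) by simp
      next
        case up
        then show ?thesis using I_plus_lower_upper(1)[OF p q ab, of c d] I lower(1) by simp
      qed
    qed
  qed
  then show ?thesis unfolding factors_uniquely_def .
qed

end
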